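(* The following identities hold: $$\frac{(2,0,27)-(7,6,9)}{(1,0,54)+(5,2,11)}=q^2\frac{\psi(-q)\psi(-q^6)\psi(-q^9)\psi(-q^{54})}{E(q^3)E(q^{72})\psi(-q^2)\psi(-q^{27})},$$ $$\frac{(2,0,17)-(5,2,7)}{(1,0,34)+(5,2,7)}=q^2\frac{\varphi(-q^4)\psi(q^{17})}{\varphi(-q^{68})\psi(q)},$$ $$\frac{(1,0,26)-(5,4,6)}{(2,0,13)+(3,2,9)}=q\frac{E(q^2)E(q^{52})}{E(q^4)E(q^{26})},$$ $$\frac{(6,0,11)-(7,4,10)}{(3,0,22)+(5,4,14)}=q^6\frac{E(q^{12})E(q^{22})\psi(-q)\psi(-q^{66})}{E(q^6)E(q^8)E(q^{33})E(q^{44})},$$ $$\frac{(1,0,66)-(5,4,14)}{(2,0,33)+(7,4,10)}=q\frac{E(q^{132})E(q^{44})E(q^{24})E(q^{11})E(q^6)E(q^2)}{E(q^{88})E(q^{66})E(q^{22})E(q^{12})E(q^{4})E(q^3)}.$$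
   Context: $|q|<1$, $E(q)=(q;q)_\infty=\prod_{k\ge1}(1-q^k)$, $\varphi(q)=\sum_{n\in\mathbb Z}q^{n^2}$, $\psi(q)=\sum_{n\ge0}q^{n(n+1)/2}$. For integers $a,b,c$ with $a,c>0$, $b^2-4ac<0$, $(a,b,c)$ denotes $\sum_{n,m=-\infty}^{\infty}q^{an^2+bnm+cm^2}$. *)

theory Defs
  imports "HOL-Analysis.Analysis"
begin

text \<open>
  All functions below are meant for \<open>norm q < 1\<close>, where the sums and the product converge
  absolutely.
\<close>

definition eulerE :: "complex \<Rightarrow> complex" where
  "eulerE q = (\<Prod>k. 1 - q ^ Suc k)"

definition ramphi :: "complex \<Rightarrow> complex" where
  "ramphi q = (\<Sum>\<^sub>\<infinity>n\<in>(UNIV :: int set). q ^ nat (n\<^sup>2))"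

definition rampsi :: "complex \<Rightarrow> complex" where
  "rampsi q = (\<Sum>n::nat. q ^ (n * (n + 1) div 2))"

text \<open>
  The theta series \<open>(a,b,c)\<close> at \<open>q\<close>, used only for positive definite forms (\<open>a > 0\<close>, \<open>c > 0\<close>,
  \<open>b\<^sup>2 - 4ac < 0\<close>). For these the exponent is nonnegative, so \<open>nat\<close> does not truncate.
\<close>

definition qtheta :: "int \<Rightarrow> int \<Rightarrow> int \<Rightarrow> complex \<Rightarrow> complex" where
  "qtheta a b c q =
     (\<Sum>\<^sub>\<infinity>(n, m)\<in>(UNIV :: (int \<times> int) set). q ^ nat (a * n\<^sup>2 + b * n * m + c * m\<^sup>2))"

end

theory Submission
  imports Defs "HOL-Complex_Analysis.Complex_Analysis" "HOL-Number_Theory.Number_Theory"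
begin

text \<open>
  After clearing denominators, each identity reads \<open>N \<Prod>\<eta>(\<delta>\<tau>) = D \<Prod>\<eta>(\<delta>'\<tau>)\<close> with \<open>q = e\<^bsup>2\<pi>i\<tau>\<^esup>\<close>, where \<open>N\<close> and \<open>D\<close> are
  linear combinations of theta series of binary forms of the same determinant \<open>k\<close>. Under
  \<open>\<Gamma>\<^sub>0(4k)\<close> all these theta series share one automorphy factor, because the Gauss sum of a form
  modulo an odd \<open>d\<close> prime to \<open>k\<close> depends on \<open>k\<close> only, and so do the squares of the two eta products.
  Hence the difference of the squares of both sides, divided by a power of \<open>\<eta>\<close>, is invariant up to
  constants and holomorphic on the upper half plane. The product of its translates over the cosets is
  bounded and decays at infinity once enough coefficients of its \<open>q\<close>-expansion vanish, so it is zero by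
  the maximum principle.
\<close>

section \<open>Theta series in one variable\<close>

text \<open>Only crude information at the cusps is used. The bound
  \<open>K * (1 + 1 / Im \<tau>)\<close> for theta series and the boundedness of |eta|^2 sqrt(Im)
  hold on the whole half plane, and after an arbitrary matrix of SL_2(Z) all powers of |c tau + d|
  cancel, so that no expansion at another cusp is ever computed. The price is that every bottom row
  modulo 4k is charged the full growth exp(pi/6 (2 + L) y) of the inverse power of eta, L being the
  number of eta factors. There are at most 12 k^2 rows; at least phi(4k) of them belong to the cusp
  at infinity, where an error O(q^n) gains exp(-2 pi n y). This gives the requirement (2 + L) k^2 <
  n phi(4k), the origin of the orders 487, 145, 57 and 436. Everything modular rests on the
  inversion of the one-dimensional theta function, obtained from uniqueness: the two sides of
  Poisson summation are entire functions with the same quasi-periods, hence proportional, and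
  comparing them at the points j/m determines the constant.\<close>

lemma holomorphic_on_infsum:
  fixes f :: "'a \<Rightarrow> complex \<Rightarrow> complex"
  assumes S: "open S"
    and hol: "\<And>n. n \<in> X \<Longrightarrow> f n holomorphic_on S"
    and bd: "\<And>z. z \<in> S \<Longrightarrow> \<exists>r>0. \<exists>M. cball z r \<subseteq> S \<and> M summable_on X \<and>
               (\<forall>n\<in>X. \<forall>w\<in>cball z r. norm (f n w) \<le> M n)"
  shows "(\<lambda>z. \<Sum>\<^sub>\<infinity>n\<in>X. f n z) holomorphic_on S"
proof (subst holomorphic_on_open[OF S], intro ballI)
  fix z assume z: "z \<in> S"
  from bd[OF z] obtain r M where r: "r > 0" "cball z r \<subseteq> S" "M summable_on X"
    and M: "\<And>n w. n \<in> X \<Longrightarrow> w \<in> cball z r \<Longrightarrow> norm (f n w) \<le> M n" by blast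
  have ul: "uniform_limit (cball z r) (\<lambda>Y w. \<Sum>n\<in>Y. f n w) (\<lambda>w. \<Sum>\<^sub>\<infinity>n\<in>X. f n w)
              (finite_subsets_at_top X)"
    by (rule Weierstrass_m_test_general[OF M r(3)])
  have holY: "(\<lambda>w. \<Sum>n\<in>Y. f n w) holomorphic_on cball z r" if "Y \<subseteq> X" for Y
    using hol holomorphic_on_subset[OF _ r(2)] that by (intro holomorphic_on_sum) blast
  have min_eigen: "eventually (\<lambda>Y. continuous_on (cball z r) (\<lambda>w. \<Sum>n\<in>Y. f n w) \<and>
               (\<lambda>w. \<Sum>n\<in>Y. f n w) holomorphic_on ball z r) (finite_subsets_at_top X)"
    using holY
    unfolding eventually_finite_subsets_at_top
    by (intro exI[of _ "{}"] conjI allI impI finite.emptyI empty_subsetI)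
       (blast intro: holomorphic_on_imp_continuous_on holomorphic_on_subset[OF _ ball_subset_cball])+
  have "(\<lambda>w. \<Sum>\<^sub>\<infinity>n\<in>X. f n w) holomorphic_on ball z r"
    by (rule holomorphic_uniform_limit[OF min_eigen ul]) auto
  then show "\<exists>f'. ((\<lambda>z. \<Sum>\<^sub>\<infinity>n\<in>X. f n z) has_field_derivative f') (at z)"
    using r(1) by (subst (asm) holomorphic_on_open) auto
qed

lemma summable_on_int_UNIV:
  fixes f :: "int \<Rightarrow> real"
  assumes "(\<lambda>n. f (int n)) summable_on UNIV" "(\<lambda>n. f (- 1 - int n)) summable_on UNIV"
  shows "f summable_on UNIV"
proof -
  have "(f summable_on range int) = ((f \<circ> int) summable_on UNIV)"
    by (rule summable_on_reindex) auto
  moreover have "(f summable_on range (\<lambda>n. - 1 - int n)) = ((f \<circ> (\<lambda>n. - 1 - int n)) summable_on UNIV)"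
    by (rule summable_on_reindex) (auto simp: inj_on_def)
  moreover have "(UNIV::int set) = range int \<union> range (\<lambda>n. - 1 - int n)"
  proof -
    have "x \<in> range int \<union> range (\<lambda>n. - 1 - int n)" for x :: int
    proof (cases "x \<ge> 0")
      case True then have "x = int (nat x)" by simp
      then show ?thesis by blast
    next
      case False then have "x = - 1 - int (nat (- 1 - x))" by simp
      then show ?thesis by blast
    qed
    then show ?thesis by blast
  qed
  moreover have "range int \<inter> range (\<lambda>n. - 1 - int n) = {}" by auto
  ultimately show ?thesis using assms summable_on_Un_disjoint[of f "range int" "range (\<lambda>n. - 1 - int n)"]
    by (simp add: o_def)
qed

lemma summable_on_power_abs:
  fixes r :: real
  assumes "0 \<le> r" "r < 1"
  shows "(\<lambda>n::int. r ^ nat \<bar>n\<bar>) summable_on UNIV"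
proof (rule summable_on_int_UNIV)
  have s: "summable (\<lambda>n. r ^ n)" using assms by (intro summable_geometric) auto
  have g: "(\<lambda>n::nat. r ^ n) summable_on UNIV"
    using s assms by (intro norm_summable_imp_summable_on) (auto simp: norm_power)
  then show "(\<lambda>n. r ^ nat \<bar>int n\<bar>) summable_on UNIV" by simp
  have "(\<lambda>n. r * r ^ n) summable_on UNIV" by (intro summable_on_cmult_right g)
  moreover have "nat \<bar>- 1 - int n\<bar> = Suc n" for n by simp
  ultimately show "(\<lambda>n. r ^ nat \<bar>- 1 - int n\<bar>) summable_on UNIV" by simp
qed

text \<open>Jacobi's theta function with nome \<open>exp a\<close>. Both coefficients of the
  exponent stay free, so that periodised Gaussians and the pentagonal series are instances.\<close>

definition Th :: "complex \<Rightarrow> complex \<Rightarrow> complex" where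
  "Th a b = (\<Sum>\<^sub>\<infinity>n::int. exp (a * of_int n ^ 2 + b * of_int n))"

text \<open>Completing the square bounds -a n^2 + (B + 1)|n| by (B + 1)^2 / (4a); the extra 1 beside
  B leaves the geometric factor exp(-|n|).\<close>

definition th_maj :: "real \<Rightarrow> real \<Rightarrow> int \<Rightarrow> real" where
  "th_maj a B n = exp ((B + 1)\<^sup>2 / (4 * a)) * exp (- 1) ^ nat \<bar>n\<bar>"

lemma th_maj_summable: "th_maj a B summable_on UNIV"
  unfolding th_maj_def by (intro summable_on_cmult_right summable_on_power_abs) auto

lemma norm_th_le:
  assumes a: "a > 0" "Re \<alpha> \<le> - a" "\<bar>Re \<beta>\<bar> \<le> B"
  shows "norm (exp (\<alpha> * of_int n ^ 2 + \<beta> * of_int n)) \<le> th_maj a B n"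
proof -
  define m where "m = real_of_int \<bar>n\<bar>"
  have m: "m \<ge> 0" "real_of_int n ^ 2 = m ^ 2" by (auto simp: m_def)
  have e: "exp (- 1::real) ^ nat \<bar>n\<bar> = exp (- m)"
    by (simp add: m_def exp_of_nat_mult[symmetric])
  have r: "Re (\<alpha> * of_int n ^ 2 + \<beta> * of_int n) = Re \<alpha> * m\<^sup>2 + Re \<beta> * n"
  proof -
    have "(of_int n ^ 2 :: complex) = of_real (m ^ 2)"
      unfolding m(2)[symmetric] by simp
    then show ?thesis by (simp add: Re_power2)
  qed
  have 1: "Re \<alpha> * m\<^sup>2 \<le> - a * m\<^sup>2" using a(2) by (intro mult_right_mono) auto
  have "Re \<beta> * n \<le> \<bar>Re \<beta>\<bar> * m" by (simp add: m_def abs_mult[symmetric])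
  also have "\<dots> \<le> B * m" using a(3) m by (intro mult_right_mono) auto
  finally have 2: "Re \<beta> * n \<le> B * m" .
  have 3: "- a * m\<^sup>2 + (B + 1) * m \<le> (B + 1)\<^sup>2 / (4 * a)"
  proof -
    have "(B + 1)\<^sup>2 / (4 * a) - (- a * m\<^sup>2 + (B + 1) * m) = a * (m - (B+1) / (2 * a))\<^sup>2"
      using a(1) by (simp add: field_simps power2_eq_square)
    also have "\<dots> \<ge> 0" using a(1) by simp
    finally show ?thesis by linarith
  qed
  have "Re \<alpha> * m\<^sup>2 + Re \<beta> * n \<le> (B + 1)\<^sup>2 / (4 * a) - m" using 1 2 3 by (simp add: algebra_simps)
  then show ?thesis unfolding th_maj_def e norm_exp_eq_Re r by (simp add: exp_add[symmetric])
qed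

lemma Th_abs_summable:
  assumes "Re a < 0"
  shows "(\<lambda>n::int. norm (exp (a * of_int n ^ 2 + b * of_int n))) summable_on UNIV"
  by (rule Infinite_Sum.abs_summable_on_comparison_test'[OF th_maj_summable[of "- Re a" "\<bar>Re b\<bar>"]])
     (use norm_th_le[of "- Re a" a b "\<bar>Re b\<bar>"] assms in auto)

text \<open>On a closed disc the continuous functions Re A and |Re B| attain their suprema, and
  these worst values give one summable majorant for the whole disc.\<close>

lemma Th_holomorphic:
  assumes S: "open S" and A: "A holomorphic_on S" and B: "B holomorphic_on S"
    and neg: "\<And>z. z \<in> S \<Longrightarrow> Re (A z) < 0"
  shows "(\<lambda>z. Th (A z) (B z)) holomorphic_on S"
  unfolding Th_def
proof (rule holomorphic_on_infsum[OF S])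
  show "(\<lambda>z. exp (A z * of_int n ^ 2 + B z * of_int n)) holomorphic_on S" for n :: int
    by (intro holomorphic_intros A B)
  fix z assume "z \<in> S"
  then obtain r where r: "r > 0" "cball z r \<subseteq> S" using S open_contains_cball by blast
  have cA: "continuous_on (cball z r) (\<lambda>w. Re (A w))" and cB: "continuous_on (cball z r) (\<lambda>w. \<bar>Re (B w)\<bar>)"
    using A B r by (auto intro!: continuous_intros intro: holomorphic_on_imp_continuous_on holomorphic_on_subset)
  have ne: "cball z r \<noteq> {}" using r by auto
  obtain w0 where w0: "w0 \<in> cball z r" "\<And>w. w \<in> cball z r \<Longrightarrow> Re (A w) \<le> Re (A w0)"
    using continuous_attains_sup[OF compact_cball ne cA] by blast
  obtain w1 where w1: "\<And>w. w \<in> cball z r \<Longrightarrow> \<bar>Re (B w)\<bar> \<le> \<bar>Re (B w1)\<bar>"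
    using continuous_attains_sup[OF compact_cball ne cB] by blast
  have "Re (A w0) < 0" using neg w0 r by blast
  then have "\<forall>n\<in>UNIV. \<forall>w\<in>cball z r. norm (exp (A w * of_int n ^ 2 + B w * of_int n))
        \<le> th_maj (- Re (A w0)) \<bar>Re (B w1)\<bar> n"
    using w0 w1 by (intro ballI norm_th_le) auto
  then show "\<exists>r>0. \<exists>M. cball z r \<subseteq> S \<and> M summable_on UNIV \<and>
      (\<forall>n\<in>UNIV. \<forall>w\<in>cball z r. norm (exp (A w * of_int n ^ 2 + B w * of_int n)) \<le> M n)"
    using r th_maj_summable by blast
qed

lemma Th_add_2pi: "Th a (b + 2 * of_real pi * \<i>) = Th a b"
proof -
  have "exp (a * of_int n ^ 2 + (b + 2 * of_real pi * \<i>) * of_int n) = exp (a * of_int n ^ 2 + b * of_int n)" for n :: int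
  proof -
    have "a * of_int n ^ 2 + (b + 2 * of_real pi * \<i>) * of_int n
        = (a * of_int n ^ 2 + b * of_int n) + 2 * of_int n * of_real pi * \<i>"
      by (simp add: algebra_simps)
    then have "exp (a * of_int n ^ 2 + (b + 2 * of_real pi * \<i>) * of_int n)
        = exp (a * of_int n ^ 2 + b * of_int n) * exp (2 * of_int n * of_real pi * \<i>)"
      by (simp only: exp_add)
    also have "exp (2 * of_int n * of_real pi * \<i>) = 1"
      using exp_integer_2pi[of "of_int n"] by (simp add: mult_ac)
    finally show ?thesis by simp
  qed
  then show ?thesis unfolding Th_def by (intro infsum_cong)
qed

text \<open>Replacing n by n + 1 produces the second quasi-period; with the period 2 pi i it
  determines \<open>Th a\<close> up to a constant factor.\<close>

lemma Th_shift: "Th a (b + 2 * a) = exp (- a - b) * Th a b"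
proof -
  have "Th a b = (\<Sum>\<^sub>\<infinity>n::int. exp (a * of_int (n + 1) ^ 2 + b * of_int (n + 1)))"
    unfolding Th_def
    by (rule infsum_reindex_bij_witness[of _ "\<lambda>n. n + 1" "\<lambda>n. n - 1"]) auto
  also have "\<dots> = (\<Sum>\<^sub>\<infinity>n::int. exp (a + b) * exp (a * of_int n ^ 2 + (b + 2 * a) * of_int n))"
    by (intro infsum_cong) (simp add: exp_add[symmetric] algebra_simps power2_eq_square)
  also have "\<dots> = exp (a + b) * Th a (b + 2 * a)"
    unfolding Th_def by (rule infsum_cmult_right')
  finally show ?thesis by (simp add: exp_minus exp_add field_simps exp_diff)
qed

section \<open>The exponential of period 1\<close>

definition ee :: "complex \<Rightarrow> complex" where "ee z = exp (2 * of_real pi * \<i> * z)"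

lemma ee_add: "ee (x + y) = ee x * ee y" by (simp add: ee_def exp_add algebra_simps)
lemma ee_0 [simp]: "ee 0 = 1" by (simp add: ee_def)
lemma ee_nz [simp]: "ee z \<noteq> 0" by (simp add: ee_def)
lemma ee_of_int [simp]: "ee (of_int n) = 1"
  using exp_integer_2pi[of "of_int n"] by (simp add: ee_def mult_ac)
lemma ee_1 [simp]: "ee 1 = 1" using ee_of_int[of 1] by simp
lemma ee_eq_1_iff: "ee z = 1 \<longleftrightarrow> z \<in> \<int>"
proof
  assume "ee z = 1"
  then obtain n :: int where "Re (2 * of_real pi * \<i> * z) = 0" "Im (2 * of_real pi * \<i> * z) = of_int (2 * n) * pi"
    unfolding ee_def exp_eq_1 by auto
  then have "z = of_int n" by (auto simp: complex_eq_iff)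
  then show "z \<in> \<int>" by simp
qed (auto elim: Ints_cases)
lemma ee_of_nat_mult: "ee (of_nat n * z) = ee z ^ n"
  by (simp add: ee_def exp_of_nat_mult[symmetric] algebra_simps)
lemma norm_ee: "norm (ee z) = exp (- 2 * pi * Im z)" by (simp add: ee_def)
lemma ee_holomorphic [holomorphic_intros]: "f holomorphic_on S \<Longrightarrow> (\<lambda>z. ee (f z)) holomorphic_on S"
  unfolding ee_def by (intro holomorphic_intros)
lemma ee_deriv: "(ee has_field_derivative 2 * of_real pi * \<i> * ee z) (at z)"
  unfolding ee_def by (auto intro!: derivative_eq_intros)

text \<open>For h of period 1 the k-th Fourier coefficient is \<open>per_int\<close> of h(z) e(-kz).
  All these integrals are evaluated through primitives of entire functions.\<close>

definition per_int :: "(complex \<Rightarrow> complex) \<Rightarrow> complex" where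
  "per_int h = contour_integral (linepath 0 1) h"

lemma per_int_primitive:
  assumes "\<And>z. (H has_field_derivative h z) (at z)"
  shows "per_int h = H 1 - H 0"
  unfolding per_int_def
  by (rule contour_integral_unique, rule contour_integral_primitive[of UNIV H h "linepath 0 1", simplified])
     (use assms in auto)

lemma entire_primitive:
  assumes "h holomorphic_on UNIV"
  obtains H where "\<And>z. (H has_field_derivative h z) (at z)"
  using holomorphic_convex_primitive'[of UNIV h] assms by auto

text \<open>For a primitive H the function H(z + 1) - H(z) has derivative 0 by periodicity. Its
  constancy moves the path by any complex w, which is how values at z and z + omega are compared
  below.\<close>

lemma per_int_shift:
  assumes h: "h holomorphic_on UNIV" and per: "\<And>z. h (z + 1) = h z"
  shows "per_int (\<lambda>z. h (z + w)) = per_int h"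
proof -
  obtain H where H: "\<And>z. (H has_field_derivative h z) (at z)" using entire_primitive[OF h] by blast
  define D where "D = (\<lambda>z. H (z + 1) - H z)"
  have "((\<lambda>z. H (z + 1)) has_field_derivative h z) (at z)" for z
    using DERIV_shift[of H "h z" z 1] H[of "z + 1"] per[of z] by simp
  from DERIV_diff[OF this H] have "(D has_field_derivative 0) (at z)" for z
    unfolding D_def by simp
  then obtain c where c: "\<And>z. D z = c"
    using has_field_derivative_zero_constant[of UNIV D] by (metis UNIV_I convex_UNIV)
  have "((\<lambda>z. H (z + w)) has_field_derivative h (z + w)) (at z)" for z
    using DERIV_shift[of H "h (z + w)" z w] H[of "z + w"] by simp
  then have "per_int (\<lambda>z. h (z + w)) = H (1 + w) - H (0 + w)" by (rule per_int_primitive)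
  also have "\<dots> = c" using c[of w] by (simp add: D_def add.commute)
  also have "c = per_int h" using c[of 0] per_int_primitive[OF H] by (simp add: D_def)
  finally show ?thesis .
qed

lemma per_int_cmult:
  assumes "h holomorphic_on UNIV"
  shows "per_int (\<lambda>z. c * h z) = c * per_int h"
proof -
  obtain H where H: "\<And>z. (H has_field_derivative h z) (at z)" using entire_primitive[OF assms] by blast
  have "((\<lambda>z. c * H z) has_field_derivative c * h z) (at z)" for z
    by (rule DERIV_cmult[OF H])
  from per_int_primitive[OF this] show ?thesis by (simp add: per_int_primitive[OF H] algebra_simps)
qed

lemma per_int_diff:
  assumes "f holomorphic_on UNIV" "g holomorphic_on UNIV"
  shows "per_int (\<lambda>z. f z - g z) = per_int f - per_int g"
proof -
  obtain F where F: "\<And>z. (F has_field_derivative f z) (at z)"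
    using entire_primitive[OF assms(1)] by blast
  obtain G where G: "\<And>z. (G has_field_derivative g z) (at z)"
    using entire_primitive[OF assms(2)] by blast
  show ?thesis
    by (simp add: per_int_primitive[OF F] per_int_primitive[OF G] per_int_primitive[OF DERIV_diff[OF F G]])
qed

lemma norm_per_int_le:
  assumes h: "h holomorphic_on UNIV" and b: "\<And>x. x \<in> closed_segment 0 1 \<Longrightarrow> norm (h x) \<le> C" and "C \<ge> 0"
  shows "norm (per_int h) \<le> C"
proof -
  have "h contour_integrable_on linepath 0 1"
    by (intro contour_integrable_continuous_linepath holomorphic_on_imp_continuous_on holomorphic_on_subset[OF h]) auto
  then have "norm (per_int h) \<le> C * norm (1 - 0 :: complex)"
    unfolding per_int_def by (rule contour_integral_bound_linepath[OF _ \<open>C \<ge> 0\<close> b])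
  then show ?thesis by simp
qed

lemma per_int_ee: "per_int (\<lambda>z. ee (of_int k * z)) = (if k = 0 then 1 else 0)"
proof (cases "k = 0")
  case True
  then show ?thesis using per_int_primitive[of "\<lambda>z. z" "\<lambda>z. 1"] by simp
next
  case False
  define c where "c = 2 * of_real pi * \<i> * of_int k"
  have c: "c \<noteq> 0" using False by (simp add: c_def)
  have e: "ee (of_int k * z) = exp (c * z)" for z by (simp add: ee_def c_def mult_ac)
  have "((\<lambda>z. exp (c * z) / c) has_field_derivative exp (c * z)) (at z)" for z
    using c by (auto intro!: derivative_eq_intros)
  from per_int_primitive[OF this] have "per_int (\<lambda>z. exp (c * z)) = exp (c * 1) / c - exp (c * 0) / c" .
  also have "exp (c * 1) = 1" using e[of 1] by simp
  finally show ?thesis using False by (simp add: e)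
qed

section \<open>Uniqueness of quasi-periodic entire functions\<close>

text \<open>Dividing u - u(0) by e(z) - 1 leaves an entire function g of period 1. The vanishing
  coefficients of u make the coefficients J(k) of g constant for k \<ge> 0 and constant for k \<le>
  -1, with a jump of u(0) between -1 and 0. Since J(k) tends to 0 in both directions, both constants
  and the jump are 0.\<close>

lemma fourier_uniqueness_0:
  assumes u: "u holomorphic_on UNIV" and per: "\<And>z. u (z + 1) = u z"
    and coeff: "\<And>k::int. per_int (\<lambda>z. u z * ee (- of_int k * z)) = 0"
  shows "u 0 = 0"
proof -
  define v where "v = (\<lambda>z. u z - u 0)"
  have v: "v holomorphic_on UNIV" unfolding v_def by (intro holomorphic_intros u)
  have vper: "v (z + 1) = v z" for z by (simp add: v_def per)
  have vint: "v (of_int n) = 0" for n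
  proof (induction n rule: int_induct[where k = 0])
    case base then show ?case by (simp add: v_def)
  next
    case (step1 i) then show ?case using vper[of "of_int i"] by simp
  next
    case (step2 i) then show ?case using vper[of "of_int (i - 1)"] by simp
  qed
  \<comment> \<open>At the integers, where numerator and denominator both vanish, the value is the
    quotient of the derivatives, so the singularities are removed.\<close>
  define g where "g = (\<lambda>z. if z \<in> \<int> then deriv v z / (2 * of_real pi * \<i>) else v z / (ee z - 1))"
  have dv: "deriv v (z + 1) = deriv v z" for z
  proof -
    have "(v has_field_derivative deriv v (z + 1)) (at (z + 1))"
      using v by (simp add: holomorphic_derivI)
    then have "((\<lambda>x. v (x + 1)) has_field_derivative deriv v (z + 1)) (at z)"
      by (simp add: DERIV_shift)
    then have "(v has_field_derivative deriv v (z + 1)) (at z)" by (simp add: vper)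
    then show ?thesis by (simp add: DERIV_imp_deriv)
  qed
  have Zp: "z + 1 \<in> \<int> \<longleftrightarrow> z \<in> \<int>" for z :: complex
    by (metis Ints_1 Ints_add Ints_diff add_diff_cancel_right')
  have gper: "g (z + 1) = g z" for z by (simp add: g_def dv vper Zp ee_add)
  have veq: "v z = g z * (ee z - 1)" for z
    using vint by (auto simp: g_def ee_eq_1_iff elim: Ints_cases)
  have g: "g holomorphic_on UNIV"
  proof -
    have "\<exists>f'. (g has_field_derivative f') (at z)" for z
    proof (cases "z \<in> \<int>")
      case False
      have "open (- (\<int> :: complex set))" by (simp add: closed_Ints open_Compl)
      moreover have "(\<lambda>z. v z / (ee z - 1)) holomorphic_on - \<int>"
        by (intro holomorphic_intros holomorphic_on_subset[OF v] ) (auto simp: ee_eq_1_iff)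
      ultimately have "(\<lambda>z. v z / (ee z - 1)) field_differentiable (at z)"
        using False holomorphic_on_imp_differentiable_at by blast
      then obtain D where D: "((\<lambda>z. v z / (ee z - 1)) has_field_derivative D) (at z)"
        by (auto simp: field_differentiable_def)
      have "(g has_field_derivative D) (at z)"
        by (rule has_field_derivative_transform_within_open[OF D \<open>open (- \<int>)\<close>])
           (use False in \<open>auto simp: g_def\<close>)
      then show ?thesis by blast
    next
      case True
      then obtain n where n: "z = of_int n" by (auto elim: Ints_cases)
      define v1 where "v1 = (\<lambda>w. if w = z then deriv v z else (v w - v z) / (w - z))"
      define e1 where "e1 = (\<lambda>w. if w = z then deriv ee z else (ee w - ee z) / (w - z))"
      have h1: "v1 holomorphic_on ball z 1" "e1 holomorphic_on ball z 1"
        unfolding v1_def e1_def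
        by (intro pole_lemma_open holomorphic_on_subset[OF v] holomorphic_intros; simp)+
      have dee: "deriv ee z = 2 * of_real pi * \<i>"
        using DERIV_imp_deriv[OF ee_deriv[of z]] n by simp
      have nint: "w \<notin> \<int>" if "w \<in> ball z 1" "w \<noteq> z" for w
      proof
        assume "w \<in> \<int>"
        then obtain m where m: "w = of_int m" by (auto elim: Ints_cases)
        have "dist z w = \<bar>real_of_int (n - m)\<bar>"
          unfolding n m dist_norm by (metis norm_of_int of_int_diff)
        with that m n show False by auto
      qed
      have e1nz: "e1 w \<noteq> 0" if "w \<in> ball z 1" for w
        using nint[OF that] dee n by (auto simp: e1_def ee_eq_1_iff)
      have geq: "v1 w / e1 w = g w" if "w \<in> ball z 1" for w
        using nint[OF that] dee n vint by (auto simp: e1_def v1_def g_def)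
      have "(\<lambda>w. v1 w / e1 w) holomorphic_on ball z 1"
        using h1 e1nz by (intro holomorphic_intros) auto
      then have "g holomorphic_on ball z 1"
        using geq by (metis (no_types, lifting) holomorphic_transform)
      then show ?thesis by (simp add: holomorphic_on_open)
    qed
    then show ?thesis by (simp add: holomorphic_on_open)
  qed
  define J where "J k = per_int (\<lambda>z. g z * ee (- of_int k * z))" for k :: int
  have hol: "(\<lambda>z. g z * ee (- of_int k * z)) holomorphic_on UNIV" for k :: int
    by (intro holomorphic_intros g)
  \<comment> \<open>Multiplying g by e(z) - 1 shifts its coefficients by one, so the difference is
    the k-th coefficient of u - u(0).\<close>
  have Jdiff: "J (k - 1) - J k = (if k = 0 then - u 0 else 0)" for k
  proof -
    have "J (k - 1) - J k = per_int (\<lambda>z. g z * ee (- of_int (k - 1) * z) - g z * ee (- of_int k * z))"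
      unfolding J_def by (rule per_int_diff[OF hol hol, symmetric])
    also have "(\<lambda>z. g z * ee (- of_int (k - 1) * z) - g z * ee (- of_int k * z))
             = (\<lambda>z. u z * ee (- of_int k * z) - u 0 * ee (of_int (-k) * z))"
    proof
      fix z :: complex
      have "- of_int (k - 1) * z = z + (- of_int k * z)" by (simp add: algebra_simps)
      then have "ee (- of_int (k - 1) * z) = ee z * ee (- of_int k * z)" by (simp only: ee_add)
      then have "g z * ee (- of_int (k - 1) * z) - g z * ee (- of_int k * z)
               = (g z * (ee z - 1)) * ee (- of_int k * z)" by (simp add: algebra_simps)
      also have "\<dots> = (u z - u 0) * ee (- of_int k * z)" using veq[of z] by (simp add: v_def)
      finally show "g z * ee (- of_int (k - 1) * z) - g z * ee (- of_int k * z)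
             = u z * ee (- of_int k * z) - u 0 * ee (of_int (-k) * z)" by (simp add: algebra_simps)
    qed
    also have "per_int \<dots> = per_int (\<lambda>z. u z * ee (- of_int k * z)) - per_int (\<lambda>z. u 0 * ee (of_int (-k) * z))"
      by (intro per_int_diff holomorphic_intros u)
    also have "per_int (\<lambda>z. u 0 * ee (of_int (-k) * z)) = u 0 * per_int (\<lambda>z. ee (of_int (-k) * z))"
      by (intro per_int_cmult holomorphic_intros)
    also have "per_int (\<lambda>z. ee (of_int (-k) * z)) = (if k = 0 then 1 else 0)"
      by (subst per_int_ee) simp
    finally show ?thesis using coeff[of k] by simp
  qed
  have dg: "deriv g holomorphic_on UNIV" using g holomorphic_deriv by blast
  obtain C where C: "\<And>x. x \<in> closed_segment 0 1 \<Longrightarrow> norm (deriv g x) \<le> C"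
  proof -
    have "continuous_on (closed_segment 0 (1::complex)) (\<lambda>x. norm (deriv g x))"
      by (intro continuous_on_norm holomorphic_on_imp_continuous_on holomorphic_on_subset[OF dg]) auto
    then have "bounded ((\<lambda>x. norm (deriv g x)) ` closed_segment 0 (1::complex))"
      by (intro compact_imp_bounded compact_continuous_image) auto
    then show ?thesis using that by (auto simp: bounded_iff)
  qed
  have C0: "C \<ge> 0" using C[of 0] norm_ge_zero order_trans by (metis ends_in_segment(1))
  \<comment> \<open>Integration by parts: the derivative of the periodic function g(z) e(-kz)
    integrates to 0 over a period.\<close>
  have Jbound: "norm (J k) \<le> C / \<bar>real_of_int k\<bar>" if "k \<noteq> 0" for k
  proof -
    define c where "c = 2 * of_real pi * \<i> * of_int k"
    have c: "norm c = 2 * pi * \<bar>real_of_int k\<bar>" by (simp add: c_def norm_mult)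
    have "((\<lambda>z. g z * ee (- of_int k * z)) has_field_derivative
             (deriv g z * ee (- of_int k * z) - c * (g z * ee (- of_int k * z)))) (at z)" for z
      unfolding ee_def using holomorphic_derivI[OF g, of z]
      by (auto intro!: derivative_eq_intros simp: c_def algebra_simps)
    from per_int_primitive[OF this]
    have "per_int (\<lambda>z. deriv g z * ee (- of_int k * z) - c * (g z * ee (- of_int k * z))) = 0"
      using gper[of 0] ee_of_int[of "- k"] by simp
    moreover have "per_int (\<lambda>z. deriv g z * ee (- of_int k * z) - c * (g z * ee (- of_int k * z)))
       = per_int (\<lambda>z. deriv g z * ee (- of_int k * z)) - per_int (\<lambda>z. c * (g z * ee (- of_int k * z)))"
      by (intro per_int_diff holomorphic_intros dg g)
    moreover have "per_int (\<lambda>z. c * (g z * ee (- of_int k * z))) = c * J k"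
      unfolding J_def by (rule per_int_cmult[OF hol])
    ultimately have "c * J k = per_int (\<lambda>z. deriv g z * ee (- of_int k * z))" by simp
    also have "norm \<dots> \<le> C"
    proof (rule norm_per_int_le[OF _ _ C0])
      fix x :: complex assume x: "x \<in> closed_segment 0 1"
      then have "Im x = 0" by (auto simp: in_segment)
      then have "norm (ee (- of_int k * x)) = 1" by (simp add: norm_ee)
      then show "norm (deriv g x * ee (- of_int k * x)) \<le> C" using C[OF x] by (simp add: norm_mult)
    qed (intro holomorphic_intros dg)
    finally have "2 * pi * \<bar>real_of_int k\<bar> * norm (J k) \<le> C" by (simp add: norm_mult c)
    moreover have "1 * (\<bar>real_of_int k\<bar> * norm (J k)) \<le> (2 * pi) * (\<bar>real_of_int k\<bar> * norm (J k))"
      using pi_ge_two by (intro mult_right_mono) auto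
    ultimately have "\<bar>real_of_int k\<bar> * norm (J k) \<le> C" by simp
    then show ?thesis using that by (simp add: field_simps)
  qed
  have small: "z = 0" if "\<And>n. n \<ge> 1 \<Longrightarrow> norm z \<le> C / real n" for z :: complex
  proof -
    have "(\<lambda>n. C / real n) \<longlonglongrightarrow> 0" by (rule lim_const_over_n)
    moreover have "\<forall>n\<ge>1. norm z \<le> C / real n" using that by simp
    ultimately have "norm z \<le> 0" by (meson LIMSEQ_le_const)
    then show ?thesis by simp
  qed
  have J0: "J (int n) = J 0" for n
  proof (induction n)
    case (Suc n) then show ?case using Jdiff[of "int (Suc n)"] by simp
  qed simp
  have J1: "J (- 1 - int n) = J (- 1)" for n
  proof (induction n)
    case (Suc n) then show ?case using Jdiff[of "- 1 - int n"] by simp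
  qed simp
  have "J 0 = 0" using Jbound J0 by (intro small) (metis (no_types, lifting) abs_of_nat not_one_le_zero of_int_of_nat_eq of_nat_eq_0_iff)
  moreover have "J (- 1) = 0"
  proof (rule small)
    fix n :: nat assume n: "n \<ge> 1"
    then have "- 1 - int (n - 1) = - int n" by simp
    then have "J (- int n) = J (- 1)" using J1[of "n - 1"] by metis
    then show "norm (J (- 1)) \<le> C / real n" using Jbound[of "- int n"] n by simp
  qed
  ultimately show ?thesis using Jdiff[of 0] by simp
qed

text \<open>Translation by w only multiplies each Fourier coefficient by e(kw), so the value at w is
  the value at 0 of a translate whose coefficients vanish as well.\<close>

lemma fourier_uniqueness:
  assumes u: "u holomorphic_on UNIV" and per: "\<And>z. u (z + 1) = u z"
    and coeff: "\<And>k::int. per_int (\<lambda>z. u z * ee (- of_int k * z)) = 0"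
  shows "u w = 0"
proof -
  have hw: "(\<lambda>z. u (z + w)) holomorphic_on UNIV"
    by (intro holomorphic_on_compose_gen[of "\<lambda>z. z + w" UNIV u UNIV, unfolded o_def] holomorphic_intros u) auto
  have "u (0 + w) = 0"
  proof (rule fourier_uniqueness_0[OF hw])
    show "u (z + 1 + w) = u (z + w)" for z using per[of "z + w"] by (simp add: add_ac)
    fix k :: int
    define h where "h = (\<lambda>z. u z * ee (- of_int k * z))"
    have hh: "h holomorphic_on UNIV" unfolding h_def by (intro holomorphic_intros u)
    have hp: "h (z + 1) = h z" for z
    proof -
      have "- of_int k * (z + 1) = - of_int k * z + of_int (- k)" by (simp add: algebra_simps)
      then have "ee (- of_int k * (z + 1)) = ee (- of_int k * z)" by (metis ee_add ee_of_int mult.right_neutral)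
      then show ?thesis by (simp add: h_def per)
    qed
    have "u (z + w) * ee (- of_int k * z) = ee (of_int k * w) * h (z + w)" for z
    proof -
      have "ee (of_int k * w) * ee (- of_int k * (z + w)) = ee (- of_int k * z)"
        by (simp add: ee_add[symmetric] algebra_simps)
      then show ?thesis by (simp add: h_def)
    qed
    then have "per_int (\<lambda>z. u (z + w) * ee (- of_int k * z)) = per_int (\<lambda>z. ee (of_int k * w) * h (z + w))"
      by simp
    also have "\<dots> = ee (of_int k * w) * per_int (\<lambda>z. h (z + w))"
      by (intro per_int_cmult holomorphic_on_compose_gen[of "\<lambda>z. z + w" UNIV h UNIV, unfolded o_def] holomorphic_intros hh) auto
    also have "per_int (\<lambda>z. h (z + w)) = per_int h" by (rule per_int_shift[OF hh hp])
    also have "per_int h = 0" unfolding h_def by (rule coeff)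
    finally show "per_int (\<lambda>z. u (z + w) * ee (- of_int k * z)) = 0" by simp
  qed
  then show ?thesis by simp
qed

text \<open>The second quasi-period becomes a two-term recursion between neighbouring Fourier
  coefficients with nonzero factors. All coefficients are therefore governed by the one of index 0,
  and the space of solutions has dimension at most 1.\<close>

lemma quasi_periodic_unique:
  assumes f: "f holomorphic_on UNIV" "\<And>z. f (z + 1) = f z" "\<And>z. f (z + \<omega>) = A * ee (- z) * f z"
    and g: "g holomorphic_on UNIV" "\<And>z. g (z + 1) = g z" "\<And>z. g (z + \<omega>) = A * ee (- z) * g z"
    and A: "A \<noteq> 0" and nz: "g z1 \<noteq> 0"
  obtains c where "\<And>z. f z = c * g z"
proof -
  define J where "J h k = per_int (\<lambda>z. h z * ee (- of_int k * z))" for h and k :: int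
  have rec: "J h k = A * ee (- of_int k * \<omega>) * J h (k + 1)"
    if h: "h holomorphic_on UNIV" "\<And>z. h (z + 1) = h z" "\<And>z. h (z + \<omega>) = A * ee (- z) * h z" for h k
  proof -
    define H where "H = (\<lambda>z. h z * ee (- of_int k * z))"
    have hH: "H holomorphic_on UNIV" unfolding H_def by (intro holomorphic_intros h)
    have hp: "H (z + 1) = H z" for z
    proof -
      have "- of_int k * (z + 1) = - of_int k * z + of_int (- k)" by (simp add: algebra_simps)
      then have "ee (- of_int k * (z + 1)) = ee (- of_int k * z)" by (metis ee_add ee_of_int mult.right_neutral)
      then show ?thesis by (simp add: H_def h)
    qed
    have "J h k = per_int (\<lambda>z. H (z + \<omega>))" unfolding J_def H_def[symmetric] by (rule per_int_shift[OF hH hp, symmetric])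
    also have "(\<lambda>z. H (z + \<omega>)) = (\<lambda>z. (A * ee (- of_int k * \<omega>)) * (h z * ee (- of_int (k + 1) * z)))"
    proof
      fix z :: complex
      have "ee (- of_int k * (z + \<omega>)) * ee (- z) = ee (- of_int k * \<omega>) * ee (- of_int (k + 1) * z)"
        by (simp add: ee_add[symmetric] algebra_simps)
      then show "H (z + \<omega>) = (A * ee (- of_int k * \<omega>)) * (h z * ee (- of_int (k + 1) * z))"
        unfolding H_def h(3) by (metis (no_types, opaque_lifting) mult.assoc mult.commute)
    qed
    also have "per_int \<dots> = (A * ee (- of_int k * \<omega>)) * J h (k + 1)"
      unfolding J_def by (intro per_int_cmult holomorphic_intros h)
    finally show ?thesis .
  qed
  have allz: "J h k = 0" if h: "h holomorphic_on UNIV" "\<And>z. h (z + 1) = h z" "\<And>z. h (z + \<omega>) = A * ee (- z) * h z"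
     and z: "J h 0 = 0" for h k
  proof (induction k rule: int_induct[where k = 0])
    case base then show ?case by (rule z)
  next
    case (step1 i) then show ?case using rec[OF h, of i] A by simp
  next
    case (step2 i) then show ?case using rec[OF h, of "i - 1"] by simp
  qed
  \<comment> \<open>If this coefficient vanished, so would all others, and g would be identically
    0.\<close>
  have g0: "J g 0 \<noteq> 0"
  proof
    assume "J g 0 = 0"
    then have "J g k = 0" for k by (rule allz[OF g])
    then have "g z1 = 0" unfolding J_def by (intro fourier_uniqueness[OF g(1,2)]) auto
    with nz show False by simp
  qed
  define c where "c = J f 0 / J g 0"
  define u where "u = (\<lambda>z. f z - c * g z)"
  have u: "u holomorphic_on UNIV" "\<And>z. u (z + 1) = u z" "\<And>z. u (z + \<omega>) = A * ee (- z) * u z"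
    unfolding u_def using f g by (auto intro!: holomorphic_intros simp: algebra_simps)
  have "J u 0 = J f 0 - c * J g 0"
    unfolding J_def u_def
    using per_int_diff[OF f(1) holomorphic_on_mult[OF holomorphic_on_const g(1)], of c] per_int_cmult[OF g(1), of c]
    by simp
  then have "J u 0 = 0" using g0 by (simp add: c_def)
  then have "J u k = 0" for k by (rule allz[OF u])
  then have "u z = 0" for z unfolding J_def by (intro fourier_uniqueness[OF u(1,2)]) auto
  then show ?thesis using that[of c] by (simp add: u_def)
qed

text \<open>Lebesgue's theorem for the counting measure; it carries the finite triple product to its
  limit.\<close>

lemma infsum_dominated_convergence:
  fixes f :: "nat \<Rightarrow> 'a \<Rightarrow> complex"
  assumes M: "M summable_on UNIV" and bd: "\<And>n x. norm (f n x) \<le> M x"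
    and lim: "\<And>x. (\<lambda>n. f n x) \<longlonglongrightarrow> g x"
  shows "(\<lambda>n. \<Sum>\<^sub>\<infinity>x. f n x) \<longlonglongrightarrow> (\<Sum>\<^sub>\<infinity>x. g x)"
proof -
  have bg: "norm (g x) \<le> M x" for x
    using lim[of x] bd by (intro LIMSEQ_le_const2[OF tendsto_norm]) auto
  have "norm (M x) = M x" for x using bd[of 0 x] norm_ge_zero order_trans abs_of_nonneg real_norm_def by metis
  then have Ma: "Infinite_Set_Sum.abs_summable_on M UNIV"
    using M by (simp add: abs_summable_equivalent[symmetric])
  have fa: "Infinite_Set_Sum.abs_summable_on (f n) UNIV" for n
    by (rule Infinite_Set_Sum.abs_summable_on_comparison_test'[OF Ma bd])
  have ga: "Infinite_Set_Sum.abs_summable_on g UNIV"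
    by (rule Infinite_Set_Sum.abs_summable_on_comparison_test'[OF Ma bg])
  have "(\<lambda>n. integral\<^sup>L (count_space UNIV) (f n)) \<longlonglongrightarrow> integral\<^sup>L (count_space UNIV) g"
    by (rule integral_dominated_convergence[where w = M])
       (use Ma lim bd in \<open>auto simp: Infinite_Set_Sum.abs_summable_on_def\<close>)
  then show ?thesis
    using infsetsum_infsum[OF fa] infsetsum_infsum[OF ga] by (simp add: infsetsum_def)
qed

section \<open>The Jacobi triple product\<close>

lemma convergent_prod_one_plus_geometric:
  fixes a q :: complex
  assumes "norm q < 1"
  shows "convergent_prod (\<lambda>k. 1 + a * q ^ k)"
proof -
  have "summable (\<lambda>k. norm a * norm q ^ k)"
    using assms by (intro summable_mult summable_geometric) auto
  then have "summable (\<lambda>k. norm (1 + a * q ^ k - 1))" by (simp add: norm_mult norm_power)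
  then show ?thesis
    by (rule abs_convergent_prod_imp_convergent_prod[OF summable_imp_abs_convergent_prod])
qed

lemma LIMSEQ_prod_one_plus_geometric:
  fixes a q :: complex
  assumes "norm q < 1"
  shows "(\<lambda>n. \<Prod>k<n. 1 + a * q ^ k) \<longlonglongrightarrow> (\<Prod>k. 1 + a * q ^ k)"
  by (rule has_prod_imp_tendsto'[OF convergent_prod_has_prod[OF convergent_prod_one_plus_geometric[OF assms]]])

lemma prodinf_one_plus_geometric_nonzero:
  fixes a q :: complex
  assumes q: "norm q < 1" and a: "norm a < 1"
  shows "(\<Prod>k. 1 + a * q ^ k) \<noteq> 0"
proof (rule prodinf_nonzero[OF convergent_prod_one_plus_geometric[OF q]])
  fix k
  have "norm (a * q ^ k) \<le> norm a * 1"
    unfolding norm_mult norm_power using q by (intro mult_left_mono power_le_one) auto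
  with a have "norm (a * q ^ k) < 1" by simp
  then show "1 + a * q ^ k \<noteq> 0"
    by (metis add_eq_0_iff norm_minus_cancel norm_one less_irrefl)
qed

lemma eulerE_altdef: "eulerE q = (\<Prod>k. 1 + (- q) * q ^ k)"
  by (simp add: eulerE_def)

lemma eulerE_nonzero: "norm q < 1 \<Longrightarrow> eulerE q \<noteq> 0"
  unfolding eulerE_altdef by (rule prodinf_one_plus_geometric_nonzero) auto

definition qpoch :: "complex \<Rightarrow> nat \<Rightarrow> complex" where
  "qpoch q m = (\<Prod>k<m. 1 - q ^ Suc k)"

text \<open>The value 0 below index 0 keeps the rule (q;q)_{k-1}^{-1} = (1 - q^k) (q;q)_k^{-1} valid
  at k = 0, and makes Gaussian binomials vanish outside their range by themselves.\<close>

definition inv_qpoch :: "complex \<Rightarrow> int \<Rightarrow> complex" where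
  "inv_qpoch q k = (if k < 0 then 0 else 1 / qpoch q (nat k))"

lemma one_minus_power_nonzero: "norm (q::complex) < 1 \<Longrightarrow> 1 - q ^ Suc k \<noteq> 0"
  using power_less_one_iff[of "norm q" "Suc k"]
  by (metis eq_iff_diff_eq_0 norm_one norm_power norm_ge_zero zero_less_Suc less_irrefl)

lemma qpoch_LIMSEQ: "norm q < 1 \<Longrightarrow> qpoch q \<longlonglongrightarrow> eulerE q"
  using LIMSEQ_prod_one_plus_geometric[of q "- q"] by (simp add: eulerE_def qpoch_def[abs_def])

lemma inv_qpoch_pred:
  assumes "norm q < 1" "k \<ge> 0"
  shows "inv_qpoch q (k - 1) = (1 - q ^ nat k) * inv_qpoch q k"
proof (cases "k = 0")
  case False
  then obtain m where m: "k = int (Suc m)" using assms(2) by (metis not0_implies_Suc of_nat_0_eq_iff zero_le_imp_eq_int)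
  have n: "nat (1 + int m) = Suc m" by simp
  show ?thesis using one_minus_power_nonzero[OF assms(1), of m]
    by (simp add: m inv_qpoch_def qpoch_def n)
qed (simp add: inv_qpoch_def)

definition tri_plus :: "int \<Rightarrow> nat" where "tri_plus j = nat (j * (j + 1) div 2)"
definition tri_minus :: "int \<Rightarrow> nat" where "tri_minus j = nat (j * (j - 1) div 2)"

lemma two_tri_plus: "2 * int (tri_plus j) = j * (j + 1)"
proof -
  have "even (j * (j + 1))" by simp
  moreover have "j * (j + 1) \<ge> 0" by (cases "j \<ge> 0") (auto simp: zero_le_mult_iff)
  ultimately show ?thesis by (simp add: tri_plus_def)
qed

lemma two_tri_minus: "2 * int (tri_minus j) = j * (j - 1)"
proof -
  have "even (j * (j - 1))" by simp
  moreover have "j * (j - 1) \<ge> 0" by (cases "j \<ge> 1") (auto simp: zero_le_mult_iff)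
  ultimately show ?thesis by (simp add: tri_minus_def)
qed

lemma two_int_eqD: "2 * int x = 2 * int y \<Longrightarrow> x = y"
  by simp

lemma tri_plus_tri_minus: "tri_plus j + tri_minus j = nat (j\<^sup>2)"
proof -
  have "2 * int (tri_plus j + tri_minus j) = 2 * int (nat (j\<^sup>2))"
    unfolding of_nat_add distrib_left two_tri_plus two_tri_minus by (simp add: algebra_simps power2_eq_square)
  then show ?thesis by (rule two_int_eqD)
qed

text \<open>The summand of Ramanujan's f(a,b). In two variables with ab = q no negative power
  occurs, whatever the sign of j.\<close>

definition jacobi_term :: "complex \<Rightarrow> complex \<Rightarrow> int \<Rightarrow> complex" where
  "jacobi_term a b j = a ^ tri_plus j * b ^ tri_minus j"

lemma jacobi_term_shift_a:
  assumes "j \<le> int n + 1"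
  shows "a * (a * b) ^ n * jacobi_term a b (j - 1) = (a * b) ^ nat (int n + 1 - j) * jacobi_term a b j"
proof -
  define N where "N = nat (int n + 1 - j)"
  have N: "int N = int n + 1 - j" using assms by (simp add: N_def)
  have "2 * int (1 + n + tri_plus (j - 1)) = 2 * int (N + tri_plus j)"
    unfolding of_nat_add distrib_left two_tri_plus N by (simp add: algebra_simps)
  then have 1: "1 + n + tri_plus (j - 1) = N + tri_plus j" by (rule two_int_eqD)
  have "2 * int (n + tri_minus (j - 1)) = 2 * int (N + tri_minus j)"
    unfolding of_nat_add distrib_left two_tri_minus N by (simp add: algebra_simps)
  then have 2: "n + tri_minus (j - 1) = N + tri_minus j" by (rule two_int_eqD)
  have "a * (a * b) ^ n * jacobi_term a b (j - 1) = a ^ (1 + n + tri_plus (j - 1)) * b ^ (n + tri_minus (j - 1))"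
    by (simp add: jacobi_term_def power_mult_distrib power_add)
  also have "\<dots> = (a * b) ^ N * jacobi_term a b j"
    unfolding 1 2 by (simp add: jacobi_term_def power_mult_distrib power_add)
  finally show ?thesis by (simp add: N_def)
qed

lemma jacobi_term_shift_b:
  assumes "- j \<le> int n + 1"
  shows "b * (a * b) ^ n * jacobi_term a b (j + 1) = (a * b) ^ nat (int n + 1 + j) * jacobi_term a b j"
proof -
  define N where "N = nat (int n + 1 + j)"
  have N: "int N = int n + 1 + j" using assms by (simp add: N_def)
  have "2 * int (n + tri_plus (j + 1)) = 2 * int (N + tri_plus j)"
    unfolding of_nat_add distrib_left two_tri_plus N by (simp add: algebra_simps)
  then have 1: "n + tri_plus (j + 1) = N + tri_plus j" by (rule two_int_eqD)
  have "2 * int (1 + n + tri_minus (j + 1)) = 2 * int (N + tri_minus j)"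
    unfolding of_nat_add distrib_left two_tri_minus N by (simp add: algebra_simps)
  then have 2: "1 + n + tri_minus (j + 1) = N + tri_minus j" by (rule two_int_eqD)
  have "b * (a * b) ^ n * jacobi_term a b (j + 1) = a ^ (n + tri_plus (j + 1)) * b ^ (1 + n + tri_minus (j + 1))"
    by (simp add: jacobi_term_def power_mult_distrib power_add)
  also have "\<dots> = (a * b) ^ N * jacobi_term a b j"
    unfolding 1 2 by (simp add: jacobi_term_def power_mult_distrib power_add)
  finally show ?thesis by (simp add: N_def)
qed

text \<open>The Gaussian binomial coefficient of 2n over n + j.\<close>

definition jacobi_coeff :: "complex \<Rightarrow> nat \<Rightarrow> int \<Rightarrow> complex" where
  "jacobi_coeff q n j = qpoch q (2 * n) * inv_qpoch q (int n - j) * inv_qpoch q (int n + j)"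

text \<open>This mirrors the expansion (1 + a q^n)(1 + b q^n) = 1 + q^(2n+1) + a q^n + b q^n for ab
  = q. All terms are multiples of 1/((q)_A (q)_B) with A = n + 1 - j and B = n + 1 + j, which leaves
  a polynomial identity in X = q^A, Y = q^B and Z = q^(2n+1), where XY = qZ.\<close>

lemma jacobi_coeff_rec:
  assumes q: "norm q < 1" and j: "\<bar>j\<bar> \<le> int n + 1"
  shows "jacobi_coeff q (Suc n) j = (1 + q ^ (2 * n + 1)) * jacobi_coeff q n j
           + q ^ nat (int n + 1 - j) * jacobi_coeff q n (j - 1) + q ^ nat (int n + 1 + j) * jacobi_coeff q n (j + 1)"
proof -
  define A where "A = int n + 1 - j"
  define B where "B = int n + 1 + j"
  have AB: "A \<ge> 0" "B \<ge> 0" using j by (auto simp: A_def B_def)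
  define X where "X = q ^ nat A"
  define Y where "Y = q ^ nat B"
  define Z where "Z = q ^ (2 * n + 1)"
  have XY: "X * Y = q * Z"
  proof -
    have "nat A + nat B = 2 * n + 2" using AB by (simp add: A_def B_def)
    then show ?thesis unfolding X_def Y_def Z_def power_add[symmetric] by simp
  qed
  have iA: "inv_qpoch q (int n - j) = (1 - X) * inv_qpoch q A"
    using inv_qpoch_pred[OF q AB(1)] by (simp add: A_def X_def algebra_simps)
  have iB: "inv_qpoch q (int n + j) = (1 - Y) * inv_qpoch q B"
    using inv_qpoch_pred[OF q AB(2)] by (simp add: B_def Y_def algebra_simps)
  have iA2: "Y * inv_qpoch q (A - 2) = (Y - Z) * (1 - X) * inv_qpoch q A"
  proof (cases "A = 0")
    case True then show ?thesis by (simp add: inv_qpoch_def X_def)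
  next
    case False
    then have A1: "A - 1 \<ge> 0" using AB by simp
    have "nat B + nat (A - 1) = 2 * n + 1" using AB A1 by (simp add: A_def B_def)
    then have "Y * q ^ nat (A - 1) = Z" unfolding Y_def Z_def power_add[symmetric] by simp
    moreover have e: "inv_qpoch q (A - 2) = (1 - q ^ nat (A - 1)) * ((1 - X) * inv_qpoch q A)"
      using inv_qpoch_pred[OF q A1] inv_qpoch_pred[OF q AB(1)] by (simp add: X_def)
    have "Y * inv_qpoch q (A - 2) = (Y - Y * q ^ nat (A - 1)) * (1 - X) * inv_qpoch q A"
      unfolding e by (simp add: algebra_simps)
    ultimately show ?thesis by simp
  qed
  have iB2: "X * inv_qpoch q (B - 2) = (X - Z) * (1 - Y) * inv_qpoch q B"
  proof (cases "B = 0")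
    case True then show ?thesis by (simp add: inv_qpoch_def Y_def)
  next
    case False
    then have B1: "B - 1 \<ge> 0" using AB by simp
    have "nat A + nat (B - 1) = 2 * n + 1" using AB B1 by (simp add: A_def B_def)
    then have "X * q ^ nat (B - 1) = Z" unfolding X_def Z_def power_add[symmetric] by simp
    moreover have e: "inv_qpoch q (B - 2) = (1 - q ^ nat (B - 1)) * ((1 - Y) * inv_qpoch q B)"
      using inv_qpoch_pred[OF q B1] inv_qpoch_pred[OF q AB(2)] by (simp add: Y_def)
    have "X * inv_qpoch q (B - 2) = (X - X * q ^ nat (B - 1)) * (1 - Y) * inv_qpoch q B"
      unfolding e by (simp add: algebra_simps)
    ultimately show ?thesis by simp
  qed
  have qpS: "qpoch q (2 * Suc n) = qpoch q (2 * n) * (1 - Z) * (1 - q * Z)"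
    by (simp add: qpoch_def Z_def)
  have e1: "jacobi_coeff q (Suc n) j = qpoch q (2 * n) * ((1 - Z) * (1 - X * Y)) * (inv_qpoch q A * inv_qpoch q B)"
    unfolding jacobi_coeff_def qpS XY by (simp add: A_def B_def algebra_simps)
  have e2: "jacobi_coeff q n (j - 1) = qpoch q (2 * n) * (inv_qpoch q A * inv_qpoch q (B - 2))"
    by (simp add: jacobi_coeff_def A_def B_def algebra_simps)
  have e3: "jacobi_coeff q n (j + 1) = qpoch q (2 * n) * (inv_qpoch q (A - 2) * inv_qpoch q B)"
    by (simp add: jacobi_coeff_def A_def B_def algebra_simps)
  have e4: "jacobi_coeff q n j = qpoch q (2 * n) * ((1 - X) * (1 - Y)) * (inv_qpoch q A * inv_qpoch q B)"
    unfolding jacobi_coeff_def iA iB by (simp add: algebra_simps)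
  have "(1 + Z) * jacobi_coeff q n j + X * jacobi_coeff q n (j - 1) + Y * jacobi_coeff q n (j + 1)
      = (1 + Z) * (qpoch q (2 * n) * ((1 - X) * (1 - Y)) * (inv_qpoch q A * inv_qpoch q B))
        + qpoch q (2 * n) * inv_qpoch q A * (X * inv_qpoch q (B - 2)) + qpoch q (2 * n) * inv_qpoch q B * (Y * inv_qpoch q (A - 2))"
    unfolding e2 e3 e4 by (simp add: algebra_simps)
  also have "\<dots> = qpoch q (2 * n) * (inv_qpoch q A * inv_qpoch q B) *
      ((1 + Z) * ((1 - X) * (1 - Y)) + (X - Z) * (1 - Y) + (Y - Z) * (1 - X))"
    unfolding iA2 iB2 by (simp add: algebra_simps)
  also have "(1 + Z) * ((1 - X) * (1 - Y)) + (X - Z) * (1 - Y) + (Y - Z) * (1 - X) = (1 - Z) * (1 - X * Y)"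
    by (simp add: algebra_simps)
  finally show ?thesis unfolding e1 by (simp add: A_def B_def X_def Y_def Z_def algebra_simps)
qed

lemma jacobi_coeff_zero: "\<bar>j\<bar> > int n \<Longrightarrow> jacobi_coeff q n j = 0"
  by (auto simp: jacobi_coeff_def inv_qpoch_def)

text \<open>Induction on n: two further factors on the left, the coefficient recurrence on the
  right. The summation ranges may be shifted freely because the coefficients vanish outside
  [-n, n].\<close>

lemma finite_jacobi_triple:
  assumes q: "norm (a * b) < 1"
  shows "(\<Prod>k<n. (1 + a * (a * b) ^ k) * (1 + b * (a * b) ^ k))
       = (\<Sum>j\<in>{- int n..int n}. jacobi_term a b j * jacobi_coeff (a * b) n j)"
proof (induction n)
  case 0
  then show ?case by (simp add: jacobi_term_def tri_plus_def tri_minus_def jacobi_coeff_def inv_qpoch_def qpoch_def)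
next
  case (Suc n)
  define q where "q = a * b"
  have nq: "norm q < 1" using q by (simp add: q_def)
  define I where "I = {- int (Suc n)..int (Suc n)}"
  define S where "S = (\<Sum>j\<in>{- int n..int n}. jacobi_term a b j * jacobi_coeff q n j)"
  have ext: "(\<Sum>j\<in>K. jacobi_term a b j * jacobi_coeff q n j) = S" if "finite K" "{- int n..int n} \<subseteq> K" for K
    unfolding S_def using that by (intro sum.mono_neutral_right) (auto simp: jacobi_coeff_zero)
  have s0: "(\<Sum>j\<in>I. jacobi_term a b j * jacobi_coeff q n j) = S" by (rule ext) (auto simp: I_def)
  have s1: "(\<Sum>j\<in>I. q ^ nat (int n + 1 - j) * jacobi_term a b j * jacobi_coeff q n (j - 1)) = a * q ^ n * S"
  proof -
    have "(\<Sum>j\<in>I. q ^ nat (int n + 1 - j) * jacobi_term a b j * jacobi_coeff q n (j - 1))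
        = (\<Sum>j\<in>I. a * q ^ n * (jacobi_term a b (j - 1) * jacobi_coeff q n (j - 1)))"
      by (intro sum.cong refl) (use jacobi_term_shift_a[of _ n a b] in \<open>auto simp: I_def q_def mult_ac\<close>)
    also have "\<dots> = a * q ^ n * (\<Sum>j\<in>(\<lambda>j. j - 1) ` I. jacobi_term a b j * jacobi_coeff q n j)"
      by (subst sum.reindex) (auto simp: sum_distrib_left inj_on_def)
    also have "(\<Sum>j\<in>(\<lambda>j. j - 1) ` I. jacobi_term a b j * jacobi_coeff q n j) = S"
    proof (rule ext)
      show "{- int n..int n} \<subseteq> (\<lambda>j. j - 1) ` I"
      proof
        fix x assume "x \<in> {- int n..int n}"
        then have "x = (x + 1) - 1" "x + 1 \<in> I" by (auto simp: I_def)
        then show "x \<in> (\<lambda>j. j - 1) ` I" by blast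
      qed
    qed (auto simp: I_def)
    finally show ?thesis .
  qed
  have s2: "(\<Sum>j\<in>I. q ^ nat (int n + 1 + j) * jacobi_term a b j * jacobi_coeff q n (j + 1)) = b * q ^ n * S"
  proof -
    have "(\<Sum>j\<in>I. q ^ nat (int n + 1 + j) * jacobi_term a b j * jacobi_coeff q n (j + 1))
        = (\<Sum>j\<in>I. b * q ^ n * (jacobi_term a b (j + 1) * jacobi_coeff q n (j + 1)))"
      by (intro sum.cong refl) (use jacobi_term_shift_b[of _ n b a] in \<open>auto simp: I_def q_def mult_ac\<close>)
    also have "\<dots> = b * q ^ n * (\<Sum>j\<in>(\<lambda>j. j + 1) ` I. jacobi_term a b j * jacobi_coeff q n j)"
      by (subst sum.reindex) (auto simp: sum_distrib_left inj_on_def)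
    also have "(\<Sum>j\<in>(\<lambda>j. j + 1) ` I. jacobi_term a b j * jacobi_coeff q n j) = S"
    proof (rule ext)
      show "{- int n..int n} \<subseteq> (\<lambda>j. j + 1) ` I"
      proof
        fix x assume "x \<in> {- int n..int n}"
        then have "x = (x - 1) + 1" "x - 1 \<in> I" by (auto simp: I_def)
        then show "x \<in> (\<lambda>j. j + 1) ` I" by blast
      qed
    qed (auto simp: I_def)
    finally show ?thesis .
  qed
  have "(\<Sum>j\<in>I. jacobi_term a b j * jacobi_coeff q (Suc n) j)
      = (\<Sum>j\<in>I. (1 + q ^ (2 * n + 1)) * (jacobi_term a b j * jacobi_coeff q n j)
           + q ^ nat (int n + 1 - j) * jacobi_term a b j * jacobi_coeff q n (j - 1)
           + q ^ nat (int n + 1 + j) * jacobi_term a b j * jacobi_coeff q n (j + 1))"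
    by (intro sum.cong refl, subst jacobi_coeff_rec[OF nq]) (auto simp: I_def algebra_simps)
  also have "\<dots> = (1 + q ^ (2 * n + 1)) * S + a * q ^ n * S + b * q ^ n * S"
    unfolding sum.distrib s1 s2 sum_distrib_left[symmetric] s0 ..
  also have "q ^ (2 * n + 1) = (a * b) * (q ^ n * q ^ n)"
    by (simp add: mult_2 power_add q_def[symmetric])
  also have "\<dots> = (a * q ^ n) * (b * q ^ n)" by (simp add: mult_ac)
  also have "(1 + (a * q ^ n) * (b * q ^ n)) * S + a * q ^ n * S + b * q ^ n * S
      = S * ((1 + a * q ^ n) * (1 + b * q ^ n))" by (simp add: algebra_simps)
  finally show ?case using Suc by (simp add: S_def I_def q_def)
qed

lemma norm_jacobi_term_le:
  assumes "norm a \<le> r" "norm b \<le> r" "r \<le> 1" "0 \<le> r"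
  shows "norm (jacobi_term a b j) \<le> r ^ nat \<bar>j\<bar>"
proof -
  have "norm (jacobi_term a b j) \<le> r ^ tri_plus j * r ^ tri_minus j"
    unfolding jacobi_term_def norm_mult norm_power using assms by (intro mult_mono power_mono) auto
  also have "\<dots> = r ^ nat (j\<^sup>2)" by (simp add: power_add[symmetric] tri_plus_tri_minus)
  also have "r ^ nat (j\<^sup>2) \<le> r ^ nat \<bar>j\<bar>"
  proof (intro power_decreasing nat_mono)
    have "\<bar>j\<bar> * 1 \<le> \<bar>j\<bar> * \<bar>j\<bar>" using mult_left_mono[of 1 "\<bar>j\<bar>" "\<bar>j\<bar>"] by (cases "j = 0") auto
    then show "\<bar>j\<bar> \<le> j\<^sup>2" by (simp add: power2_eq_square abs_mult[symmetric])
  qed (use assms in auto)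
  finally show ?thesis .
qed

lemma jacobi_term_summable:
  assumes "norm a < 1" "norm b < 1"
  shows "(\<lambda>j. jacobi_term a b j) summable_on UNIV"
proof -
  define r where "r = max (norm a) (norm b)"
  have "(\<lambda>j. norm (jacobi_term a b j)) summable_on UNIV"
    by (rule Infinite_Sum.abs_summable_on_comparison_test'[OF summable_on_power_abs[of r]])
       (use assms in \<open>auto simp: r_def le_max_iff_disj intro!: norm_jacobi_term_le\<close>)
  then show ?thesis by (rule abs_summable_summable)
qed

text \<open>In the finite form each coefficient tends to 1/(q;q)_inf and all are bounded by one
  constant, while the terms are dominated by r^|j| with r = max(|a|, |b|); hence the limit may be
  taken termwise.\<close>

theorem jacobi_triple:
  assumes ab: "norm a < 1" "norm b < 1"
  shows "(\<Sum>\<^sub>\<infinity>j. jacobi_term a b j) = (\<Prod>k. 1 + a * (a * b) ^ k) * (\<Prod>k. 1 + b * (a * b) ^ k) * eulerE (a * b)"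
proof -
  define q where "q = a * b"
  have q: "norm q < 1"
    using ab mult_left_mono[of "norm b" 1 "norm a"] by (simp add: q_def norm_mult)
  define r where "r = max (norm a) (norm b)"
  have E: "eulerE q \<noteq> 0" by (rule eulerE_nonzero[OF q])
  obtain K1 where K1: "\<And>m. norm (qpoch q m) \<le> K1"
    using convergent_imp_Bseq[OF convergentI[OF qpoch_LIMSEQ[OF q]]] by (auto simp: Bseq_def)
  obtain K2 where K2: "\<And>m. norm (1 / qpoch q m) \<le> K2"
    using convergent_imp_Bseq[OF convergentI[OF tendsto_divide[OF tendsto_const qpoch_LIMSEQ[OF q] E]]]
    by (auto simp: Bseq_def)
  have K0: "K1 \<ge> 0" "K2 \<ge> 0" using K1[of 0] K2[of 0] norm_ge_zero order_trans by blast+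
  have iqb: "norm (inv_qpoch q k) \<le> K2" for k using K2[of "nat k"] K0 by (simp add: inv_qpoch_def)
  have jcb: "norm (jacobi_coeff q n j) \<le> K1 * K2 * K2" for n j
    unfolding jacobi_coeff_def norm_mult using K1 iqb K0 by (intro mult_mono mult_nonneg_nonneg) auto
  have iqlim: "(\<lambda>n. inv_qpoch q (int n + j)) \<longlonglongrightarrow> 1 / eulerE q" for j
  proof -
    have l: "(\<lambda>n. 1 / qpoch q n) \<longlonglongrightarrow> 1 / eulerE q" by (intro tendsto_intros qpoch_LIMSEQ q E)
    have f: "filterlim (\<lambda>n. nat (int n + j)) at_top sequentially"
      unfolding filterlim_at_top
    proof
      fix Z
      show "\<forall>\<^sub>F n in sequentially. Z \<le> nat (int n + j)"
        using eventually_ge_at_top[of "nat (int Z - j)"] by eventually_elim linarith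
    qed
    have "(\<lambda>n. 1 / qpoch q (nat (int n + j))) \<longlonglongrightarrow> 1 / eulerE q" by (rule filterlim_compose[OF l f])
    moreover have "\<forall>\<^sub>F n in sequentially. 1 / qpoch q (nat (int n + j)) = inv_qpoch q (int n + j)"
      using eventually_ge_at_top[of "nat (- j)"] by eventually_elim (auto simp: inv_qpoch_def)
    ultimately show ?thesis by (rule Lim_transform_eventually)
  qed
  have jclim: "(\<lambda>n. jacobi_coeff q n j) \<longlonglongrightarrow> eulerE q * (1 / eulerE q) * (1 / eulerE q)" for j
  proof -
    have "(\<lambda>n. qpoch q (2 * n)) \<longlonglongrightarrow> eulerE q"
      using LIMSEQ_subseq_LIMSEQ[OF qpoch_LIMSEQ[OF q], of "\<lambda>n. 2 * n"] by (simp add: strict_mono_def o_def)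
    then show ?thesis
      unfolding jacobi_coeff_def using iqlim[of "- j"] iqlim[of j] by (intro tendsto_mult) auto
  qed
  have dom: "(\<lambda>n. \<Sum>\<^sub>\<infinity>j. jacobi_term a b j * jacobi_coeff q n j) \<longlonglongrightarrow> (\<Sum>\<^sub>\<infinity>j. jacobi_term a b j * (1 / eulerE q))"
  proof (rule infsum_dominated_convergence)
    show "(\<lambda>j. r ^ nat \<bar>j\<bar> * (K1 * K2 * K2)) summable_on UNIV"
      using ab by (intro summable_on_cmult_left summable_on_power_abs) (auto simp: r_def le_max_iff_disj)
    show "norm (jacobi_term a b j * jacobi_coeff q n j) \<le> r ^ nat \<bar>j\<bar> * (K1 * K2 * K2)" for n j
      unfolding norm_mult[of "jacobi_term a b j"] using ab jcb
      by (intro mult_mono norm_jacobi_term_le) (auto simp: r_def le_max_iff_disj)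
    show "(\<lambda>n. jacobi_term a b j * jacobi_coeff q n j) \<longlonglongrightarrow> jacobi_term a b j * (1 / eulerE q)" for j
      using jclim[of j] E by (intro tendsto_mult tendsto_const) simp
  qed
  have fin: "(\<Sum>\<^sub>\<infinity>j. jacobi_term a b j * jacobi_coeff q n j) = (\<Prod>k<n. (1 + a * q ^ k) * (1 + b * q ^ k))" for n
  proof -
    have "(\<Sum>\<^sub>\<infinity>j. jacobi_term a b j * jacobi_coeff q n j) = (\<Sum>\<^sub>\<infinity>j\<in>{- int n..int n}. jacobi_term a b j * jacobi_coeff q n j)"
      by (rule infsum_cong_neutral) (auto simp: jacobi_coeff_zero)
    then show ?thesis using finite_jacobi_triple[of a b n] q by (simp add: q_def)
  qed
  have "(\<lambda>n. (\<Prod>k<n. 1 + a * q ^ k) * (\<Prod>k<n. 1 + b * q ^ k))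
      \<longlonglongrightarrow> (\<Prod>k. 1 + a * q ^ k) * (\<Prod>k. 1 + b * q ^ k)"
    by (intro tendsto_mult LIMSEQ_prod_one_plus_geometric q)
  with dom have "(\<Sum>\<^sub>\<infinity>j. jacobi_term a b j * (1 / eulerE q)) = (\<Prod>k. 1 + a * q ^ k) * (\<Prod>k. 1 + b * q ^ k)"
    unfolding fin prod.distrib by (rule LIMSEQ_unique)
  moreover have "(\<Sum>\<^sub>\<infinity>j. jacobi_term a b j * (1 / eulerE q)) = (\<Sum>\<^sub>\<infinity>j. jacobi_term a b j) * (1 / eulerE q)"
    by (rule infsum_cmult_left')
  ultimately show ?thesis using E by (simp add: q_def field_simps)
qed

text \<open>The product (q;q^2)_inf over the odd exponents.\<close>

definition oddE :: "complex \<Rightarrow> complex" where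
  "oddE q = (\<Prod>k. 1 + (- q) * (q\<^sup>2) ^ k)"

lemma norm_power_less_1: "norm (q::complex) < 1 \<Longrightarrow> n > 0 \<Longrightarrow> norm (q ^ n) < 1"
  by (simp add: norm_power power_less_one_iff)

lemma oddE_nonzero: "norm q < 1 \<Longrightarrow> oddE q \<noteq> 0"
  unfolding oddE_def by (rule prodinf_one_plus_geometric_nonzero) (auto intro: norm_power_less_1)

lemma eulerE_split2:
  assumes q: "norm q < 1"
  shows "eulerE q = oddE q * eulerE (q\<^sup>2)"
proof -
  have q2: "norm (q\<^sup>2) < 1" using norm_power_less_1[OF q, of 2] by simp
  have "(\<lambda>n. qpoch q (2 * n)) \<longlonglongrightarrow> eulerE q"
    using LIMSEQ_subseq_LIMSEQ[OF qpoch_LIMSEQ[OF q], of "\<lambda>n. 2 * n"] by (simp add: strict_mono_def o_def)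
  moreover have "qpoch q (2 * n) = (\<Prod>k<n. 1 + (- q) * (q\<^sup>2) ^ k) * (\<Prod>k<n. 1 + (- (q\<^sup>2)) * (q\<^sup>2) ^ k)" for n
    by (induction n) (simp_all add: qpoch_def algebra_simps power_mult power2_eq_square power_mult_distrib)
  moreover have "(\<lambda>n. (\<Prod>k<n. 1 + (- q) * (q\<^sup>2) ^ k) * (\<Prod>k<n. 1 + (- (q\<^sup>2)) * (q\<^sup>2) ^ k)) \<longlonglongrightarrow> oddE q * eulerE (q\<^sup>2)"
    unfolding oddE_def eulerE_altdef[of "q\<^sup>2"] by (intro tendsto_mult LIMSEQ_prod_one_plus_geometric q2)
  ultimately show ?thesis using LIMSEQ_unique by fastforce
qed

text \<open>Factors pair up as (1 - q^m)(1 + q^m) = 1 - q^(2m) for odd m.\<close>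

lemma oddE_mult_minus:
  assumes q: "norm q < 1"
  shows "oddE q * oddE (- q) = oddE (q\<^sup>2)"
proof -
  have q2: "norm (q\<^sup>2) < 1" "norm ((q\<^sup>2)\<^sup>2) < 1"
    using norm_power_less_1[OF q, of 2] norm_power_less_1[OF q, of 4] by (auto simp: power_mult[symmetric])
  have "(\<lambda>n. (\<Prod>k<n. 1 + (- q) * (q\<^sup>2) ^ k) * (\<Prod>k<n. 1 + (- (- q)) * ((- q)\<^sup>2) ^ k)) \<longlonglongrightarrow> oddE q * oddE (- q)"
    unfolding oddE_def using q2 by (intro tendsto_mult LIMSEQ_prod_one_plus_geometric) auto
  moreover have "(\<Prod>k<n. 1 + (- q) * (q\<^sup>2) ^ k) * (\<Prod>k<n. 1 + (- (- q)) * ((- q)\<^sup>2) ^ k)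
     = (\<Prod>k<n. 1 + (- (q\<^sup>2)) * ((q\<^sup>2)\<^sup>2) ^ k)" for n
    by (induction n) (simp_all add: algebra_simps power2_eq_square power_mult_distrib)
  moreover have "(\<lambda>n. \<Prod>k<n. 1 + (- (q\<^sup>2)) * ((q\<^sup>2)\<^sup>2) ^ k) \<longlonglongrightarrow> oddE (q\<^sup>2)"
    unfolding oddE_def by (intro LIMSEQ_prod_one_plus_geometric q2)
  ultimately show ?thesis using LIMSEQ_unique by fastforce
qed

text \<open>The triple product at a = -q, b = -q^2: as ab = q^3, its three products run through the
  exponents 1, 2 and 0 modulo 3 and fill up (q;q)_inf.\<close>

lemma pentagonal:
  assumes q: "norm q < 1"
  shows "(\<Sum>\<^sub>\<infinity>j. jacobi_term (- q) (- (q\<^sup>2)) j) = eulerE q"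
proof -
  have q2: "norm (q\<^sup>2) < 1" "norm (q ^ 3) < 1" using norm_power_less_1[OF q] by auto
  have q3: "- q * - (q\<^sup>2) = q ^ 3" by (simp add: power2_eq_square power3_eq_cube)
  have "(\<lambda>n. qpoch q (3 * n)) \<longlonglongrightarrow> eulerE q"
    using LIMSEQ_subseq_LIMSEQ[OF qpoch_LIMSEQ[OF q], of "\<lambda>n. 3 * n"] by (simp add: strict_mono_def o_def)
  moreover have "qpoch q (3 * n) = (\<Prod>k<n. 1 + (- q) * (q ^ 3) ^ k) * (\<Prod>k<n. 1 + (- (q\<^sup>2)) * (q ^ 3) ^ k)
      * (\<Prod>k<n. 1 + (- (q ^ 3)) * (q ^ 3) ^ k)" for n
  proof (induction n)
    case (Suc n)
    have "3 * Suc n = Suc (Suc (Suc (3 * n)))" by simp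
    then have "qpoch q (3 * Suc n) = qpoch q (3 * n) * ((1 - q ^ Suc (3 * n)) * (1 - q ^ Suc (Suc (3 * n))) * (1 - q ^ Suc (Suc (Suc (3 * n)))))"
      unfolding qpoch_def by (simp only: prod.lessThan_Suc mult.assoc)
    also have "q ^ Suc (3 * n) = q * (q ^ 3) ^ n" by (simp add: power_mult)
    also have "q ^ Suc (Suc (3 * n)) = q\<^sup>2 * (q ^ 3) ^ n" by (simp add: power_mult power2_eq_square)
    also have "q ^ Suc (Suc (Suc (3 * n))) = q ^ 3 * (q ^ 3) ^ n" by (simp add: power_mult power3_eq_cube)
    finally show ?case unfolding Suc by simp
  qed (simp add: qpoch_def)
  moreover have "(\<lambda>n. (\<Prod>k<n. 1 + (- q) * (q ^ 3) ^ k) * (\<Prod>k<n. 1 + (- (q\<^sup>2)) * (q ^ 3) ^ k)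
      * (\<Prod>k<n. 1 + (- (q ^ 3)) * (q ^ 3) ^ k)) \<longlonglongrightarrow>
      (\<Prod>k. 1 + (- q) * (q ^ 3) ^ k) * (\<Prod>k. 1 + (- (q\<^sup>2)) * (q ^ 3) ^ k) * eulerE (q ^ 3)"
    unfolding eulerE_altdef[of "q ^ 3"] by (intro tendsto_mult LIMSEQ_prod_one_plus_geometric q2)
  ultimately have "eulerE q = (\<Prod>k. 1 + (- q) * (q ^ 3) ^ k) * (\<Prod>k. 1 + (- (q\<^sup>2)) * (q ^ 3) ^ k) * eulerE (q ^ 3)"
    using LIMSEQ_unique by fastforce
  also have "\<dots> = (\<Sum>\<^sub>\<infinity>j. jacobi_term (- q) (- (q\<^sup>2)) j)"
    using jacobi_triple[of "- q" "- (q\<^sup>2)"] q q2 unfolding q3 by simp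
  finally show ?thesis ..
qed

lemma jacobi_term_diag: "jacobi_term a a j = a ^ nat (j\<^sup>2)"
  by (simp add: jacobi_term_def power_add[symmetric] tri_plus_tri_minus)

lemma infsum_square_power:
  assumes q: "norm q < 1"
  shows "(\<Sum>\<^sub>\<infinity>n::int. q ^ nat (n\<^sup>2)) = oddE (- q) ^ 2 * eulerE (q\<^sup>2)"
  using jacobi_triple[of q q] q by (simp add: jacobi_term_diag oddE_def power2_eq_square)

lemma ramphi_eulerE:
  assumes q: "norm q < 1"
  shows "(\<Sum>\<^sub>\<infinity>n::int. (- q) ^ nat (n\<^sup>2)) * eulerE (q\<^sup>2) = eulerE q ^ 2"
  using infsum_square_power[of "- q"] eulerE_split2[OF q] q by (simp add: power2_eq_square)

text \<open>Here psi(q) = f(q, q^3), and in the triple product the exponents 1 and 3 modulo 4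
  recombine to (-q;q^2)_inf.\<close>

lemma rampsi_eulerE:
  assumes q: "norm q < 1"
  shows "(\<Sum>n::nat. q ^ (n * (n + 1) div 2)) * eulerE q = eulerE (q\<^sup>2) ^ 2"
proof -
  have q3: "norm (q ^ 3) < 1" "norm (q\<^sup>2) < 1" "norm (q ^ 4) < 1" using norm_power_less_1[OF q] by auto
  \<comment> \<open>Triangular numbers n(n + 1)/2 are the values 2 j^2 - j over all integers j, with
    j = -n/2 for even n and j = (n + 1)/2 for odd n.\<close>
  define h where "h = (\<lambda>n::nat. if even n then - int (n div 2) else int ((n + 1) div 2))"
  have bij: "bij_betw h UNIV UNIV"
  proof (rule bij_betwI[where g = "\<lambda>j. if j \<le> 0 then nat (- 2 * j) else nat (2 * j - 1)"])
    show "(if h x \<le> 0 then nat (- 2 * h x) else nat (2 * h x - 1)) = x" for x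
      by (cases "even x") (auto simp: h_def elim!: evenE oddE)
    show "h (if y \<le> 0 then nat (- 2 * y) else nat (2 * y - 1)) = y" for y
    proof (cases "y \<le> 0")
      case True
      then have "nat (- 2 * y) = 2 * nat (- y)" by simp
      with True show ?thesis by (simp add: h_def)
    next
      case False
      then have "nat (2 * y - 1) = 2 * nat (y - 1) + 1" by simp
      with False show ?thesis by (simp add: h_def)
    qed
  qed auto
  have fth: "jacobi_term q (q ^ 3) (h n) = q ^ (n * (n + 1) div 2)" for n
  proof -
    have "2 * int (tri_plus (h n) + 3 * tri_minus (h n)) = h n * (h n + 1) + 3 * (h n * (h n - 1))"
      unfolding two_tri_plus[symmetric] two_tri_minus[symmetric] by simp
    also have "\<dots> = int (n * (n + 1))"
      by (cases "even n") (auto simp: h_def algebra_simps elim!: evenE oddE)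
    finally have "int (2 * (tri_plus (h n) + 3 * tri_minus (h n))) = int (n * (n + 1))" by simp
    then have "n * (n + 1) = 2 * (tri_plus (h n) + 3 * tri_minus (h n))" by (simp only: of_nat_eq_iff)
    then have "tri_plus (h n) + 3 * tri_minus (h n) = n * (n + 1) div 2" by simp
    then show ?thesis by (simp add: jacobi_term_def power_mult[symmetric] power_add[symmetric])
  qed
  have s: "(\<lambda>j. jacobi_term q (q ^ 3) j) summable_on UNIV" by (rule jacobi_term_summable) (use q q3 in auto)
  then have "((\<lambda>j. jacobi_term q (q ^ 3) j) has_sum (\<Sum>\<^sub>\<infinity>j. jacobi_term q (q ^ 3) j)) UNIV" by simp
  then have "((\<lambda>n. jacobi_term q (q ^ 3) (h n)) has_sum (\<Sum>\<^sub>\<infinity>j. jacobi_term q (q ^ 3) j)) UNIV"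
    using has_sum_reindex_bij_betw[OF bij] by metis
  then have "(\<lambda>n. q ^ (n * (n + 1) div 2)) sums (\<Sum>\<^sub>\<infinity>j. jacobi_term q (q ^ 3) j)"
    unfolding fth by (rule has_sum_imp_sums)
  then have "(\<Sum>n::nat. q ^ (n * (n + 1) div 2)) = (\<Sum>\<^sub>\<infinity>j. jacobi_term q (q ^ 3) j)" by (simp add: sums_iff)
  also have "\<dots> = (\<Prod>k. 1 + q * (q ^ 4) ^ k) * (\<Prod>k. 1 + q ^ 3 * (q ^ 4) ^ k) * eulerE (q ^ 4)"
    using jacobi_triple[of q "q ^ 3"] q q3 by (simp add: power_Suc[symmetric] del: power_Suc)
  also have "(\<Prod>k. 1 + q * (q ^ 4) ^ k) * (\<Prod>k. 1 + q ^ 3 * (q ^ 4) ^ k) = oddE (- q)"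
  proof -
    have "(\<lambda>n. \<Prod>k<n. 1 + q * (q\<^sup>2) ^ k) \<longlonglongrightarrow> oddE (- q)"
      unfolding oddE_def using LIMSEQ_prod_one_plus_geometric[OF q3(2), of q] by simp
    then have "(\<lambda>n. \<Prod>k<2 * n. 1 + q * (q\<^sup>2) ^ k) \<longlonglongrightarrow> oddE (- q)"
      using LIMSEQ_subseq_LIMSEQ[of _ _ "\<lambda>n. 2 * n"] by (force simp: strict_mono_def o_def)
    moreover have "(\<Prod>k<2 * n. 1 + q * (q\<^sup>2) ^ k) = (\<Prod>k<n. 1 + q * (q ^ 4) ^ k) * (\<Prod>k<n. 1 + q ^ 3 * (q ^ 4) ^ k)" for n
    proof (induction n)
      case (Suc n)
      have e: "(q\<^sup>2) ^ (2 * n) = (q ^ 4) ^ n" by (simp add: power_mult[symmetric])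
      moreover have "q * (q\<^sup>2) ^ Suc (2 * n) = q ^ 3 * (q ^ 4) ^ n"
        unfolding e[symmetric] by (simp add: power2_eq_square power3_eq_cube)
      moreover have "2 * Suc n = Suc (Suc (2 * n))" by simp
      ultimately show ?case using Suc by (simp del: power_Suc add: mult_ac)
    qed simp
    moreover have "(\<lambda>n. (\<Prod>k<n. 1 + q * (q ^ 4) ^ k) * (\<Prod>k<n. 1 + q ^ 3 * (q ^ 4) ^ k)) \<longlonglongrightarrow>
       (\<Prod>k. 1 + q * (q ^ 4) ^ k) * (\<Prod>k. 1 + q ^ 3 * (q ^ 4) ^ k)"
      by (intro tendsto_mult LIMSEQ_prod_one_plus_geometric q3)
    ultimately show ?thesis using LIMSEQ_unique by fastforce
  qed
  also have "oddE (- q) * eulerE (q ^ 4) * eulerE q = eulerE (q\<^sup>2) ^ 2"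
  proof -
    have "eulerE (q\<^sup>2) = oddE (q\<^sup>2) * eulerE (q ^ 4)"
      using eulerE_split2[OF q3(2)] by (simp add: power_mult[symmetric])
    then show ?thesis using eulerE_split2[OF q] oddE_mult_minus[OF q]
      by (simp add: power2_eq_square mult_ac)
  qed
  finally show ?thesis .
qed

section \<open>Poisson summation for Gaussians\<close>

lemma infsum_int_residues:
  fixes F :: "int \<Rightarrow> complex"
  assumes m: "m > 0" and F: "F summable_on UNIV"
  shows "(\<Sum>\<^sub>\<infinity>k. F k) = (\<Sum>j\<in>{0..<m}. \<Sum>\<^sub>\<infinity>n. F (j + m * n))"
proof -
  have bij: "bij_betw (\<lambda>(j, n). j + m * n) ({0..<m} \<times> UNIV) UNIV"
  proof (rule bij_betwI[where g = "\<lambda>k. (k mod m, k div m)"])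
    show "(\<lambda>k. (k mod m, k div m)) \<in> UNIV \<rightarrow> {0..<m} \<times> UNIV" using m by auto
  qed (use m in auto)
  have s: "(\<lambda>(j, n). F (j + m * n)) summable_on ({0..<m} \<times> UNIV)"
    using F summable_on_reindex_bij_betw[OF bij, of F] by (simp add: case_prod_unfold)
  have "(\<Sum>\<^sub>\<infinity>k. F k) = (\<Sum>\<^sub>\<infinity>(j, n)\<in>{0..<m} \<times> UNIV. F (j + m * n))"
    using infsum_reindex_bij_betw[OF bij, of F] by (simp add: case_prod_unfold)
  also have "\<dots> = (\<Sum>\<^sub>\<infinity>j\<in>{0..<m}. \<Sum>\<^sub>\<infinity>n. F (j + m * n))"
    by (rule infsum_Sigma'_banach[symmetric, OF s])
  also have "\<dots> = (\<Sum>j\<in>{0..<m}. \<Sum>\<^sub>\<infinity>n. F (j + m * n))" by (rule infsum_finite) simp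
  finally show ?thesis .
qed

lemma infsum_sum_finite:
  fixes f :: "'a \<Rightarrow> 'b \<Rightarrow> complex"
  assumes "finite J" "\<And>j. j \<in> J \<Longrightarrow> f j summable_on A"
  shows "(\<Sum>\<^sub>\<infinity>k\<in>A. \<Sum>j\<in>J. f j k) = (\<Sum>j\<in>J. \<Sum>\<^sub>\<infinity>k\<in>A. f j k)"
proof -
  have "((\<lambda>k. \<Sum>j\<in>J. f j k) has_sum (\<Sum>j\<in>J. \<Sum>\<^sub>\<infinity>k\<in>A. f j k)) A"
    using assms
  proof (induction J rule: finite_induct)
    case (insert x F)
    then have "((\<lambda>k. f x k + (\<Sum>j\<in>F. f j k)) has_sum (infsum (f x) A + (\<Sum>j\<in>F. infsum (f j) A))) A"
      by (intro has_sum_add has_sum_infsum) auto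
    with insert show ?case by simp
  qed simp
  then show ?thesis by (rule infsumI)
qed

text \<open>The product formula has no vanishing factor. This nonvanishing allows every later
  division by a theta constant.\<close>

lemma Th_0_nonzero:
  assumes "Re a < 0"
  shows "Th a 0 \<noteq> 0"
proof -
  define p where "p = exp a"
  have p: "norm p < 1" using assms by (simp add: p_def)
  have "exp (a * of_int n ^ 2) = p ^ nat (n\<^sup>2)" for n :: int
  proof -
    have "a * of_int n ^ 2 = of_nat (nat (n\<^sup>2)) * a" by (simp add: of_nat_nat)
    then show ?thesis by (simp only: p_def exp_of_nat_mult)
  qed
  then have "Th a 0 = (\<Sum>\<^sub>\<infinity>n::int. p ^ nat (n\<^sup>2))" by (simp add: Th_def)
  also have "\<dots> \<noteq> 0"
    using infsum_square_power[OF p] oddE_nonzero[of "- p"] eulerE_nonzero[of "p\<^sup>2"] p norm_power_less_1[OF p, of 2] by simp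
  finally show ?thesis .
qed

text \<open>The periodised Gaussian with its square expanded, so that holomorphy in x is inherited
  from \<open>Th\<close>.\<close>

definition gauss_series :: "complex \<Rightarrow> complex \<Rightarrow> complex" where
  "gauss_series s x = exp (- of_real pi * s * x\<^sup>2) * Th (- of_real pi * s) (- 2 * of_real pi * s * x)"

lemma gauss_series_eq_infsum: "gauss_series s x = (\<Sum>\<^sub>\<infinity>n::int. exp (- of_real pi * s * (of_int n + x)\<^sup>2))"
proof -
  have "gauss_series s x = (\<Sum>\<^sub>\<infinity>n::int. exp (- of_real pi * s * x\<^sup>2) *
      exp (- of_real pi * s * of_int n ^ 2 + (- 2 * of_real pi * s * x) * of_int n))"
    unfolding gauss_series_def Th_def by (rule infsum_cmult_right'[symmetric])
  also have "\<dots> = (\<Sum>\<^sub>\<infinity>n::int. exp (- of_real pi * s * (of_int n + x)\<^sup>2))"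
    by (intro infsum_cong) (simp add: exp_add[symmetric] algebra_simps power2_eq_square)
  finally show ?thesis .
qed

lemma Re_pi_pos: "Re s > 0 \<Longrightarrow> Re (- of_real pi * s) < 0"
  by simp

lemma Re_inverse_pos: "Re s > 0 \<Longrightarrow> Re (1 / s) > 0"
  by (simp add: Re_divide sum_power2_gt_zero_iff complex_eq_iff)

text \<open>As functions of x both sides are entire with period 1 and have the same multiplier
  exp(pi/s) e(-x) under x -> x + i/s. The factor c is still unknown here;
  \<open>gauss_poisson\<close> evaluates it.\<close>

lemma gauss_series_proportional:
  assumes s: "Re s > 0"
  obtains c where "\<And>x. gauss_series s x = c * Th (- of_real pi / s) (2 * of_real pi * \<i> * x)"
proof -
  have s0: "s \<noteq> 0" using s by auto
  define g where "g = (\<lambda>x. Th (- of_real pi / s) (2 * of_real pi * \<i> * x))"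
  have n1: "Re (- of_real pi * s) < 0" using s by simp
  have n2: "Re (- of_real pi / s) < 0" using Re_pi_pos[OF Re_inverse_pos[OF s]] by simp
  have hf: "gauss_series s holomorphic_on UNIV"
    unfolding gauss_series_def[abs_def] using n1 by (intro holomorphic_intros Th_holomorphic) auto
  have hg: "g holomorphic_on UNIV"
    unfolding g_def using n2 by (intro holomorphic_intros Th_holomorphic) auto
  have f1: "gauss_series s (z + 1) = gauss_series s z" for z
  proof -
    have "Th (- of_real pi * s) (- 2 * of_real pi * s * (z + 1))
        = Th (- of_real pi * s) (- 2 * of_real pi * s * z + 2 * (- of_real pi * s))"
      by (simp add: algebra_simps)
    also have "\<dots> = exp (of_real pi * s + 2 * of_real pi * s * z) * Th (- of_real pi * s) (- 2 * of_real pi * s * z)"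
      by (subst Th_shift) simp
    finally show ?thesis
      unfolding gauss_series_def by (simp add: exp_add[symmetric] mult.assoc[symmetric])
        (simp add: algebra_simps power2_eq_square)
  qed
  have f2: "gauss_series s (z + \<i> / s) = exp (of_real pi / s) * ee (- z) * gauss_series s z" for z
  proof -
    have "Th (- of_real pi * s) (- 2 * of_real pi * s * (z + \<i> / s) + 2 * of_real pi * \<i>)
        = Th (- of_real pi * s) (- 2 * of_real pi * s * (z + \<i> / s))" by (rule Th_add_2pi)
    moreover have "- 2 * of_real pi * s * (z + \<i> / s) + 2 * of_real pi * \<i> = - 2 * of_real pi * s * z"
      using s0 by (simp add: field_simps)
    ultimately have t: "Th (- of_real pi * s) (- 2 * of_real pi * s * (z + \<i> / s))
       = Th (- of_real pi * s) (- 2 * of_real pi * s * z)" by simp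
    have "- of_real pi * s * (z + \<i> / s)\<^sup>2 = of_real pi / s + 2 * of_real pi * \<i> * (- z) + (- of_real pi * s * z\<^sup>2)"
      using s0 by (simp add: field_simps power2_eq_square)
    then have "exp (- of_real pi * s * (z + \<i> / s)\<^sup>2) = exp (of_real pi / s) * ee (- z) * exp (- of_real pi * s * z\<^sup>2)"
      by (simp only: exp_add ee_def)
    then show ?thesis unfolding gauss_series_def t by simp
  qed
  have g1: "g (z + 1) = g z" for z
    unfolding g_def using Th_add_2pi[of "- of_real pi / s" "2 * of_real pi * \<i> * z"] by (simp add: algebra_simps)
  have g2: "g (z + \<i> / s) = exp (of_real pi / s) * ee (- z) * g z" for z
  proof -
    have "2 * of_real pi * \<i> * (z + \<i> / s) = 2 * of_real pi * \<i> * z + 2 * (- of_real pi / s)"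
      using s0 by (simp add: field_simps)
    then have "g (z + \<i> / s) = exp (- (- of_real pi / s) - 2 * of_real pi * \<i> * z) * g z"
      unfolding g_def by (simp only: Th_shift)
    also have "- (- of_real pi / s) - 2 * of_real pi * \<i> * z = of_real pi / s + 2 * of_real pi * \<i> * (- z)" by simp
    finally show ?thesis by (simp only: exp_add ee_def)
  qed
  have nz: "g 0 \<noteq> 0" using Th_0_nonzero[OF n2] by (simp add: g_def)
  from quasi_periodic_unique[OF hf f1 f2 hg g1 g2 _ nz] that show ?thesis unfolding g_def by auto
qed

abbreviation th0 :: "complex \<Rightarrow> complex" where
  "th0 s \<equiv> Th (- of_real pi * s) 0"

lemma th0_holomorphic: "th0 holomorphic_on {s. Re s > 0}"
proof (rule Th_holomorphic)
  show "open {s. Re s > 0}" by (rule open_halfspace_Re_gt)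
qed (auto intro!: holomorphic_intros)

lemma sum_ee_roots:
  assumes m: "m > (0::int)"
  shows "(\<Sum>j\<in>{0..<m}. ee (of_int k * (of_int j / of_int m))) = (if m dvd k then of_int m else 0)"
proof -
  define z where "z = ee (of_int k / of_int m)"
  have "(\<Sum>j\<in>{0..<m}. ee (of_int k * (of_int j / of_int m))) = (\<Sum>i<nat m. z ^ i)"
  proof (rule sum.reindex_bij_witness[of _ int nat])
    fix j assume "j \<in> {0..<m}"
    then show "z ^ nat j = ee (of_int k * (of_int j / of_int m))"
      unfolding z_def ee_of_nat_mult[symmetric] by (simp add: mult_ac)
  qed (use m in auto)
  also have "\<dots> = (if m dvd k then of_int m else 0)"
  proof (cases "m dvd k")
    case True
    then obtain l where "k = m * l" by auto
    then have "z = 1" using m by (simp add: z_def)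
    then show ?thesis using m True by simp
  next
    case False
    have "z \<noteq> 1"
    proof
      assume "z = 1"
      then obtain l where "of_int k / of_int m = (of_int l :: complex)"
        unfolding z_def ee_eq_1_iff by (auto elim: Ints_cases)
      then have "(of_int k :: complex) = of_int (l * m)" using m by (simp add: field_simps)
      then have "k = l * m" by (simp only: of_int_eq_iff)
      with False show False by simp
    qed
    moreover have "z ^ nat m = 1"
      unfolding z_def ee_of_nat_mult[symmetric] using m by simp
    ultimately show ?thesis using False by (simp add: geometric_sum)
  qed
  finally show ?thesis .
qed

text \<open>The proportionality is summed over x = j/m for j modulo m. The left side becomes a sum
  over the lattice (1/m)Z, that is, the theta constant at t/m^2; on the right only multiples of m
  survive, each counted m times.\<close>

lemma th0_scaling:
  assumes t: "t > 0" and m: "m > (0::int)"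
    and c: "\<And>x. gauss_series (of_real t) x = c * Th (- of_real pi / of_real t) (2 * of_real pi * \<i> * x)"
  shows "th0 (of_real (t / of_int m ^ 2)) = c * of_int m * th0 (of_real (of_int m ^ 2 / t))"
proof -
  define s where "s = complex_of_real t"
  have s: "Re s > 0" using t by (simp add: s_def)
  have s0: "s \<noteq> 0" using s by auto
  have mm: "(of_int m :: complex) \<noteq> 0" using m by simp
  have "Re (- of_real pi * of_real (t / of_int m ^ 2)) < 0" using t m by (simp add: divide_simps zero_less_mult_iff)
  then have sm: "(\<lambda>k::int. exp (- complex_of_real pi * of_real (t / of_int m ^ 2) * of_int k ^ 2 + 0 * of_int k)) summable_on UNIV"
    by (rule abs_summable_summable[OF Th_abs_summable])
  have "th0 (of_real (t / of_int m ^ 2))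
      = (\<Sum>j\<in>{0..<m}. \<Sum>\<^sub>\<infinity>n. exp (- of_real pi * of_real (t / of_int m ^ 2) * of_int (j + m * n) ^ 2 + 0 * of_int (j + m * n)))"
    unfolding Th_def by (rule infsum_int_residues[OF m sm])
  also have "\<dots> = (\<Sum>j\<in>{0..<m}. gauss_series s (of_int j / of_int m))"
    unfolding gauss_series_eq_infsum s_def
  proof (intro sum.cong infsum_cong refl)
    fix j n :: int
    have "of_int n + of_int j / of_int m = (of_int (j + m * n) / of_int m :: complex)"
      using mm by (simp add: field_simps)
    then show "exp (- of_real pi * of_real (t / of_int m ^ 2) * of_int (j + m * n) ^ 2 + 0 * of_int (j + m * n))
      = exp (- of_real pi * of_real t * (of_int n + of_int j / of_int m)\<^sup>2 :: complex)"
      by (simp add: power_divide)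
  qed
  also have "\<dots> = c * (\<Sum>j\<in>{0..<m}. Th (- of_real pi / s) (2 * of_real pi * \<i> * (of_int j / of_int m)))"
    unfolding s_def c sum_distrib_left ..
  also have "(\<Sum>j\<in>{0..<m}. Th (- of_real pi / s) (2 * of_real pi * \<i> * (of_int j / of_int m)))
     = (\<Sum>\<^sub>\<infinity>k::int. exp (- of_real pi / s * of_int k ^ 2) * (if m dvd k then of_int m else 0))"
  proof -
    have n2: "Re (- of_real pi / s) < 0" using Re_pi_pos[OF Re_inverse_pos[OF s]] by simp
    have "(\<Sum>j\<in>{0..<m}. Th (- of_real pi / s) (2 * of_real pi * \<i> * (of_int j / of_int m)))
       = (\<Sum>\<^sub>\<infinity>k::int. \<Sum>j\<in>{0..<m}. exp (- of_real pi / s * of_int k ^ 2 + 2 * of_real pi * \<i> * (of_int j / of_int m) * of_int k))"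
      unfolding Th_def by (rule infsum_sum_finite[symmetric], simp, rule abs_summable_summable[OF Th_abs_summable[OF n2]])
    also have "\<dots> = (\<Sum>\<^sub>\<infinity>k::int. exp (- of_real pi / s * of_int k ^ 2) * (if m dvd k then of_int m else 0))"
      unfolding sum_ee_roots[OF m, symmetric] sum_distrib_left ee_def exp_add by (simp add: mult_ac)
    finally show ?thesis .
  qed
  also have "\<dots> = (\<Sum>\<^sub>\<infinity>k\<in>range (\<lambda>l. m * l). exp (- of_real pi / s * of_int k ^ 2) * of_int m)"
    by (rule infsum_cong_neutral) (auto simp: dvd_def)
  also have "\<dots> = (\<Sum>\<^sub>\<infinity>l. exp (- of_real pi / s * of_int (m * l) ^ 2) * of_int m)"
    using m by (subst infsum_reindex) (auto simp: inj_on_def o_def)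
  also have "\<dots> = (\<Sum>\<^sub>\<infinity>l. exp (- of_real pi / s * of_int (m * l) ^ 2)) * of_int m"
    by (rule infsum_cmult_left')
  also have "(\<Sum>\<^sub>\<infinity>l. exp (- of_real pi / s * of_int (m * l) ^ 2)) = th0 (of_real (of_int m ^ 2 / t))"
    unfolding Th_def s_def by (intro infsum_cong) (simp add: field_simps power2_eq_square)
  finally show ?thesis by (simp add: mult_ac)
qed

text \<open>With cc(t) the unknown constant, u(x) = x cc(x^2) satisfies u(x/m) = u(x) for all
  positive integers m by the scaling relation. From u(1) = 1 it follows that u = 1 at all positive
  rationals, hence everywhere by continuity.\<close>

lemma th0_inversion_real:
  assumes t: "t > 0"
  shows "of_real (sqrt t) * th0 (of_real t) = th0 (of_real (1 / t))"
proof -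
  define cc where "cc = (\<lambda>t::real. th0 (of_real t) / th0 (of_real (1 / t)))"
  have nz: "th0 (of_real t) \<noteq> 0" if "t > 0" for t using that by (intro Th_0_nonzero) auto
  have cceq: "th0 (of_real (t / of_int m ^ 2)) = cc t * of_int m * th0 (of_real (of_int m ^ 2 / t))"
    if "t > 0" "m > 0" for t and m :: int
  proof -
    have "Re (of_real t) > 0" using that by simp
    then obtain c where c: "\<And>x. gauss_series (of_real t) x = c * Th (- of_real pi / of_real t) (2 * of_real pi * \<i> * x)"
      using gauss_series_proportional by blast
    have "th0 (of_real t) = c * th0 (of_real (1 / t))"
      using th0_scaling[OF that(1) _ c, of 1] by simp
    then have "c = cc t" using nz[of "1 / t"] that by (simp add: cc_def)
    then show ?thesis using th0_scaling[OF that c] by simp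
  qed
  define u where "u = (\<lambda>x::real. of_real x * cc (x\<^sup>2))"
  have usc: "u (x / of_int m) = u x" if "x > 0" "m > 0" for x and m :: int
  proof -
    have "x\<^sup>2 / of_int m ^ 2 > 0" using that by simp
    have "cc (x\<^sup>2 / of_int m ^ 2) = cc (x\<^sup>2) * of_int m"
      using cceq[of "x\<^sup>2" m] nz[of "of_int m ^ 2 / x\<^sup>2"] that by (simp add: cc_def)
    then show ?thesis using that by (simp add: u_def power_divide)
  qed
  have u1: "u 1 = 1" using nz[of 1] by (simp add: u_def cc_def)
  have urat: "u (of_int l / of_int m) = 1" if "l > 0" "m > 0" for l m :: int
    using usc[of "of_int l" m] usc[of "of_int l" l] that u1 by simp
  have cont: "isCont u x" if x: "x > 0" for x
  proof -
    have th: "continuous_on {s. Re s > 0} th0" by (rule holomorphic_on_imp_continuous_on[OF th0_holomorphic])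
    have "continuous_on {0<..} u"
      unfolding u_def cc_def
    proof (intro continuous_intros continuous_on_compose2[OF th])
      show "\<forall>x\<in>{0<..}. th0 (complex_of_real (1 / x\<^sup>2)) \<noteq> 0" using nz[of "1 / _\<^sup>2"] by simp
    qed auto
    then show ?thesis using x by (simp add: continuous_on_eq_continuous_at)
  qed
  define x where "x = sqrt t"
  have x: "x > 0" using t by (simp add: x_def)
  \<comment> \<open>Rational approximations from above, within 1/(n + 1) of x, with positive
    numerators because x > 0.\<close>
  define r :: "nat \<Rightarrow> real" where "r = (\<lambda>n::nat. of_int (\<lceil>real (Suc n) * x\<rceil>) / of_int (int (Suc n)))"
  have rlim: "r \<longlonglongrightarrow> x"
  proof (rule tendsto_sandwich)
    show "\<forall>\<^sub>F n in sequentially. x \<le> r n"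
    proof (rule always_eventually, rule allI)
      fix n
      have "real (Suc n) * x \<le> of_int \<lceil>real (Suc n) * x\<rceil>" by (rule le_of_int_ceiling)
      then show "x \<le> r n" by (simp add: r_def field_simps)
    qed
    show "\<forall>\<^sub>F n in sequentially. r n \<le> x + 1 / real (Suc n)"
    proof (rule always_eventually, rule allI)
      fix n
      have "of_int \<lceil>real (Suc n) * x\<rceil> \<le> real (Suc n) * x + 1" by linarith
      then have "r n \<le> (real (Suc n) * x + 1) / real (Suc n)" unfolding r_def of_int_of_nat_eq by (intro divide_right_mono) auto
      also have "\<dots> = x + 1 / real (Suc n)" by (simp add: field_simps)
      finally show "r n \<le> x + 1 / real (Suc n)" .
    qed
    show "(\<lambda>n. x + 1 / real (Suc n)) \<longlonglongrightarrow> x"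
      using tendsto_add[OF tendsto_const LIMSEQ_inverse_real_of_nat, of x] by (simp add: inverse_eq_divide)
  qed auto
  have "(\<lambda>n. u (r n)) \<longlonglongrightarrow> u x" by (rule isCont_tendsto_compose[OF cont[OF x] rlim])
  moreover have "u (r n) = 1" for n
    unfolding r_def using x by (intro urat) auto
  ultimately have "u x = 1" by (simp add: LIMSEQ_const_iff)
  then have "of_real x * (th0 (of_real (x\<^sup>2)) / th0 (of_real (1 / x\<^sup>2))) = 1"
    by (simp only: u_def cc_def)
  moreover have "x\<^sup>2 = t" using t by (simp add: x_def)
  ultimately have "of_real (sqrt t) * (th0 (of_real t) / th0 (of_real (1 / t))) = 1"
    by (simp only: x_def)
  then show ?thesis using nz[of "1 / t"] t by (simp add: field_simps)
qed

text \<open>Both sides are holomorphic for Re s > 0, where the principal root is too, and they agree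
  on the positive reals.\<close>

lemma th0_inversion:
  assumes s: "Re s > 0"
  shows "csqrt s * th0 s = th0 (1 / s)"
proof -
  define S where "S = {s. Re s > 0}"
  define F where "F = (\<lambda>s. csqrt s * th0 s - th0 (1 / s))"
  have S: "open S" "connected S" unfolding S_def
    by (auto simp: open_halfspace_Re_gt intro: convex_connected convex_halfspace_Re_gt)
  have h1: "(\<lambda>s. th0 (1 / s)) holomorphic_on S"
  proof (rule Th_holomorphic[OF S(1)])
    show "Re (- of_real pi * (1 / s)) < 0" if "s \<in> S" for s
      using that Re_pi_pos[OF Re_inverse_pos[of s]] by (simp only: S_def mem_Collect_eq)
  qed (auto intro!: holomorphic_intros simp: S_def)
  have hF: "F holomorphic_on S"
    unfolding F_def using h1 th0_holomorphic
    by (intro holomorphic_intros) (auto simp: S_def complex_nonpos_Reals_iff)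
  have "F s = 0"
  proof (rule analytic_continuation[OF hF S, of "of_real ` {0<..}" 1])
    show "of_real ` {0<..} \<subseteq> S" by (auto simp: S_def)
    show "(1::complex) \<in> S" by (simp add: S_def)
    show "(1::complex) islimpt of_real ` {0<..}"
    proof -
      have "(\<lambda>n. complex_of_real (1 + 1 / real (Suc n))) \<longlonglongrightarrow> of_real (1 + 0)"
        by (intro tendsto_of_real tendsto_add tendsto_const) (use LIMSEQ_inverse_real_of_nat in \<open>simp add: inverse_eq_divide\<close>)
      then show ?thesis
        unfolding islimpt_sequential
        by (intro exI[of _ "\<lambda>n. complex_of_real (1 + 1 / real (Suc n))"] conjI allI)
           (auto simp: add_pos_pos simp del: of_real_add of_real_divide of_nat_Suc intro!: imageI)
    qed
    show "F z = 0" if "z \<in> of_real ` {0<..}" for z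
      using that th0_inversion_real by (auto simp: F_def)
    show "s \<in> S" using s by (simp add: S_def)
  qed
  then show ?thesis by (simp add: F_def)
qed

text \<open>At x = 0 the proportionality is the inversion formula, so its constant is the reciprocal
  of \<open>csqrt s\<close>.\<close>

theorem gauss_poisson:
  assumes s: "Re s > 0"
  shows "csqrt s * (\<Sum>\<^sub>\<infinity>n::int. exp (- of_real pi * s * (of_int n + x)\<^sup>2))
       = Th (- of_real pi / s) (2 * of_real pi * \<i> * x)"
proof -
  obtain c where c: "\<And>x. gauss_series s x = c * Th (- of_real pi / s) (2 * of_real pi * \<i> * x)"
    using gauss_series_proportional[OF s] by blast
  have n2: "Re (- of_real pi / s) < 0" using Re_pi_pos[OF Re_inverse_pos[OF s]] by simp
  have "th0 s = c * Th (- of_real pi / s) 0" using c[of 0] by (simp add: gauss_series_def)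
  moreover have "csqrt s * th0 s = Th (- of_real pi / s) 0" using th0_inversion[OF s] by simp
  ultimately have "(csqrt s * c) * Th (- of_real pi / s) 0 = 1 * Th (- of_real pi / s) 0" by simp
  then have "csqrt s * c = 1" using Th_0_nonzero[OF n2] by (simp only: mult_cancel_right) simp
  then show ?thesis unfolding gauss_series_eq_infsum[symmetric] c by (simp add: mult.assoc[symmetric])
qed

section \<open>The Dedekind eta function\<close>

text \<open>Dedekind's function in the form of the pentagonal number series, which inherits the inversion
  formula of theta series.\<close>
definition eta :: "complex \<Rightarrow> complex" where
  "eta \<tau> = ee (\<tau> / 24) * Th (3 * of_real pi * \<i> * \<tau>) (of_real pi * \<i> * (1 - \<tau>))"

lemma norm_ee_less_1: "Im \<tau> > 0 \<Longrightarrow> norm (ee \<tau>) < 1"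
  by (simp add: norm_ee)

lemma exp_pi_int: "exp (of_real pi * \<i> * of_int j) = (- 1) ^ nat (j\<^sup>2)"
proof (cases "even j")
  case True
  then obtain k where k: "j = 2 * k" by auto
  have "nat (j\<^sup>2) = 2 * nat (2 * k\<^sup>2)" by (simp add: k power_mult_distrib nat_mult_distrib)
  moreover have "exp (of_real pi * \<i> * of_int j) = ee (of_int k)" by (simp add: k ee_def mult_ac)
  ultimately show ?thesis by simp
next
  case False
  then obtain k where k: "j = 2 * k + 1" by (auto elim: oddE)
  have "int (nat (j\<^sup>2)) = j\<^sup>2" by simp
  then have "odd (nat (j\<^sup>2))" using False by (metis even_of_nat even_power)
  moreover have "of_real pi * \<i> * of_int j = 2 * of_real pi * \<i> * of_int k + of_real pi * \<i>"
    by (simp add: k algebra_simps)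
  then have "exp (of_real pi * \<i> * of_int j) = ee (of_int k) * exp (of_real pi * \<i>)"
    by (simp only: exp_add ee_def)
  ultimately show ?thesis by simp
qed

lemma eta_eulerE:
  assumes t: "Im \<tau> > 0"
  shows "eta \<tau> = ee (\<tau> / 24) * eulerE (ee \<tau>)"
proof -
  have "exp (3 * of_real pi * \<i> * \<tau> * of_int j ^ 2 + of_real pi * \<i> * (1 - \<tau>) * of_int j)
      = jacobi_term (- ee \<tau>) (- ((ee \<tau>)\<^sup>2)) j" for j
  proof -
    define N where "N = tri_plus j + 2 * tri_minus j"
    have "2 * int N = j * (j + 1) + 2 * (j * (j - 1))"
      unfolding two_tri_plus[symmetric] two_tri_minus[symmetric] N_def by simp
    then have "2 * int N = 3 * j\<^sup>2 - j" by (simp add: algebra_simps power2_eq_square)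
    then have "(of_int (2 * int N) :: complex) = of_int (3 * j\<^sup>2 - j)" by (simp only:)
    then have N: "2 * of_nat N = (3 * of_int j ^ 2 - of_int j :: complex)" by simp
    have "jacobi_term (- ee \<tau>) (- ((ee \<tau>)\<^sup>2)) j = ((- 1) ^ tri_plus j * (- 1) ^ tri_minus j) * (ee \<tau> ^ tri_plus j * (ee \<tau> ^ 2) ^ tri_minus j)"
      unfolding jacobi_term_def power_minus[of "ee \<tau>"] power_minus[of "(ee \<tau>)\<^sup>2"] by (simp add: mult_ac)
    also have "\<dots> = (- 1) ^ nat (j\<^sup>2) * ee \<tau> ^ N"
      by (simp add: power_add[symmetric] tri_plus_tri_minus power_mult[symmetric] N_def)
    also have "\<dots> = exp (of_real pi * \<i> * of_int j) * exp (of_real pi * \<i> * \<tau> * (2 * of_nat N))"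
    proof -
      have "exp (of_real pi * \<i> * \<tau> * (2 * of_nat N)) = ee (of_nat N * \<tau>)" by (simp add: ee_def mult_ac)
      then show ?thesis by (simp only: exp_pi_int ee_of_nat_mult)
    qed
    also have "\<dots> = exp (of_real pi * \<i> * of_int j + of_real pi * \<i> * \<tau> * (3 * of_int j ^ 2 - of_int j))"
      unfolding N exp_add ..
    also have "of_real pi * \<i> * of_int j + of_real pi * \<i> * \<tau> * (3 * of_int j ^ 2 - of_int j)
       = 3 * of_real pi * \<i> * \<tau> * of_int j ^ 2 + of_real pi * \<i> * (1 - \<tau>) * of_int j"
      by (simp add: algebra_simps)
    finally show ?thesis ..
  qed
  then show ?thesis unfolding eta_def Th_def using pentagonal[OF norm_ee_less_1[OF t]] by simp
qed

lemma eta_nonzero: "Im \<tau> > 0 \<Longrightarrow> eta \<tau> \<noteq> 0"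
  using eulerE_nonzero[OF norm_ee_less_1] by (simp add: eta_eulerE)

lemma eta_holomorphic: "eta holomorphic_on {\<tau>. Im \<tau> > 0}"
  unfolding eta_def[abs_def]
  by (intro holomorphic_intros Th_holomorphic open_halfspace_Im_gt) auto

lemma eta_plus_1: "Im \<tau> > 0 \<Longrightarrow> eta (\<tau> + 1) = ee (1 / 24) * eta \<tau>"
  by (simp add: eta_eulerE ee_add add_divide_distrib)

lemma Th_minus: "Th a (- b) = Th a b"
  unfolding Th_def by (rule infsum_reindex_bij_witness[of _ uminus uminus]) auto

lemma Im_minus_inverse_pos: "Im \<tau> > 0 \<Longrightarrow> Im (- (1 / \<tau>)) > 0"
  by (simp add: Im_divide sum_power2_gt_zero_iff complex_eq_iff)

text \<open>Poisson summation turns the pentagonal series at tau into a series over all k at -1/tau.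
  Split modulo 3, the classes 0 and 1 both reproduce the pentagonal series up to a factor and the
  class 2 cancels. The sum 1 + exp(-pi i/3) = sqrt 3 exp(-pi i/6) then absorbs the root of 3 coming
  from s.\<close>

lemma eta_minus_inverse:
  assumes t: "Im \<tau> > 0"
  shows "eta (- (1 / \<tau>)) = csqrt (- \<i> * \<tau>) * eta \<tau>"
proof -
  have t0: "\<tau> \<noteq> 0" using t by auto
  define P where "P = of_real pi * \<i>"
  define \<sigma> where "\<sigma> = - (1 / \<tau>)"
  \<comment> \<open>Chosen so that -pi s = 3 pi i tau and -2 pi s x = pi i (1 - tau), the two
    parameters of the pentagonal series in \<open>eta\<close>.\<close>
  define s where "s = - 3 * \<i> * \<tau>"
  define x where "x = (1 - \<tau>) / (6 * \<tau>)"
  have s: "Re s > 0" using t by (simp add: s_def)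
  have sI: "Im \<sigma> > 0" unfolding \<sigma>_def by (rule Im_minus_inverse_pos[OF t])
  define a where "a = 3 * P * \<sigma>"
  have ra: "Re a < 0" using sI by (simp add: a_def P_def)
  have bs: "- of_real pi / s = P * \<sigma> / 3" "2 * of_real pi * \<i> * x = - P * (\<sigma> + 1) / 3"
    using t0 unfolding s_def \<sigma>_def x_def P_def by (simp_all add: field_simps)
  define F where "F = (\<lambda>k::int. exp (P * \<sigma> / 3 * of_int k ^ 2 + (- P * (\<sigma> + 1) / 3) * of_int k))"
  have sumF: "F summable_on UNIV"
    unfolding F_def using sI by (intro abs_summable_summable[OF Th_abs_summable]) (simp add: P_def)
  have F0: "(\<Sum>\<^sub>\<infinity>n. F (0 + 3 * n)) = Th a (P * (1 - \<sigma>))"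
  proof -
    have "Th a (P * (1 - \<sigma>)) = Th a (- P * (1 + \<sigma>) + 2 * of_real pi * \<i>)" by (simp add: P_def algebra_simps)
    also have "\<dots> = Th a (- P * (1 + \<sigma>))" by (rule Th_add_2pi)
    also have "\<dots> = (\<Sum>\<^sub>\<infinity>n. F (0 + 3 * n))"
    proof -
      have "a * of_int n ^ 2 + - P * (1 + \<sigma>) * of_int n
          = P * \<sigma> / 3 * of_int (0 + 3 * n) ^ 2 + (- P * (\<sigma> + 1) / 3) * of_int (0 + 3 * n)" for n :: int
        by (simp add: a_def field_simps power2_eq_square)
      then show ?thesis unfolding Th_def F_def by simp
    qed
    finally show ?thesis ..
  qed
  have F1: "(\<Sum>\<^sub>\<infinity>n. F (1 + 3 * n)) = exp (- P / 3) * Th a (P * (1 - \<sigma>))"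
  proof -
    have "exp (- P / 3) * Th a (P * (1 - \<sigma>)) = exp (- P / 3) * Th a (- (P * (1 - \<sigma>)))" by (simp only: Th_minus)
    also have "\<dots> = (\<Sum>\<^sub>\<infinity>n. exp (- P / 3) * exp (a * of_int n ^ 2 + - (P * (1 - \<sigma>)) * of_int n))"
      unfolding Th_def by (rule infsum_cmult_right'[symmetric])
    also have "\<dots> = (\<Sum>\<^sub>\<infinity>n. F (1 + 3 * n))"
    proof -
      have "- P / 3 + (a * of_int n ^ 2 + - (P * (1 - \<sigma>)) * of_int n)
          = P * \<sigma> / 3 * of_int (1 + 3 * n) ^ 2 + (- P * (\<sigma> + 1) / 3) * of_int (1 + 3 * n)" for n :: int
        by (simp add: a_def field_simps power2_eq_square)
      then show ?thesis unfolding F_def exp_add[symmetric] by simp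
    qed
    finally show ?thesis ..
  qed
  \<comment> \<open>A shift by the quasi-period 2a, the reflection n -> -n and the period 2 pi i
    together map this series to its negative, since exp(pi i) = -1.\<close>
  have F2: "(\<Sum>\<^sub>\<infinity>n. F (2 + 3 * n)) = 0"
  proof -
    have "Th a (a - P) = Th a ((- a - P) + 2 * a)" by (simp add: algebra_simps)
    also have "\<dots> = exp P * Th a (- a - P)" by (subst Th_shift) simp
    also have "exp P = - 1" by (simp add: P_def)
    also have "Th a (- a - P) = Th a (a + P)" using Th_minus[of a "a + P"] by simp
    also have "a + P = (a - P) + 2 * of_real pi * \<i>" by (simp add: P_def)
    also have "Th a \<dots> = Th a (a - P)" by (rule Th_add_2pi)
    finally have z: "Th a (a - P) = 0" by simp
    have "(\<Sum>\<^sub>\<infinity>n. F (2 + 3 * n)) = (\<Sum>\<^sub>\<infinity>n. exp (2 * P * \<sigma> / 3 - 2 * P / 3) * exp (a * of_int n ^ 2 + (a - P) * of_int n))"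
    proof -
      have "2 * P * \<sigma> / 3 - 2 * P / 3 + (a * of_int n ^ 2 + (a - P) * of_int n)
          = P * \<sigma> / 3 * of_int (2 + 3 * n) ^ 2 + (- P * (\<sigma> + 1) / 3) * of_int (2 + 3 * n)" for n :: int
        by (simp add: a_def field_simps power2_eq_square)
      then show ?thesis unfolding F_def exp_add[symmetric] by simp
    qed
    also have "\<dots> = exp (2 * P * \<sigma> / 3 - 2 * P / 3) * Th a (a - P)"
      unfolding Th_def by (rule infsum_cmult_right')
    finally show ?thesis by (simp add: z)
  qed
  have "csqrt s * gauss_series s x = Th (- of_real pi / s) (2 * of_real pi * \<i> * x)"
    unfolding gauss_series_eq_infsum by (rule gauss_poisson[OF s])
  also have "\<dots> = (\<Sum>\<^sub>\<infinity>k. F k)" unfolding bs Th_def F_def ..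
  also have "\<dots> = (\<Sum>j\<in>{0..<3}. \<Sum>\<^sub>\<infinity>n. F (j + 3 * n))" by (rule infsum_int_residues[OF _ sumF]) simp
  also have "{0..<3} = {0, 1, 2::int}" by auto
  also have "(\<Sum>j\<in>{0, 1, 2}. \<Sum>\<^sub>\<infinity>n. F (j + 3 * n)) = (1 + exp (- P / 3)) * Th a (P * (1 - \<sigma>))"
    using F0 F1 F2 by (simp add: algebra_simps)
  also have "1 + exp (- P / 3) = of_real (sqrt 3) * exp (- P / 6)"
  proof -
    have e1: "exp (- P / 3) = cis (- (pi / 3))" "exp (- P / 6) = cis (- (pi / 6))"
      unfolding cis_conv_exp P_def by (simp_all add: mult_ac)
    show ?thesis unfolding e1
      by (simp add: complex_eq_iff cos_60 sin_60 cos_30 sin_30 real_sqrt_mult[symmetric])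
  qed
  finally have main: "csqrt s * gauss_series s x = of_real (sqrt 3) * exp (- P / 6) * Th a (P * (1 - \<sigma>))" .
  have cs: "csqrt s = of_real (sqrt 3) * csqrt (- \<i> * \<tau>)"
  proof -
    have "csqrt (of_real 3 * (- \<i> * \<tau>)) = csqrt (of_real 3) * csqrt (- \<i> * \<tau>)"
      using t by (intro csqrt_mult) (auto simp: Arg_of_real intro: less_imp_le Arg_bounded simp: Arg_le_pi mpi_less_Arg)
    then show ?thesis by (simp add: s_def mult_ac)
  qed
  have g: "gauss_series s x = exp (- of_real pi * s * x\<^sup>2) * Th (3 * of_real pi * \<i> * \<tau>) (of_real pi * \<i> * (1 - \<tau>))"
  proof -
    have "- of_real pi * s = 3 * of_real pi * \<i> * \<tau>" "- 2 * of_real pi * s * x = of_real pi * \<i> * (1 - \<tau>)"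
      using t0 by (simp_all add: s_def x_def field_simps)
    then show ?thesis unfolding gauss_series_def by simp
  qed
  have s3: "of_real (sqrt 3) \<noteq> (0::complex)" by simp
  have main2: "csqrt (- \<i> * \<tau>) * (exp (- of_real pi * s * x\<^sup>2) * Th (3 * of_real pi * \<i> * \<tau>) (of_real pi * \<i> * (1 - \<tau>)))
      = exp (- P / 6) * Th a (P * (1 - \<sigma>))"
    using main s3 unfolding cs g by simp
  \<comment> \<open>The Gaussian prefactor contains exactly the two fractional powers e(tau/24) and
    e(sigma/24) that complete the series to \<open>eta\<close>.\<close>
  have ex: "- of_real pi * s * x\<^sup>2 = P * \<tau> / 12 - P / 6 - P * \<sigma> / 12"
    using t0 by (simp add: s_def x_def \<sigma>_def P_def field_simps power2_eq_square)
  have e2: "exp (- of_real pi * s * x\<^sup>2) = ee (\<tau> / 24) * exp (- P / 6) / ee (\<sigma> / 24)"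
    unfolding ex exp_diff by (simp add: ee_def P_def exp_minus field_simps)
  have "csqrt (- \<i> * \<tau>) * eta \<tau> * exp (- P / 6) = eta \<sigma> * exp (- P / 6)"
    using main2 unfolding e2 eta_def[of \<tau>] eta_def[of \<sigma>] a_def P_def by (simp add: field_simps)
  then show ?thesis by (simp add: \<sigma>_def)
qed

lemma eta_minus_inverse_sq:
  "Im \<tau> > 0 \<Longrightarrow> (eta (- (1 / \<tau>)))\<^sup>2 = ee (- 1 / 4) * \<tau> * (eta \<tau>)\<^sup>2"
proof -
  assume t: "Im \<tau> > 0"
  have "ee (- 1 / 4) = - \<i>"
  proof -
    have "ee (- 1 / 4) = cis (- (pi / 2))" unfolding cis_conv_exp ee_def by (simp add: mult_ac)
    then show ?thesis by (simp add: complex_eq_iff)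
  qed
  then show ?thesis unfolding eta_minus_inverse[OF t] by (simp add: power_mult_distrib)
qed

section \<open>Moebius transformations and induction over SL_2(Z)\<close>

definition mob :: "int \<Rightarrow> int \<Rightarrow> int \<Rightarrow> int \<Rightarrow> complex \<Rightarrow> complex" where
  "mob a b c d \<tau> = (of_int a * \<tau> + of_int b) / (of_int c * \<tau> + of_int d)"

lemma mob_denom_nonzero:
  assumes "a * d - b * c = 1" "Im \<tau> > 0"
  shows "of_int c * \<tau> + of_int d \<noteq> 0"
proof
  assume e: "of_int c * \<tau> + of_int d = 0"
  then have "Im (of_int c * \<tau> + of_int d) = 0" by simp
  with assms have "c = 0" by simp
  with e have "d = 0" by simp
  with \<open>c = 0\<close> assms show False by simp
qed

lemma Im_mob:
  assumes "a * d - b * c = 1" "Im \<tau> > 0"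
  shows "Im (mob a b c d \<tau>) = Im \<tau> / (norm (of_int c * \<tau> + of_int d))\<^sup>2"
proof -
  have "Im (mob a b c d \<tau>) = of_int (a * d - b * c) * Im \<tau> / (norm (of_int c * \<tau> + of_int d))\<^sup>2"
    unfolding mob_def Im_divide cmod_power2
    by (simp add: field_simps) 
  then show ?thesis using assms by simp
qed

lemma Im_mob_pos: "a * d - b * c = 1 \<Longrightarrow> Im \<tau> > 0 \<Longrightarrow> Im (mob a b c d \<tau>) > 0"
  using Im_mob mob_denom_nonzero by simp

lemma mob_T: "mob a b c d (\<tau> + 1) = mob a (a + b) c (c + d) \<tau>"
  by (simp add: mob_def algebra_simps)

lemma mob_S: "\<tau> \<noteq> 0 \<Longrightarrow> mob a b c d (- (1 / \<tau>)) = mob b (- a) d (- c) \<tau>"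
proof -
  assume t: "\<tau> \<noteq> 0"
  have "mob a b c d (- (1 / \<tau>)) = ((of_int a * (- (1 / \<tau>)) + of_int b) * \<tau>) / ((of_int c * (- (1 / \<tau>)) + of_int d) * \<tau>)"
    using t by (simp add: mob_def)
  also have "\<dots> = mob b (- a) d (- c) \<tau>" using t by (simp add: mob_def algebra_simps)
  finally show ?thesis .
qed

text \<open>Euclid's algorithm on the bottom row. Closure is assumed only under right multiplication
  by T and S, matching \<open>mob_T\<close> and \<open>mob_S\<close>, so the inverses have to be
  derived: S^{-1} = S^3, and T^{-1} from S and T.\<close>

lemma SL2_induct [consumes 1, case_names id T S]:
  fixes a b c d :: int
  assumes det: "a * d - b * c = 1"
    and P1: "P 1 0 0 1"
    and PT: "\<And>a b c d. a * d - b * c = 1 \<Longrightarrow> P a b c d \<Longrightarrow> P a (a + b) c (c + d)"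
    and PS: "\<And>a b c d. a * d - b * c = 1 \<Longrightarrow> P a b c d \<Longrightarrow> P b (- a) d (- c)"
  shows "P a b c d"
proof -
  have PSi: "P a b c d" if "a * d - b * c = 1" "P b (- a) d (- c)" for a b c d
  proof -
    have "P (- a) (- b) (- c) (- d)" using PS[OF _ that(2)] that(1) by (simp add: algebra_simps)
    then have "P (- b) a (- d) c" using PS[of "- a" "- d" "- b" "- c"] that(1) by simp
    then show ?thesis using PS[of "- b" c a "- d"] that(1) by (simp add: algebra_simps)
  qed
  \<comment> \<open>The relation T^{-1} = S T S T S^{-1}, carried out on the entries.\<close>
  have PTi: "P a (b - a) c (d - c)" if "a * d - b * c = 1" "P a b c d" for a b c d
  proof -
    have "P b (- a) d (- c)" by (rule PS[OF that])
    then have "P b (b - a) d (d - c)" using PT[of b "- c" "- a" d] that(1) by (simp add: algebra_simps)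
    then have "P (b - a) (- b) (d - c) (- d)" using PS[of b "d - c" "b - a" d] that(1) by (simp add: algebra_simps)
    then have "P (b - a) (- a) (d - c) (- c)" using PT[of "b - a" "- d" "- b" "d - c"] that(1) by (simp add: algebra_simps)
    moreover have "a * (d - c) - (b - a) * c = 1" using that(1) by (simp add: algebra_simps)
    ultimately show ?thesis by (rule PSi[rotated])
  qed
  have PTn: "P a (b + of_nat n * a) c (d + of_nat n * c)" if "a * d - b * c = 1" "P a b c d" for a b c d and n :: nat
  proof (induction n)
    case (Suc n)
    have "a * (d + of_nat n * c) - (b + of_nat n * a) * c = 1" using that(1) by (simp add: algebra_simps)
    from PT[OF this Suc] show ?case by (simp add: algebra_simps)
  qed (use that in simp)
  have PTni: "P a (b - of_nat n * a) c (d - of_nat n * c)" if "a * d - b * c = 1" "P a b c d" for a b c d and n :: nat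
  proof (induction n)
    case (Suc n)
    have "a * (d - of_nat n * c) - (b - of_nat n * a) * c = 1" using that(1) by (simp add: algebra_simps)
    from PTi[OF this Suc] show ?case by (simp add: algebra_simps)
  qed (use that in simp)
  have PTk: "P a (b + k * a) c (d + k * c)" if "a * d - b * c = 1" "P a b c d" for a b c d k
    using PTn[OF that, of "nat k"] PTni[OF that, of "nat (- k)"] by (cases "k \<ge> 0") auto
  have Pm1: "P (- 1) 0 0 (- 1)" using PS[OF _ PS[OF _ P1]] by simp
  show ?thesis using det
  proof (induction "nat \<bar>c\<bar>" arbitrary: a b c d rule: less_induct)
    case less
    show ?case
    proof (cases "c = 0")
      case True
      then have "a * d = 1" using less.prems by simp
      then consider "a = 1" "d = 1" | "a = - 1" "d = - 1" using zmult_eq_1_iff by auto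
      then show ?thesis
      proof cases
        case 1 then show ?thesis using PTk[OF _ P1, of b] True by simp
      next
        case 2 then show ?thesis using PTk[OF _ Pm1, of "- b"] True by simp
      qed
    next
      case False
      \<comment> \<open>Powers of T reduce d modulo c, after which S moves the remainder into the
        lower left corner, where it is smaller in absolute value than c.\<close>
      define k where "k = - (d div c)"
      define b' where "b' = b + k * a"
      define d' where "d' = d + k * c"
      have d': "d' = d mod c" by (simp add: d'_def k_def minus_div_mult_eq_mod algebra_simps minus_mult_div_eq_mod)
      have det': "a * d' - b' * c = 1" using less.prems by (simp add: b'_def d'_def algebra_simps)
      have "\<bar>d'\<bar> < \<bar>c\<bar>" using False abs_mod_less unfolding d' by blast
      then have "P b' (- a) d' (- c)"
        using det' by (intro less.hyps) (auto simp: algebra_simps)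
      then have "P a b' c d'" by (rule PSi[OF det'])
      from PTk[OF det' this, of "- k"] show ?thesis by (simp add: b'_def d'_def)
    qed
  qed
qed

text \<open>Petersson's formula for the multiplier of \<open>\<eta>\<^sup>2\<close>, a power of \<open>e\<^bsup>2\<pi>i/12\<^esup>\<close>. Only its class modulo 12 matters.\<close>
definition eta_exponent :: "int \<Rightarrow> int \<Rightarrow> int \<Rightarrow> int \<Rightarrow> int" where
  "eta_exponent a b c d = (a + d) * c - b * d * (c\<^sup>2 - 1) +
     (if odd c then - 3 * c else 3 * d - 3 - 3 * c * d)"

lemma ee_cong_12: "12 dvd m - n \<Longrightarrow> ee (of_int m / 12) = ee (of_int n / 12)"
proof -
  assume "12 dvd m - n"
  then obtain k where "m = n + 12 * k" by (auto simp: dvd_def algebra_simps)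
  then have "of_int m / 12 = (of_int n / 12 + of_int k :: complex)" by simp
  then show ?thesis by (simp only: ee_add ee_of_int) simp
qed

lemma six_dvd_consecutive: "6 dvd (c - 1) * c * (c + 1 :: int)"
proof -
  have "2 dvd (c - 1) * c * (c + 1)" by (cases "even c") auto
  moreover have "3 dvd (c - 1) * c * (c + 1)"
  proof -
    have "c mod 3 = 0 \<or> c mod 3 = 1 \<or> c mod 3 = 2" by presburger
    then have "3 dvd c \<or> 3 dvd c - 1 \<or> 3 dvd c + 1" by presburger
    then show ?thesis by (auto intro: dvd_mult dvd_mult2)
  qed
  moreover have "coprime (2::int) 3" by simp
  ultimately have "2 * 3 dvd (c - 1) * c * (c + 1)" by (rule divides_mult)
  then show ?thesis by simp
qed

text \<open>Translation multiplies eta^2 by e(1/12). The defect for odd c is a multiple of (c -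
  1)c(c + 1), divisible by 3 and 4. For even c the determinant forces a odd, and the defect splits
  into two multiples of 12.\<close>

lemma eta_exponent_T:
  assumes det: "a * d - b * c = 1"
  shows "12 dvd eta_exponent a (a + b) c (c + d) - (eta_exponent a b c d + 1)"
proof (cases "odd c")
  case True
  have "eta_exponent a (a + b) c (c + d) - (eta_exponent a b c d + 1) = (c\<^sup>2 - 1) * (1 - a * c - a * d - b * c)"
    using True by (simp add: eta_exponent_def algebra_simps power2_eq_square)
  also have "a * d = 1 + b * c" using det by simp
  also have "(c\<^sup>2 - 1) * (1 - a * c - (1 + b * c) - b * c) = (c - 1) * c * (c + 1) * (- (a + 2 * b))"
    by (simp add: algebra_simps power2_eq_square)
  finally have e: "eta_exponent a (a + b) c (c + d) - (eta_exponent a b c d + 1) = (c - 1) * c * (c + 1) * (- (a + 2 * b))" .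
  obtain k where k: "c = 2 * k + 1" using True by (auto elim: oddE)
  have "(c - 1) * (c + 1) = 4 * (k * (k + 1))" by (simp add: k algebra_simps)
  then have "(c - 1) * c * (c + 1) = 4 * (c * (k * (k + 1)))" by (metis mult.assoc mult.commute)
  then have 4: "4 dvd (c - 1) * c * (c + 1)" by (metis dvd_triv_left)
  have 3: "3 dvd (c - 1) * c * (c + 1)" using six_dvd_consecutive[of c] dvd_trans[of 3 6] by auto
  have "12 dvd x" if "3 dvd x" "4 dvd x" for x :: int using that by presburger
  from this[OF 3 4] show ?thesis unfolding e by (rule dvd_mult2)
next
  case False
  have "odd a"
  proof
    assume "even a"
    with False have "even (a * d - b * c)" by simp
    with det show False by simp
  qed
  have "eta_exponent a (a + b) c (c + d) - (eta_exponent a b c d + 1) = (c\<^sup>2 - 1) * (1 - a * c - a * d - b * c) - 3 * c * (c - 1)"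
    using False by (simp add: eta_exponent_def algebra_simps power2_eq_square)
  also have "a * d = 1 + b * c" using det by simp
  finally have e: "eta_exponent a (a + b) c (c + d) - (eta_exponent a b c d + 1) = (c\<^sup>2 - 1) * (1 - a * c - (1 + b * c) - b * c) - 3 * c * (c - 1)" .
  obtain k where k: "c = 2 * k" using False by auto
  obtain l where l: "a = 2 * l + 1" using \<open>odd a\<close> by (auto elim: oddE)
  obtain m where m: "(c - 1) * c * (c + 1) = 6 * m" using six_dvd_consecutive[of c] by (auto simp: dvd_def)
  have "eta_exponent a (a + b) c (c + d) - (eta_exponent a b c d + 1) = - ((c - 1) * c * (c + 1)) * (2 * l + 2 * b) - ((c - 1) * c * (c + 1)) - 3 * c * (c - 1)"
    unfolding e unfolding l by (simp add: algebra_simps power2_eq_square)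
  also have "\<dots> = - ((c - 1) * c * (c + 1)) * (2 * l + 2 * b) - (c - 1) * c * (c + 4)"
    by (simp add: algebra_simps)
  also have "(c - 1) * c * (c + 4) = (c - 1) * c * (c + 1) + 6 * k * (c - 1)"
    by (simp add: k algebra_simps)
  also have "(c - 1) * c * (c + 1) + 6 * k * (c - 1) = 2 * (k * (c - 1) * (c + 4))"
    by (simp add: k algebra_simps)
  also have "\<dots> = 4 * (k * (c - 1) * (k + 2))" by (simp add: k algebra_simps)
  finally have e2: "eta_exponent a (a + b) c (c + d) - (eta_exponent a b c d + 1) = - (6 * m) * (2 * l + 2 * b) - 4 * (k * (c - 1) * (k + 2))"
    unfolding m .
  have "3 dvd k * (c - 1) * (k + 2)"
  proof -
    have "k mod 3 = 0 \<or> k mod 3 = 1 \<or> k mod 3 = 2" by presburger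
    then have "3 dvd k \<or> 3 dvd k + 2 \<or> 3 dvd 2 * k - 1" by presburger
    then show ?thesis unfolding k by (auto intro: dvd_mult dvd_mult2)
  qed
  then obtain n where n: "k * (c - 1) * (k + 2) = 3 * n" by (auto simp: dvd_def)
  have "eta_exponent a (a + b) c (c + d) - (eta_exponent a b c d + 1) = 12 * (- m * (l + b) - n)"
    unfolding e2 n by (simp add: algebra_simps)
  then show ?thesis by simp
qed

text \<open>Inversion contributes e(-1/4) = e(-3/12). The parity-free part of the exponent changes
  by -3cd, and the three possible parities of (c, d) account for the rest; both even is excluded by
  the determinant.\<close>

lemma eta_exponent_S:
  assumes det: "a * d - b * c = 1"
  shows "12 dvd eta_exponent b (- a) d (- c) - (eta_exponent a b c d - 3)"
proof -
  have ad: "a * d = 1 + b * c" using det by simp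
  have base: "(b - c) * d - a * c * (d\<^sup>2 - 1) - ((a + d) * c - b * d * (c\<^sup>2 - 1)) = - 3 * c * d"
  proof -
    have "(b - c) * d - a * c * (d\<^sup>2 - 1) - ((a + d) * c - b * d * (c\<^sup>2 - 1))
        = - 2 * c * d - c * d * (a * d) + b * c * c * d"
      by (simp add: algebra_simps power2_eq_square)
    also have "\<dots> = - 3 * c * d" unfolding ad by (simp add: algebra_simps)
    finally show ?thesis .
  qed
  have "\<not> (even c \<and> even d)"
  proof
    assume "even c \<and> even d"
    then have "even (a * d - b * c)" by simp
    with det show False by simp
  qed
  then consider "odd c" "odd d" | "even c" "odd d" | "odd c" "even d"
    by blast
  then show ?thesis
  proof cases
    case 1
    then have "eta_exponent b (- a) d (- c) - (eta_exponent a b c d - 3) = - 3 * ((c + 1) * (d - 1))"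
      using base by (simp add: eta_exponent_def algebra_simps)
    moreover have "even (c + 1)" "even (d - 1)" using 1 by simp_all
    moreover from this obtain k l where "c + 1 = 2 * k" "d - 1 = 2 * l" by (elim evenE)
    ultimately have "eta_exponent b (- a) d (- c) - (eta_exponent a b c d - 3) = 12 * (- k * l)" by simp
    then show ?thesis by simp
  next
    case 2
    then have "eta_exponent b (- a) d (- c) - (eta_exponent a b c d - 3) = - 6 * (d - 1)"
      using base by (simp add: eta_exponent_def algebra_simps)
    moreover have "even (d - 1)" using 2 by simp
    moreover from this obtain l where "d - 1 = 2 * l" by (elim evenE)
    ultimately have "eta_exponent b (- a) d (- c) - (eta_exponent a b c d - 3) = 12 * (- l)" by simp
    then show ?thesis by simp
  next
    case 3
    then have "eta_exponent b (- a) d (- c) - (eta_exponent a b c d - 3) = 0"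
      using base by (simp add: eta_exponent_def algebra_simps)
    then show ?thesis by simp
  qed
qed

text \<open>The induction leaves only the two generators to check. For eta^2 the automorphy factor
  is c tau + d itself, without any branch of a root.\<close>

theorem eta_sq_mob:
  assumes "a * d - b * c = 1" "Im \<tau> > 0"
  shows "(eta (mob a b c d \<tau>))\<^sup>2 = ee (of_int (eta_exponent a b c d) / 12) * (of_int c * \<tau> + of_int d) * (eta \<tau>)\<^sup>2"
  using assms
proof (induction a b c d arbitrary: \<tau> rule: SL2_induct)
  case id
  then show ?case by (simp add: mob_def eta_exponent_def)
next
  case (T a b c d)
  have i: "Im (\<tau> + 1) > 0" using T by simp
  have "(eta (mob a (a + b) c (c + d) \<tau>))\<^sup>2
      = ee (of_int (eta_exponent a b c d) / 12) * (of_int c * (\<tau> + 1) + of_int d) * (eta (\<tau> + 1))\<^sup>2"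
    unfolding mob_T[symmetric] by (rule T.IH[OF i])
  also have "(eta (\<tau> + 1))\<^sup>2 = ee (1 / 12) * (eta \<tau>)\<^sup>2"
  proof -
    have "(ee (1 / 24))\<^sup>2 = ee (1 / 12)" by (simp add: power2_eq_square ee_add[symmetric])
    then show ?thesis using T by (simp add: eta_plus_1 power_mult_distrib)
  qed
  also have "ee (of_int (eta_exponent a (a + b) c (c + d)) / 12) = ee (of_int (eta_exponent a b c d) / 12) * ee (1 / 12)"
    using ee_cong_12[OF eta_exponent_T[OF T.hyps]] by (simp add: ee_add[symmetric] add_divide_distrib)
  ultimately show ?case by (simp add: algebra_simps)
next
  case (S a b c d)
  have t0: "\<tau> \<noteq> 0" using S by auto
  have "(eta (mob b (- a) d (- c) \<tau>))\<^sup>2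
      = ee (of_int (eta_exponent a b c d) / 12) * (of_int c * (- (1 / \<tau>)) + of_int d) * (eta (- (1 / \<tau>)))\<^sup>2"
    unfolding mob_S[OF t0, symmetric] by (rule S.IH[OF Im_minus_inverse_pos[OF S.prems]])
  also have "\<dots> = (ee (of_int (eta_exponent a b c d) / 12) * ee (- 1 / 4)) * ((of_int c * (- (1 / \<tau>)) + of_int d) * \<tau>) * (eta \<tau>)\<^sup>2"
    unfolding eta_minus_inverse_sq[OF S.prems] by (simp only: mult_ac)
  also have "(of_int c * (- (1 / \<tau>)) + of_int d) * \<tau> = of_int d * \<tau> + of_int (- c)"
    using t0 by (simp add: field_simps)
  also have "ee (of_int (eta_exponent a b c d) / 12) * ee (- 1 / 4) = ee (of_int (eta_exponent b (- a) d (- c)) / 12)"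
    using ee_cong_12[OF eta_exponent_S[OF S.hyps]] by (simp add: ee_add[symmetric] diff_divide_distrib)
  finally show ?case .
qed

section \<open>Gauss sums of binary quadratic forms\<close>

lemma card_squares_mod_prime:
  assumes p: "prime p" "p > (2::int)"
  shows "2 * card ((\<lambda>x. x\<^sup>2 mod p) ` {0..<p}) \<ge> nat p + 1"
proof -
  define h where "h = (p - 1) div 2"
  have odd: "odd p" using p prime_odd_int by auto
  then have h: "p = 2 * h + 1" by (simp add: h_def)
  have "inj_on (\<lambda>x. x\<^sup>2 mod p) {0..h}"
  proof (rule inj_onI)
    fix x y assume xy: "x \<in> {0..h}" "y \<in> {0..h}" "x\<^sup>2 mod p = y\<^sup>2 mod p"
    then have "p dvd x\<^sup>2 - y\<^sup>2" by (simp add: mod_eq_dvd_iff)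
    then have "p dvd (x - y) * (x + y)" by (simp add: algebra_simps power2_eq_square)
    then consider "p dvd x - y" | "p dvd x + y" using p(1) prime_dvd_mult_iff by blast
    then show "x = y"
    proof cases
      case 1
      have "\<bar>x - y\<bar> < p" using xy h by auto
      with 1 show ?thesis by (metis abs_zero dvd_imp_le_int eq_iff_diff_eq_0 linorder_not_less abs_of_nonneg zdvd_not_zless zero_less_abs_iff dvd_abs_iff)
    next
      case 2
      have "x + y < p" "x + y \<ge> 0" using xy h by auto
      with 2 have "x + y = 0" by (metis order_le_less zdvd_not_zless)
      with xy show ?thesis by auto
    qed
  qed
  then have "card ((\<lambda>x. x\<^sup>2 mod p) ` {0..h}) = nat (h + 1)" by (simp add: card_image)
  moreover have "card ((\<lambda>x. x\<^sup>2 mod p) ` {0..h}) \<le> card ((\<lambda>x. x\<^sup>2 mod p) ` {0..<p})"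
    using h p by (intro card_mono image_mono) auto
  moreover have "2 * nat (h + 1) = nat p + 1" using h p by auto
  ultimately show ?thesis by simp
qed

text \<open>Pigeonhole: x^2 and t - k y^2 take at least (p + 1)/2 residues each, hence share
  one.\<close>

lemma norm_form_prime:
  assumes p: "prime p" "p > (2::int)" and k: "coprime k p"
  shows "\<exists>x y. [x\<^sup>2 + k * y\<^sup>2 = t] (mod p)"
proof -
  define S where "S = (\<lambda>x. x\<^sup>2 mod p) ` {0..<p}"
  define T where "T = (\<lambda>s. (t - k * s) mod p) ` S"
  have pp: "p > 0" using p by simp
  have fin: "finite S" by (simp add: S_def)
  have inj: "inj_on (\<lambda>s. (t - k * s) mod p) S"
  proof (rule inj_onI)
    fix x y assume xy: "x \<in> S" "y \<in> S" "(t - k * x) mod p = (t - k * y) mod p"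
    then have "p dvd (t - k * x) - (t - k * y)" by (simp add: mod_eq_dvd_iff)
    then have "p dvd k * (y - x)" by (simp add: algebra_simps)
    then have "p dvd y - x" using k by (simp add: coprime_commute coprime_dvd_mult_right_iff)
    then have "y mod p = x mod p" by (simp add: mod_eq_dvd_iff)
    then show "x = y" using xy pp by (auto simp: S_def)
  qed
  have "card T = card S" unfolding T_def by (rule card_image[OF inj])
  moreover have "S \<subseteq> {0..<p}" "T \<subseteq> {0..<p}" using pp by (auto simp: S_def T_def)
  moreover have "2 * card S \<ge> nat p + 1" unfolding S_def by (rule card_squares_mod_prime[OF p])
  ultimately have "S \<inter> T \<noteq> {}"
  proof (intro notI)
    assume a: "card T = card S" "S \<subseteq> {0..<p}" "T \<subseteq> {0..<p}" "2 * card S \<ge> nat p + 1" "S \<inter> T = {}"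
    have "card (S \<union> T) = card S + card T"
      using a fin by (intro card_Un_disjoint) (auto simp: T_def)
    moreover have "card (S \<union> T) \<le> card {0..<p}" using a by (intro card_mono) auto
    ultimately show False using a by simp
  qed
  then obtain x y where "x\<^sup>2 mod p = (t - k * (y\<^sup>2 mod p)) mod p" by (auto simp: S_def T_def)
  then have "[x\<^sup>2 = t - k * (y\<^sup>2 mod p)] (mod p)" by (simp only: cong_def)
  moreover have "[t - k * (y\<^sup>2 mod p) = t - k * y\<^sup>2] (mod p)"
    by (intro cong_diff cong_mult cong_refl) (simp add: cong_def)
  ultimately have "[x\<^sup>2 = t - k * y\<^sup>2] (mod p)" by (rule cong_trans)
  then have "[x\<^sup>2 + k * y\<^sup>2 = t - k * y\<^sup>2 + k * y\<^sup>2] (mod p)" by (rule cong_add) simp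
  then show ?thesis by auto
qed

text \<open>A Hensel step. Passing to x + m r, y + m s changes the value by m (2xr + 2kys) modulo
  pm, because p divides m. Since t is a unit modulo p, not both x and y are divisible by p, and so
  the linear condition on r and s is solvable.\<close>

lemma norm_form_lift:
  assumes p: "prime p" "p > (2::int)" and k: "coprime k p" and pd: "p dvd m" and t: "coprime t p"
    and xy: "[x\<^sup>2 + k * y\<^sup>2 = t] (mod m)"
  shows "\<exists>x y. [x\<^sup>2 + k * y\<^sup>2 = t] (mod (p * m))"
proof -
  obtain u where u: "x\<^sup>2 + k * y\<^sup>2 = t + m * u" using xy by (metis cong_iff_lin cong_sym)
  obtain n where n: "m = p * n" using pd by auto
  have two: "coprime 2 p" using p by (metis coprime_left_2_iff_odd prime_odd_int)
  have "\<exists>r s. [u + 2 * x * r + 2 * k * y * s = 0] (mod p)"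
  proof (cases "p dvd x")
    case False
    then have "coprime x p" using p by (metis coprime_commute prime_imp_coprime)
    then have "coprime (2 * x) p" using two by simp
    then obtain r where "[(2 * x) * r = 1] (mod p)" using cong_solve_coprime_int by blast
    then have "[(2 * x) * r * (- u) = 1 * (- u)] (mod p)" by (rule cong_mult) simp
    then have "[u + (2 * x) * r * (- u) = u + 1 * (- u)] (mod p)" by (intro cong_add) simp_all
    then show ?thesis by (intro exI[of _ "r * (- u)"] exI[of _ 0]) (simp add: mult_ac)
  next
    case True
    have "\<not> p dvd y"
    proof
      assume "p dvd y"
      with True have "p dvd x\<^sup>2 + k * y\<^sup>2" by (simp add: power2_eq_square)
      moreover have "p dvd m * u" using pd by simp
      ultimately have "p dvd t" unfolding u by (simp add: dvd_add_left_iff)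
      with t p show False by (meson coprime_common_divisor dvd_refl not_prime_unit)
    qed
    then have "coprime y p" using p by (metis coprime_commute prime_imp_coprime)
    then have "coprime (2 * k * y) p" using two k by simp
    then obtain r where "[(2 * k * y) * r = 1] (mod p)" using cong_solve_coprime_int by blast
    then have "[(2 * k * y) * r * (- u) = 1 * (- u)] (mod p)" by (rule cong_mult) simp
    then have "[u + (2 * k * y) * r * (- u) = u + 1 * (- u)] (mod p)" by (intro cong_add) simp_all
    then show ?thesis by (intro exI[of _ 0] exI[of _ "r * (- u)"]) (simp add: mult_ac)
  qed
  then obtain r s where rs: "[u + 2 * x * r + 2 * k * y * s = 0] (mod p)" by blast
  then obtain v where v: "u + 2 * x * r + 2 * k * y * s = p * v" by (auto simp: cong_0_iff)
  have "(x + m * r)\<^sup>2 + k * (y + m * s)\<^sup>2 - t = m * (u + 2 * x * r + 2 * k * y * s) + m * m * (r\<^sup>2 + k * s\<^sup>2)"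
    using u by (simp add: power2_eq_square algebra_simps)
  also have "\<dots> = (p * m) * (v + n * (r\<^sup>2 + k * s\<^sup>2))" unfolding v by (simp add: n algebra_simps)
  finally have "[(x + m * r)\<^sup>2 + k * (y + m * s)\<^sup>2 = t] (mod (p * m))" by (simp add: cong_iff_dvd_diff)
  then show ?thesis by blast
qed

text \<open>Induction over the prime factors of d: a new prime is joined by the Chinese remainder
  theorem, a repeated one by lifting.\<close>

lemma norm_form_surj_aux:
  fixes d k t :: int
  assumes "d \<noteq> 0"
  shows "odd d \<Longrightarrow> coprime k d \<Longrightarrow> coprime t d \<Longrightarrow> \<exists>x y. [x\<^sup>2 + k * y\<^sup>2 = t] (mod d)"
  using assms
proof (induction d rule: prime_divisors_induct)
  case zero then show ?case by simp
next
  case (unit d)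
  then have "[0\<^sup>2 + k * 0\<^sup>2 = t] (mod d)" by (auto simp: cong_iff_dvd_diff intro: unit_imp_dvd)
  then show ?case by blast
next
  case (factor p m)
  have p2: "p > 2" using factor.prems(1) factor.hyps prime_ge_2_int[of p] by (cases "p = 2") auto
  have kp: "coprime k p" "coprime k m" "coprime t p" "coprime t m" "odd m" "m \<noteq> 0" using factor.prems by auto
  obtain x y where xy: "[x\<^sup>2 + k * y\<^sup>2 = t] (mod m)" using factor.IH kp by blast
  show ?case
  proof (cases "p dvd m")
    case True
    show ?thesis by (rule norm_form_lift[OF factor.hyps p2 kp(1) True kp(3) xy])
  next
    case False
    then have cp: "coprime p m" using factor.hyps prime_imp_coprime by blast
    obtain x' y' where xy': "[x'\<^sup>2 + k * y'\<^sup>2 = t] (mod p)" using norm_form_prime[OF factor.hyps p2 kp(1)] by blast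
    obtain X where X: "[X = x'] (mod p)" "[X = x] (mod m)" using binary_chinese_remainder_int[OF cp] by blast
    obtain Y where Y: "[Y = y'] (mod p)" "[Y = y] (mod m)" using binary_chinese_remainder_int[OF cp] by blast
    have "[X\<^sup>2 + k * Y\<^sup>2 = x'\<^sup>2 + k * y'\<^sup>2] (mod p)" "[X\<^sup>2 + k * Y\<^sup>2 = x\<^sup>2 + k * y\<^sup>2] (mod m)"
      using X Y by (auto intro!: cong_add cong_mult cong_pow)
    then have "[X\<^sup>2 + k * Y\<^sup>2 = t] (mod p)" "[X\<^sup>2 + k * Y\<^sup>2 = t] (mod m)" using xy xy' cong_trans by blast+
    then have "[X\<^sup>2 + k * Y\<^sup>2 = t] (mod (p * m))" using cp coprime_cong_mult by blast
    then show ?thesis by blast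
  qed
qed

lemma norm_form_surj:
  fixes d k t :: int
  assumes "d > 0" "odd d" "coprime k d" "coprime t d"
  obtains x y where "[x\<^sup>2 + k * y\<^sup>2 = t] (mod d)"
  using norm_form_surj_aux assms by (metis less_irrefl)

text \<open>The middle coefficient is 2B, as in all forms of the theorem, so that the determinant A
  C - B^2 is an integer.\<close>

definition Qf :: "int \<Rightarrow> int \<Rightarrow> int \<Rightarrow> int \<Rightarrow> int \<Rightarrow> int" where
  "Qf A B C x y = A * x\<^sup>2 + 2 * B * x * y + C * y\<^sup>2"

abbreviation ed :: "int \<Rightarrow> int \<Rightarrow> complex" where
  "ed d n \<equiv> ee (of_int n / of_int d)"

lemma ed_cong:
  assumes "[m = n] (mod d)" "d \<noteq> 0"
  shows "ed d m = ed d n"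
proof -
  obtain k where "m = n + d * k" using assms by (metis cong_iff_lin cong_sym)
  then have "of_int m / of_int d = (of_int n / of_int d + of_int k :: complex)"
    using assms by (simp add: field_simps)
  then show ?thesis by (simp only: ee_add ee_of_int) simp
qed

lemma ed_add: "ed d (m + n) = ed d m * ed d n"
  by (simp add: ee_add[symmetric] add_divide_distrib)

lemma residue_sum_bij:
  fixes F :: "int \<Rightarrow> int \<Rightarrow> complex" and d :: int
  assumes d: "d > 0"
    and F: "\<And>x y x' y'. [x = x'] (mod d) \<Longrightarrow> [y = y'] (mod d) \<Longrightarrow> F x y = F x' y'"
    and inj: "\<And>x y x' y'. [L1 x y = L1 x' y'] (mod d) \<Longrightarrow> [L2 x y = L2 x' y'] (mod d) \<Longrightarrow>
                 [x = x'] (mod d) \<and> [y = y'] (mod d)"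
  shows "(\<Sum>(x, y)\<in>{0..<d} \<times> {0..<d}. F (L1 x y) (L2 x y)) = (\<Sum>(x, y)\<in>{0..<d} \<times> {0..<d}. F x y)"
proof -
  define R where "R = {0..<d} \<times> {0..<d}"
  define h where "h = (\<lambda>(x, y). (L1 x y mod d, L2 x y mod d))"
  have "inj_on h R"
  proof (rule inj_onI)
    fix u v assume uv: "u \<in> R" "v \<in> R" "h u = h v"
    obtain x y x' y' where e: "u = (x, y)" "v = (x', y')" by (cases u, cases v)
    from uv e have "[L1 x y = L1 x' y'] (mod d)" "[L2 x y = L2 x' y'] (mod d)" by (auto simp: h_def cong_def)
    from inj[OF this] uv e show "u = v" by (auto simp: R_def cong_def)
  qed
  moreover have "h ` R \<subseteq> R" using d by (auto simp: h_def R_def)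
  moreover have "finite R" by (simp add: R_def)
  ultimately have b: "bij_betw h R R" by (simp add: bij_betw_def endo_inj_surj)
  have "(\<Sum>(x, y)\<in>R. F (L1 x y) (L2 x y)) = (\<Sum>p\<in>R. (\<lambda>(x, y). F x y) (h p))"
    by (intro sum.cong refl) (auto simp: h_def cong_def intro!: F)
  also have "\<dots> = (\<Sum>(x, y)\<in>R. F x y)" by (rule sum.reindex_bij_betw[OF b])
  finally show ?thesis by (simp add: R_def)
qed

definition gauss_sum :: "int \<Rightarrow> int \<Rightarrow> int \<Rightarrow> int \<Rightarrow> int \<Rightarrow> complex" where
  "gauss_sum A B C b d = (\<Sum>(x, y)\<in>{0..<d} \<times> {0..<d}. ed d (b * Qf A B C x y))"

lemma Qf_cong: "[x = x'] (mod d) \<Longrightarrow> [y = y'] (mod d) \<Longrightarrow> [Qf A B C x y = Qf A B C x' y'] (mod d)"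
  unfolding Qf_def by (intro cong_add cong_mult cong_pow cong_refl)

text \<open>Cramer's rule modulo d.\<close>

lemma cong_coprime_det:
  fixes p q r t :: int
  assumes det: "coprime (p * t - q * r) d"
    and 1: "[p * x + q * y = p * x' + q * y'] (mod d)" and 2: "[r * x + t * y = r * x' + t * y'] (mod d)"
  shows "[x = x'] (mod d) \<and> [y = y'] (mod d)"
proof -
  have d1: "d dvd (p * x + q * y) - (p * x' + q * y')" and d2: "d dvd (r * x + t * y) - (r * x' + t * y')"
    using 1 2 by (simp_all add: cong_iff_dvd_diff)
  have "d dvd t * ((p * x + q * y) - (p * x' + q * y')) - q * ((r * x + t * y) - (r * x' + t * y'))"
    by (rule dvd_diff[OF dvd_mult[OF d1] dvd_mult[OF d2]])
  also have "t * ((p * x + q * y) - (p * x' + q * y')) - q * ((r * x + t * y) - (r * x' + t * y')) = (p * t - q * r) * (x - x')"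
    by (simp add: algebra_simps)
  finally have x: "d dvd x - x'" using det by (simp add: coprime_commute coprime_dvd_mult_right_iff)
  have "d dvd p * ((r * x + t * y) - (r * x' + t * y')) - r * ((p * x + q * y) - (p * x' + q * y'))"
    by (rule dvd_diff[OF dvd_mult[OF d2] dvd_mult[OF d1]])
  also have "p * ((r * x + t * y) - (r * x' + t * y')) - r * ((p * x + q * y) - (p * x' + q * y')) = (p * t - q * r) * (y - y')"
    by (simp add: algebra_simps)
  finally have "d dvd y - y'" using det by (simp add: coprime_commute coprime_dvd_mult_right_iff)
  with x show ?thesis by (simp add: cong_iff_dvd_diff)
qed

text \<open>Multiplying by an element whose norm is \<open>A\<close> modulo \<open>d\<close> turns \<open>A (A x\<^sup>2 + 2 B x y + C y\<^sup>2)\<close>,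
  itself a value of the principal form, into \<open>A\<^sup>2\<close> times the principal form.\<close>
lemma gauss_sum_eq_principal:
  assumes d: "d > 0" "odd d" and k: "A * C - B\<^sup>2 = k" and cop: "coprime k d" "coprime A d"
  shows "gauss_sum A B C b d = gauss_sum 1 0 k b d"
proof -
  obtain u v where uv: "[u\<^sup>2 + k * v\<^sup>2 = A] (mod d)" using norm_form_surj[OF d cop] by blast
  obtain i where i: "[A * i = 1] (mod d)" using cop(2) cong_solve_coprime_int by blast
  \<comment> \<open>L1 and L2 are the coordinates of (Ax + By + y sqrt(-k)) (u - v sqrt(-k)) / A,
    with i in place of 1/A. The first factor has norm A times the form, the second has norm A modulo
    d.\<close>
  define L1 where "L1 x y = (i * (u * A)) * x + (i * (u * B + k * v)) * y" for x y
  define L2 where "L2 x y = (i * (- v * A)) * x + (i * (u - v * B)) * y" for x y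
  have id: "(L1 x y)\<^sup>2 + k * (L2 x y)\<^sup>2 = i\<^sup>2 * (u\<^sup>2 + k * v\<^sup>2) * (A * Qf A B C x y)" for x y
    unfolding k[symmetric] L1_def L2_def Qf_def by (simp add: power2_eq_square algebra_simps)
  have Qc: "[Qf 1 0 k (L1 x y) (L2 x y) = Qf A B C x y] (mod d)" for x y
  proof -
    have "[i\<^sup>2 * (u\<^sup>2 + k * v\<^sup>2) * (A * Qf A B C x y) = i\<^sup>2 * A * (A * Qf A B C x y)] (mod d)"
      by (intro cong_mult uv cong_refl)
    moreover have "i\<^sup>2 * A * (A * Qf A B C x y) = (A * i) * (A * i) * Qf A B C x y"
      by (simp add: power2_eq_square)
    moreover have "[(A * i) * (A * i) * Qf A B C x y = 1 * 1 * Qf A B C x y] (mod d)"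
      by (intro cong_mult i cong_refl)
    ultimately have "[i\<^sup>2 * (u\<^sup>2 + k * v\<^sup>2) * (A * Qf A B C x y) = 1 * 1 * Qf A B C x y] (mod d)"
      using cong_trans by metis
    then show ?thesis using id[of x y] by (simp add: Qf_def)
  qed
  have det: "coprime ((i * (u * A)) * (i * (u - v * B)) - (i * (u * B + k * v)) * (i * (- v * A))) d"
  proof -
    have "(i * (u * A)) * (i * (u - v * B)) - (i * (u * B + k * v)) * (i * (- v * A)) = i * (A * i) * (u\<^sup>2 + k * v\<^sup>2)"
      by (simp add: power2_eq_square algebra_simps)
    also have "[\<dots> = i * 1 * A] (mod d)" by (intro cong_mult uv i cong_refl)
    also have "i * 1 * A = A * i" by simp
    also note i
    finally show ?thesis using cong_imp_coprime[OF cong_sym] by (metis coprime_1_left)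
  qed
  have "gauss_sum A B C b d = (\<Sum>(x, y)\<in>{0..<d} \<times> {0..<d}. ed d (b * Qf 1 0 k (L1 x y) (L2 x y)))"
    unfolding gauss_sum_def using d Qc
    by (intro sum.cong refl) (auto simp del: of_int_add of_int_mult intro!: ed_cong cong_mult cong_sym[OF Qc])
  also have "\<dots> = gauss_sum 1 0 k b d"
    unfolding gauss_sum_def
  proof (rule residue_sum_bij[OF d(1)])
    show "ed d (b * Qf 1 0 k x y) = ed d (b * Qf 1 0 k x' y')" if "[x = x'] (mod d)" "[y = y'] (mod d)" for x y x' y'
      using d by (intro ed_cong cong_mult Qf_cong that cong_refl) auto
    show "[x = x'] (mod d) \<and> [y = y'] (mod d)"
      if "[L1 x y = L1 x' y'] (mod d)" "[L2 x y = L2 x' y'] (mod d)" for x y x' y'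
      using cong_coprime_det[OF det] that unfolding L1_def L2_def by blast
  qed
  finally show ?thesis .
qed

text \<open>Completing the square modulo d. The determinant makes -c an inverse of b, and the factor
  4k of c provides the divisions by 2 and by the determinant k that the completion requires.\<close>

lemma gauss_sum_twisted:
  assumes d: "d > 0" and k: "A * C - B\<^sup>2 = k" and c: "c = 4 * k * c'" and det: "a * d - b * c = 1"
  shows "(\<Sum>(x, y)\<in>{0..<d} \<times> {0..<d}. ed d (b * Qf A B C x y + (w1 * x + w2 * y)))
       = ed d (c' * Qf C (- B) A w1 w2) * gauss_sum A B C b d"
proof -
  \<comment> \<open>The centre (2b)^{-1} k^{-1} times the adjugate matrix applied to (w1, w2), with
    -4kc' for the inverse of b.\<close>
  define u1 where "u1 = - 2 * c' * (C * w1 - B * w2)"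
  define u2 where "u2 = - 2 * c' * (- B * w1 + A * w2)"
  have bc: "[- b * c = 1] (mod d)"
    using det by (metis cong_iff_lin mult_minus_left add.commute diff_conv_add_uminus diff_eq_eq mult.commute cong_sym)
  have e: "b * Qf A B C (x + u1) (y + u2) + c' * Qf C (- B) A w1 w2
     = b * Qf A B C x y + (- b * c) * (w1 * x + w2 * y) + (1 + b * c) * (c' * Qf C (- B) A w1 w2)" for x y
    unfolding Qf_def u1_def u2_def c k[symmetric] by (simp add: power2_eq_square algebra_simps)
  have "[b * Qf A B C x y + (- b * c) * (w1 * x + w2 * y) + (1 + b * c) * (c' * Qf C (- B) A w1 w2)
       = b * Qf A B C x y + 1 * (w1 * x + w2 * y) + (1 - 1) * (c' * Qf C (- B) A w1 w2)] (mod d)" for x y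
  proof -
    have "[1 + b * c = 1 - 1] (mod d)" using cong_diff[OF cong_refl[of 1 d] bc] by simp
    then show ?thesis by (intro cong_add cong_mult bc cong_refl)
  qed
  then have cg: "[b * Qf A B C (x + u1) (y + u2) + c' * Qf C (- B) A w1 w2 = b * Qf A B C x y + (w1 * x + w2 * y)] (mod d)" for x y
    unfolding e by simp
  have "(\<Sum>(x, y)\<in>{0..<d} \<times> {0..<d}. ed d (b * Qf A B C x y + (w1 * x + w2 * y)))
      = (\<Sum>(x, y)\<in>{0..<d} \<times> {0..<d}. ed d (b * Qf A B C (x + u1) (y + u2)) * ed d (c' * Qf C (- B) A w1 w2))"
    unfolding ed_add[symmetric] using d
    by (intro sum.cong refl) (auto simp del: of_int_add of_int_mult intro!: ed_cong cong_sym[OF cg])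
  also have "\<dots> = (\<Sum>(x, y)\<in>{0..<d} \<times> {0..<d}. ed d (b * Qf A B C (x + u1) (y + u2))) * ed d (c' * Qf C (- B) A w1 w2)"
    by (simp add: sum_distrib_right case_prod_unfold)
  also have "(\<Sum>(x, y)\<in>{0..<d} \<times> {0..<d}. ed d (b * Qf A B C (x + u1) (y + u2))) = gauss_sum A B C b d"
    unfolding gauss_sum_def
  proof (rule residue_sum_bij[OF d(1)])
    show "ed d (b * Qf A B C x y) = ed d (b * Qf A B C x' y')" if "[x = x'] (mod d)" "[y = y'] (mod d)" for x y x' y'
      using d by (intro ed_cong cong_mult Qf_cong that cong_refl) auto
  qed (auto simp: cong_add_rcancel)
  finally show ?thesis by simp
qed

section \<open>Theta series of binary quadratic forms\<close>

definition real_theta :: "real \<Rightarrow> real" where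
  "real_theta t = (\<Sum>\<^sub>\<infinity>n::int. exp (- pi * t * of_int n ^ 2))"

lemma real_theta_summable:
  assumes "t > 0"
  shows "(\<lambda>n::int. exp (- pi * t * of_int n ^ 2)) summable_on UNIV"
proof -
  have "Re (- of_real pi * of_real t) < 0" using assms by simp
  from Th_abs_summable[OF this, of 0]
  have "(\<lambda>n::int. exp (Re (- of_real pi * of_real t * of_int n ^ 2))) summable_on UNIV" by (simp add: norm_exp_eq_Re)
  moreover have "Re (- of_real pi * of_real t * of_int n ^ 2) = - pi * t * of_int n ^ 2" for n :: int
    by (simp add: Re_power2)
  ultimately show ?thesis by simp
qed

lemma of_real_real_theta: "t > 0 \<Longrightarrow> of_real (real_theta t) = th0 (of_real t)"
proof -
  assume t: "t > 0"
  have "((\<lambda>n::int. complex_of_real (exp (- pi * t * of_int n ^ 2))) has_sum of_real (real_theta t)) UNIV"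
    unfolding real_theta_def by (rule has_sum_bounded_linear[OF bounded_linear_of_real has_sum_infsum[OF real_theta_summable[OF t]]])
  then show ?thesis unfolding Th_def by (intro infsumI[symmetric]) (simp add: exp_of_real[symmetric])
qed

lemma real_theta_pos: "t > 0 \<Longrightarrow> real_theta t \<ge> 0"
  unfolding real_theta_def by (intro infsum_nonneg) auto

lemma real_theta_antimono:
  assumes "0 < s" "s \<le> t"
  shows "real_theta t \<le> real_theta s"
  unfolding real_theta_def
  by (intro infsum_mono real_theta_summable) (use assms in \<open>auto intro!: mult_right_mono mult_left_mono\<close>)

lemma real_theta_inversion: "t > 0 \<Longrightarrow> sqrt t * real_theta t = real_theta (1 / t)"
  using th0_inversion_real[of t] of_real_real_theta[of t] of_real_real_theta[of "1 / t"]
  by (metis of_real_eq_iff of_real_mult zero_less_divide_1_iff)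

text \<open>Monotonicity handles t \<ge> 1, and inversion reduces t < 1 to that range at the cost of
  a factor 1/t for the square.\<close>

lemma real_theta_bound:
  assumes t: "t > 0"
  shows "(real_theta t)\<^sup>2 \<le> (real_theta 1)\<^sup>2 * (1 + 1 / t)"
proof (cases "t \<ge> 1")
  case True
  have "(real_theta t)\<^sup>2 \<le> (real_theta 1)\<^sup>2" using real_theta_antimono[of 1 t] real_theta_pos[of t] True by (intro power_mono) auto
  also have "\<dots> \<le> (real_theta 1)\<^sup>2 * (1 + 1 / t)" using t by (simp add: mult_le_cancel_left1)
  finally show ?thesis .
next
  case False
  have "sqrt t * real_theta t \<le> real_theta 1" unfolding real_theta_inversion[OF t] using False t by (intro real_theta_antimono) auto
  then have "(sqrt t * real_theta t)\<^sup>2 \<le> (real_theta 1)\<^sup>2" using t real_theta_pos[OF t] by (intro power_mono) auto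
  then have "t * (real_theta t)\<^sup>2 \<le> (real_theta 1)\<^sup>2" using t by (simp add: power_mult_distrib)
  then have "(real_theta t)\<^sup>2 \<le> (real_theta 1)\<^sup>2 * (1 / t)" using t by (simp add: field_simps)
  also have "\<dots> \<le> (real_theta 1)\<^sup>2 * (1 + 1 / t)" by (intro mult_left_mono) auto
  finally show ?thesis .
qed

lemma has_sum_product_nonneg:
  fixes f :: "'a \<Rightarrow> real" and g :: "'b \<Rightarrow> real"
  assumes f: "f summable_on UNIV" "\<And>x. f x \<ge> 0" and g: "g summable_on UNIV" "\<And>x. g x \<ge> 0"
  shows "((\<lambda>(x, y). f x * g y) has_sum (infsum f UNIV * infsum g UNIV)) UNIV"
proof -
  have 1: "((\<lambda>y. (\<lambda>(x, y). f x * g y) (x, y)) has_sum (f x * infsum g UNIV)) UNIV" for x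
    using has_sum_cmult_right[OF has_sum_infsum[OF g(1)], of "f x"] by simp
  have 2: "((\<lambda>x. f x * infsum g UNIV) has_sum (infsum f UNIV * infsum g UNIV)) UNIV"
    using has_sum_cmult_left[OF has_sum_infsum[OF f(1)]] by simp
  have s: "(\<lambda>(x, y). f x * g y) summable_on UNIV \<times> UNIV"
    by (rule summable_on_SigmaI[where g = "\<lambda>x. f x * infsum g UNIV"])
       (use 1 2 f g in \<open>auto simp: summable_on_def intro: mult_nonneg_nonneg\<close>)
  have "((\<lambda>(x, y). f x * g y) has_sum (infsum f UNIV * infsum g UNIV)) (UNIV \<times> UNIV)"
    by (rule has_sum_SigmaI[OF 1 2 s])
  then show ?thesis by simp
qed

text \<open>The smaller eigenvalue of a positive definite binary form is at least the determinant over the trace.\<close>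
lemma Qf_lower:
  assumes "A > 0" "C > 0" "A * C - B\<^sup>2 = k"
  shows "real_of_int k / of_int (A + C) * (of_int x ^ 2 + of_int y ^ 2) \<le> of_int (Qf A B C x y)"
proof -
  have "(A + C) * Qf A B C x y = k * (x\<^sup>2 + y\<^sup>2) + (A * x + B * y)\<^sup>2 + (B * x + C * y)\<^sup>2"
    unfolding assms(3)[symmetric] Qf_def by (simp add: power2_eq_square algebra_simps)
  then have "k * (x\<^sup>2 + y\<^sup>2) \<le> (A + C) * Qf A B C x y" by simp
  then have "real_of_int (k * (x\<^sup>2 + y\<^sup>2)) \<le> real_of_int ((A + C) * Qf A B C x y)" by (simp only: of_int_le_iff)
  then show ?thesis using assms by (simp add: field_simps)
qed

locale pos_form =
  fixes A B C k :: int
  assumes A: "A > 0" and k: "k > 0" and disc: "A * C - B\<^sup>2 = k"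
begin

lemma C: "C > 0"
proof -
  have "A * C > 0" using k disc by (metis add.commute diff_add_cancel less_add_same_cancel2 add_pos_nonneg zero_le_power2)
  then show ?thesis using A by (simp add: zero_less_mult_iff)
qed

text \<open>The adjugate form appears on the dual side of Poisson summation.\<close>

lemma adj: "pos_form C (- B) A k"
  using C k disc by unfold_locales (auto simp: mult.commute)

definition min_eigen :: real where "min_eigen = of_int k / of_int (A + C)"

lemma min_eigen_pos: "min_eigen > 0" using A C k by (simp add: min_eigen_def)

lemma norm_term_le:
  assumes "t > 0" "Re s \<ge> t"
  shows "norm (exp (- of_real pi * s * of_int (Qf A B C x y)))
      \<le> exp (- pi * (t * min_eigen) * of_int x ^ 2) * exp (- pi * (t * min_eigen) * of_int y ^ 2)"
proof -
  have Q: "min_eigen * (of_int x ^ 2 + of_int y ^ 2) \<le> of_int (Qf A B C x y)"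
    unfolding min_eigen_def by (rule Qf_lower[OF A C disc])
  have "0 \<le> min_eigen * (of_int x ^ 2 + of_int y ^ 2)" using min_eigen_pos by simp
  then have "t * (min_eigen * (of_int x ^ 2 + of_int y ^ 2)) \<le> Re s * of_int (Qf A B C x y)"
    using Q assms by (intro mult_mono) auto
  then have "pi * (t * (min_eigen * (of_int x ^ 2 + of_int y ^ 2))) \<le> pi * (Re s * of_int (Qf A B C x y))"
    by (intro mult_left_mono) auto
  then show ?thesis by (simp add: norm_exp_eq_Re exp_add[symmetric] algebra_simps)
qed

lemma abs_summable:
  assumes "Re s > 0"
  shows "(\<lambda>(x, y). norm (exp (- of_real pi * s * of_int (Qf A B C x y)))) summable_on UNIV"
proof -
  have p: "Re s * min_eigen > 0" using assms min_eigen_pos by simp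
  have "(\<lambda>(x, y). exp (- pi * (Re s * min_eigen) * of_int x ^ 2) * exp (- pi * (Re s * min_eigen) * of_int y ^ 2)) summable_on (UNIV :: (int \<times> int) set)"
    using has_sum_product_nonneg[OF real_theta_summable[OF p] _ real_theta_summable[OF p]] by (auto simp: summable_on_def)
  from Infinite_Sum.abs_summable_on_comparison_test'[OF this, of "\<lambda>(x, y). exp (- of_real pi * s * of_int (Qf A B C x y))"]
  show ?thesis using norm_term_le[OF assms order_refl] by (auto simp: case_prod_unfold)
qed

lemma summable:
  assumes "Re s > 0"
  shows "(\<lambda>(x, y). exp (- of_real pi * s * of_int (Qf A B C x y))) summable_on UNIV"
  using abs_summable_summable[of "\<lambda>(x, y). exp (- of_real pi * s * of_int (Qf A B C x y))"] abs_summable[OF assms]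
  by (simp add: case_prod_unfold)

lemma abs_summable_coset:
  assumes s: "Re s > 0" and d: "(d::int) > 0"
  shows "(\<lambda>(n, m). norm (exp (- of_real pi * s * of_int (Qf A B C (g1 + d * n) (g2 + d * m))))) summable_on UNIV"
proof -
  define h where "h = (\<lambda>(n, m). (g1 + d * n, g2 + d * m))"
  have inj: "inj h" using d by (auto simp: h_def inj_def)
  have "(\<lambda>(x, y). norm (exp (- of_real pi * s * of_int (Qf A B C x y)))) summable_on range h"
    using abs_summable[OF s] by (rule summable_on_subset_banach) simp
  then have "(\<lambda>(x, y). norm (exp (- of_real pi * s * of_int (Qf A B C x y)))) \<circ> h summable_on UNIV"
    using summable_on_reindex[OF inj] by blast
  then show ?thesis by (simp add: h_def o_def case_prod_unfold)
qed

lemma summable_coset: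
  assumes s: "Re s > 0" and d: "(d::int) > 0"
  shows "(\<lambda>(n, m). exp (- of_real pi * s * of_int (Qf A B C (g1 + d * n) (g2 + d * m)))) summable_on UNIV"
  using abs_summable_summable[of "\<lambda>(n, m). exp (- of_real pi * s * of_int (Qf A B C (g1 + d * n) (g2 + d * m)))"]
    abs_summable_coset[OF assms]
  by (simp add: case_prod_unfold)

end

text \<open>A linear term in the exponent is a complex shift of the Gaussian: completing the square
  moves x to xi - i l/s.\<close>

lemma gauss_poisson_char:
  assumes s: "Re s > 0"
  shows "csqrt s * (\<Sum>\<^sub>\<infinity>m::int. exp (- of_real pi * s * (of_int m + \<xi>)\<^sup>2 + 2 * of_real pi * \<i> * l * (of_int m + \<xi>)))
       = (\<Sum>\<^sub>\<infinity>j::int. exp (- of_real pi * (of_int j - l)\<^sup>2 / s + 2 * of_real pi * \<i> * of_int j * \<xi>))"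
proof -
  have s0: "s \<noteq> 0" using s by auto
  define x where "x = \<xi> - \<i> * l / s"
  have e: "- of_real pi * s * (of_int m + \<xi>)\<^sup>2 + 2 * of_real pi * \<i> * l * (of_int m + \<xi>)
     = - (of_real pi * l\<^sup>2 / s) + - of_real pi * s * (of_int m + x)\<^sup>2" for m :: int
    unfolding x_def using s0 by (simp add: power2_eq_square field_simps)
  have f: "- (of_real pi * l\<^sup>2 / s) + (- of_real pi / s * of_int j ^ 2 + 2 * of_real pi * \<i> * x * of_int j)
     = - of_real pi * (of_int j - l)\<^sup>2 / s + 2 * of_real pi * \<i> * of_int j * \<xi>" for j :: int
    unfolding x_def using s0 by (simp add: power2_eq_square field_simps)
  have "(\<Sum>\<^sub>\<infinity>m::int. exp (- of_real pi * s * (of_int m + \<xi>)\<^sup>2 + 2 * of_real pi * \<i> * l * (of_int m + \<xi>)))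
     = exp (- (of_real pi * l\<^sup>2 / s)) * (\<Sum>\<^sub>\<infinity>m::int. exp (- of_real pi * s * (of_int m + x)\<^sup>2))"
    unfolding e exp_add by (rule infsum_cmult_right')
  then have "csqrt s * (\<Sum>\<^sub>\<infinity>m::int. exp (- of_real pi * s * (of_int m + \<xi>)\<^sup>2 + 2 * of_real pi * \<i> * l * (of_int m + \<xi>)))
     = exp (- (of_real pi * l\<^sup>2 / s)) * Th (- of_real pi / s) (2 * of_real pi * \<i> * x)"
    using gauss_poisson[OF s, of x] by simp
  also have "\<dots> = (\<Sum>\<^sub>\<infinity>j::int. exp (- (of_real pi * l\<^sup>2 / s)) * exp (- of_real pi / s * of_int j ^ 2 + 2 * of_real pi * \<i> * x * of_int j))"
    unfolding Th_def by (rule infsum_cmult_right'[symmetric])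
  also have "\<dots> = (\<Sum>\<^sub>\<infinity>j::int. exp (- of_real pi * (of_int j - l)\<^sup>2 / s + 2 * of_real pi * \<i> * of_int j * \<xi>))"
    unfolding exp_add[symmetric] f ..
  finally show ?thesis .
qed

lemma csqrt_of_real_mult:
  assumes "r > 0" "Re s > 0"
  shows "csqrt (of_real r * s) = of_real (sqrt r) * csqrt s"
proof (rule csqrt_unique)
  show "(of_real (sqrt r) * csqrt s)\<^sup>2 = of_real r * s"
    using assms by (simp add: power_mult_distrib of_real_power[symmetric] del: of_real_power)
  have "cmod s + Re s > 0" using assms by (simp add: add_nonneg_pos)
  then have "Re (csqrt s) > 0" by simp
  then show "0 < Re (of_real (sqrt r) * csqrt s) \<or> Re (of_real (sqrt r) * csqrt s) = 0 \<and> 0 \<le> Im (of_real (sqrt r) * csqrt s)"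
    using assms by simp
qed

context pos_form
begin

text \<open>Poisson summation in two variables is carried out one variable at a time: first over n
  for fixed m, then, after exchanging the sums, over m with the character produced by the first
  step.\<close>

theorem poisson_coset:
  assumes s: "Re s > 0" and d: "(d::int) > 0"
  shows "s * of_int d ^ 2 * of_real (sqrt (of_int k)) *
           (\<Sum>\<^sub>\<infinity>(n, m). exp (- of_real pi * s * of_int (Qf A B C (g1 + d * n) (g2 + d * m))))
       = (\<Sum>\<^sub>\<infinity>(v, w). exp (- of_real pi / (s * of_int d ^ 2 * of_int k) * of_int (Qf C (- B) A v w)) * ed d (v * g1 + w * g2))"
proof -
  have s0: "s \<noteq> 0" using s by auto
  \<comment> \<open>From Q = A (x + By/A)^2 + (k/A) y^2, scaled by d^2. The product r1 r2 = d^4 k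
    yields the factor d^2 sqrt k of the statement.\<close>
  define r1 where "r1 = real_of_int (A * d\<^sup>2)"
  define r2 where "r2 = real_of_int (k * d\<^sup>2) / real_of_int A"
  have r: "r1 > 0" "r2 > 0" using A k d by (auto simp: r1_def r2_def)
  define s1 where "s1 = of_real r1 * s"
  define s2 where "s2 = of_real r2 * s"
  have s12: "Re s1 > 0" "Re s2 > 0" using s r by (auto simp: s1_def s2_def)
  have s12n: "s1 \<noteq> 0" "s2 \<noteq> 0" using s12 by auto
  define ca cb cc ck cd where cdefs: "ca = (of_int A :: complex)" "cb = (of_int B :: complex)" "cc = (of_int C :: complex)"
    "ck = (of_int k :: complex)" "cd = (of_int d :: complex)"
  have nz: "ca \<noteq> 0" "cd \<noteq> 0" "ck \<noteq> 0" using A d k by (auto simp: cdefs)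
  have disc': "ca * cc = ck + cb\<^sup>2"
  proof -
    have "A * C = k + B\<^sup>2" using disc by simp
    then show ?thesis unfolding cdefs by (metis of_int_add of_int_mult of_int_power)
  qed
  have s1e: "s1 = ca * cd\<^sup>2 * s" by (simp add: s1_def r1_def cdefs)
  have s2e: "s2 = ck * cd\<^sup>2 / ca * s" by (simp add: s2_def r2_def cdefs)
  define P where "P = complex_of_real pi"
  define y where "y m = of_int m + of_int g2 / cd" for m :: int
  define X where "X m = of_int g1 / cd + cb * y m / ca" for m :: int
  have trm: "- P * s * of_int (Qf A B C (g1 + d * n) (g2 + d * m))
      = - P * s2 * (y m)\<^sup>2 + - P * s1 * (of_int n + X m)\<^sup>2" for n m
  proof -
    have 1: "of_int (g1 + d * n) = cd * (of_int n + of_int g1 / cd)" "of_int (g2 + d * m) = cd * y m"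
      using nz by (simp_all add: y_def cdefs field_simps)
    define z where "z = of_int n + of_int g1 / cd"
    have X: "of_int n + X m = z + cb * y m / ca" by (simp add: X_def z_def)
    have "of_int (Qf A B C (g1 + d * n) (g2 + d * m)) = cd\<^sup>2 * (ca * z\<^sup>2 + 2 * cb * z * y m + cc * (y m)\<^sup>2)"
      unfolding Qf_def of_int_add[of "A * _ + _"] of_int_add[of "A * _"] of_int_mult of_int_power 1
      by (simp add: cdefs[symmetric] z_def[symmetric] power2_eq_square algebra_simps)
    also have "\<dots> = cd\<^sup>2 * (ck / ca * (y m)\<^sup>2 + ca * (z + cb * y m / ca)\<^sup>2)"
    proof -
      have "ca * (ca * z\<^sup>2 + 2 * cb * z * y m + cc * (y m)\<^sup>2) = ca * ca * z\<^sup>2 + 2 * ca * cb * z * y m + (ca * cc) * (y m)\<^sup>2"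
        by (simp add: algebra_simps)
      also have "\<dots> = ca * (ck / ca * (y m)\<^sup>2 + ca * (z + cb * y m / ca)\<^sup>2)"
        unfolding disc' using nz by (simp add: field_simps power2_eq_square)
      finally show ?thesis using nz by simp
    qed
    finally show ?thesis unfolding X s1e s2e using nz by (simp add: field_simps)
  qed
  have sm: "(\<lambda>(n, m). exp (- P * s * of_int (Qf A B C (g1 + d * n) (g2 + d * m)))) summable_on UNIV"
    unfolding P_def by (rule summable_coset[OF s d])
  have bsw: "bij_betw prod.swap (UNIV :: (int \<times> int) set) (UNIV :: (int \<times> int) set)" by (simp add: bij_swap)
  have sm': "(\<lambda>(m, n). exp (- P * s * of_int (Qf A B C (g1 + d * n) (g2 + d * m)))) summable_on UNIV \<times> UNIV"
    using sm summable_on_reindex_bij_betw[OF bsw, of "\<lambda>(n, m). exp (- P * s * of_int (Qf A B C (g1 + d * n) (g2 + d * m)))"]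
    by (simp add: case_prod_unfold)
  have lhs: "(\<Sum>\<^sub>\<infinity>(n, m). exp (- P * s * of_int (Qf A B C (g1 + d * n) (g2 + d * m))))
     = (\<Sum>\<^sub>\<infinity>m. \<Sum>\<^sub>\<infinity>n. exp (- P * s * of_int (Qf A B C (g1 + d * n) (g2 + d * m))))"
    using infsum_reindex_bij_betw[OF bsw, of "\<lambda>(n, m). exp (- P * s * of_int (Qf A B C (g1 + d * n) (g2 + d * m)))"]
      infsum_Sigma'_banach[OF sm'] by (simp add: case_prod_unfold)
  have inner1: "csqrt s1 * (\<Sum>\<^sub>\<infinity>n::int. exp (- P * s * of_int (Qf A B C (g1 + d * n) (g2 + d * m))))
     = (\<Sum>\<^sub>\<infinity>v::int. exp (- P * s2 * (y m)\<^sup>2) * exp (- P / s1 * of_int v ^ 2 + 2 * P * \<i> * X m * of_int v))" for m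
  proof -
    have "csqrt s1 * (\<Sum>\<^sub>\<infinity>n::int. exp (- P * s * of_int (Qf A B C (g1 + d * n) (g2 + d * m))))
       = csqrt s1 * (exp (- P * s2 * (y m)\<^sup>2) * (\<Sum>\<^sub>\<infinity>n::int. exp (- P * s1 * (of_int n + X m)\<^sup>2)))"
      unfolding trm exp_add by (subst infsum_cmult_right') simp
    also have "\<dots> = exp (- P * s2 * (y m)\<^sup>2) * Th (- P / s1) (2 * P * \<i> * X m)"
      using gauss_poisson[OF s12(1), of "X m"] by (simp add: P_def)
    finally show ?thesis unfolding Th_def by (simp only: infsum_cmult_right')
  qed
  have trm2: "exp (- P * s2 * (y m)\<^sup>2) * exp (- P / s1 * of_int v ^ 2 + 2 * P * \<i> * X m * of_int v)
     = exp (- P / s1 * of_int v ^ 2 + 2 * P * \<i> * of_int v * of_int g1 / cd) *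
       exp (- P * s2 * (of_int m + of_int g2 / cd)\<^sup>2 + 2 * P * \<i> * (of_int v * cb / ca) * (of_int m + of_int g2 / cd))" for v m :: int
    unfolding exp_add[symmetric] X_def y_def[symmetric] using nz by (simp add: field_simps)
  define G where "G = (\<lambda>m v. exp (- P * s2 * (y m)\<^sup>2) * exp (- P / s1 * of_int v ^ 2 + 2 * P * \<i> * X m * of_int v))"
  \<comment> \<open>Absolute convergence for the exchange of the sums: X m is real, so the mixed
    exponential has modulus 1 and |G m v| is a product.\<close>
  have smG: "(\<lambda>(m, v). G m v) summable_on UNIV"
  proof -
    define f where "f = (\<lambda>m. norm (exp (- P * s2 * (y m)\<^sup>2)))"
    define h where "h = (\<lambda>v::int. norm (exp (- P / s1 * of_int v ^ 2 + 0 * of_int v)))"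
    have "f summable_on UNIV"
    proof -
      have e: "- P * s2 * (y m)\<^sup>2 = - P * s2 * (of_int g2 / cd)\<^sup>2 + (- P * s2 * of_int m ^ 2 + (- 2 * P * s2 * of_int g2 / cd) * of_int m)" for m
        unfolding y_def using nz by (simp add: field_simps power2_eq_square)
      have "(\<lambda>m::int. norm (exp (- P * s2 * (of_int g2 / cd)\<^sup>2)) * norm (exp (- P * s2 * of_int m ^ 2 + (- 2 * P * s2 * of_int g2 / cd) * of_int m))) summable_on UNIV"
        using s12 by (intro summable_on_cmult_right Th_abs_summable) (simp add: P_def)
      then show ?thesis unfolding f_def e exp_add[of "- P * s2 * (of_int g2 / cd)\<^sup>2"] norm_mult .
    qed
    moreover have "h summable_on UNIV"
      unfolding h_def using Re_pi_pos[OF Re_inverse_pos[OF s12(1)]] by (intro Th_abs_summable) (simp add: P_def)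
    ultimately have "(\<lambda>(m, v). f m * h v) summable_on UNIV"
      using has_sum_product_nonneg[of f h] by (auto simp: summable_on_def f_def h_def)
    moreover have "norm (G m v) = f m * h v" for m v
    proof -
      have "Re (2 * P * \<i> * X m * of_int v) = 0"
        by (simp add: P_def X_def y_def cdefs)
      then show ?thesis unfolding G_def f_def h_def norm_mult exp_add by (simp add: norm_exp_eq_Re)
    qed
    ultimately show ?thesis
      using abs_summable_summable[of "\<lambda>(m, v). G m v"] by (simp add: case_prod_unfold)
  qed
  have inner2: "csqrt s2 * (\<Sum>\<^sub>\<infinity>m. G m v)
     = (\<Sum>\<^sub>\<infinity>w::int. exp (- P / (s * cd\<^sup>2 * ck) * of_int (Qf C (- B) A v w)) * ed d (v * g1 + w * g2))" for v
  proof -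
    define pre where "pre = exp (- P / s1 * of_int v ^ 2 + 2 * P * \<i> * of_int v * of_int g1 / cd)"
    have "csqrt s2 * (\<Sum>\<^sub>\<infinity>m. G m v) = pre * (csqrt s2 * (\<Sum>\<^sub>\<infinity>m::int. exp (- P * s2 * (of_int m + of_int g2 / cd)\<^sup>2 + 2 * P * \<i> * (of_int v * cb / ca) * (of_int m + of_int g2 / cd))))"
      unfolding G_def trm2 pre_def by (subst infsum_cmult_right') (simp add: mult_ac)
    also have "\<dots> = pre * (\<Sum>\<^sub>\<infinity>w::int. exp (- P * (of_int w - of_int v * cb / ca)\<^sup>2 / s2 + 2 * P * \<i> * of_int w * (of_int g2 / cd)))"
      unfolding P_def by (subst gauss_poisson_char[OF s12(2)]) simp
    also have "\<dots> = (\<Sum>\<^sub>\<infinity>w::int. pre * exp (- P * (of_int w - of_int v * cb / ca)\<^sup>2 / s2 + 2 * P * \<i> * of_int w * (of_int g2 / cd)))"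
      by (rule infsum_cmult_right'[symmetric])
    also have "\<dots> = (\<Sum>\<^sub>\<infinity>w::int. exp (- P / (s * cd\<^sup>2 * ck) * of_int (Qf C (- B) A v w)) * ed d (v * g1 + w * g2))"
    proof (intro infsum_cong)
      fix w :: int
      define V W where "V = (of_int v :: complex)" "W = (of_int w :: complex)"
      \<comment> \<open>The two one-dimensional dual Gaussians combine to the adjugate form; the
        relation AC = k + B^2 enters here.\<close>
      have q: "- P / s1 * V\<^sup>2 + - P * (W - V * cb / ca)\<^sup>2 / s2 = - P / (s * cd\<^sup>2 * ck) * (cc * V\<^sup>2 - 2 * cb * V * W + ca * W\<^sup>2)"
      proof -
        have "- P / s1 * V\<^sup>2 + - P * (W - V * cb / ca)\<^sup>2 / s2
          = - P / (s * cd\<^sup>2 * ck) * (ck * V\<^sup>2 / ca + ca * (W - V * cb / ca)\<^sup>2)"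
          unfolding s1e s2e using nz s0 by (simp add: field_simps)
        also have "ck * V\<^sup>2 / ca + ca * (W - V * cb / ca)\<^sup>2 = ((ck + cb\<^sup>2) * V\<^sup>2 - 2 * ca * cb * V * W + ca * ca * W\<^sup>2) / ca"
          using nz by (simp add: field_simps power2_eq_square)
        also have "\<dots> = cc * V\<^sup>2 - 2 * cb * V * W + ca * W\<^sup>2"
          unfolding disc'[symmetric] using nz by (simp add: field_simps)
        finally show ?thesis .
      qed
      have qf: "of_int (Qf C (- B) A v w) = cc * V\<^sup>2 - 2 * cb * V * W + ca * W\<^sup>2"
        by (simp add: Qf_def cdefs V_W_def)
      have "pre * exp (- P * (of_int w - of_int v * cb / ca)\<^sup>2 / s2 + 2 * P * \<i> * of_int w * (of_int g2 / cd))
         = exp ((- P / s1 * V\<^sup>2 + - P * (W - V * cb / ca)\<^sup>2 / s2) + 2 * P * \<i> * ((V * of_int g1 + W * of_int g2) / cd))"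
        unfolding pre_def exp_add[symmetric] V_W_def[symmetric] by (simp add: algebra_simps add_divide_distrib)
      also have "\<dots> = exp (- P / (s * cd\<^sup>2 * ck) * of_int (Qf C (- B) A v w)) * ed d (v * g1 + w * g2)"
        unfolding q exp_add qf ee_def by (simp add: P_def V_W_def cdefs)
      finally show "pre * exp (- P * (of_int w - of_int v * cb / ca)\<^sup>2 / s2 + 2 * P * \<i> * of_int w * (of_int g2 / cd))
        = exp (- P / (s * cd\<^sup>2 * ck) * of_int (Qf C (- B) A v w)) * ed d (v * g1 + w * g2)" .
    qed
    finally show ?thesis .
  qed
  have rhs_sm: "(\<lambda>(v, w). exp (- P / (s * cd\<^sup>2 * ck) * of_int (Qf C (- B) A v w)) * ed d (v * g1 + w * g2)) summable_on UNIV \<times> UNIV"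
  proof -
    define s' where "s' = 1 / (s * cd\<^sup>2 * ck)"
    have "Re (of_real (of_int (d\<^sup>2 * k)) * s) > 0" using s d k by simp
    then have "Re s' > 0" using Re_inverse_pos[of "of_real (of_int (d\<^sup>2 * k)) * s"] by (simp add: s'_def cdefs mult_ac)
    from pos_form.abs_summable[OF adj this]
    have "(\<lambda>(v, w). norm (exp (- P / (s * cd\<^sup>2 * ck) * of_int (Qf C (- B) A v w)) * ed d (v * g1 + w * g2))) summable_on UNIV"
      by (simp add: norm_mult norm_ee s'_def P_def)
    then show ?thesis
      using abs_summable_summable[of "\<lambda>(v, w). exp (- P / (s * cd\<^sup>2 * ck) * of_int (Qf C (- B) A v w)) * ed d (v * g1 + w * g2)"]
      by (simp add: case_prod_unfold)
  qed
  have "csqrt s2 * (csqrt s1 * (\<Sum>\<^sub>\<infinity>(n, m). exp (- P * s * of_int (Qf A B C (g1 + d * n) (g2 + d * m)))))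
     = csqrt s2 * (\<Sum>\<^sub>\<infinity>m. csqrt s1 * (\<Sum>\<^sub>\<infinity>n. exp (- P * s * of_int (Qf A B C (g1 + d * n) (g2 + d * m)))))"
    unfolding lhs by (subst infsum_cmult_right') simp
  also have "\<dots> = csqrt s2 * (\<Sum>\<^sub>\<infinity>m. \<Sum>\<^sub>\<infinity>v. G m v)" unfolding inner1 G_def ..
  also have "(\<Sum>\<^sub>\<infinity>m. \<Sum>\<^sub>\<infinity>v. G m v) = (\<Sum>\<^sub>\<infinity>v. \<Sum>\<^sub>\<infinity>m. G m v)"
    by (rule infsum_swap_banach) (use smG in simp)
  also have "csqrt s2 * (\<Sum>\<^sub>\<infinity>v. \<Sum>\<^sub>\<infinity>m. G m v) = (\<Sum>\<^sub>\<infinity>v. csqrt s2 * (\<Sum>\<^sub>\<infinity>m. G m v))"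
    by (rule infsum_cmult_right'[symmetric])
  also have "\<dots> = (\<Sum>\<^sub>\<infinity>(v, w). exp (- P / (s * cd\<^sup>2 * ck) * of_int (Qf C (- B) A v w)) * ed d (v * g1 + w * g2))"
    unfolding inner2 using infsum_Sigma'_banach[OF rhs_sm] by simp
  finally have main: "csqrt s2 * csqrt s1 * (\<Sum>\<^sub>\<infinity>(n, m). exp (- P * s * of_int (Qf A B C (g1 + d * n) (g2 + d * m))))
     = (\<Sum>\<^sub>\<infinity>(v, w). exp (- P / (s * cd\<^sup>2 * ck) * of_int (Qf C (- B) A v w)) * ed d (v * g1 + w * g2))"
    by (simp add: mult.assoc)
  have "csqrt s2 * csqrt s1 = of_real (sqrt r2 * sqrt r1) * (csqrt s)\<^sup>2"
    unfolding s1_def s2_def csqrt_of_real_mult[OF r(1) s] csqrt_of_real_mult[OF r(2) s] by (simp add: power2_eq_square)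
  also have "sqrt r2 * sqrt r1 = of_int (d\<^sup>2) * sqrt (of_int k)"
  proof -
    have "r2 * r1 = (of_int (d\<^sup>2))\<^sup>2 * of_int k" using A by (simp add: r1_def r2_def power2_eq_square)
    then have "sqrt r2 * sqrt r1 = sqrt ((of_int (d\<^sup>2))\<^sup>2 * of_int k)"
      by (simp only: real_sqrt_mult[symmetric])
    then show ?thesis by (simp only: real_sqrt_mult real_sqrt_abs) simp
  qed
  finally have "csqrt s2 * csqrt s1 = s * of_int d ^ 2 * of_real (sqrt (of_int k))" by (simp add: mult_ac)
  then show ?thesis using main unfolding P_def cdefs by simp
qed

end

definition form_theta :: "int \<Rightarrow> int \<Rightarrow> int \<Rightarrow> complex \<Rightarrow> complex" where
  "form_theta A B C \<tau> = (\<Sum>\<^sub>\<infinity>(x, y). ee (of_int (Qf A B C x y) * \<tau>))"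

lemma ee_eq_exp_gauss: "ee (of_int n * \<tau>) = exp (- of_real pi * (- 2 * \<i> * \<tau>) * of_int n)"
  by (simp add: ee_def mult_ac)

lemma infsum_int2_residues:
  fixes F :: "int \<Rightarrow> int \<Rightarrow> complex"
  assumes d: "d > 0" and F: "(\<lambda>(x, y). F x y) summable_on UNIV"
  shows "(\<Sum>\<^sub>\<infinity>(x, y). F x y) = (\<Sum>(g1, g2)\<in>{0..<d} \<times> {0..<d}. \<Sum>\<^sub>\<infinity>(n, m). F (g1 + d * n) (g2 + d * m))"
proof -
  define R where "R = {0..<d} \<times> {0..<d}"
  define h where "h = (\<lambda>((g1, g2), (n, m)). (g1 + d * n, g2 + d * m))"
  have bij: "bij_betw h (R \<times> UNIV) UNIV"
  proof (rule bij_betwI[where g = "\<lambda>(x, y). ((x mod d, y mod d), (x div d, y div d))"])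
    show "(\<lambda>(x, y). ((x mod d, y mod d), (x div d, y div d))) \<in> UNIV \<rightarrow> R \<times> UNIV" using d by (auto simp: R_def)
  qed (use d in \<open>auto simp: h_def R_def\<close>)
  have "(\<lambda>p. case h p of (x, y) \<Rightarrow> F x y) summable_on (R \<times> UNIV)"
    using F summable_on_reindex_bij_betw[OF bij, of "\<lambda>(x, y). F x y"] by simp
  then have s: "(\<lambda>(g, v). case h (g, v) of (x, y) \<Rightarrow> F x y) summable_on (R \<times> UNIV)" by (simp add: case_prod_unfold)
  have "(\<Sum>\<^sub>\<infinity>(x, y). F x y) = (\<Sum>\<^sub>\<infinity>(g, v)\<in>R \<times> UNIV. case h (g, v) of (x, y) \<Rightarrow> F x y)"
    using infsum_reindex_bij_betw[OF bij, of "\<lambda>(x, y). F x y"] by (simp add: case_prod_unfold)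
  also have "\<dots> = (\<Sum>\<^sub>\<infinity>g\<in>R. \<Sum>\<^sub>\<infinity>v. case h (g, v) of (x, y) \<Rightarrow> F x y)"
    by (rule infsum_Sigma'_banach[symmetric, OF s])
  also have "\<dots> = (\<Sum>g\<in>R. \<Sum>\<^sub>\<infinity>v. case h (g, v) of (x, y) \<Rightarrow> F x y)" by (rule infsum_finite) (simp add: R_def)
  finally show ?thesis unfolding R_def by (simp add: h_def case_prod_unfold)
qed

context pos_form
begin

lemma Re_gauss: "Im \<tau> > 0 \<Longrightarrow> Re (- 2 * \<i> * \<tau>) > 0"
  by simp

lemma form_theta_summable: "Im \<tau> > 0 \<Longrightarrow> (\<lambda>(x, y). ee (of_int (Qf A B C x y) * \<tau>)) summable_on UNIV"
  unfolding ee_eq_exp_gauss by (rule summable[OF Re_gauss])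

lemma norm_form_theta_term_le:
  assumes "t > 0" "2 * Im \<tau> \<ge> t"
  shows "norm (ee (of_int (Qf A B C x y) * \<tau>)) \<le> exp (- pi * (t * min_eigen) * of_int x ^ 2) * exp (- pi * (t * min_eigen) * of_int y ^ 2)"
  unfolding ee_eq_exp_gauss using assms by (intro norm_term_le) auto

lemma maj_has_sum:
  assumes "t > 0"
  shows "((\<lambda>(x, y). exp (- pi * (t * min_eigen) * of_int x ^ 2) * exp (- pi * (t * min_eigen) * of_int y ^ 2)) has_sum (real_theta (t * min_eigen))\<^sup>2) (UNIV :: (int \<times> int) set)"
proof -
  have p: "t * min_eigen > 0" using assms min_eigen_pos by simp
  show ?thesis
    using has_sum_product_nonneg[OF real_theta_summable[OF p] _ real_theta_summable[OF p]] by (simp add: power2_eq_square real_theta_def)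
qed

text \<open>The smaller eigenvalue bounds the series by the square of a one-dimensional theta
  constant, whose growth at the real axis is known from inversion.\<close>

lemma form_theta_growth:
  "\<exists>K. \<forall>\<tau>. Im \<tau> > 0 \<longrightarrow> norm (form_theta A B C \<tau>) \<le> K * (1 + 1 / Im \<tau>)"
proof -
  define K where "K = (real_theta 1)\<^sup>2 * (1 + 1 / (2 * min_eigen))"
  have "norm (form_theta A B C \<tau>) \<le> K * (1 + 1 / Im \<tau>)" if t: "Im \<tau> > 0" for \<tau>
  proof -
    define y where "y = Im \<tau>"
    have y: "2 * y > 0" using t by (simp add: y_def)
    have "norm (form_theta A B C \<tau>) \<le> (\<Sum>\<^sub>\<infinity>(u, v)\<in>(UNIV :: (int \<times> int) set). exp (- pi * (2 * y * min_eigen) * of_int u ^ 2) * exp (- pi * (2 * y * min_eigen) * of_int v ^ 2))"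
      unfolding form_theta_def
    proof (rule norm_infsum_le)
      show "((\<lambda>(x, y). ee (of_int (Qf A B C x y) * \<tau>)) has_sum (\<Sum>\<^sub>\<infinity>(x, y). ee (of_int (Qf A B C x y) * \<tau>))) UNIV"
        by (rule has_sum_infsum[OF form_theta_summable[OF t]])
      show "((\<lambda>(u, v). exp (- pi * (2 * y * min_eigen) * of_int u ^ 2) * exp (- pi * (2 * y * min_eigen) * of_int v ^ 2)) has_sum
         (\<Sum>\<^sub>\<infinity>(u, v)\<in>(UNIV :: (int \<times> int) set). exp (- pi * (2 * y * min_eigen) * of_int u ^ 2) * exp (- pi * (2 * y * min_eigen) * of_int v ^ 2))) UNIV"
        using maj_has_sum[OF y] by (simp add: infsumI)
      show "norm (case p of (x, z) \<Rightarrow> ee (of_int (Qf A B C x z) * \<tau>)) \<le>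
          (case p of (u, v) \<Rightarrow> exp (- pi * (2 * y * min_eigen) * of_int u ^ 2) * exp (- pi * (2 * y * min_eigen) * of_int v ^ 2))" for p
        using norm_form_theta_term_le[OF y, of \<tau>] by (simp add: y_def case_prod_unfold)
    qed
    also have "\<dots> = (real_theta (2 * y * min_eigen))\<^sup>2" using maj_has_sum[OF y] by (simp add: infsumI)
    also have "\<dots> \<le> (real_theta 1)\<^sup>2 * (1 + 1 / (2 * y * min_eigen))" using y min_eigen_pos by (intro real_theta_bound) auto
    also have "\<dots> \<le> (real_theta 1)\<^sup>2 * ((1 + 1 / (2 * min_eigen)) * (1 + 1 / y))"
    proof (rule mult_left_mono)
      have "(1 + 1 / (2 * min_eigen)) * (1 + 1 / y) - (1 + 1 / (2 * y * min_eigen)) = 1 / (2 * min_eigen) + 1 / y"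
        using y min_eigen_pos by (simp add: field_simps)
      also have "\<dots> \<ge> 0" using y min_eigen_pos by simp
      finally show "1 + 1 / (2 * y * min_eigen) \<le> (1 + 1 / (2 * min_eigen)) * (1 + 1 / y)" by simp
    qed simp
    finally show ?thesis by (simp add: K_def y_def mult.assoc)
  qed
  then show ?thesis by blast
qed

lemma form_theta_holomorphic: "form_theta A B C holomorphic_on {\<tau>. Im \<tau> > 0}"
proof -
  have "(\<lambda>z. \<Sum>\<^sub>\<infinity>p. (case p of (x, y) \<Rightarrow> \<lambda>z. ee (of_int (Qf A B C x y) * z)) z) holomorphic_on {\<tau>. Im \<tau> > 0}"
  proof (rule holomorphic_on_infsum)
    show "open {\<tau>. Im \<tau> > 0}" by (rule open_halfspace_Im_gt)
    show "(case p of (x, y) \<Rightarrow> \<lambda>z. ee (of_int (Qf A B C x y) * z)) holomorphic_on {\<tau>. Im \<tau> > 0}" for p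
      by (cases p) (auto intro!: holomorphic_intros)
    fix z assume "z \<in> {\<tau>. Im \<tau> > 0}"
    then have z: "Im z > 0" by simp
    define M where "M = (\<lambda>(x, y). exp (- pi * (Im z * min_eigen) * of_int x ^ 2) * exp (- pi * (Im z * min_eigen) * of_int y ^ 2))"
    have im: "2 * Im w \<ge> Im z" if "w \<in> cball z (Im z / 2)" for w
    proof -
      have "\<bar>Im (z - w)\<bar> \<le> Im z / 2" using that abs_Im_le_cmod[of "z - w"] by (simp add: dist_norm)
      then have "Im (z - w) \<le> Im z / 2" by (rule abs_le_D1)
      then show ?thesis by simp
    qed
    have "cball z (Im z / 2) \<subseteq> {\<tau>. Im \<tau> > 0}" using im z by force
    moreover have "M summable_on UNIV" unfolding M_def using maj_has_sum[OF z] by (auto simp: summable_on_def)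
    moreover have "\<forall>p\<in>UNIV. \<forall>w\<in>cball z (Im z / 2). norm ((case p of (x, y) \<Rightarrow> \<lambda>z. ee (of_int (Qf A B C x y) * z)) w) \<le> M p"
      using norm_form_theta_term_le[OF z] im by (auto simp: M_def)
    ultimately show "\<exists>r>0. \<exists>M. cball z r \<subseteq> {\<tau>. Im \<tau> > 0} \<and> M summable_on UNIV \<and>
       (\<forall>p\<in>UNIV. \<forall>w\<in>cball z r. norm ((case p of (x, y) \<Rightarrow> \<lambda>z. ee (of_int (Qf A B C x y) * z)) w) \<le> M p)"
      using z by (intro exI[of _ "Im z / 2"] conjI exI[of _ M]) auto
  qed
  then show ?thesis unfolding form_theta_def[abs_def] by (simp add: case_prod_unfold)
qed

lemma form_theta_add_int: "form_theta A B C (\<tau> + of_int j) = form_theta A B C \<tau>"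
proof -
  have "ee (of_int n * (\<tau> + of_int j)) = ee (of_int n * \<tau>)" for n
  proof -
    have "of_int n * (\<tau> + of_int j) = of_int n * \<tau> + of_int (n * j)" by (simp add: algebra_simps)
    then show ?thesis by (simp only: ee_add ee_of_int) simp
  qed
  then show ?thesis by (simp add: form_theta_def)
qed

text \<open>Since gamma tau = b/d + tau/(d(c tau + d)), the rational part b/d is constant on cosets
  modulo d. Poisson summation on each coset and summation over the cosets leave a Gauss sum with a
  linear twist; the untwisted Gauss sum factors out, and the remaining dual series is that of tau,
  so Poisson summation can be undone.\<close>

theorem form_theta_mob:
  assumes t: "Im \<tau> > 0" and det: "a * d - b * c = 1" and c: "c = 4 * k * c'" and d: "d > 0"
  shows "of_int d * form_theta A B C (mob a b c d \<tau>) = gauss_sum A B C b d * (of_int c * \<tau> + of_int d) * form_theta A B C \<tau>"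
proof -
  define cd where "cd = (of_int d :: complex)"
  define ck where "ck = (of_int k :: complex)"
  define j where "j = of_int c * \<tau> + cd"
  have j: "j \<noteq> 0" unfolding j_def cd_def by (rule mob_denom_nonzero[OF det t])
  have nz: "cd \<noteq> 0" "\<tau> \<noteq> 0" "ck \<noteq> 0" using d t k by (auto simp: cd_def ck_def)
  define \<tau>' where "\<tau>' = \<tau> / (cd * j)"
  have det': "cd * of_int a = 1 + of_int b * of_int c"
  proof -
    have "d * a = 1 + b * c" using det by (simp add: mult.commute)
    then show ?thesis unfolding cd_def by (metis of_int_1 of_int_add of_int_mult)
  qed
  \<comment> \<open>Rests on ad = 1 + bc.\<close>
  have mob: "mob a b c d \<tau> = of_int b / cd + \<tau>'"
  proof -
    have "mob a b c d \<tau> = (of_int a * \<tau> + of_int b) / j" by (simp add: mob_def j_def cd_def)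
    also have "\<dots> = ((cd * of_int a) * \<tau> + of_int b * cd) / (cd * j)"
      using nz j by (simp add: field_simps)
    also have "\<dots> = (of_int b * j + \<tau>) / (cd * j)" unfolding det' j_def by (simp add: algebra_simps)
    also have "\<dots> = of_int b / cd + \<tau>'" using nz j by (simp add: \<tau>'_def field_simps)
    finally show ?thesis .
  qed
  have t': "Im \<tau>' > 0"
  proof -
    have "Im (mob a b c d \<tau>) = Im \<tau>'" unfolding mob cd_def
      by (simp add: Im_divide_of_real[of _ "of_int d", simplified])
    then show ?thesis using Im_mob_pos[OF det t] by simp
  qed
  define s s0 where "s = - 2 * \<i> * \<tau>'" and "s0 = - 2 * \<i> * \<tau>"
  have s: "Re s > 0" "Re s0 > 0" using t t' by (auto simp: s_def s0_def)
  define rk where "rk = complex_of_real (sqrt (of_int k))"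
  have rk: "rk \<noteq> 0" using k by (simp add: rk_def)
  define q where "q = (\<lambda>v w. exp (- of_real pi / (s0 * ck) * of_int (Qf C (- B) A v w)))"
  \<comment> \<open>Poisson summation at tau on the full lattice, that is, with modulus 1; used
    backwards at the end.\<close>
  have base: "s0 * rk * form_theta A B C \<tau> = (\<Sum>\<^sub>\<infinity>(v, w). q v w)"
    using poisson_coset[OF s(2), of 1 0 0] ee_of_int
    unfolding form_theta_def ee_eq_exp_gauss s0_def[symmetric] q_def rk_def ck_def by simp
  have decomp: "form_theta A B C (mob a b c d \<tau>) = (\<Sum>(g1, g2)\<in>{0..<d} \<times> {0..<d}. ed d (b * Qf A B C g1 g2) *
       (\<Sum>\<^sub>\<infinity>(n, m). exp (- of_real pi * s * of_int (Qf A B C (g1 + d * n) (g2 + d * m)))))"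
  proof -
    have e: "ee (of_int (Qf A B C (g1 + d * n) (g2 + d * m)) * mob a b c d \<tau>)
       = ed d (b * Qf A B C g1 g2) * exp (- of_real pi * s * of_int (Qf A B C (g1 + d * n) (g2 + d * m)))" for g1 g2 n m
    proof -
      define N where "N = Qf A B C (g1 + d * n) (g2 + d * m)"
      have "[g1 + d * n = g1] (mod d)" "[g2 + d * m = g2] (mod d)" by (auto simp: cong_def)
      then have "[N = Qf A B C g1 g2] (mod d)" unfolding N_def by (rule Qf_cong)
      then have "ed d (b * N) = ed d (b * Qf A B C g1 g2)" using d by (intro ed_cong cong_mult cong_refl) auto
      moreover have "of_int N * mob a b c d \<tau> = of_int (b * N) / of_int d + of_int N * \<tau>'"
        unfolding mob cd_def by (simp add: algebra_simps)
      ultimately have "ee (of_int N * mob a b c d \<tau>) = ed d (b * Qf A B C g1 g2) * ee (of_int N * \<tau>')"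
        by (simp only: ee_add)
      moreover have "ee (of_int N * \<tau>') = exp (- of_real pi * s * of_int N)"
        unfolding s_def by (rule ee_eq_exp_gauss)
      ultimately show ?thesis by (simp only: N_def)
    qed
    have "form_theta A B C (mob a b c d \<tau>) = (\<Sum>(g1, g2)\<in>{0..<d} \<times> {0..<d}.
       \<Sum>\<^sub>\<infinity>(n, m). ee (of_int (Qf A B C (g1 + d * n) (g2 + d * m)) * mob a b c d \<tau>))"
      unfolding form_theta_def by (rule infsum_int2_residues[OF d form_theta_summable[OF Im_mob_pos[OF det t]]])
    then show ?thesis unfolding e
      by (simp add: case_prod_unfold infsum_cmult_right'[symmetric])
  qed
  define Z where "Z = (\<lambda>v w. exp (- of_real pi / (s * cd\<^sup>2 * ck) * of_int (Qf C (- B) A v w)))"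
  have adjsum: "(\<lambda>(v, w). Z v w) summable_on UNIV"
  proof -
    define s' where "s' = 1 / (s * cd\<^sup>2 * ck)"
    have "Re (of_real (of_int (d\<^sup>2 * k)) * s) > 0" using s d k by simp
    then have "Re s' > 0" using Re_inverse_pos[of "of_real (of_int (d\<^sup>2 * k)) * s"] by (simp add: s'_def cd_def ck_def mult_ac)
    from pos_form.summable[OF adj this] show ?thesis unfolding Z_def s'_def by simp
  qed
  have "s * cd\<^sup>2 * rk * form_theta A B C (mob a b c d \<tau>)
      = (\<Sum>(g1, g2)\<in>{0..<d} \<times> {0..<d}. ed d (b * Qf A B C g1 g2) * (\<Sum>\<^sub>\<infinity>(v, w). Z v w * ed d (v * g1 + w * g2)))"
    unfolding decomp sum_distrib_left
  proof (intro sum.cong refl, clarify)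
    fix g1 g2
    have move: "u * (e * x) = e * y" if "u * x = y" for u e x y :: complex using that by (simp add: mult_ac)
    show "s * cd\<^sup>2 * rk * (ed d (b * Qf A B C g1 g2) * (\<Sum>\<^sub>\<infinity>(n, m). exp (- of_real pi * s * of_int (Qf A B C (g1 + d * n) (g2 + d * m)))))
        = ed d (b * Qf A B C g1 g2) * (\<Sum>\<^sub>\<infinity>(v, w). Z v w * ed d (v * g1 + w * g2))"
      unfolding Z_def cd_def ck_def rk_def by (rule move[OF poisson_coset[OF s(1) d]])
  qed
  also have "\<dots> = (\<Sum>\<^sub>\<infinity>(v, w). \<Sum>(g1, g2)\<in>{0..<d} \<times> {0..<d}. Z v w * (ed d (b * Qf A B C g1 g2) * ed d (v * g1 + w * g2)))"
  proof -
    have "(\<Sum>\<^sub>\<infinity>p. \<Sum>g\<in>{0..<d} \<times> {0..<d}. (case p of (v, w) \<Rightarrow> Z v w) * (case g of (g1, g2) \<Rightarrow> ed d (b * Qf A B C g1 g2) * ed d (fst p * g1 + snd p * g2)))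
       = (\<Sum>g\<in>{0..<d} \<times> {0..<d}. \<Sum>\<^sub>\<infinity>p. (case p of (v, w) \<Rightarrow> Z v w) * (case g of (g1, g2) \<Rightarrow> ed d (b * Qf A B C g1 g2) * ed d (fst p * g1 + snd p * g2)))"
    proof (rule infsum_sum_finite)
      fix g :: "int \<times> int"
      have "(\<lambda>p. norm ((case p of (v, w) \<Rightarrow> Z v w) * (case g of (g1, g2) \<Rightarrow> ed d (b * Qf A B C g1 g2) * ed d (fst p * g1 + snd p * g2)))) summable_on UNIV"
        using adjsum summable_on_iff_abs_summable_on_complex[of "\<lambda>(v, w). Z v w" UNIV] by (simp add: norm_mult norm_ee case_prod_unfold)
      then show "(\<lambda>p. (case p of (v, w) \<Rightarrow> Z v w) * (case g of (g1, g2) \<Rightarrow> ed d (b * Qf A B C g1 g2) * ed d (fst p * g1 + snd p * g2))) summable_on UNIV"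
        by (rule abs_summable_summable)
    qed simp
    then show ?thesis by (simp add: case_prod_unfold infsum_cmult_right'[symmetric] mult_ac)
  qed
  also have "\<dots> = (\<Sum>\<^sub>\<infinity>(v, w). Z v w * (ed d (c' * Qf C (- B) A v w) * gauss_sum A B C b d))"
  proof -
    have "(\<Sum>(g1, g2)\<in>{0..<d} \<times> {0..<d}. Z v w * (ed d (b * Qf A B C g1 g2) * ed d (v * g1 + w * g2)))
       = Z v w * (ed d (c' * Qf C (- B) A v w) * gauss_sum A B C b d)" for v w
    proof -
      have "(\<Sum>(g1, g2)\<in>{0..<d} \<times> {0..<d}. Z v w * (ed d (b * Qf A B C g1 g2) * ed d (v * g1 + w * g2)))
         = Z v w * (\<Sum>(g1, g2)\<in>{0..<d} \<times> {0..<d}. ed d (b * Qf A B C g1 g2 + (v * g1 + w * g2)))"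
        by (simp only: sum_distrib_left case_prod_unfold ed_add[where m = "b * Qf A B C (fst g) (snd g)" for g])
      then show ?thesis by (simp only: gauss_sum_twisted[OF d disc c det])
    qed
    then show ?thesis by simp
  qed
  also have "\<dots> = (\<Sum>\<^sub>\<infinity>(v, w). q v w * gauss_sum A B C b d)"
  proof -
    \<comment> \<open>With j = c tau + d the character supplies the part of the exponent that comes
      from c tau; what remains is the dual Gaussian of tau.\<close>
    have "Z v w * ed d (c' * Qf C (- B) A v w) = q v w" for v w
    proof -
      define X where "X = (of_int (Qf C (- B) A v w) :: complex)"
      have cc: "of_int c = 4 * ck * of_int c'" by (simp add: c ck_def)
      have "- of_real pi / (s * cd\<^sup>2 * ck) * X + 2 * of_real pi * \<i> * (of_int c' * X / cd) = - of_real pi / (s0 * ck) * X"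
      proof -
        have 1: "- of_real pi / (s * cd\<^sup>2 * ck) * X = of_real pi * j * X / (2 * \<i> * \<tau> * cd * ck)"
          using nz j by (simp add: s_def \<tau>'_def field_simps power2_eq_square)
        have 2: "2 * of_real pi * \<i> * (of_int c' * X / cd) = - of_real pi * (of_int c * \<tau>) * X / (2 * \<i> * \<tau> * cd * ck)"
          unfolding cc using nz by (simp add: field_simps)
        have 3: "- of_real pi / (s0 * ck) * X = of_real pi * cd * X / (2 * \<i> * \<tau> * cd * ck)"
          using nz by (simp add: s0_def field_simps)
        have n: "of_real pi * j * X + - of_real pi * (of_int c * \<tau>) * X = of_real pi * cd * X"
          by (simp add: j_def algebra_simps)
        show ?thesis unfolding 1 2 3 add_divide_distrib[symmetric] n ..
      qed
      then have "exp (- of_real pi / (s * cd\<^sup>2 * ck) * X) * exp (2 * of_real pi * \<i> * (of_int c' * X / cd)) = exp (- of_real pi / (s0 * ck) * X)"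
        by (simp only: exp_add[symmetric])
      then show ?thesis unfolding Z_def q_def ee_def X_def cd_def by simp
    qed
    then show ?thesis by (simp add: mult.assoc[symmetric])
  qed
  also have "\<dots> = (\<Sum>\<^sub>\<infinity>(v, w). q v w) * gauss_sum A B C b d"
    by (simp add: case_prod_unfold infsum_cmult_left')
  also have "\<dots> = s0 * rk * form_theta A B C \<tau> * gauss_sum A B C b d" unfolding base ..
  finally have E1: "s * cd\<^sup>2 * rk * form_theta A B C (mob a b c d \<tau>) = s0 * rk * form_theta A B C \<tau> * gauss_sum A B C b d" .
  \<comment> \<open>Comparing the Poisson factors of the two sides produces the automorphy factor
    j.\<close>
  have E2: "s * cd\<^sup>2 * j = s0 * cd" using nz j by (simp add: s_def s0_def \<tau>'_def power2_eq_square field_simps)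
  have "s0 * cd * rk * form_theta A B C (mob a b c d \<tau>) = (s * cd\<^sup>2 * rk * form_theta A B C (mob a b c d \<tau>)) * j"
    unfolding E2[symmetric] by (simp only: mult_ac)
  then have "(s0 * rk) * (cd * form_theta A B C (mob a b c d \<tau>)) = (s0 * rk) * (gauss_sum A B C b d * j * form_theta A B C \<tau>)"
    unfolding E1 by (simp only: mult_ac)
  moreover have "s0 * rk \<noteq> 0" using nz rk by (simp add: s0_def)
  ultimately show ?thesis unfolding cd_def[symmetric] j_def[symmetric] by (simp only: mult_cancel_left) simp
qed

end

lemma principal_pos_form: "k > 0 \<Longrightarrow> pos_form 1 0 k k"
  by unfold_locales auto

text \<open>The principal form has no mixed term, so its series is a product of two theta constants.
  Nonvanishing makes it the reference that fixes multipliers.\<close>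

lemma form_theta_principal_nonzero:
  assumes k: "k > 0" and t: "Im \<tau> > 0"
  shows "form_theta 1 0 k \<tau> \<noteq> 0"
proof -
  define a where "a = 2 * of_real pi * \<i> * \<tau>"
  have a: "Re a < 0" "Re (of_int k * a) < 0" using k t by (auto simp: a_def)
  have e: "ee (of_int (Qf 1 0 k x y) * \<tau>) = exp (a * of_int x ^ 2 + 0 * of_int x) * exp (of_int k * a * of_int y ^ 2 + 0 * of_int y)" for x y
    by (simp add: ee_def Qf_def a_def exp_add[symmetric] algebra_simps)
  have s: "(\<lambda>(x, y). ee (of_int (Qf 1 0 k x y) * \<tau>)) summable_on UNIV \<times> UNIV"
    using pos_form.form_theta_summable[OF principal_pos_form[OF k] t] by simp
  have "form_theta 1 0 k \<tau> = (\<Sum>\<^sub>\<infinity>x. \<Sum>\<^sub>\<infinity>y. ee (of_int (Qf 1 0 k x y) * \<tau>))"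
    unfolding form_theta_def using infsum_Sigma'_banach[OF s] by simp
  also have "\<dots> = Th a 0 * Th (of_int k * a) 0"
    unfolding e Th_def by (simp add: infsum_cmult_right' infsum_cmult_left')
  finally show ?thesis using Th_0_nonzero[OF a(1)] Th_0_nonzero[OF a(2)] by simp
qed

lemma coprime_add_mult:
  fixes m n y :: int
  assumes "coprime m n"
  shows "coprime m (n + m * y)"
proof -
  have "gcd m (y * m + n) = gcd m n" by (rule gcd_add_mult)
  then show ?thesis using assms by (simp add: coprime_iff_gcd_eq_1 add.commute mult.commute)
qed

text \<open>If A divides m it divides c and is already prime to d. If A is prime, then d or d + c
  avoids A, because A cannot divide both c and d.\<close>

lemma exists_shift_coprime:
  fixes c d A m :: int
  assumes "coprime c d" "c \<noteq> 0" "A > 0" "prime A \<or> A dvd m" "m dvd c"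
  obtains j where "d + j * c > 0" "coprime A (d + j * c)"
proof -
  obtain i where i: "coprime A (d + i * c)"
  proof (cases "A dvd m")
    case True
    then have "A dvd c" using assms(5) dvd_trans by blast
    then have "coprime A d" using assms(1) coprime_divisors[of A c d d] by simp
    then show ?thesis using that[of 0] by simp
  next
    case False
    then have p: "prime A" using assms by blast
    show ?thesis
    proof (cases "A dvd d")
      case True
      have "\<not> A dvd c" using True assms(1) p by (meson coprime_common_divisor not_prime_unit)
      then have "\<not> A dvd d + 1 * c" using True by (simp add: dvd_add_right_iff)
      then show ?thesis using that[of 1] prime_imp_coprime[OF p] by blast
    next
      case False
      then show ?thesis using that[of 0] prime_imp_coprime[OF p, of d] by simp
    qed
  qed
  \<comment> \<open>A multiple of A c does not change the residue modulo A. The size of N and the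
    factor sgn c make the shifted number positive.\<close>
  define N where "N = \<bar>d + i * c\<bar> + 1"
  define j where "j = i + A * (N * sgn c)"
  have e: "d + j * c = (d + i * c) + A * (N * \<bar>c\<bar>)"
    by (simp add: j_def algebra_simps abs_sgn)
  have "coprime A (d + j * c)" unfolding e using i by (rule coprime_add_mult)
  moreover have "d + j * c > 0"
  proof -
    have "A * \<bar>c\<bar> \<ge> 1" using assms by (simp add: int_one_le_iff_zero_less)
    then have "N * 1 \<le> N * (A * \<bar>c\<bar>)" by (intro mult_left_mono) (auto simp: N_def)
    then have "N \<le> A * (N * \<bar>c\<bar>)" by (simp add: mult_ac)
    moreover have "d + i * c > - N" by (simp add: N_def)
    ultimately show ?thesis unfolding e by linarith
  qed
  ultimately show ?thesis by (rule that[rotated])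
qed

text \<open>Either alternative allows to make \<open>d\<close> coprime to \<open>A\<close> by translations, so that the Gauss sum
  modulo \<open>d\<close> can be compared with the one of the principal form.\<close>
definition genform :: "int \<Rightarrow> int \<Rightarrow> int \<Rightarrow> int \<Rightarrow> bool" where
  "genform k A B C \<longleftrightarrow> pos_form A B C k \<and> (prime A \<or> A dvd 4 * k)"

text \<open>The automorphy factor under \<open>\<Gamma>\<^sub>0(4 k)\<close> is the same for all forms of determinant \<open>k\<close>,
  whatever their genus.\<close>
theorem form_theta_automorphy:
  assumes k: "k > 0" and det: "a * d - b * c = 1" and c: "4 * k dvd c"
  obtains \<kappa> where "\<And>A B C \<tau>. genform k A B C \<Longrightarrow> Im \<tau> > 0 \<Longrightarrow>
     form_theta A B C (mob a b c d \<tau>) = \<kappa> * (of_int c * \<tau> + of_int d) * form_theta A B C \<tau>"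
proof -
  have indiv: "\<exists>\<kappa>. \<forall>\<tau>. Im \<tau> > 0 \<longrightarrow> form_theta A B C (mob a b c d \<tau>) = \<kappa> * (of_int c * \<tau> + of_int d) * form_theta A B C \<tau> \<and>
      form_theta 1 0 k (mob a b c d \<tau>) = \<kappa> * (of_int c * \<tau> + of_int d) * form_theta 1 0 k \<tau>"
    if g: "genform k A B C" for A B C
  proof (cases "c = 0")
    \<comment> \<open>For c = 0 the matrix is plus or minus a translation by an integer, and d = a =
      1 or -1 is its own inverse.\<close>
    case True
    then have "a * d = 1" using det by simp
    then have ad: "a = d" "d * d = 1" using zmult_eq_1_iff by auto
    then have dd: "of_int d * of_int d = (1::complex)" by (metis of_int_1 of_int_mult)
    have "mob a b c d \<tau> = \<tau> + of_int (b * d)" for \<tau>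
    proof -
      have "(of_int d :: complex) \<noteq> 0" using dd by auto
      then have "mob a b c d \<tau> = \<tau> + of_int b / of_int d" by (simp add: mob_def True ad field_simps)
      also have "of_int b / of_int d = (of_int (b * d) :: complex)"
        using dd \<open>(of_int d :: complex) \<noteq> 0\<close> by (simp add: field_simps)
      finally show ?thesis .
    qed
    then show ?thesis
      using pos_form.form_theta_add_int[of A B C k] pos_form.form_theta_add_int[OF principal_pos_form[OF k]] g dd True
      by (intro exI[of _ "of_int d"]) (simp add: genform_def del: of_int_mult)
  next
    case False
    interpret Q: pos_form A B C k using g by (simp add: genform_def)
    interpret Q1: pos_form 1 0 k k by (rule principal_pos_form[OF k])
    have cop: "coprime c d"
    proof (rule coprimeI)
      fix e assume "e dvd c" "e dvd d"
      then have "e dvd a * d - b * c" by (intro dvd_diff dvd_mult)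
      then show "is_unit e" by (simp add: det)
    qed
    obtain j where j: "d + j * c > 0" "coprime A (d + j * c)"
      using exists_shift_coprime[OF cop False Q.A _ c] g by (auto simp: genform_def)
    define d' where "d' = d + j * c"
    define b' where "b' = b + j * a"
    have det': "a * d' - b' * c = 1" using det by (simp add: d'_def b'_def algebra_simps)
    obtain c' where c': "c = 4 * k * c'" using c by auto
    have "even c" by (simp add: c')
    have odd: "odd d'"
    proof
      assume "even d'"
      with \<open>even c\<close> have "even (a * d' - b' * c)" by simp
      then show False by (simp add: det')
    qed
    have kd: "coprime k d'"
    proof -
      have "coprime c d'" using coprime_add_mult[OF cop, of j] by (simp add: d'_def mult.commute)
      then show ?thesis by (simp add: c')
    qed
    have gs: "gauss_sum A B C b' d' = gauss_sum 1 0 k b' d'"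
      using gauss_sum_eq_principal[of d' A C B k b'] j odd Q.disc kd by (simp add: d'_def)
    have d0: "(of_int d' :: complex) \<noteq> 0" using j unfolding d'_def[symmetric] by simp
    define \<kappa> where "\<kappa> = gauss_sum 1 0 k b' d' / of_int d'"
    have law: "form_theta A' B' C' (mob a b c d \<tau>) = \<kappa> * (of_int c * \<tau> + of_int d) * form_theta A' B' C' \<tau>"
      if f: "pos_form A' B' C' k" and gs': "gauss_sum A' B' C' b' d' = gauss_sum 1 0 k b' d'" and t: "Im \<tau> > 0" for A' B' C' \<tau>
    proof -
      interpret F: pos_form A' B' C' k by (rule f)
      define \<sigma> where "\<sigma> = \<tau> + of_int (- j)"
      have s: "Im \<sigma> > 0" using t by (simp add: \<sigma>_def)
      have m: "mob a b' c d' \<sigma> = mob a b c d \<tau>" and den: "of_int c * \<sigma> + of_int d' = of_int c * \<tau> + of_int d"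
        by (simp_all add: mob_def \<sigma>_def b'_def d'_def algebra_simps)
      have "of_int d' * form_theta A' B' C' (mob a b c d \<tau>) = gauss_sum A' B' C' b' d' * (of_int c * \<tau> + of_int d) * form_theta A' B' C' \<sigma>"
        using F.form_theta_mob[OF s det' c'] j unfolding m den by (simp add: d'_def)
      also have "form_theta A' B' C' \<sigma> = form_theta A' B' C' \<tau>" unfolding \<sigma>_def by (rule F.form_theta_add_int)
      finally show ?thesis using d0 unfolding \<kappa>_def gs' by (simp add: field_simps)
    qed
    show ?thesis
      using law[OF Q.pos_form_axioms gs] law[OF Q1.pos_form_axioms refl] by blast
  qed
  \<comment> \<open>The multiplier found for a single form depends on a shift chosen for its leading
    coefficient. The principal form obeys the same law with the same multiplier, so its value at the
    point i identifies all of them.\<close>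
  define \<kappa> where "\<kappa> = form_theta 1 0 k (mob a b c d \<i>) / ((of_int c * \<i> + of_int d) * form_theta 1 0 k \<i>)"
  show ?thesis
  proof (rule that[of \<kappa>])
    fix A B C \<tau> assume g: "genform k A B C" and t: "Im \<tau> > 0"
    from indiv[OF g] obtain \<kappa>' where k': "\<And>\<tau>. Im \<tau> > 0 \<Longrightarrow> form_theta A B C (mob a b c d \<tau>) = \<kappa>' * (of_int c * \<tau> + of_int d) * form_theta A B C \<tau>"
      "\<And>\<tau>. Im \<tau> > 0 \<Longrightarrow> form_theta 1 0 k (mob a b c d \<tau>) = \<kappa>' * (of_int c * \<tau> + of_int d) * form_theta 1 0 k \<tau>" by blast
    define J where "J = of_int c * \<i> + (of_int d :: complex)"
    have "J \<noteq> 0" unfolding J_def by (rule mob_denom_nonzero[OF det]) simp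
    moreover have "form_theta 1 0 k (mob a b c d \<i>) = \<kappa>' * J * form_theta 1 0 k \<i>" using k'(2)[of \<i>] by (simp add: J_def)
    ultimately have "\<kappa> = \<kappa>'"
      unfolding \<kappa>_def J_def[symmetric] using form_theta_principal_nonzero[OF k, of \<i>] by simp
    then show "form_theta A B C (mob a b c d \<tau>) = \<kappa> * (of_int c * \<tau> + of_int d) * form_theta A B C \<tau>" using k'(1)[OF t] by simp
  qed
qed

section \<open>A vanishing criterion\<close>

abbreviation uhp :: "complex set" where "uhp \<equiv> {\<tau>. Im \<tau> > 0}"

lemma open_uhp: "open uhp" by (rule open_halfspace_Im_gt)
lemma connected_uhp: "connected uhp" by (intro convex_connected convex_halfspace_Im_gt)

lemma mob_comp:
  assumes "of_int c' * \<tau> + of_int d' \<noteq> 0"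
  shows "mob a b c d (mob a' b' c' d' \<tau>) = mob (a * a' + b * c') (a * b' + b * d') (c * a' + d * c') (c * b' + d * d') \<tau>"
proof -
  define X Y where "X = of_int a' * \<tau> + of_int b'" and "Y = of_int c' * \<tau> + of_int d'"
  have Y: "Y \<noteq> 0" using assms by (simp add: Y_def)
  have "mob a b c d (X / Y) = ((of_int a * (X / Y) + of_int b) * Y) / ((of_int c * (X / Y) + of_int d) * Y)"
    using Y by (simp add: mob_def)
  also have "(of_int a * (X / Y) + of_int b) * Y = of_int a * X + of_int b * Y" using Y by (simp add: field_simps)
  also have "(of_int c * (X / Y) + of_int d) * Y = of_int c * X + of_int d * Y" using Y by (simp add: field_simps)
  finally show ?thesis unfolding mob_def[of a' b' c' d'] X_def Y_def by (simp add: mob_def algebra_simps)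
qed

lemma mob_holomorphic:
  assumes "a * d - b * c = 1"
  shows "mob a b c d holomorphic_on uhp"
  unfolding mob_def[abs_def] using mob_denom_nonzero[OF assms] by (intro holomorphic_intros) auto

lemma mob_inverse:
  assumes det: "a * d - b * c = 1" and t: "\<tau> \<in> uhp"
  obtains \<sigma> where "\<sigma> \<in> uhp" "mob a b c d \<sigma> = \<tau>"
proof -
  have det': "d * a - (- b) * (- c) = 1" using det by (simp add: mult_ac)
  define \<sigma> where "\<sigma> = mob d (- b) (- c) a \<tau>"
  have s: "\<sigma> \<in> uhp" using Im_mob_pos[OF det'] t by (simp add: \<sigma>_def)
  have e: "a * - b + b * a = 0" "c * d + d * - c = 0" "a * d + b * - c = 1" "c * - b + d * a = 1"
    using det by (simp_all add: mult_ac)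
  have "mob a b c d \<sigma> = mob 1 0 0 1 \<tau>"
    unfolding \<sigma>_def using mob_comp[of "- c" \<tau> a a b c d d "- b"] mob_denom_nonzero[OF det'] t unfolding e by simp
  then show ?thesis using that[OF s] by (simp add: mob_def)
qed

text \<open>On the open set where g is nonzero f vanishes, and the identity theorem spreads this
  over S.\<close>

lemma holomorphic_mult_zero:
  assumes S: "open S" "connected S" and fg: "f holomorphic_on S" "g holomorphic_on S"
    and zero: "\<And>z. z \<in> S \<Longrightarrow> f z * g z = (0::complex)"
  shows "(\<forall>z\<in>S. f z = 0) \<or> (\<forall>z\<in>S. g z = 0)"
proof (rule disjCI)
  assume "\<not> (\<forall>z\<in>S. g z = 0)"
  then obtain w where w: "w \<in> S" "g w \<noteq> 0" by blast
  define U where "U = g -` (- {0}) \<inter> S"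
  have U: "open U"
    unfolding U_def using holomorphic_on_imp_continuous_on[OF fg(2)] S(1)
    by (intro continuous_on_open_vimage[THEN iffD1, rule_format]) auto
  have wU: "w \<in> U" using w by (simp add: U_def)
  show "\<forall>z\<in>S. f z = 0"
  proof
    fix z assume z: "z \<in> S"
    show "f z = 0"
    proof (rule analytic_continuation[OF fg(1) S, of U w])
      show "U \<subseteq> S" by (auto simp: U_def)
      show "w islimpt U" using interior_limit_point[of w U] U wU by (simp add: interior_open)
      show "f u = 0" if "u \<in> U" for u using that zero[of u] by (auto simp: U_def)
    qed (use w z in auto)
  qed
qed

lemma holomorphic_prod_zero:
  assumes S: "open S" "connected S" "S \<noteq> {}" and I: "finite I"
    and f: "\<And>i. i \<in> I \<Longrightarrow> f i holomorphic_on S"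
    and zero: "\<And>z. z \<in> S \<Longrightarrow> (\<Prod>i\<in>I. f i z) = (0::complex)"
  shows "\<exists>i\<in>I. \<forall>z\<in>S. f i z = 0"
  using I f zero
proof (induction I rule: finite_induct)
  case empty
  then show ?case using S(3) by auto
next
  case (insert i I)
  have "(\<forall>z\<in>S. f i z = 0) \<or> (\<forall>z\<in>S. (\<Prod>i\<in>I. f i z) = 0)"
    by (rule holomorphic_mult_zero[OF S(1,2)]) (use insert in \<open>auto intro!: holomorphic_on_prod\<close>)
  then show ?case using insert by auto
qed

text \<open>Below height \<open>1/2\<close>, after a translation, inversion at least doubles the imaginary part.\<close>
lemma fundamental_strip:
  fixes f :: "complex \<Rightarrow> 'a"
  assumes fT: "\<And>\<tau>. \<tau> \<in> uhp \<Longrightarrow> f (\<tau> + 1) = f \<tau>" and fS: "\<And>\<tau>. \<tau> \<in> uhp \<Longrightarrow> f (- (1 / \<tau>)) = f \<tau>"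
    and t: "\<tau> \<in> uhp"
  obtains \<sigma> where "Im \<sigma> \<ge> 1 / 2" "\<bar>Re \<sigma>\<bar> \<le> 1 / 2" "f \<sigma> = f \<tau>"
proof -
  have fTn: "f (\<tau> + of_nat n) = f \<tau>" if "\<tau> \<in> uhp" for \<tau> n
  proof (induction n)
    case (Suc n)
    then show ?case using fT[of "\<tau> + of_nat n"] that by (simp add: add_ac)
  qed simp
  have fTi: "f (\<tau> + of_int j) = f \<tau>" if t: "\<tau> \<in> uhp" for \<tau> j
  proof (cases "j \<ge> 0")
    case True
    then show ?thesis using fTn[OF t, of "nat j"] by simp
  next
    case False
    then have "of_nat (nat (- j)) = (- of_int j :: complex)" by simp
    then show ?thesis using fTn[of "\<tau> + of_int j" "nat (- j)"] t by simp
  qed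
  have trans: "\<exists>\<sigma>. \<sigma> \<in> uhp \<and> Im \<sigma> = Im \<tau> \<and> \<bar>Re \<sigma>\<bar> \<le> 1 / 2 \<and> f \<sigma> = f \<tau>" if t: "\<tau> \<in> uhp" for \<tau>
  proof -
    define \<sigma> where "\<sigma> = \<tau> + of_int (- round (Re \<tau>))"
    have "\<bar>of_int (round (Re \<tau>)) - Re \<tau>\<bar> \<le> 1 / 2" by (rule of_int_round_abs_le)
    then have "\<bar>Re \<sigma>\<bar> \<le> 1 / 2" by (simp add: \<sigma>_def abs_minus_commute)
    moreover have "Im \<sigma> = Im \<tau>" by (simp add: \<sigma>_def)
    moreover have "f \<sigma> = f \<tau>" unfolding \<sigma>_def by (rule fTi[OF t])
    ultimately show ?thesis using t by (intro exI[of _ \<sigma>]) simp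
  qed
  \<comment> \<open>The exponent n bounds the number of doublings still needed to reach height
    1/2.\<close>
  have "\<exists>\<sigma>. Im \<sigma> \<ge> 1 / 2 \<and> \<bar>Re \<sigma>\<bar> \<le> 1 / 2 \<and> f \<sigma> = f \<tau>" if "\<tau> \<in> uhp" "Im \<tau> * 2 ^ n \<ge> 1 / 2" for n \<tau>
    using that
  proof (induction n arbitrary: \<tau>)
    case 0
    obtain \<sigma> where "Im \<sigma> = Im \<tau>" "\<bar>Re \<sigma>\<bar> \<le> 1 / 2" "f \<sigma> = f \<tau>" using trans[OF 0(1)] by blast
    then show ?case using 0(2) by (intro exI[of _ \<sigma>]) simp
  next
    case (Suc n)
    obtain \<sigma> where s: "\<sigma> \<in> uhp" "Im \<sigma> = Im \<tau>" "\<bar>Re \<sigma>\<bar> \<le> 1 / 2" "f \<sigma> = f \<tau>" using trans[OF Suc.prems(1)] by blast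
    show ?case
    proof (cases "Im \<sigma> \<ge> 1 / 2")
      case True then show ?thesis using s by blast
    next
      case False
      define \<rho> where "\<rho> = - (1 / \<sigma>)"
      have r: "\<rho> \<in> uhp" using Im_minus_inverse_pos s by (simp add: \<rho>_def)
      have "(Re \<sigma>)\<^sup>2 \<le> (1 / 2)\<^sup>2" using s by (intro abs_le_square_iff[THEN iffD1]) auto
      moreover have "(Im \<sigma>)\<^sup>2 \<le> (1 / 2)\<^sup>2" using False s by (intro power_mono) auto
      ultimately have n: "(Re \<sigma>)\<^sup>2 + (Im \<sigma>)\<^sup>2 \<le> 1 / 2" by (simp add: power2_eq_square)
      have p: "(Re \<sigma>)\<^sup>2 + (Im \<sigma>)\<^sup>2 > 0" using s by (simp add: sum_power2_gt_zero_iff)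
      have "Im \<rho> = Im \<sigma> / ((Re \<sigma>)\<^sup>2 + (Im \<sigma>)\<^sup>2)" by (simp add: \<rho>_def Im_divide)
      also have "\<dots> \<ge> Im \<sigma> / (1 / 2)" using n p s by (intro divide_left_mono) auto
      finally have "Im \<rho> \<ge> 2 * Im \<tau>" using s by simp
      then have "(2 * Im \<tau>) * 2 ^ n \<le> Im \<rho> * 2 ^ n" by (intro mult_right_mono) auto
      moreover have "Im \<tau> * 2 ^ Suc n = (2 * Im \<tau>) * 2 ^ n" by simp
      ultimately have "Im \<rho> * 2 ^ n \<ge> 1 / 2" using Suc.prems(2) by linarith
      from Suc.IH[OF r this] show ?thesis using fS[OF s(1)] s(4) by (simp add: \<rho>_def)
    qed
  qed
  moreover obtain n where "Im \<tau> * 2 ^ n \<ge> 1 / 2"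
  proof -
    have t': "Im \<tau> > 0" using t by simp
    obtain n where "(1 / 2) / Im \<tau> < 2 ^ n" using real_arch_pow[of 2 "(1 / 2) / Im \<tau>"] by auto
    then have "1 / 2 \<le> Im \<tau> * 2 ^ n" using t' by (simp add: field_simps)
    then show ?thesis using that by blast
  qed
  ultimately show ?thesis using t that by blast
qed

text \<open>Bottom rows modulo \<open>M\<close> of matrices in \<open>SL\<^sub>2(\<int>)\<close>.\<close>
definition rows :: "int \<Rightarrow> (int \<times> int) set" where
  "rows M = (\<lambda>(c, d). (c mod M, d mod M)) ` {(c, d). coprime c d}"

lemma rows_subset: "M > 0 \<Longrightarrow> rows M \<subseteq> {0..<M} \<times> {0..<M}"
  by (auto simp: rows_def)

lemma finite_rows: "M > 0 \<Longrightarrow> finite (rows M)"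
  using rows_subset finite_subset by blast

lemma coprime_row:
  fixes a b c d :: int
  assumes "a * d - b * c = 1"
  shows "coprime c d"
proof (rule coprimeI)
  fix e assume "e dvd c" "e dvd d"
  then have "e dvd a * d - b * c" by (intro dvd_diff dvd_mult)
  then show "is_unit e" by (simp add: assms)
qed

lemma rows_memI:
  assumes "a * d - b * c = 1"
  shows "(c mod M, d mod M) \<in> rows M"
  unfolding rows_def using coprime_row[OF assms] by (intro image_eqI[of _ _ "(c, d)"]) auto

lemma rows_rep:
  assumes "r \<in> rows M"
  shows "\<exists>a b c d. a * d - b * c = 1 \<and> (c mod M, d mod M) = r"
proof -
  obtain c d where cd: "coprime c d" "(c mod M, d mod M) = r" using assms by (auto simp: rows_def)
  obtain u v where "u * c + v * d = 1" using cd(1) by (metis bezout_int coprime_iff_gcd_eq_1)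
  then have "v * d - (- u) * c = 1" by simp
  then show ?thesis using cd(2) by blast
qed

text \<open>The functions \<open>h \<circ> \<gamma>\<close>, with \<open>\<gamma>\<close> running over the bottom rows modulo \<open>M\<close>, are permuted up to
  constants by \<open>SL\<^sub>2(\<int>)\<close>. The modulus of their product is therefore invariant, and it decays at
  infinity, so the maximum principle makes it vanish.\<close>
theorem vanishing_criterion:
  fixes h :: "complex \<Rightarrow> complex" and M :: int
  assumes M: "M > 0" and hol: "h holomorphic_on uhp"
    and inv: "\<And>a b c d. a * d - b * c = 1 \<Longrightarrow> M dvd c \<Longrightarrow>
        \<exists>\<kappa>. \<kappa> \<noteq> 0 \<and> (\<forall>\<tau>\<in>uhp. h (mob a b c d \<tau>) = \<kappa> * h \<tau>)"
    and growth: "\<And>a b c d. a * d - b * c = 1 \<Longrightarrow>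
        \<exists>K. \<forall>\<tau>. Im \<tau> \<ge> 1 / 2 \<longrightarrow> \<bar>Re \<tau>\<bar> \<le> 1 / 2 \<longrightarrow> norm (h (mob a b c d \<tau>)) \<le> K * exp (\<alpha> * Im \<tau>)"
    and cusp: "\<exists>K. \<forall>\<tau>. Im \<tau> \<ge> 1 / 2 \<longrightarrow> \<bar>Re \<tau>\<bar> \<le> 1 / 2 \<longrightarrow> norm (h \<tau>) \<le> K * exp ((\<alpha> - \<beta>) * Im \<tau>)"
    and count: "\<alpha> * card (rows M) < \<beta> * card {r \<in> rows M. fst r = 0}"
    and z: "z \<in> uhp"
  shows "h z = 0"
proof -
  define R where "R = rows M"
  have finR: "finite R" unfolding R_def by (rule finite_rows[OF M])
  have "\<forall>r\<in>R. \<exists>g. case g of (a, b, c, d) \<Rightarrow> a * d - b * c = 1 \<and> (c mod M, d mod M) = r"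
  proof
    fix r assume "r \<in> R"
    then obtain a b c d where "a * d - b * c = 1 \<and> (c mod M, d mod M) = r"
      using rows_rep unfolding R_def by blast
    then show "\<exists>g. case g of (a, b, c, d) \<Rightarrow> a * d - b * c = 1 \<and> (c mod M, d mod M) = r"
      by (intro exI[of _ "(a, b, c, d)"]) simp
  qed
  from bchoice[OF this] obtain \<gamma> where
    "\<forall>r\<in>R. case \<gamma> r of (a, b, c, d) \<Rightarrow> a * d - b * c = 1 \<and> (c mod M, d mod M) = r"
    by (rule exE)
  note \<gamma> = this[rule_format]
  define g where "g r \<tau> = (case \<gamma> r of (a, b, c, d) \<Rightarrow> h (mob a b c d \<tau>))" for r \<tau>
  \<comment> \<open>Two matrices with the same bottom row modulo M differ by a left factor whose
    lower left entry is c d' - d c', a multiple of M. By invariance, h composed with either differs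
    by a constant only.\<close>
  have A: "\<exists>\<kappa>. \<kappa> \<noteq> 0 \<and> (\<forall>\<tau>\<in>uhp. h (mob a b c d \<tau>) = \<kappa> * g r \<tau>)"
    if det: "a * d - b * c = 1" and r: "r \<in> R" "(c mod M, d mod M) = r" for a b c d r
  proof -
    obtain a' b' c' d' where g': "\<gamma> r = (a', b', c', d')" by (cases "\<gamma> r")
    have det': "a' * d' - b' * c' = 1" and r': "(c' mod M, d' mod M) = r" using \<gamma>[OF r(1)] g' by auto
    define p q s t where "p = a * d' - b * c'" and "q = b * a' - a * b'" and "s = c * d' - d * c'" and "t = d * a' - c * b'"
    have "p * t - q * s = (a * d - b * c) * (a' * d' - b' * c')"
      unfolding p_def q_def s_def t_def by (simp add: algebra_simps)
    then have det2: "p * t - q * s = 1" by (simp add: det det')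
    have "[c = c'] (mod M)" "[d = d'] (mod M)" using r(2) r' by (auto simp: cong_def)
    then have "[c * d' - d * c' = c' * d' - d' * c'] (mod M)" by (intro cong_diff cong_mult) auto
    then have "M dvd s" by (simp add: s_def cong_0_iff)
    from inv[OF det2 this] obtain \<kappa> where \<kappa>: "\<kappa> \<noteq> 0" "\<And>\<tau>. \<tau> \<in> uhp \<Longrightarrow> h (mob p q s t \<tau>) = \<kappa> * h \<tau>" by auto
    have e: "p * a' + q * c' = a" "p * b' + q * d' = b" "s * a' + t * c' = c" "s * b' + t * d' = d"
    proof -
      have "p * a' + q * c' = a * (a' * d' - b' * c')" "p * b' + q * d' = b * (a' * d' - b' * c')"
           "s * a' + t * c' = c * (a' * d' - b' * c')" "s * b' + t * d' = d * (a' * d' - b' * c')"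
        unfolding p_def q_def s_def t_def by (simp_all add: algebra_simps)
      then show "p * a' + q * c' = a" "p * b' + q * d' = b" "s * a' + t * c' = c" "s * b' + t * d' = d"
        by (simp_all add: det')
    qed
    have "h (mob a b c d \<tau>) = \<kappa> * g r \<tau>" if t: "\<tau> \<in> uhp" for \<tau>
    proof -
      have "mob p q s t (mob a' b' c' d' \<tau>) = mob a b c d \<tau>"
        using mob_comp[of c' \<tau> d' p q s t a' b'] mob_denom_nonzero[OF det'] t unfolding e by simp
      moreover have "mob a' b' c' d' \<tau> \<in> uhp" using Im_mob_pos[OF det'] t by simp
      ultimately show ?thesis using \<kappa>(2)[of "mob a' b' c' d' \<tau>"] by (simp add: g_def g')
    qed
    then show ?thesis using \<kappa>(1) by blast
  qed
  have gT: "\<exists>\<kappa>. \<kappa> \<noteq> 0 \<and> (\<forall>\<tau>\<in>uhp. g r (\<tau> + 1) = \<kappa> * g (fst r, (fst r + snd r) mod M) \<tau>)"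
    and mT: "(fst r, (fst r + snd r) mod M) \<in> R" if r: "r \<in> R" for r
  proof -
    obtain a b c d where gr: "\<gamma> r = (a, b, c, d)" by (cases "\<gamma> r")
    have det: "a * d - b * c = 1" and rr: "(c mod M, d mod M) = r" using \<gamma>[OF r] gr by auto
    have det': "a * (c + d) - (a + b) * c = 1" using det by (simp add: algebra_simps)
    have e: "(c mod M, (c + d) mod M) = (fst r, (fst r + snd r) mod M)"
      unfolding rr[symmetric] by (simp add: mod_add_eq)
    show m: "(fst r, (fst r + snd r) mod M) \<in> R"
      unfolding e[symmetric] R_def by (rule rows_memI[OF det'])
    show "\<exists>\<kappa>. \<kappa> \<noteq> 0 \<and> (\<forall>\<tau>\<in>uhp. g r (\<tau> + 1) = \<kappa> * g (fst r, (fst r + snd r) mod M) \<tau>)"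
      using A[OF det' m e] unfolding g_def[of r] gr by (simp add: mob_T)
  qed
  have gS: "\<exists>\<kappa>. \<kappa> \<noteq> 0 \<and> (\<forall>\<tau>\<in>uhp. g r (- (1 / \<tau>)) = \<kappa> * g (snd r, (- fst r) mod M) \<tau>)"
    and mS: "(snd r, (- fst r) mod M) \<in> R" if r: "r \<in> R" for r
  proof -
    obtain a b c d where gr: "\<gamma> r = (a, b, c, d)" by (cases "\<gamma> r")
    have det: "a * d - b * c = 1" and rr: "(c mod M, d mod M) = r" using \<gamma>[OF r] gr by auto
    have det': "b * (- c) - (- a) * d = 1" using det by (simp add: algebra_simps)
    have e: "(d mod M, (- c) mod M) = (snd r, (- fst r) mod M)"
      unfolding rr[symmetric] by (simp add: mod_minus_eq)
    show m: "(snd r, (- fst r) mod M) \<in> R"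
      unfolding e[symmetric] R_def by (rule rows_memI[OF det'])
    have "\<forall>\<tau>\<in>uhp. g r (- (1 / \<tau>)) = h (mob b (- a) d (- c) \<tau>)"
      unfolding g_def gr by (auto intro!: arg_cong[where f = h] mob_S)
    then show "\<exists>\<kappa>. \<kappa> \<noteq> 0 \<and> (\<forall>\<tau>\<in>uhp. g r (- (1 / \<tau>)) = \<kappa> * g (snd r, (- fst r) mod M) \<tau>)"
      using A[OF det' m e] by simp
  qed
  define P where "P \<tau> = (\<Prod>r\<in>R. g r \<tau>)" for \<tau>
  have ginR: "0 \<le> fst r" "fst r < M" "0 \<le> snd r" "snd r < M" if "r \<in> R" for r
    using rows_subset[OF M] that unfolding R_def by (metis atLeastLessThan_iff mem_Times_iff subset_iff)+
  have bT: "bij_betw (\<lambda>r. (fst r, (fst r + snd r) mod M)) R R"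
  proof -
    have "inj_on (\<lambda>r. (fst r, (fst r + snd r) mod M)) R"
    proof (rule inj_onI)
      fix r r' assume rr: "r \<in> R" "r' \<in> R" "(fst r, (fst r + snd r) mod M) = (fst r', (fst r' + snd r') mod M)"
      then have "[fst r + snd r = fst r + snd r'] (mod M)" by (auto simp: cong_def)
      then have "[snd r = snd r'] (mod M)" by (simp only: cong_add_lcancel)
      then have "snd r mod M = snd r' mod M" by (simp only: cong_def)
      then have "snd r = snd r'" using ginR rr by simp
      with rr show "r = r'" by (simp add: prod_eq_iff)
    qed
    moreover have "(\<lambda>r. (fst r, (fst r + snd r) mod M)) ` R \<subseteq> R" using mT by blast
    ultimately show ?thesis using finR by (simp add: bij_betw_def endo_inj_surj)
  qed
  have bS: "bij_betw (\<lambda>r. (snd r, (- fst r) mod M)) R R"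
  proof -
    have "inj_on (\<lambda>r. (snd r, (- fst r) mod M)) R"
    proof (rule inj_onI)
      fix r r' assume rr: "r \<in> R" "r' \<in> R" "(snd r, (- fst r) mod M) = (snd r', (- fst r') mod M)"
      then have "[- fst r = - fst r'] (mod M)" by (auto simp: cong_def)
      then have "[fst r = fst r'] (mod M)" by (simp only: cong_minus_minus_iff)
      then have "fst r mod M = fst r' mod M" by (simp only: cong_def)
      then have "fst r = fst r'" using ginR rr by simp
      with rr show "r = r'" by (simp add: prod_eq_iff)
    qed
    moreover have "(\<lambda>r. (snd r, (- fst r) mod M)) ` R \<subseteq> R" using mS by blast
    ultimately show ?thesis using finR by (simp add: bij_betw_def endo_inj_surj)
  qed
  have permute: "\<exists>C. \<forall>\<tau>\<in>uhp. P (u \<tau>) = C * P \<tau>"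
    if b: "bij_betw f R R" and u: "\<And>r. r \<in> R \<Longrightarrow> \<exists>\<kappa>. \<kappa> \<noteq> 0 \<and> (\<forall>\<tau>\<in>uhp. g r (u \<tau>) = \<kappa> * g (f r) \<tau>)" for f u
  proof -
    obtain \<kappa> where \<kappa>: "\<And>r \<tau>. r \<in> R \<Longrightarrow> \<tau> \<in> uhp \<Longrightarrow> g r (u \<tau>) = \<kappa> r * g (f r) \<tau>" using u by metis
    have "P (u \<tau>) = (\<Prod>r\<in>R. \<kappa> r) * P \<tau>" if "\<tau> \<in> uhp" for \<tau>
    proof -
      have "P (u \<tau>) = (\<Prod>r\<in>R. \<kappa> r * g (f r) \<tau>)" unfolding P_def using \<kappa> that by (intro prod.cong) auto
      also have "\<dots> = (\<Prod>r\<in>R. \<kappa> r) * (\<Prod>r\<in>R. g (f r) \<tau>)" by (rule prod.distrib)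
      also have "(\<Prod>r\<in>R. g (f r) \<tau>) = P \<tau>" unfolding P_def by (rule prod.reindex_bij_betw[OF b])
      finally show ?thesis .
    qed
    then show ?thesis by blast
  qed
  obtain CT where CT: "\<And>\<tau>. \<tau> \<in> uhp \<Longrightarrow> P (\<tau> + 1) = CT * P \<tau>"
    using permute[OF bT gT] by blast
  obtain CS where CS: "\<And>\<tau>. \<tau> \<in> uhp \<Longrightarrow> P (- (1 / \<tau>)) = CS * P \<tau>"
    using permute[OF bS gS] by blast
  have ghol: "g r holomorphic_on uhp" if r: "r \<in> R" for r
  proof -
    obtain a b c d where gr: "\<gamma> r = (a, b, c, d)" by (cases "\<gamma> r")
    have det: "a * d - b * c = 1" using \<gamma>[OF r] gr by auto
    have "h \<circ> mob a b c d holomorphic_on uhp"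
      by (rule holomorphic_on_compose_gen[OF mob_holomorphic[OF det] hol]) (use Im_mob_pos[OF det] in auto)
    then show ?thesis by (simp add: g_def[abs_def] gr o_def)
  qed
  have Phol: "P holomorphic_on uhp" unfolding P_def[abs_def] using ghol by (intro holomorphic_on_prod)
  \<comment> \<open>The net rate of decay of the product: every row costs at most \<alpha>, and each
    row with c divisible by M gains \<beta>.\<close>
  define \<epsilon> where "\<epsilon> = \<beta> * card {r \<in> R. fst r = 0} - \<alpha> * card R"
  have \<epsilon>: "\<epsilon> > 0" using count by (simp add: \<epsilon>_def R_def)
  have absK: "x \<le> \<bar>L\<bar> * exp t" if "x \<le> L * exp t" for x L t :: real
    by (rule order_trans[OF that mult_right_mono]) auto
  \<comment> \<open>For c divisible by M the translate is a multiple of h itself and inherits the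
    decay at infinity.\<close>
  have gbound: "\<exists>K\<ge>0. \<forall>\<tau>. Im \<tau> \<ge> 1 / 2 \<longrightarrow> \<bar>Re \<tau>\<bar> \<le> 1 / 2 \<longrightarrow>
      norm (g r \<tau>) \<le> K * exp ((\<alpha> - (if fst r = 0 then \<beta> else 0)) * Im \<tau>)" if r: "r \<in> R" for r
  proof -
    obtain a b c d where gr: "\<gamma> r = (a, b, c, d)" by (cases "\<gamma> r")
    have det: "a * d - b * c = 1" and rr: "(c mod M, d mod M) = r" using \<gamma>[OF r] gr by auto
    show ?thesis
    proof (cases "fst r = 0")
      case False
      obtain K where K: "\<And>\<tau>. Im \<tau> \<ge> 1 / 2 \<Longrightarrow> \<bar>Re \<tau>\<bar> \<le> 1 / 2 \<Longrightarrow> norm (h (mob a b c d \<tau>)) \<le> K * exp (\<alpha> * Im \<tau>)"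
        using growth[OF det] by blast
      have "norm (g r \<tau>) \<le> \<bar>K\<bar> * exp (\<alpha> * Im \<tau>)" if "Im \<tau> \<ge> 1 / 2" "\<bar>Re \<tau>\<bar> \<le> 1 / 2" for \<tau>
        using absK[OF K[OF that]] by (simp add: g_def gr)
      then show ?thesis using False by (intro exI[of _ "\<bar>K\<bar>"]) auto
    next
      case True
      then have "M dvd c" using rr by auto
      from inv[OF det this] obtain \<kappa> where \<kappa>: "\<And>\<tau>. \<tau> \<in> uhp \<Longrightarrow> h (mob a b c d \<tau>) = \<kappa> * h \<tau>" by blast
      obtain K where K: "\<And>\<tau>. Im \<tau> \<ge> 1 / 2 \<Longrightarrow> \<bar>Re \<tau>\<bar> \<le> 1 / 2 \<Longrightarrow> norm (h \<tau>) \<le> K * exp ((\<alpha> - \<beta>) * Im \<tau>)"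
        using cusp by blast
      have "norm (g r \<tau>) \<le> (norm \<kappa> * \<bar>K\<bar>) * exp ((\<alpha> - \<beta>) * Im \<tau>)" if s: "Im \<tau> \<ge> 1 / 2" "\<bar>Re \<tau>\<bar> \<le> 1 / 2" for \<tau>
      proof -
        have "norm (h \<tau>) \<le> \<bar>K\<bar> * exp ((\<alpha> - \<beta>) * Im \<tau>)"
          by (rule absK[OF K[OF s]])
        then have "norm \<kappa> * norm (h \<tau>) \<le> norm \<kappa> * (\<bar>K\<bar> * exp ((\<alpha> - \<beta>) * Im \<tau>))" by (intro mult_left_mono) auto
        then show ?thesis using \<kappa>[of \<tau>] s by (simp add: g_def gr norm_mult mult.assoc)
      qed
      then show ?thesis using True by (intro exI[of _ "norm \<kappa> * \<bar>K\<bar>"]) auto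
    qed
  qed
  obtain Kr where Kr: "\<And>r. r \<in> R \<Longrightarrow> Kr r \<ge> 0" "\<And>r \<tau>. r \<in> R \<Longrightarrow> Im \<tau> \<ge> 1 / 2 \<Longrightarrow> \<bar>Re \<tau>\<bar> \<le> 1 / 2 \<Longrightarrow>
      norm (g r \<tau>) \<le> Kr r * exp ((\<alpha> - (if fst r = 0 then \<beta> else 0)) * Im \<tau>)"
    using gbound by metis
  define K where "K = (\<Prod>r\<in>R. Kr r)"
  have Pbound: "norm (P \<tau>) \<le> K * exp (- \<epsilon> * Im \<tau>)" if s: "Im \<tau> \<ge> 1 / 2" "\<bar>Re \<tau>\<bar> \<le> 1 / 2" for \<tau>
  proof -
    have "norm (P \<tau>) = (\<Prod>r\<in>R. norm (g r \<tau>))" by (simp add: P_def prod_norm)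
    also have "\<dots> \<le> (\<Prod>r\<in>R. Kr r * exp ((\<alpha> - (if fst r = 0 then \<beta> else 0)) * Im \<tau>))"
      using Kr s by (intro prod_mono) auto
    also have "\<dots> = K * exp (\<Sum>r\<in>R. (\<alpha> - (if fst r = 0 then \<beta> else 0)) * Im \<tau>)"
      unfolding prod.distrib K_def by (simp add: exp_sum[OF finR])
    also have "(\<Sum>r\<in>R. (\<alpha> - (if fst r = 0 then \<beta> else 0)) * Im \<tau>) = - \<epsilon> * Im \<tau>"
    proof -
      have "(\<Sum>r\<in>R. if fst r = 0 then \<beta> else 0) = \<beta> * card {r \<in> R. fst r = 0}"
        using finR by (simp add: sum.If_cases Int_def)
      then have "(\<Sum>r\<in>R. \<alpha> - (if fst r = 0 then \<beta> else 0)) = - \<epsilon>"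
        unfolding sum_subtractf by (simp add: \<epsilon>_def)
      then show ?thesis unfolding sum_distrib_right[symmetric] by (simp only:)
    qed
    finally show ?thesis .
  qed
  have PZ: "\<forall>\<tau>\<in>uhp. P \<tau> = 0"
  proof (rule ccontr)
    assume "\<not> (\<forall>\<tau>\<in>uhp. P \<tau> = 0)"
    then obtain \<tau>0 where t0: "\<tau>0 \<in> uhp" "P \<tau>0 \<noteq> 0" by blast
    have sm: "- (1 / \<tau>) \<in> uhp" if "\<tau> \<in> uhp" for \<tau> using Im_minus_inverse_pos that by simp
    have "P (- (1 / - (1 / \<tau>0))) = CS * (CS * P \<tau>0)" using CS[OF sm[OF t0(1)]] CS[OF t0(1)] by simp
    moreover have "- (1 / - (1 / \<tau>0)) = \<tau>0" using t0 by simp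
    ultimately have "CS * CS = 1" using t0(2) by simp
    then have "norm CS * norm CS = 1" by (metis norm_mult norm_one)
    then have nS: "norm CS = 1" by (metis norm_ge_zero abs_of_nonneg abs_square_eq_1 power2_eq_square)
    \<comment> \<open>S has order 2 and S T order 3 as transformations. Applied at a point where P
      is nonzero, this forces CS^2 = 1 and (CS CT)^3 = 1, so both constants have modulus 1 and |P|
      is invariant.\<close>
    define st where "st \<tau> = - (1 / (\<tau> + 1))" for \<tau> :: complex
    have st: "st \<tau> \<in> uhp" "P (st \<tau>) = (CS * CT) * P \<tau>" if "\<tau> \<in> uhp" for \<tau>
    proof -
      have "\<tau> + 1 \<in> uhp" using that by simp
      then show "st \<tau> \<in> uhp" "P (st \<tau>) = (CS * CT) * P \<tau>"
        using sm CS[of "\<tau> + 1"] CT[OF that] by (auto simp: st_def)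
    qed
    have "st (st (st \<tau>0)) = \<tau>0"
    proof -
      have n0: "\<tau>0 \<noteq> 0" "\<tau>0 + 1 \<noteq> 0" using t0(1) by (auto simp: complex_eq_iff)
      have "st \<tau>0 + 1 = \<tau>0 / (\<tau>0 + 1)" using n0 by (simp add: st_def field_simps)
      then have "st (st \<tau>0) = - ((\<tau>0 + 1) / \<tau>0)" unfolding st_def[of "st \<tau>0"] by simp
      then have "st (st \<tau>0) + 1 = - (1 / \<tau>0)" using n0 by (simp add: field_simps)
      then show ?thesis unfolding st_def[of "st (st \<tau>0)"] by simp
    qed
    moreover have "P (st (st (st \<tau>0))) = (CS * CT) * ((CS * CT) * ((CS * CT) * P \<tau>0))"
      using st t0(1) by simp
    ultimately have "(CS * CT) ^ 3 = 1" using t0(2) by (simp add: power3_eq_cube mult.assoc)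
    then have "norm (CS * CT) ^ 3 = 1" by (metis norm_power norm_one)
    then have "norm (CS * CT) = 1" using power_eq_iff_eq_base[of 3 "norm (CS * CT)" 1] by simp
    then have nT: "norm CT = 1" by (simp add: norm_mult nS)
    have nPT: "norm (P (\<tau> + 1)) = norm (P \<tau>)" and nPS: "norm (P (- (1 / \<tau>))) = norm (P \<tau>)" if "\<tau> \<in> uhp" for \<tau>
      using CT[OF that] CS[OF that] nS nT by (simp_all add: norm_mult)
    define v where "v = norm (P \<tau>0)"
    have v: "v > 0" using t0 by (simp add: v_def)
    have K0: "K \<ge> 0" unfolding K_def using Kr(1) by (intro prod_nonneg) auto
    \<comment> \<open>Above height Y the product is smaller than its value at \<tau>0. Together with
      the fundamental strip this confines the supremum of |P| to a compact rectangle.\<close>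
    obtain Y where Y: "Y \<ge> 1 / 2" "\<And>y. y \<ge> Y \<Longrightarrow> K * exp (- \<epsilon> * y) < v"
    proof -
      define Y where "Y = max (1 / 2) (K / (v * \<epsilon>))"
      have "K * exp (- \<epsilon> * y) < v" if y: "y \<ge> Y" for y
      proof -
        have "y \<ge> K / (v * \<epsilon>)" using y by (simp add: Y_def)
        then have "K \<le> v * (\<epsilon> * y)" using v \<epsilon> by (simp add: field_simps)
        also have "\<dots> < v * exp (\<epsilon> * y)"
          using v exp_ge_add_one_self[of "\<epsilon> * y"] by (intro mult_strict_left_mono) linarith+
        finally show ?thesis using v by (simp add: exp_minus field_simps)
      qed
      then show ?thesis using that[of Y] by (simp add: Y_def)
    qed
    define F where "F = cbox (Complex (- 1 / 2) (1 / 2)) (Complex (1 / 2) Y)"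
    have F: "\<tau> \<in> F \<longleftrightarrow> \<bar>Re \<tau>\<bar> \<le> 1 / 2 \<and> Im \<tau> \<ge> 1 / 2 \<and> Im \<tau> \<le> Y" for \<tau>
      unfolding F_def by (auto simp: in_cbox_complex_iff abs_le_iff)
    have Fu: "F \<subseteq> uhp" using F by auto
    have inF: "\<sigma> \<in> F" if "Im \<sigma> \<ge> 1 / 2" "\<bar>Re \<sigma>\<bar> \<le> 1 / 2" "norm (P \<sigma>) \<ge> v" for \<sigma>
      using Pbound[OF that(1,2)] Y(2)[of "Im \<sigma>"] that F by force
    obtain \<sigma>0 where s0: "Im \<sigma>0 \<ge> 1 / 2" "\<bar>Re \<sigma>0\<bar> \<le> 1 / 2" "norm (P \<sigma>0) = v"
      unfolding v_def by (rule fundamental_strip[where f = "\<lambda>\<tau>. norm (P \<tau>)", OF nPT nPS t0(1)])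
    then have "\<sigma>0 \<in> F" using inF by simp
    have "continuous_on F (\<lambda>\<tau>. norm (P \<tau>))"
      by (intro continuous_on_norm holomorphic_on_imp_continuous_on holomorphic_on_subset[OF Phol Fu])
    then obtain m where m: "m \<in> F" "\<And>\<tau>. \<tau> \<in> F \<Longrightarrow> norm (P \<tau>) \<le> norm (P m)"
      using continuous_attains_sup[of F] \<open>\<sigma>0 \<in> F\<close> unfolding F_def by (metis compact_cbox empty_iff)
    have mv: "norm (P m) \<ge> v" using m(2)[OF \<open>\<sigma>0 \<in> F\<close>] s0 by simp
    have max: "norm (P \<tau>) \<le> norm (P m)" if tu: "\<tau> \<in> uhp" for \<tau>
    proof -
      obtain \<sigma> where s: "Im \<sigma> \<ge> 1 / 2" "\<bar>Re \<sigma>\<bar> \<le> 1 / 2" "norm (P \<sigma>) = norm (P \<tau>)"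
        by (rule fundamental_strip[where f = "\<lambda>\<tau>. norm (P \<tau>)", OF nPT nPS tu])
      show ?thesis
      proof (cases "norm (P \<sigma>) \<ge> v")
        case True
        show ?thesis using m(2)[OF inF[OF s(1,2) True]] s(3) by simp
      next
        case False then show ?thesis using mv s(3) by simp
      qed
    qed
    \<comment> \<open>An attained maximum makes P constant, which contradicts its being smaller than
      v in modulus at i Y.\<close>
    have "P constant_on uhp"
      by (rule maximum_modulus_principle[OF Phol open_uhp connected_uhp open_uhp order_refl, of m]) (use m Fu max in auto)
    then obtain w where w: "\<And>\<tau>. \<tau> \<in> uhp \<Longrightarrow> P \<tau> = w" by (auto simp: constant_on_def)
    have "norm (P (Complex 0 Y)) < v" using Pbound[of "Complex 0 Y"] Y by fastforce
    moreover have "P (Complex 0 Y) = P \<tau>0" using w t0(1) Y(1) by simp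
    ultimately show False by (simp add: v_def)
  qed
  \<comment> \<open>If the product vanishes, one translate of h vanishes identically, and h with it,
    as Moebius maps are onto the half plane.\<close>
  have "\<exists>r\<in>R. \<forall>\<tau>\<in>uhp. g r \<tau> = 0"
    by (rule holomorphic_prod_zero[OF open_uhp connected_uhp _ finR ghol]) (use PZ z in \<open>auto simp: P_def\<close>)
  then obtain r where r: "r \<in> R" "\<And>\<tau>. \<tau> \<in> uhp \<Longrightarrow> g r \<tau> = 0" by blast
  obtain a b c d where gr: "\<gamma> r = (a, b, c, d)" by (cases "\<gamma> r")
  have det: "a * d - b * c = 1" using \<gamma>[OF r(1)] gr by auto
  obtain \<sigma> where "\<sigma> \<in> uhp" "mob a b c d \<sigma> = z" using mob_inverse[OF det z] by blast
  then show ?thesis using r(2)[of \<sigma>] by (simp add: g_def gr)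
qed

section \<open>Identities between theta series and eta products\<close>

lemma norm_eulerE_ge:
  assumes q: "norm q \<le> r" and r: "r < 1"
  shows "norm (eulerE (of_real r)) \<le> norm (eulerE q)"
proof -
  have r0: "r \<ge> 0" using q norm_ge_zero order_trans by blast
  have nq: "norm q < 1" "norm (complex_of_real r) < 1" using q r r0 by auto
  have "norm (qpoch (of_real r) n) \<le> norm (qpoch q n)" for n
    unfolding qpoch_def prod_norm[symmetric]
  proof (rule prod_mono)
    fix k
    have "norm (q ^ Suc k) \<le> r ^ Suc k" unfolding norm_power by (rule power_mono[OF q norm_ge_zero])
    then have "1 - r ^ Suc k \<le> norm (1 - q ^ Suc k)" using norm_triangle_ineq2[of 1 "q ^ Suc k"] by simp
    moreover have "r ^ Suc k \<le> 1" using r r0 by (intro power_le_one) auto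
    moreover have "norm (1 - complex_of_real r ^ Suc k) = \<bar>1 - r ^ Suc k\<bar>"
      by (metis norm_of_real of_real_1 of_real_diff of_real_power)
    ultimately show "0 \<le> norm (1 - complex_of_real r ^ Suc k) \<and> norm (1 - complex_of_real r ^ Suc k) \<le> norm (1 - q ^ Suc k)"
      by simp
  qed
  then show ?thesis
    by (intro LIMSEQ_le[OF tendsto_norm[OF qpoch_LIMSEQ[OF nq(2)]] tendsto_norm[OF qpoch_LIMSEQ[OF nq(1)]]]) auto
qed

lemma norm_eulerE_le:
  assumes q: "norm q \<le> r" and r: "r < 1"
  shows "norm (eulerE q) \<le> norm (\<Prod>k. 1 + complex_of_real r * of_real r ^ k)"
proof -
  have r0: "r \<ge> 0" using q norm_ge_zero order_trans by blast
  have nq: "norm q < 1" "norm (complex_of_real r) < 1" using q r r0 by auto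
  have "norm (qpoch q n) \<le> norm (\<Prod>k<n. 1 + complex_of_real r * of_real r ^ k)" for n
    unfolding qpoch_def prod_norm[symmetric]
  proof (rule prod_mono)
    fix k
    have "norm (q ^ Suc k) \<le> r ^ Suc k" unfolding norm_power by (rule power_mono[OF q norm_ge_zero])
    then have "norm (1 - q ^ Suc k) \<le> 1 + r ^ Suc k" using norm_triangle_ineq4[of 1 "q ^ Suc k"] by simp
    moreover have "norm (1 + complex_of_real r * of_real r ^ k) = \<bar>1 + r ^ Suc k\<bar>"
      by (metis norm_of_real of_real_1 of_real_add of_real_power power_Suc)
    ultimately show "0 \<le> norm (1 - q ^ Suc k) \<and> norm (1 - q ^ Suc k) \<le> norm (1 + complex_of_real r * of_real r ^ k)"
      by simp
  qed
  then show ?thesis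
    by (intro LIMSEQ_le[OF tendsto_norm[OF qpoch_LIMSEQ[OF nq(1)]] tendsto_norm[OF LIMSEQ_prod_one_plus_geometric[OF nq(2)]]]) auto
qed

lemma norm_ee_le_half: "Im \<tau> \<ge> 1 / 2 \<Longrightarrow> norm (ee \<tau>) \<le> exp (- pi)"
  by (simp add: norm_ee)

text \<open>The exponential is |e(tau/24)|, and the remaining product lies between positive
  constants since |q| \<le> exp(-pi).\<close>

lemma eta_bounds:
  obtains c C where "c > 0" "C \<ge> 0"
    "\<And>\<tau>. Im \<tau> \<ge> 1 / 2 \<Longrightarrow> c * exp (- pi / 12 * Im \<tau>) \<le> norm (eta \<tau>)"
    "\<And>\<tau>. Im \<tau> \<ge> 1 / 2 \<Longrightarrow> norm (eta \<tau>) \<le> C * exp (- pi / 12 * Im \<tau>)"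
proof -
  define r where "r = exp (- pi)"
  have r: "r < 1" "0 \<le> r" by (auto simp: r_def)
  have e: "norm (eta \<tau>) = exp (- pi / 12 * Im \<tau>) * norm (eulerE (ee \<tau>))" if "Im \<tau> \<ge> 1 / 2" for \<tau>
  proof -
    have "norm (ee (\<tau> / 24)) = exp (- pi / 12 * Im \<tau>)" by (simp add: norm_ee)
    then show ?thesis using that by (simp add: eta_eulerE norm_mult)
  qed
  show ?thesis
  proof (rule that)
    show "norm (eulerE (of_real r)) > 0" using eulerE_nonzero[of "of_real r"] r by simp
    show "norm (eulerE (of_real r)) * exp (- pi / 12 * Im \<tau>) \<le> norm (eta \<tau>)" if "Im \<tau> \<ge> 1 / 2" for \<tau>
      using norm_eulerE_ge[OF _ r(1), of "ee \<tau>"] norm_ee_le_half[OF that] e[OF that] by (simp add: r_def)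
    show "norm (eta \<tau>) \<le> norm (\<Prod>k. 1 + complex_of_real r * of_real r ^ k) * exp (- pi / 12 * Im \<tau>)"
      if "Im \<tau> \<ge> 1 / 2" for \<tau>
      using norm_eulerE_le[OF _ r(1), of "ee \<tau>"] norm_ee_le_half[OF that] e[OF that] by (simp add: r_def)
  qed simp
qed

text \<open>|eta|^2 sqrt(Im) is invariant under both generators, so a bound on the fundamental strip
  is global.\<close>

lemma eta_sq_growth: "\<exists>C. \<forall>w\<in>uhp. (norm (eta w))\<^sup>2 * sqrt (Im w) \<le> C"
proof -
  obtain c C where C: "C \<ge> 0" "\<And>\<tau>. Im \<tau> \<ge> 1 / 2 \<Longrightarrow> norm (eta \<tau>) \<le> C * exp (- pi / 12 * Im \<tau>)"
    by (rule eta_bounds) (rule that; assumption)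
  define f where "f w = (norm (eta w))\<^sup>2 * sqrt (Im w)" for w
  have fT: "f (w + 1) = f w" if "w \<in> uhp" for w
    using that by (simp add: f_def eta_plus_1 norm_mult norm_ee)
  have fS: "f (- (1 / w)) = f w" if w: "w \<in> uhp" for w
  proof -
    have w0: "norm w > 0" using w by auto
    have "norm ((eta (- (1 / w)))\<^sup>2) = norm w * (norm (eta w))\<^sup>2"
      using w eta_minus_inverse_sq[of w] by (simp add: norm_mult norm_ee norm_power)
    moreover have "Im (- (1 / w)) = Im w / (norm w)\<^sup>2" by (simp add: Im_divide cmod_power2)
    ultimately show ?thesis using w w0 by (simp add: f_def norm_power real_sqrt_divide)
  qed
  have "f w \<le> C\<^sup>2" if w: "w \<in> uhp" for w
  proof -
    obtain \<sigma> where s: "Im \<sigma> \<ge> 1 / 2" "f \<sigma> = f w" by (rule fundamental_strip[where f = f, OF fT fS w])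
    define y where "y = Im \<sigma>"
    have y: "y \<ge> 1 / 2" using s by (simp add: y_def)
    have "(norm (eta \<sigma>))\<^sup>2 \<le> (C * exp (- pi / 12 * y))\<^sup>2" using C(2)[OF s(1)] by (intro power_mono) (auto simp: y_def)
    also have "\<dots> = C\<^sup>2 * exp (- pi / 6 * y)" by (simp add: power_mult_distrib exp_double[symmetric] power2_eq_square exp_add[symmetric])
    finally have "f \<sigma> \<le> C\<^sup>2 * (exp (- pi / 6 * y) * sqrt y)"
      unfolding f_def y_def[symmetric] using y by (simp add: mult_right_mono mult.assoc[symmetric])
    also have "exp (- pi / 6 * y) * sqrt y \<le> 1"
    proof -
      have "y \<le> (exp (pi / 6 * y))\<^sup>2"
      proof -
        have "y \<le> pi / 3 * y" using pi_gt3 y by simp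
        also have "\<dots> \<le> exp (pi / 3 * y)" using exp_ge_add_one_self[of "pi / 3 * y"] by linarith
        also have "\<dots> = (exp (pi / 6 * y))\<^sup>2" by (simp add: exp_double[symmetric])
        finally show ?thesis .
      qed
      then have "sqrt y \<le> exp (pi / 6 * y)" by (intro real_le_lsqrt) auto
      then show ?thesis by (simp add: exp_minus field_simps)
    qed
    then have "C\<^sup>2 * (exp (- pi / 6 * y) * sqrt y) \<le> C\<^sup>2 * 1" by (intro mult_left_mono) auto
    finally show ?thesis using s by simp
  qed
  then show ?thesis unfolding f_def by blast
qed

lemma norm_ee_of_int [simp]: "norm (ee (of_int n / 12)) = 1" by (simp add: norm_ee)

lemma norm_eta_mob_sq:
  assumes "a * d - b * c = 1" "Im \<tau> > 0"
  shows "(norm (eta (mob a b c d \<tau>)))\<^sup>2 = norm (of_int c * \<tau> + of_int d) * (norm (eta \<tau>))\<^sup>2"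
  using arg_cong[OF eta_sq_mob[OF assms], of norm] by (simp add: norm_mult norm_power)

text \<open>Multiplicities are expressed by repetition in the list; quotients are handled with
  denominators cleared.\<close>

definition eta_prod :: "nat list \<Rightarrow> complex \<Rightarrow> complex" where
  "eta_prod ds \<tau> = (\<Prod>\<delta>\<leftarrow>ds. eta (of_nat \<delta> * \<tau>))"

lemma eta_prod_simps [simp]: "eta_prod [] \<tau> = 1" "eta_prod (\<delta> # ds) \<tau> = eta (of_nat \<delta> * \<tau>) * eta_prod ds \<tau>"
  by (simp_all add: eta_prod_def)

lemma eta_prod_holomorphic: "\<forall>\<delta>\<in>set ds. \<delta> > 0 \<Longrightarrow> eta_prod ds holomorphic_on uhp"
proof (induction ds)
  case (Cons \<delta> ds)
  have "eta \<circ> (\<lambda>\<tau>. of_nat \<delta> * \<tau>) holomorphic_on uhp"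
    using Cons.prems by (intro holomorphic_on_compose_gen[OF _ eta_holomorphic] holomorphic_intros) auto
  moreover have "eta_prod (\<delta> # ds) = (\<lambda>\<tau>. eta (of_nat \<delta> * \<tau>) * eta_prod ds \<tau>)" by (rule ext) simp
  ultimately show ?case using Cons by (auto simp: o_def intro!: holomorphic_intros)
qed (simp add: eta_prod_def[abs_def])

text \<open>Multiplication by \<delta> conjugates the matrix into (a, b \<delta>; c/\<delta>, d),
  again of determinant 1 because \<delta> divides c, with the same automorphy factor.\<close>

lemma eta_scaled_mob_sq:
  assumes det: "a * d - b * c = 1" and t: "Im \<tau> > 0" and \<delta>: "\<delta> > 0" "int \<delta> dvd c"
  shows "(eta (of_nat \<delta> * mob a b c d \<tau>))\<^sup>2
       = ee (of_int (eta_exponent a (b * int \<delta>) (c div int \<delta>) d) / 12) * (of_int c * \<tau> + of_int d) * (eta (of_nat \<delta> * \<tau>))\<^sup>2"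
proof -
  obtain e where e: "c = int \<delta> * e" using \<delta> by auto
  have ce: "c div int \<delta> = e" using e \<delta> by simp
  have det': "a * d - (b * int \<delta>) * e = 1" using det by (simp add: e mult_ac)
  have "of_nat \<delta> * mob a b c d \<tau> = mob a (b * int \<delta>) e d (of_nat \<delta> * \<tau>)"
    by (simp add: mob_def e algebra_simps)
  moreover have "of_int e * (of_nat \<delta> * \<tau>) + of_int d = of_int c * \<tau> + of_int d" by (simp add: e)
  moreover have "Im (of_nat \<delta> * \<tau>) > 0" using t \<delta> by simp
  ultimately show ?thesis using eta_sq_mob[OF det', of "of_nat \<delta> * \<tau>"] unfolding ce by simp
qed

lemma eta_prod_mob_sq:
  assumes det: "a * d - b * c = 1" and t: "Im \<tau> > 0" and ds: "\<forall>\<delta>\<in>set ds. \<delta> > 0 \<and> int \<delta> dvd c"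
  shows "(eta_prod ds (mob a b c d \<tau>))\<^sup>2
       = ee (of_int (\<Sum>\<delta>\<leftarrow>ds. eta_exponent a (b * int \<delta>) (c div int \<delta>) d) / 12) * (of_int c * \<tau> + of_int d) ^ length ds * (eta_prod ds \<tau>)\<^sup>2"
  using ds
proof (induction ds)
  case (Cons \<delta> ds)
  have "(eta_prod (\<delta> # ds) (mob a b c d \<tau>))\<^sup>2 = (eta (of_nat \<delta> * mob a b c d \<tau>))\<^sup>2 * (eta_prod ds (mob a b c d \<tau>))\<^sup>2"
    by (simp add: power_mult_distrib)
  also have "\<dots> = ee (of_int (eta_exponent a (b * int \<delta>) (c div int \<delta>) d) / 12) * (of_int c * \<tau> + of_int d) * (eta (of_nat \<delta> * \<tau>))\<^sup>2 *
     (ee (of_int (\<Sum>\<delta>\<leftarrow>ds. eta_exponent a (b * int \<delta>) (c div int \<delta>) d) / 12) * (of_int c * \<tau> + of_int d) ^ length ds * (eta_prod ds \<tau>)\<^sup>2)"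
    using Cons eta_scaled_mob_sq[OF det t] by simp
  finally show ?case by (simp add: power_mult_distrib ee_add add_divide_distrib mult_ac)
qed simp

text \<open>For odd d both parity branches agree modulo 12, the difference for odd c being 3(c -
  1)(d - 1). One polynomial formula thus covers every c/\<delta>, whatever its parity.\<close>

lemma eta_exponent_odd_d:
  assumes "odd d"
  shows "[eta_exponent a b c d = (a + d) * c - b * d * (c\<^sup>2 - 1) + 3 * d - 3 - 3 * c * d] (mod 12)"
proof (cases "odd c")
  case True
  obtain x y where xy: "d = 2 * x + 1" "c = 2 * y + 1" using assms True by (auto elim!: oddE)
  have "eta_exponent a b c d - ((a + d) * c - b * d * (c\<^sup>2 - 1) + 3 * d - 3 - 3 * c * d) = 3 * ((c - 1) * (d - 1))"
    using True by (simp add: eta_exponent_def algebra_simps)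
  also have "\<dots> = 12 * (x * y)" by (simp add: xy)
  finally show ?thesis by (simp add: cong_iff_dvd_diff)
next
  case False then show ?thesis by (simp add: eta_exponent_def algebra_simps)
qed

text \<open>The total exponent depends on the list only through the sum of the \<delta>, the sum of
  the M/\<delta> and the length. This is the source of the congruence conditions on eta products,
  modulo 12 because squares are transformed.\<close>

lemma eta_exponent_list_cong:
  assumes M: "even M" "c = M * e" and d: "odd d" and ds: "\<forall>\<delta>\<in>set ds. \<delta> > 0 \<and> int \<delta> dvd M"
  shows "[(\<Sum>\<delta>\<leftarrow>ds. eta_exponent a (b * int \<delta>) (c div int \<delta>) d)
     = e * (a - 2 * d - b * d * e * M) * (\<Sum>\<delta>\<leftarrow>ds. M div int \<delta>) + b * d * (\<Sum>\<delta>\<leftarrow>ds. int \<delta>) + 3 * (d - 1) * int (length ds)] (mod 12)"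
  using ds
proof (induction ds)
  case (Cons \<delta> ds)
  obtain m where m: "M = int \<delta> * m" using Cons.prems by auto
  have Md: "M div int \<delta> = m" "c div int \<delta> = m * e" using Cons.prems by (simp_all add: m M(2))
  have eq: "(a + d) * (m * e) - b * int \<delta> * d * ((m * e)\<^sup>2 - 1) + 3 * d - 3 - 3 * (m * e) * d
     = e * (a - 2 * d - b * d * e * M) * m + b * d * int \<delta> + 3 * (d - 1)"
    unfolding m by (simp add: algebra_simps power2_eq_square)
  have "[eta_exponent a (b * int \<delta>) (c div int \<delta>) d = e * (a - 2 * d - b * d * e * M) * m + b * d * int \<delta> + 3 * (d - 1)] (mod 12)"
    unfolding Md using eta_exponent_odd_d[OF d, of a "b * int \<delta>" "m * e"] unfolding eq .
  from cong_add[OF this Cons.IH] Cons.prems show ?case by (simp add: Md algebra_simps)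
qed simp

text \<open>A coprime pair is never even in both entries, nor are its residues modulo 4k; this
  removes 4 k^2 of the 16 k^2 pairs.\<close>

lemma card_rows_le:
  assumes k: "k > (0::int)"
  shows "card (rows (4 * k)) \<le> nat (12 * k\<^sup>2)"
proof -
  define U where "U = {0..<4 * k} \<times> {0..<4 * k}"
  define V where "V = (\<lambda>(x, y). (2 * x, 2 * y)) ` ({0..<2 * k} \<times> {0..<2 * k})"
  have sub: "rows (4 * k) \<subseteq> U - V"
  proof
    fix r assume r: "r \<in> rows (4 * k)"
    then obtain c d where cd: "coprime c d" "r = (c mod (4 * k), d mod (4 * k))" by (auto simp: rows_def)
    have "r \<notin> V"
    proof
      assume "r \<in> V"
      then have "even (c mod (4 * k))" "even (d mod (4 * k))" using cd by (auto simp: V_def)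
      then have "even c" "even d" by (simp_all add: dvd_mod_iff)
      with cd(1) show False by (metis coprime_common_divisor odd_one)
    qed
    then show "r \<in> U - V" using rows_subset[of "4 * k"] r k by (auto simp: U_def)
  qed
  have fin: "finite U" by (simp add: U_def)
  have VU: "V \<subseteq> U" by (auto simp: U_def V_def)
  have cV: "card V = nat (2 * k) * nat (2 * k)"
    unfolding V_def by (subst card_image) (auto simp: inj_on_def card_cartesian_product)
  have cU: "card U = nat (4 * k) * nat (4 * k)" by (simp add: U_def card_cartesian_product)
  have "card (rows (4 * k)) \<le> card (U - V)" using sub fin by (intro card_mono) auto
  also have "\<dots> = card U - card V" using VU fin by (intro card_Diff_subset) (auto intro: finite_subset)
  also have "\<dots> = nat (12 * k\<^sup>2)"
  proof -
    obtain n where n: "k = int n" using k by (metis nonneg_int_cases less_imp_le)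
    have "nat (4 * k) = 4 * n" "nat (2 * k) = 2 * n" "nat (12 * k\<^sup>2) = 12 * n\<^sup>2"
      by (simp_all add: n nat_mult_distrib nat_power_eq)
    then show ?thesis unfolding cU cV by (simp add: power2_eq_square)
  qed
  finally show ?thesis .
qed

text \<open>Each unit u modulo 4k gives the coprime pair (4k, u), whose row is (0, u).\<close>

lemma card_cusp_rows_ge:
  assumes k: "k > (0::int)"
  shows "card {u \<in> {0..<4 * k}. coprime u (4 * k)} \<le> card {r \<in> rows (4 * k). fst r = 0}"
proof (rule card_inj_on_le[where f = "\<lambda>u. (0, u)"])
  show "(\<lambda>u. (0, u)) ` {u \<in> {0..<4 * k}. coprime u (4 * k)} \<subseteq> {r \<in> rows (4 * k). fst r = 0}"
  proof clarify
    fix u assume u: "u \<in> {0..<4 * k}" "coprime u (4 * k)"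
    then have "(0, u) = ((4 * k) mod (4 * k), u mod (4 * k))" by simp
    moreover have "coprime (4 * k) u" using u(2) by (simp add: coprime_commute)
    ultimately have "(0, u) \<in> rows (4 * k)" unfolding rows_def by (intro image_eqI[of _ _ "(4 * k, u)"]) auto
    then show "(0, u) \<in> rows (4 * k) \<and> fst (0, u) = 0" by simp
  qed
  show "finite {r \<in> rows (4 * k). fst r = 0}" using finite_rows[of "4 * k"] k by simp
qed (auto simp: inj_on_def)

text \<open>Squares are compared because the multiplier is available for \<open>\<eta>\<^sup>2\<close> only. The sign that this
  leaves open is settled by the behaviour on the imaginary axis.\<close>
theorem eta_theta_identity:
  fixes N D :: "complex \<Rightarrow> complex" and k :: int and ys xs :: "nat list" and n0 :: nat
  assumes k: "k > 0"
    and hol: "N holomorphic_on uhp" "D holomorphic_on uhp"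
    and gN: "\<exists>K. \<forall>\<tau>\<in>uhp. norm (N \<tau>) \<le> K * (1 + 1 / Im \<tau>)"
    and gD: "\<exists>K. \<forall>\<tau>\<in>uhp. norm (D \<tau>) \<le> K * (1 + 1 / Im \<tau>)"
    and aut: "\<And>a b c d. a * d - b * c = 1 \<Longrightarrow> 4 * k dvd c \<Longrightarrow> \<exists>\<kappa>. \<kappa> \<noteq> 0 \<and>
        (\<forall>\<tau>\<in>uhp. N (mob a b c d \<tau>) = \<kappa> * (of_int c * \<tau> + of_int d) * N \<tau> \<and>
                 D (mob a b c d \<tau>) = \<kappa> * (of_int c * \<tau> + of_int d) * D \<tau>)"
    and len: "length xs = length ys"
    and lev: "\<forall>\<delta>\<in>set (ys @ xs). \<delta> > 0 \<and> int \<delta> dvd 4 * k"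
    and c1: "[(\<Sum>\<delta>\<leftarrow>ys. int \<delta>) = (\<Sum>\<delta>\<leftarrow>xs. int \<delta>)] (mod 12)"
    and c2: "[(\<Sum>\<delta>\<leftarrow>ys. 4 * k div int \<delta>) = (\<Sum>\<delta>\<leftarrow>xs. 4 * k div int \<delta>)] (mod 12)"
    and van: "\<exists>K. \<forall>\<tau>. Im \<tau> \<ge> 1 / 2 \<longrightarrow> norm (N \<tau> * eta_prod ys \<tau> - D \<tau> * eta_prod xs \<tau>) \<le> K * exp (- (2 * pi * n0) * Im \<tau>)"
    and Dlow: "\<And>y. y \<ge> 1 \<Longrightarrow> norm (D (Complex 0 y)) \<ge> 1"
    and n0: "sum_list xs < 24 * n0"
    and count: "(2 + int (length ys)) * k\<^sup>2 < int n0 * int (card {u \<in> {0..<4 * k}. coprime u (4 * k)})"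
    and z: "z \<in> uhp"
  shows "N z * eta_prod ys z = D z * eta_prod xs z"
proof -
  define L where "L = length ys"
  \<comment> \<open>The squares of N and D have weight 2, those of the eta products weight L and
    eta^2 has weight 1, so the quotient has weight 0.\<close>
  define h where "h \<tau> = ((N \<tau>)\<^sup>2 * (eta_prod ys \<tau>)\<^sup>2 - (D \<tau>)\<^sup>2 * (eta_prod xs \<tau>)\<^sup>2) / ((eta \<tau>)\<^sup>2) ^ (2 + L)" for \<tau>
  have lxs: "length xs = L" using len by (simp add: L_def)
  have pos: "\<forall>\<delta>\<in>set ys. \<delta> > 0" "\<forall>\<delta>\<in>set xs. \<delta> > 0" using lev by auto
  have hepr: "eta_prod ys holomorphic_on uhp" "eta_prod xs holomorphic_on uhp" using eta_prod_holomorphic pos by auto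
  have hhol: "h holomorphic_on uhp"
    unfolding h_def[abs_def] using hol hepr eta_nonzero
    by (intro holomorphic_intros eta_holomorphic) auto
  obtain c0 C0 where c0: "c0 > 0" and C0: "C0 \<ge> 0"
    and elow: "\<And>\<tau>. Im \<tau> \<ge> 1 / 2 \<Longrightarrow> c0 * exp (- pi / 12 * Im \<tau>) \<le> norm (eta \<tau>)"
    and eup: "\<And>\<tau>. Im \<tau> \<ge> 1 / 2 \<Longrightarrow> norm (eta \<tau>) \<le> C0 * exp (- pi / 12 * Im \<tau>)"
    by (rule eta_bounds) (rule that; assumption)
  \<comment> \<open>The inverse of eta^2 grows like exp(pi/6 y), and it enters to the power 2 +
    L.\<close>
  define \<alpha> where "\<alpha> = pi / 6 * (2 + real L)"
  have invE: "1 / ((norm (eta \<tau>))\<^sup>2) ^ (2 + L) \<le> (1 / c0\<^sup>2) ^ (2 + L) * exp (\<alpha> * Im \<tau>)" if y: "Im \<tau> \<ge> 1 / 2" for \<tau>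
  proof -
    have e1: "(c0 * exp (- pi / 12 * Im \<tau>))\<^sup>2 \<le> (norm (eta \<tau>))\<^sup>2"
      using elow[OF y] c0 by (intro power_mono) auto
    have e2: "(c0 * exp (- pi / 12 * Im \<tau>))\<^sup>2 = c0\<^sup>2 * exp (- (pi / 6 * Im \<tau>))"
      by (simp add: power_mult_distrib exp_double[symmetric])
    have "1 / (norm (eta \<tau>))\<^sup>2 \<le> 1 / (c0\<^sup>2 * exp (- (pi / 6 * Im \<tau>)))"
      by (rule frac_le[OF _ _ _ e1[unfolded e2]]) (use c0 in auto)
    also have "\<dots> = 1 / c0\<^sup>2 * exp (pi / 6 * Im \<tau>)" using c0 by (simp add: exp_minus field_simps)
    finally have "(1 / (norm (eta \<tau>))\<^sup>2) ^ (2 + L) \<le> (1 / c0\<^sup>2 * exp (pi / 6 * Im \<tau>)) ^ (2 + L)"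
      by (intro power_mono) auto
    also have "\<dots> = (1 / c0\<^sup>2) ^ (2 + L) * exp (\<alpha> * Im \<tau>)"
      unfolding power_mult_distrib exp_of_nat_mult[symmetric] by (simp add: \<alpha>_def mult_ac)
    finally show ?thesis by (simp add: power_one_over)
  qed
  obtain KN where KN: "KN \<ge> 0" "\<And>\<tau>. \<tau> \<in> uhp \<Longrightarrow> norm (N \<tau>) \<le> KN * (1 + 1 / Im \<tau>)" "\<And>\<tau>. \<tau> \<in> uhp \<Longrightarrow> norm (D \<tau>) \<le> KN * (1 + 1 / Im \<tau>)"
  proof -
    obtain K1 K2 where K1: "\<And>\<tau>. \<tau> \<in> uhp \<Longrightarrow> norm (N \<tau>) \<le> K1 * (1 + 1 / Im \<tau>)"
      and K2: "\<And>\<tau>. \<tau> \<in> uhp \<Longrightarrow> norm (D \<tau>) \<le> K2 * (1 + 1 / Im \<tau>)" using gN gD by blast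
    show ?thesis
    proof (rule that[of "max 0 (max K1 K2)"])
      show "norm (N \<tau>) \<le> max 0 (max K1 K2) * (1 + 1 / Im \<tau>)" if t: "\<tau> \<in> uhp" for \<tau>
        by (rule order_trans[OF K1[OF t] mult_right_mono]) (use t in auto)
      show "norm (D \<tau>) \<le> max 0 (max K1 K2) * (1 + 1 / Im \<tau>)" if t: "\<tau> \<in> uhp" for \<tau>
        by (rule order_trans[OF K2[OF t] mult_right_mono]) (use t in auto)
    qed simp
  qed
  obtain Ce where Ce: "\<And>w. w \<in> uhp \<Longrightarrow> (norm (eta w))\<^sup>2 * sqrt (Im w) \<le> Ce" using eta_sq_growth by blast
  have Ce0: "Ce \<ge> 0" using Ce[of \<i>] by (simp add: order_trans[OF zero_le_power2])
  have hzero: "h z = 0" if z: "z \<in> uhp" for z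
  proof (rule vanishing_criterion[where M = "4 * k" and h = h and \<alpha> = \<alpha> and \<beta> = "2 * pi * n0"])
    show "4 * k > 0" using k by simp
    show "h holomorphic_on uhp" by (rule hhol)
    show "z \<in> uhp" by (rule z)
  next
    fix a b c d :: int
    assume det: "a * d - b * c = 1" and Mc: "4 * k dvd c"
    obtain \<kappa> where \<kappa>: "\<kappa> \<noteq> 0" "\<And>\<tau>. \<tau> \<in> uhp \<Longrightarrow> N (mob a b c d \<tau>) = \<kappa> * (of_int c * \<tau> + of_int d) * N \<tau>"
       "\<And>\<tau>. \<tau> \<in> uhp \<Longrightarrow> D (mob a b c d \<tau>) = \<kappa> * (of_int c * \<tau> + of_int d) * D \<tau>" using aut[OF det Mc] by blast
    obtain e where e: "c = (4 * k) * e" using Mc by auto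
    have od: "odd d"
    proof
      assume "even d"
      then have "even (a * d - b * c)" by (simp add: e)
      then show False by (simp add: det)
    qed
    have ds: "\<forall>\<delta>\<in>set ys. \<delta> > 0 \<and> int \<delta> dvd c" "\<forall>\<delta>\<in>set xs. \<delta> > 0 \<and> int \<delta> dvd c"
      using lev Mc dvd_trans by auto
    define Sy where "Sy = (\<Sum>\<delta>\<leftarrow>ys. eta_exponent a (b * int \<delta>) (c div int \<delta>) d)"
    define Sx where "Sx = (\<Sum>\<delta>\<leftarrow>xs. eta_exponent a (b * int \<delta>) (c div int \<delta>) d)"
    \<comment> \<open>The two eta products have equal multipliers, by \<open>c1\<close>,
      \<open>c2\<close> and the equality of lengths.\<close>
    have "[Sy = Sx] (mod 12)"
    proof -
      have "[Sy = e * (a - 2 * d - b * d * e * (4 * k)) * (\<Sum>\<delta>\<leftarrow>ys. 4 * k div int \<delta>) + b * d * (\<Sum>\<delta>\<leftarrow>ys. int \<delta>) + 3 * (d - 1) * int L] (mod 12)"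
        unfolding Sy_def L_def by (rule eta_exponent_list_cong) (use e od lev in auto)
      also have "[e * (a - 2 * d - b * d * e * (4 * k)) * (\<Sum>\<delta>\<leftarrow>ys. 4 * k div int \<delta>) + b * d * (\<Sum>\<delta>\<leftarrow>ys. int \<delta>) + 3 * (d - 1) * int L
         = e * (a - 2 * d - b * d * e * (4 * k)) * (\<Sum>\<delta>\<leftarrow>xs. 4 * k div int \<delta>) + b * d * (\<Sum>\<delta>\<leftarrow>xs. int \<delta>) + 3 * (d - 1) * int L] (mod 12)"
        by (intro cong_add cong_mult c1 c2 cong_refl)
      also have "[e * (a - 2 * d - b * d * e * (4 * k)) * (\<Sum>\<delta>\<leftarrow>xs. 4 * k div int \<delta>) + b * d * (\<Sum>\<delta>\<leftarrow>xs. int \<delta>) + 3 * (d - 1) * int L = Sx] (mod 12)"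
        unfolding Sx_def lxs[symmetric] by (rule cong_sym, rule eta_exponent_list_cong) (use e od lev in auto)
      finally show ?thesis .
    qed
    then have Sxy: "ee (of_int Sx / 12) = ee (of_int Sy / 12)"
      by (intro ee_cong_12) (simp add: cong_iff_dvd_diff dvd_diff_commute)
    define E1 where "E1 = ee (of_int Sy / 12)"
    define E2 where "E2 = ee (of_int (eta_exponent a b c d) / 12)"
    have "h (mob a b c d \<tau>) = (\<kappa>\<^sup>2 * E1 / E2 ^ (2 + L)) * h \<tau>" if t: "\<tau> \<in> uhp" for \<tau>
    proof -
      have t': "Im \<tau> > 0" using t by simp
      define j where "j = of_int c * \<tau> + (of_int d :: complex)"
      have j: "j \<noteq> 0" unfolding j_def by (rule mob_denom_nonzero[OF det t'])
      have ey: "(eta_prod ys (mob a b c d \<tau>))\<^sup>2 = E1 * j ^ L * (eta_prod ys \<tau>)\<^sup>2"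
        using eta_prod_mob_sq[OF det t' ds(1)] by (simp add: E1_def Sy_def j_def L_def)
      have ex: "(eta_prod xs (mob a b c d \<tau>))\<^sup>2 = E1 * j ^ L * (eta_prod xs \<tau>)\<^sup>2"
        using eta_prod_mob_sq[OF det t' ds(2)] unfolding Sx_def[symmetric] Sxy by (simp add: E1_def j_def lxs)
      have et: "(eta (mob a b c d \<tau>))\<^sup>2 = E2 * j * (eta \<tau>)\<^sup>2"
        using eta_sq_mob[OF det t'] by (simp add: E2_def j_def)
      have n2: "(N (mob a b c d \<tau>))\<^sup>2 = \<kappa>\<^sup>2 * j\<^sup>2 * (N \<tau>)\<^sup>2" "(D (mob a b c d \<tau>))\<^sup>2 = \<kappa>\<^sup>2 * j\<^sup>2 * (D \<tau>)\<^sup>2"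
        using \<kappa>(2,3)[OF t] by (simp_all add: j_def power_mult_distrib)
      have cancel: "(x1 * w * x2) / (y1 * w * y2) = (x1 / y1) * (x2 / y2)" if "w \<noteq> 0" for x1 x2 y1 y2 w :: complex
        using that by simp
      have hm: "h (mob a b c d \<tau>) = (\<kappa>\<^sup>2 * E1 * j ^ (2 + L) * ((N \<tau>)\<^sup>2 * (eta_prod ys \<tau>)\<^sup>2 - (D \<tau>)\<^sup>2 * (eta_prod xs \<tau>)\<^sup>2)) / (E2 ^ (2 + L) * j ^ (2 + L) * ((eta \<tau>)\<^sup>2) ^ (2 + L))"
        unfolding h_def ey ex et n2 power_mult_distrib[of "E2 * j"] power_mult_distrib[of E2] power_add[of j]
        by (simp add: algebra_simps)
      show ?thesis unfolding hm unfolding cancel[OF power_not_zero[OF j]] unfolding h_def ..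
    qed
    moreover have "\<kappa>\<^sup>2 * E1 / E2 ^ (2 + L) \<noteq> 0" using \<kappa>(1) by (simp add: E1_def E2_def)
    ultimately show "\<exists>\<kappa>. \<kappa> \<noteq> 0 \<and> (\<forall>\<tau>\<in>uhp. h (mob a b c d \<tau>) = \<kappa> * h \<tau>)" by blast
  next
    fix a b c d :: int
    assume det: "a * d - b * c = 1"
    \<comment> \<open>On the strip |tau| \<le> 2 Im tau and 1 \<le> 2 Im tau, so that |c tau + d|
      \<le> B Im tau.\<close>
    define B where "B = 2 * \<bar>real_of_int c\<bar> + 2 * \<bar>real_of_int d\<bar>"
    define C1 where "C1 = KN * (2 + B)"
    define C2 where "C2 = 2 * Ce"
    have B0: "B \<ge> 0" by (simp add: B_def)
    have C1: "C1 \<ge> 0" using KN(1) B0 by (simp add: C1_def)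
    have "norm (h (mob a b c d \<tau>)) \<le> (2 * C1\<^sup>2 * C2 ^ L * (1 / c0\<^sup>2) ^ (2 + L)) * exp (\<alpha> * Im \<tau>)"
      if y: "Im \<tau> \<ge> 1 / 2" and x: "\<bar>Re \<tau>\<bar> \<le> 1 / 2" for \<tau>
    proof -
      define \<gamma> where "\<gamma> = mob a b c d \<tau>"
      have t: "Im \<tau> > 0" using y by simp
      define J where "J = norm (of_int c * \<tau> + (of_int d :: complex))"
      have g: "\<gamma> \<in> uhp" "Im \<gamma> = Im \<tau> / J\<^sup>2" using Im_mob_pos[OF det t] Im_mob[OF det t] by (simp_all add: \<gamma>_def J_def)
      have J1: "J \<ge> 1 / 2"
      proof (cases "c = 0")
        case True
        then have "d * a = 1" using det by (simp add: mult.commute)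
        then have "\<bar>d\<bar> = 1" using zmult_eq_1_iff by fastforce
        then have "norm (of_int d :: complex) = 1" by (metis norm_of_int of_int_1 of_int_abs)
        then show ?thesis using True by (simp add: J_def)
      next
        case False
        have "\<bar>Im (of_int c * \<tau> + (of_int d :: complex))\<bar> \<le> J" unfolding J_def by (rule abs_Im_le_cmod)
        then have "\<bar>real_of_int c\<bar> * Im \<tau> \<le> J" using t by (simp add: abs_mult)
        moreover have "1 \<le> \<bar>real_of_int c\<bar>" using False by linarith
        then have "1 * Im \<tau> \<le> \<bar>real_of_int c\<bar> * Im \<tau>" using t by (intro mult_right_mono) auto
        ultimately show ?thesis using y by linarith
      qed
      have J2: "J \<le> B * Im \<tau>"
      proof -
        have "norm \<tau> \<le> 2 * Im \<tau>" using cmod_le[of \<tau>] x y by linarith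
        then have "\<bar>real_of_int c\<bar> * norm \<tau> \<le> \<bar>real_of_int c\<bar> * (2 * Im \<tau>)" by (intro mult_left_mono) auto
        moreover have "\<bar>real_of_int d\<bar> * 1 \<le> \<bar>real_of_int d\<bar> * (2 * Im \<tau>)" using y by (intro mult_left_mono) auto
        moreover have "J \<le> \<bar>real_of_int c\<bar> * norm \<tau> + \<bar>real_of_int d\<bar>"
          unfolding J_def using norm_triangle_ineq[of "of_int c * \<tau>" "of_int d"] by (simp add: norm_mult)
        ultimately show ?thesis by (simp add: B_def algebra_simps)
      qed
      \<comment> \<open>Here 1/Im gamma = J^2/Im tau \<le> B J and 1 \<le> 2J. With the bound C2 J
        for |eta|^2 below, the numerator is at most a constant times J^(2 + L), which the
        denominator cancels.\<close>
      have w1: "KN * (1 + 1 / Im \<gamma>) \<le> C1 * J"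
      proof -
        have "1 / Im \<gamma> = J * (J / Im \<tau>)" using g J1 by (simp add: power2_eq_square)
        moreover have "J / Im \<tau> \<le> B" using J2 t by (simp add: field_simps)
        then have "J * (J / Im \<tau>) \<le> J * B" using J1 by (intro mult_left_mono) auto
        ultimately have "1 + 1 / Im \<gamma> \<le> (2 + B) * J" using J1 by (simp add: algebra_simps)
        then have "KN * (1 + 1 / Im \<gamma>) \<le> KN * ((2 + B) * J)" using KN(1) by (intro mult_left_mono)
        then show ?thesis by (simp add: C1_def mult.assoc)
      qed
      have nN: "(norm (N \<gamma>))\<^sup>2 \<le> (C1 * J)\<^sup>2" "(norm (D \<gamma>))\<^sup>2 \<le> (C1 * J)\<^sup>2"
        using order_trans[OF KN(2)[OF g(1)] w1] order_trans[OF KN(3)[OF g(1)] w1] by (intro power_mono; simp)+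
      \<comment> \<open>The invariant bound for |eta|^2 is divided by sqrt(Im), which equals s/J
        with s \<ge> 1/2.\<close>
      have ne: "(norm (eta (of_nat \<delta> * \<gamma>)))\<^sup>2 \<le> C2 * J" if \<delta>: "\<delta> > 0" for \<delta>
      proof -
        have u: "of_nat \<delta> * \<gamma> \<in> uhp" using g(1) \<delta> by simp
        define s where "s = sqrt (real \<delta> * Im \<tau>)"
        have "real \<delta> * Im \<tau> \<ge> 1 * (1 / 2)" using \<delta> y by (intro mult_mono) auto
        then have s: "s \<ge> 1 / 2" unfolding s_def by (intro real_le_rsqrt) (simp add: power2_eq_square)
        have "sqrt (Im (of_nat \<delta> * \<gamma>)) = s / J" using g J1 by (simp add: s_def real_sqrt_divide real_sqrt_mult)
        then have "(norm (eta (of_nat \<delta> * \<gamma>)))\<^sup>2 * (s / J) \<le> Ce" using Ce[OF u] by simp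
        then have "(norm (eta (of_nat \<delta> * \<gamma>)))\<^sup>2 * s \<le> Ce * J" using J1 by (simp add: field_simps)
        moreover have "(norm (eta (of_nat \<delta> * \<gamma>)))\<^sup>2 * (1 / 2) \<le> (norm (eta (of_nat \<delta> * \<gamma>)))\<^sup>2 * s"
          using s by (intro mult_left_mono) auto
        ultimately show ?thesis by (simp add: C2_def)
      qed
      have nepr: "(norm (eta_prod ds \<gamma>))\<^sup>2 \<le> (C2 * J) ^ length ds" if "\<forall>\<delta>\<in>set ds. \<delta> > 0" for ds
        using that
      proof (induction ds)
        case (Cons \<delta> ds)
        then have "(norm (eta (of_nat \<delta> * \<gamma>)))\<^sup>2 * (norm (eta_prod ds \<gamma>))\<^sup>2 \<le> (C2 * J) * (C2 * J) ^ length ds"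
          using ne[of \<delta>] Ce0 J1 by (intro mult_mono) (auto simp: C2_def)
        then show ?case by (simp add: norm_mult power_mult_distrib)
      qed simp
      have num: "norm ((N \<gamma>)\<^sup>2 * (eta_prod ys \<gamma>)\<^sup>2 - (D \<gamma>)\<^sup>2 * (eta_prod xs \<gamma>)\<^sup>2) \<le> 2 * ((C1 * J)\<^sup>2 * (C2 * J) ^ L)"
      proof -
        have "norm ((N \<gamma>)\<^sup>2 * (eta_prod ys \<gamma>)\<^sup>2 - (D \<gamma>)\<^sup>2 * (eta_prod xs \<gamma>)\<^sup>2)
            \<le> (norm (N \<gamma>))\<^sup>2 * (norm (eta_prod ys \<gamma>))\<^sup>2 + (norm (D \<gamma>))\<^sup>2 * (norm (eta_prod xs \<gamma>))\<^sup>2"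
          using norm_triangle_ineq4[of "(N \<gamma>)\<^sup>2 * (eta_prod ys \<gamma>)\<^sup>2" "(D \<gamma>)\<^sup>2 * (eta_prod xs \<gamma>)\<^sup>2"] by (simp add: norm_mult norm_power)
        also have "\<dots> \<le> (C1 * J)\<^sup>2 * (C2 * J) ^ L + (C1 * J)\<^sup>2 * (C2 * J) ^ L"
          using nN nepr[OF pos(1)] nepr[OF pos(2)] by (intro add_mono mult_mono) (auto simp: lxs L_def[symmetric])
        finally show ?thesis by (simp only: mult_2)
      qed
      have J0: "J > 0" using J1 by simp
      have E0: "norm (eta \<tau>) > 0" using eta_nonzero[OF t] by simp
      have den: "norm (((eta \<gamma>)\<^sup>2) ^ (2 + L)) = J ^ (2 + L) * ((norm (eta \<tau>))\<^sup>2) ^ (2 + L)"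
        unfolding norm_power \<gamma>_def norm_eta_mob_sq[OF det t] J_def by (simp only: power_mult_distrib)
      have "norm (h \<gamma>) \<le> 2 * ((C1 * J)\<^sup>2 * (C2 * J) ^ L) / (J ^ (2 + L) * ((norm (eta \<tau>))\<^sup>2) ^ (2 + L))"
        unfolding h_def norm_divide den using num J0 by (intro divide_right_mono) auto
      also have "\<dots> = 2 * C1\<^sup>2 * C2 ^ L * (1 / ((norm (eta \<tau>))\<^sup>2) ^ (2 + L))"
      proof -
        have eq: "2 * ((C1 * J)\<^sup>2 * (C2 * J) ^ L) = J ^ (2 + L) * (2 * C1\<^sup>2 * C2 ^ L)"
          by (simp add: power_mult_distrib power_add mult_ac power2_eq_square)
        have "J ^ (2 + L) \<noteq> 0" using J0 by simp
        then show ?thesis unfolding eq by (subst nonzero_mult_divide_mult_cancel_left) (auto simp: divide_inverse)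
      qed
      also have "\<dots> \<le> 2 * C1\<^sup>2 * C2 ^ L * ((1 / c0\<^sup>2) ^ (2 + L) * exp (\<alpha> * Im \<tau>))"
        using Ce0 by (intro mult_left_mono invE[OF y]) (auto simp: C2_def)
      finally show ?thesis by (simp add: \<gamma>_def mult.assoc)
    qed
    then show "\<exists>K. \<forall>\<tau>. Im \<tau> \<ge> 1 / 2 \<longrightarrow> \<bar>Re \<tau>\<bar> \<le> 1 / 2 \<longrightarrow> norm (h (mob a b c d \<tau>)) \<le> K * exp (\<alpha> * Im \<tau>)" by blast
  next
    obtain K where K: "\<And>\<tau>. Im \<tau> \<ge> 1 / 2 \<Longrightarrow> norm (N \<tau> * eta_prod ys \<tau> - D \<tau> * eta_prod xs \<tau>) \<le> K * exp (- (2 * pi * n0) * Im \<tau>)"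
      using van by blast
    have eprb: "norm (eta_prod ds \<tau>) \<le> C0 ^ length ds" if "\<forall>\<delta>\<in>set ds. \<delta> > 0" "Im \<tau> \<ge> 1 / 2" for ds \<tau>
      using that
    proof (induction ds)
      case (Cons \<delta> ds)
      have "1 * (1 / 2) \<le> real \<delta> * Im \<tau>" using Cons.prems by (intro mult_mono) auto
      then have u: "Im (of_nat \<delta> * \<tau>) \<ge> 1 / 2" by simp
      have "norm (eta (of_nat \<delta> * \<tau>)) \<le> C0 * exp (- pi / 12 * Im (of_nat \<delta> * \<tau>))" by (rule eup[OF u])
      also have "\<dots> \<le> C0 * 1" using u C0 by (intro mult_left_mono) auto
      finally have "norm (eta (of_nat \<delta> * \<tau>)) * norm (eta_prod ds \<tau>) \<le> C0 * C0 ^ length ds"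
        using Cons C0 by (intro mult_mono) auto
      then show ?case by (simp add: norm_mult)
    qed simp
    have "norm (h \<tau>) \<le> (\<bar>K\<bar> * (2 * (3 * KN * C0 ^ L)) * (1 / c0\<^sup>2) ^ (2 + L)) * exp ((\<alpha> - 2 * pi * n0) * Im \<tau>)"
      if y: "Im \<tau> \<ge> 1 / 2" for \<tau>
    proof -
      have t: "\<tau> \<in> uhp" using y by simp
      have "1 / Im \<tau> \<le> 2" using y by (simp add: field_simps)
      then have "KN * (1 + 1 / Im \<tau>) \<le> KN * 3" using KN(1) by (intro mult_left_mono) auto
      then have nd: "norm (N \<tau>) \<le> 3 * KN" "norm (D \<tau>) \<le> 3 * KN" using KN(2,3)[OF t] by linarith+
      have "norm (N \<tau> * eta_prod ys \<tau> + D \<tau> * eta_prod xs \<tau>) \<le> norm (N \<tau>) * norm (eta_prod ys \<tau>) + norm (D \<tau>) * norm (eta_prod xs \<tau>)"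
        using norm_triangle_ineq[of "N \<tau> * eta_prod ys \<tau>" "D \<tau> * eta_prod xs \<tau>"] by (simp add: norm_mult)
      also have "\<dots> \<le> 3 * KN * C0 ^ L + 3 * KN * C0 ^ L"
        using nd eprb[OF pos(1) y] eprb[OF pos(2) y] KN(1) by (intro add_mono mult_mono) (auto simp: lxs L_def[symmetric])
      finally have plus: "norm (N \<tau> * eta_prod ys \<tau> + D \<tau> * eta_prod xs \<tau>) \<le> 2 * (3 * KN * C0 ^ L)" by (simp only: mult_2)
      have minus: "norm (N \<tau> * eta_prod ys \<tau> - D \<tau> * eta_prod xs \<tau>) \<le> \<bar>K\<bar> * exp (- (2 * pi * n0) * Im \<tau>)"
        by (rule order_trans[OF K[OF y] mult_right_mono]) auto
      \<comment> \<open>The vanishing to order n0 sits in the difference; the sum of the two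
        products is merely bounded.\<close>
      have "norm (h \<tau>) = (norm (N \<tau> * eta_prod ys \<tau> - D \<tau> * eta_prod xs \<tau>) * norm (N \<tau> * eta_prod ys \<tau> + D \<tau> * eta_prod xs \<tau>)) * (1 / ((norm (eta \<tau>))\<^sup>2) ^ (2 + L))"
      proof -
        have "(N \<tau>)\<^sup>2 * (eta_prod ys \<tau>)\<^sup>2 - (D \<tau>)\<^sup>2 * (eta_prod xs \<tau>)\<^sup>2 = (N \<tau> * eta_prod ys \<tau> - D \<tau> * eta_prod xs \<tau>) * (N \<tau> * eta_prod ys \<tau> + D \<tau> * eta_prod xs \<tau>)"
          by (simp add: power2_eq_square algebra_simps)
        then show ?thesis unfolding h_def by (simp only: norm_divide norm_mult norm_power mult_1_right times_divide_eq_right)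
      qed
      also have "\<dots> \<le> ((\<bar>K\<bar> * exp (- (2 * pi * n0) * Im \<tau>)) * (2 * (3 * KN * C0 ^ L))) * ((1 / c0\<^sup>2) ^ (2 + L) * exp (\<alpha> * Im \<tau>))"
        using plus minus KN(1) C0 by (intro mult_mono invE[OF y]) auto
      also have "\<dots> = (\<bar>K\<bar> * (2 * (3 * KN * C0 ^ L)) * (1 / c0\<^sup>2) ^ (2 + L)) * (exp (- (2 * pi * n0) * Im \<tau>) * exp (\<alpha> * Im \<tau>))"
        by (simp only: mult_ac)
      also have "exp (- (2 * pi * n0) * Im \<tau>) * exp (\<alpha> * Im \<tau>) = exp ((\<alpha> - 2 * pi * n0) * Im \<tau>)"
        by (simp add: exp_add[symmetric] algebra_simps)
      finally show ?thesis .
    qed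
    then show "\<exists>K. \<forall>\<tau>. Im \<tau> \<ge> 1 / 2 \<longrightarrow> \<bar>Re \<tau>\<bar> \<le> 1 / 2 \<longrightarrow> norm (h \<tau>) \<le> K * exp ((\<alpha> - 2 * pi * real n0) * Im \<tau>)" by blast
  next
    \<comment> \<open>After bounding the number of rows by 12 k^2, both sides contain the factor 2
      pi, since pi/6 times 12 is 2 pi; \<open>count\<close> is what remains.\<close>
    define cR where "cR = card (rows (4 * k))"
    define cu where "cu = card {u \<in> {0..<4 * k}. coprime u (4 * k)}"
    have 1: "int cR \<le> 12 * k\<^sup>2" using card_rows_le[OF k] by (simp add: cR_def nat_le_iff le_nat_iff)
    have "(2 + int L) * int cR \<le> (2 + int L) * (12 * k\<^sup>2)" using 1 by (intro mult_left_mono) auto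
    also have "\<dots> < 12 * (int n0 * int cu)" using count by (simp add: L_def cu_def)
    also have "\<dots> \<le> 12 * (int n0 * int (card {r \<in> rows (4 * k). fst r = 0}))"
      using card_cusp_rows_ge[OF k] by (simp add: cu_def mult_left_mono)
    finally have "real_of_int ((2 + int L) * int cR) < real_of_int (12 * (int n0 * int (card {r \<in> rows (4 * k). fst r = 0})))"
      by (simp only: of_int_less_iff)
    then have "(2 + real L) * real cR < 12 * (real n0 * real (card {r \<in> rows (4 * k). fst r = 0}))" by simp
    then have "pi / 6 * ((2 + real L) * real cR) < pi / 6 * (12 * (real n0 * real (card {r \<in> rows (4 * k). fst r = 0})))"
      by (intro mult_strict_left_mono) auto
    then show "\<alpha> * real (card (rows (4 * k))) < 2 * pi * real n0 * real (card {r \<in> rows (4 * k). fst r = 0})"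
      by (simp add: \<alpha>_def cR_def mult_ac)
  qed
  have prodzero: "(N \<tau> * eta_prod ys \<tau> - D \<tau> * eta_prod xs \<tau>) * (N \<tau> * eta_prod ys \<tau> + D \<tau> * eta_prod xs \<tau>) = 0" if t: "\<tau> \<in> uhp" for \<tau>
  proof -
    have "(N \<tau>)\<^sup>2 * (eta_prod ys \<tau>)\<^sup>2 - (D \<tau>)\<^sup>2 * (eta_prod xs \<tau>)\<^sup>2 = 0"
      using hzero[OF t] eta_nonzero[of \<tau>] t by (simp add: h_def)
    then show ?thesis by (simp add: power2_eq_square algebra_simps)
  qed
  have "(\<forall>\<tau>\<in>uhp. N \<tau> * eta_prod ys \<tau> - D \<tau> * eta_prod xs \<tau> = 0) \<or> (\<forall>\<tau>\<in>uhp. N \<tau> * eta_prod ys \<tau> + D \<tau> * eta_prod xs \<tau> = 0)"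
    by (rule holomorphic_mult_zero[OF open_uhp connected_uhp _ _ prodzero]) (intro holomorphic_intros hol hepr)+
  moreover have "\<not> (\<forall>\<tau>\<in>uhp. N \<tau> * eta_prod ys \<tau> + D \<tau> * eta_prod xs \<tau> = 0)"
  proof
    \<comment> \<open>With this sign the difference would be twice D times the product over xs up to
      sign. On the imaginary axis D has modulus at least 1 and the product decays no faster than
      exp(-pi/12 S y), up to a constant, which is too slow for exp(-2 pi n0 y) because S < 24
      n0.\<close>
    assume plus: "\<forall>\<tau>\<in>uhp. N \<tau> * eta_prod ys \<tau> + D \<tau> * eta_prod xs \<tau> = 0"
    obtain K where K: "\<And>\<tau>. Im \<tau> \<ge> 1 / 2 \<Longrightarrow> norm (N \<tau> * eta_prod ys \<tau> - D \<tau> * eta_prod xs \<tau>) \<le> K * exp (- (2 * pi * n0) * Im \<tau>)"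
      using van by blast
    have low: "c0 ^ length ds * exp (- pi / 12 * real (sum_list ds) * y) \<le> norm (eta_prod ds (Complex 0 y))"
      if "\<forall>\<delta>\<in>set ds. \<delta> > 0" "y \<ge> 1" for ds y
      using that
    proof (induction ds)
      case (Cons \<delta> ds)
      have "1 * 1 \<le> real \<delta> * y" using Cons.prems by (intro mult_mono) auto
      then have "Im (of_nat \<delta> * Complex 0 y) \<ge> 1 / 2" by simp
      from elow[OF this] have "c0 * exp (- pi / 12 * (real \<delta> * y)) \<le> norm (eta (of_nat \<delta> * Complex 0 y))" by simp
      then have "(c0 * exp (- pi / 12 * (real \<delta> * y))) * (c0 ^ length ds * exp (- pi / 12 * real (sum_list ds) * y))
         \<le> norm (eta (of_nat \<delta> * Complex 0 y)) * norm (eta_prod ds (Complex 0 y))"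
        using Cons c0 by (intro mult_mono) auto
      moreover have "exp (- pi / 12 * real (sum_list (\<delta> # ds)) * y) = exp (- pi / 12 * (real \<delta> * y)) * exp (- pi / 12 * real (sum_list ds) * y)"
        unfolding exp_add[symmetric] by (simp add: algebra_simps)
      ultimately show ?case by (simp add: norm_mult mult_ac)
    qed simp
    define S where "S = real (sum_list xs)"
    define \<epsilon> where "\<epsilon> = pi / 12 * (24 * real n0 - S)"
    have "\<epsilon> > 0" using n0 by (simp add: \<epsilon>_def S_def)
    have bound: "2 * c0 ^ L * exp (\<epsilon> * y) \<le> K" if y: "y \<ge> 1" for y
    proof -
      define \<tau> where "\<tau> = Complex 0 y"
      have t: "\<tau> \<in> uhp" "Im \<tau> \<ge> 1 / 2" using y by (auto simp: \<tau>_def)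
      have "N \<tau> * eta_prod ys \<tau> = - (D \<tau> * eta_prod xs \<tau>)" using plus t(1) by (simp add: eq_neg_iff_add_eq_0)
      then have "norm (N \<tau> * eta_prod ys \<tau> - D \<tau> * eta_prod xs \<tau>) = 2 * (norm (D \<tau>) * norm (eta_prod xs \<tau>))"
        by (metis diff_minus_eq_add minus_diff_eq mult_2 norm_minus_cancel norm_mult norm_numeral)
      then have "2 * (norm (D \<tau>) * norm (eta_prod xs \<tau>)) \<le> K * exp (- (2 * pi * n0) * y)"
        using K[OF t(2)] by (simp add: \<tau>_def)
      moreover have "1 * norm (eta_prod xs \<tau>) \<le> norm (D \<tau>) * norm (eta_prod xs \<tau>)"
        using Dlow[OF y] by (intro mult_right_mono) (auto simp: \<tau>_def)
      moreover have "c0 ^ L * exp (- pi / 12 * S * y) \<le> norm (eta_prod xs \<tau>)"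
        using low[OF pos(2) y] by (simp add: \<tau>_def S_def lxs)
      ultimately have "2 * (c0 ^ L * exp (- pi / 12 * S * y)) \<le> K * exp (- (2 * pi * n0) * y)" by linarith
      then have "2 * (c0 ^ L * exp (- pi / 12 * S * y)) * exp ((2 * pi * n0) * y) \<le> K * exp (- (2 * pi * n0) * y) * exp ((2 * pi * n0) * y)"
        by (intro mult_right_mono) auto
      also have "K * exp (- (2 * pi * n0) * y) * exp ((2 * pi * n0) * y) = K"
        by (simp add: mult.assoc exp_add[symmetric])
      also have "2 * (c0 ^ L * exp (- pi / 12 * S * y)) * exp ((2 * pi * n0) * y) = 2 * c0 ^ L * (exp (- pi / 12 * S * y) * exp ((2 * pi * n0) * y))"
        by (simp only: mult_ac)
      also have "exp (- pi / 12 * S * y) * exp ((2 * pi * n0) * y) = exp (\<epsilon> * y)"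
        unfolding exp_add[symmetric] by (simp add: \<epsilon>_def algebra_simps)
      finally show ?thesis .
    qed
    define y where "y = max 1 (K / (2 * c0 ^ L * \<epsilon>))"
    have "K \<le> 2 * c0 ^ L * (\<epsilon> * y)"
    proof -
      have "K / (2 * c0 ^ L * \<epsilon>) \<le> y" by (simp add: y_def)
      then show ?thesis using c0 \<open>\<epsilon> > 0\<close> by (simp add: field_simps)
    qed
    also have "\<dots> < 2 * c0 ^ L * exp (\<epsilon> * y)"
      using c0 exp_ge_add_one_self[of "\<epsilon> * y"] by (intro mult_strict_left_mono) (linarith, simp)
    also have "\<dots> \<le> K" by (rule bound) (simp add: y_def)
    finally show False by simp
  qed
  ultimately show ?thesis using z by auto
qed

section \<open>Truncated power series\<close>

primrec list_poly :: "int list \<Rightarrow> complex \<Rightarrow> complex" where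
  "list_poly [] q = 0"
| "list_poly (a # p) q = of_int a + q * list_poly p q"

text \<open>Truncated power series are multiplied by \<open>code_simp\<close>. Every \<open>if\<close> on the way slows the rewriting
  down considerably, hence the unary shift by a list of zeros, which itself is built by doubling.\<close>
fun add_trunc :: "int \<Rightarrow> int list \<Rightarrow> int list \<Rightarrow> int list" where
  "add_trunc c [] ys = ys"
| "add_trunc c (x # xs) [] = []"
| "add_trunc c (x # xs) (y # ys) = (y + c * x) # add_trunc c xs ys"

text \<open>The accumulator keeps its length, and this length is the order of truncation: whatever
  runs past its end is dropped.\<close>

fun shift_add :: "int \<Rightarrow> int list \<Rightarrow> int list \<Rightarrow> int list \<Rightarrow> int list" where
  "shift_add c [] p ys = add_trunc c p ys"
| "shift_add c (z # zs) p [] = []"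
| "shift_add c (z # zs) p (y # ys) = y # shift_add c zs p ys"

definition double_zeros :: "bool \<Rightarrow> int list \<Rightarrow> int list" where
  "double_zeros b z = (if b then z @ z else 0 # z @ z)"

function zeros :: "int \<Rightarrow> int list" where
  "zeros k = (if k \<le> 0 then [] else double_zeros (even k) (zeros (k div 2)))"
  by auto
termination by (relation "Wellfounded.measure nat") auto

declare zeros.simps [simp del]

primrec sparse_mult :: "(int \<times> int) list \<Rightarrow> int list \<Rightarrow> int list \<Rightarrow> int list" where
  "sparse_mult [] p r = r"
| "sparse_mult (t # ts) p r = shift_add (fst t) (zeros (snd t)) p (sparse_mult ts p r)"

definition sparse_poly :: "(int \<times> int) list \<Rightarrow> complex \<Rightarrow> complex" where
  "sparse_poly ts q = (\<Sum>t\<leftarrow>ts. of_int (fst t) * q ^ nat (snd t))"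

text \<open>Equality modulo q^n as an analytic error bound, so that computed lists act directly on
  functions. The radius 1/2 suffices because |q| \<le> exp(-pi) when Im tau \<ge> 1/2.\<close>

definition agrees :: "int \<Rightarrow> int list \<Rightarrow> (complex \<Rightarrow> complex) \<Rightarrow> bool" where
  "agrees n p f \<longleftrightarrow> (\<exists>K. \<forall>q. norm q \<le> 1 / 2 \<longrightarrow> norm (f q - list_poly p q) \<le> K * norm q ^ nat n)"

definition near_sparse :: "int \<Rightarrow> (int \<times> int) list \<Rightarrow> (complex \<Rightarrow> complex) \<Rightarrow> bool" where
  "near_sparse n ts g \<longleftrightarrow> (\<exists>K. \<forall>q. norm q \<le> 1 / 2 \<longrightarrow> norm (g q - sparse_poly ts q) \<le> K * norm q ^ nat n)"

lemma length_add_trunc [simp]: "length (add_trunc c p r) = length r"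
  by (induction c p r rule: add_trunc.induct) auto

lemma length_shift_add [simp]: "length (shift_add c zs p r) = length r"
  by (induction c zs p r rule: shift_add.induct) auto

lemma length_sparse_mult [simp]: "length (sparse_mult ts p r) = length r"
  by (induction ts) auto

lemma zeros_eq: "zeros k = replicate (nat k) 0"
proof (induction k rule: zeros.induct)
  case (1 k)
  show ?case
  proof (cases "k \<le> 0")
    case True
    then show ?thesis by (simp add: zeros.simps[of k])
  next
    case False
    define h where "h = nat (k div 2)"
    have h: "zeros (k div 2) = replicate h 0" using 1 False by (simp add: h_def)
    show ?thesis
    proof (cases "even k")
      case True
      then have "nat k = h + h" using False by (auto simp: h_def elim!: evenE)
      then show ?thesis using True False h by (subst zeros.simps) (simp add: double_zeros_def replicate_add)
    next
      case odd: False
      then have "nat k = Suc (h + h)" using False by (auto simp: h_def elim!: oddE)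
      then show ?thesis using odd False h by (subst zeros.simps) (simp add: double_zeros_def replicate_add)
    qed
  qed
qed

lemma length_zeros [simp]: "length (zeros k) = nat k"
  by (simp add: zeros_eq)

lemma list_poly_zeros [simp]: "list_poly (zeros k) q = 0"
proof -
  have "list_poly (replicate m 0) q = 0" for m by (induction m) auto
  then show ?thesis by (simp add: zeros_eq)
qed

lemma list_poly_bound: "\<exists>K\<ge>0. \<forall>q. norm q \<le> 1 \<longrightarrow> norm (list_poly p q) \<le> K"
proof (induction p)
  case (Cons a p)
  then obtain K where K: "K \<ge> 0" "\<And>q. norm q \<le> 1 \<Longrightarrow> norm (list_poly p q) \<le> K" by blast
  have "norm (list_poly (a # p) q) \<le> \<bar>of_int a\<bar> + K" if q: "norm q \<le> 1" for q
  proof -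
    have "norm (q * list_poly p q) \<le> 1 * K" unfolding norm_mult using q K by (intro mult_mono) auto
    then show ?thesis using norm_triangle_ineq[of "of_int a" "q * list_poly p q"] by simp
  qed
  then show ?case using K(1) by (intro exI[of _ "\<bar>of_int a\<bar> + K"]) auto
qed auto

lemma norm_mult_power_Suc_le:
  fixes w q :: complex
  shows "norm w \<le> K * norm q ^ n \<Longrightarrow> norm (q * w) \<le> K * norm q ^ Suc n"
  using mult_left_mono[of "norm w" "K * norm q ^ n" "norm q"] by (simp add: norm_mult mult_ac)

text \<open>Each entry of the accumulator strips off one factor q, and the part dropped at the end
  is a polynomial, bounded on the unit disc.\<close>

lemma add_trunc_error:
  "\<exists>K. \<forall>q. norm q \<le> 1 \<longrightarrow> norm (list_poly r q + of_int c * list_poly p q - list_poly (add_trunc c p r) q) \<le> K * norm q ^ length r"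
proof (induction c p r rule: add_trunc.induct)
  case (1 c r)
  then show ?case by (intro exI[of _ 0]) auto
next
  case (2 c x xs)
  obtain K where K: "K \<ge> 0" "\<And>q. norm q \<le> 1 \<Longrightarrow> norm (list_poly (x # xs) q) \<le> K" using list_poly_bound by blast
  have "norm (of_int c * list_poly (x # xs) q) \<le> \<bar>of_int c\<bar> * K" if q: "norm q \<le> 1" for q
    unfolding norm_mult using q K by (intro mult_mono) auto
  then show ?case by (intro exI[of _ "\<bar>of_int c\<bar> * K"]) auto
next
  case (3 c x xs y ys)
  then obtain K where K: "\<And>q. norm q \<le> 1 \<Longrightarrow> norm (list_poly ys q + of_int c * list_poly xs q - list_poly (add_trunc c xs ys) q) \<le> K * norm q ^ length ys"
    by blast
  have "list_poly (y # ys) q + of_int c * list_poly (x # xs) q - list_poly (add_trunc c (x # xs) (y # ys)) q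
    = q * (list_poly ys q + of_int c * list_poly xs q - list_poly (add_trunc c xs ys) q)" for q by (simp add: algebra_simps)
  then show ?case using norm_mult_power_Suc_le[OF K] by (metis length_Cons)
qed

lemma shift_add_error:
  "\<exists>K. \<forall>q. norm q \<le> 1 \<longrightarrow>
     norm (list_poly r q + of_int c * q ^ length zs * list_poly p q - list_poly (shift_add c zs p r) q) \<le> K * norm q ^ length r"
proof (induction c zs p r rule: shift_add.induct)
  case (1 c p ys)
  then show ?case using add_trunc_error[of ys c p] by simp
next
  case (2 c z zs p)
  obtain K where K: "K \<ge> 0" "\<And>q. norm q \<le> 1 \<Longrightarrow> norm (list_poly p q) \<le> K" using list_poly_bound by blast
  have "norm (of_int c * q ^ length (z # zs) * list_poly p q) \<le> \<bar>of_int c\<bar> * 1 * K" if q: "norm q \<le> 1" for q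
    unfolding norm_mult norm_power using q K by (intro mult_mono power_le_one) auto
  then show ?case by (intro exI[of _ "\<bar>of_int c\<bar> * 1 * K"]) auto
next
  case (3 c z zs p y ys)
  then obtain K where K: "\<And>q. norm q \<le> 1 \<Longrightarrow> norm (list_poly ys q + of_int c * q ^ length zs * list_poly p q - list_poly (shift_add c zs p ys) q) \<le> K * norm q ^ length ys"
    by blast
  have "list_poly (y # ys) q + of_int c * q ^ length (z # zs) * list_poly p q - list_poly (shift_add c (z # zs) p (y # ys)) q
    = q * (list_poly ys q + of_int c * q ^ length zs * list_poly p q - list_poly (shift_add c zs p ys) q)" for q by (simp add: algebra_simps)
  then show ?case using norm_mult_power_Suc_le[OF K] by (metis length_Cons)
qed

lemma agrees_shift_add:
  assumes r: "agrees n r g" and p: "agrees n p f" and l: "length r = nat n"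
  shows "agrees n (shift_add c (zeros k) p r) (\<lambda>q. g q + of_int c * q ^ nat k * f q)"
proof -
  obtain K1 where K1: "\<And>q. norm q \<le> 1 / 2 \<Longrightarrow> norm (g q - list_poly r q) \<le> K1 * norm q ^ nat n" using r by (auto simp: agrees_def)
  obtain K2 where K2: "\<And>q. norm q \<le> 1 / 2 \<Longrightarrow> norm (f q - list_poly p q) \<le> K2 * norm q ^ nat n" using p by (auto simp: agrees_def)
  obtain K3 where K3: "\<And>q. norm q \<le> 1 \<Longrightarrow> norm (list_poly r q + of_int c * q ^ nat k * list_poly p q - list_poly (shift_add c (zeros k) p r) q) \<le> K3 * norm q ^ nat n"
    using shift_add_error[of r c "zeros k" p] l by auto
  have "norm (g q + of_int c * q ^ nat k * f q - list_poly (shift_add c (zeros k) p r) q) \<le> (K1 + \<bar>of_int c\<bar> * K2 + K3) * norm q ^ nat n"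
    if q: "norm q \<le> 1 / 2" for q
  proof -
    have "norm (of_int c * q ^ nat k * (f q - list_poly p q)) \<le> \<bar>of_int c\<bar> * 1 * (K2 * norm q ^ nat n)"
      unfolding norm_mult norm_power using q K2[OF q] by (intro mult_mono) (auto intro: power_le_one)
    moreover have "norm (list_poly r q + of_int c * q ^ nat k * list_poly p q - list_poly (shift_add c (zeros k) p r) q) \<le> K3 * norm q ^ nat n"
      using q by (intro K3) simp
    moreover have "g q + of_int c * q ^ nat k * f q - list_poly (shift_add c (zeros k) p r) q
       = (g q - list_poly r q) + of_int c * q ^ nat k * (f q - list_poly p q) + (list_poly r q + of_int c * q ^ nat k * list_poly p q - list_poly (shift_add c (zeros k) p r) q)"
      by (simp add: algebra_simps)
    ultimately have "norm (g q + of_int c * q ^ nat k * f q - list_poly (shift_add c (zeros k) p r) q)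
        \<le> K1 * norm q ^ nat n + \<bar>of_int c\<bar> * 1 * (K2 * norm q ^ nat n) + K3 * norm q ^ nat n"
      using K1[OF q] by (smt (verit) norm_triangle_ineq)
    then show ?thesis by (simp add: algebra_simps)
  qed
  then show ?thesis unfolding agrees_def by blast
qed

lemma agrees_zeros: "agrees n (zeros n) (\<lambda>_. 0)"
  by (auto simp: agrees_def intro!: exI[of _ 0])

lemma agrees_sparse_mult: "agrees n p f \<Longrightarrow> agrees n (sparse_mult ts p (zeros n)) (\<lambda>q. sparse_poly ts q * f q)"
proof (induction ts)
  case (Cons t ts)
  have "agrees n (shift_add (fst t) (zeros (snd t)) p (sparse_mult ts p (zeros n))) (\<lambda>q. sparse_poly ts q * f q + of_int (fst t) * q ^ nat (snd t) * f q)"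
    by (rule agrees_shift_add) (use Cons in auto)
  then show ?case by (simp add: sparse_poly_def algebra_simps)
qed (simp add: sparse_poly_def agrees_zeros)

text \<open>Both errors are O(q^n), and each is multiplied by a factor bounded on the disc.\<close>

lemma agrees_mult:
  assumes p: "agrees n p f" and g: "near_sparse n ts g"
  shows "agrees n (sparse_mult ts p (zeros n)) (\<lambda>q. g q * f q)"
proof -
  obtain K1 where K1: "\<And>q. norm q \<le> 1 / 2 \<Longrightarrow> norm (sparse_poly ts q * f q - list_poly (sparse_mult ts p (zeros n)) q) \<le> K1 * norm q ^ nat n"
    using agrees_sparse_mult[OF p] by (auto simp: agrees_def)
  obtain K2 where K2: "\<And>q. norm q \<le> 1 / 2 \<Longrightarrow> norm (g q - sparse_poly ts q) \<le> K2 * norm q ^ nat n" using g by (auto simp: near_sparse_def)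
  obtain K3 where K3: "\<And>q. norm q \<le> 1 / 2 \<Longrightarrow> norm (f q - list_poly p q) \<le> K3 * norm q ^ nat n" using p by (auto simp: agrees_def)
  obtain K4 where K4: "K4 \<ge> 0" "\<And>q. norm q \<le> 1 \<Longrightarrow> norm (list_poly p q) \<le> K4" using list_poly_bound by blast
  have "norm (g q * f q - list_poly (sparse_mult ts p (zeros n)) q) \<le> (K1 + K2 * (\<bar>K3\<bar> + K4)) * norm q ^ nat n"
    if q: "norm q \<le> 1 / 2" for q
  proof -
    have "norm (f q - list_poly p q) \<le> \<bar>K3\<bar> * 1"
      by (rule order_trans[OF K3[OF q] mult_mono]) (use q in \<open>auto intro: power_le_one\<close>)
    moreover have "norm (list_poly p q) \<le> K4" using q by (intro K4) auto
    ultimately have f: "norm (f q) \<le> \<bar>K3\<bar> + K4" using norm_triangle_sub[of "f q" "list_poly p q"] by linarith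
    have "norm ((g q - sparse_poly ts q) * f q) \<le> (K2 * norm q ^ nat n) * (\<bar>K3\<bar> + K4)"
      unfolding norm_mult using K2[OF q] f by (intro mult_mono) (auto intro: order_trans[OF norm_ge_zero])
    moreover have "g q * f q - list_poly (sparse_mult ts p (zeros n)) q = (g q - sparse_poly ts q) * f q + (sparse_poly ts q * f q - list_poly (sparse_mult ts p (zeros n)) q)"
      by (simp add: algebra_simps)
    ultimately have "norm (g q * f q - list_poly (sparse_mult ts p (zeros n)) q) \<le> (K2 * norm q ^ nat n) * (\<bar>K3\<bar> + K4) + K1 * norm q ^ nat n"
      using K1[OF q] by (smt (verit) norm_triangle_ineq)
    then show ?thesis by (simp add: algebra_simps)
  qed
  then show ?thesis unfolding agrees_def by blast
qed

lemma agrees_one: "agrees n [1] (\<lambda>_. 1)"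
  by (auto simp: agrees_def intro!: exI[of _ 0])

lemma near_sparse_append:
  assumes "near_sparse n ts g" "near_sparse n us h"
  shows "near_sparse n (ts @ us) (\<lambda>q. g q + h q)"
proof -
  obtain K1 K2 where K1: "\<And>q. norm q \<le> 1 / 2 \<Longrightarrow> norm (g q - sparse_poly ts q) \<le> K1 * norm q ^ nat n"
    and K2: "\<And>q. norm q \<le> 1 / 2 \<Longrightarrow> norm (h q - sparse_poly us q) \<le> K2 * norm q ^ nat n" using assms by (auto simp: near_sparse_def)
  have "norm (g q + h q - sparse_poly (ts @ us) q) \<le> (K1 + K2) * norm q ^ nat n" if q: "norm q \<le> 1 / 2" for q
    using norm_triangle_ineq[of "g q - sparse_poly ts q" "h q - sparse_poly us q"] K1[OF q] K2[OF q]
    by (simp add: sparse_poly_def algebra_simps)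
  then show ?thesis unfolding near_sparse_def by blast
qed

lemma near_sparse_power: "near_sparse n [(1, int s)] (\<lambda>q. q ^ s)"
  by (auto simp: near_sparse_def sparse_poly_def intro!: exI[of _ 0])

text \<open>A term with exponent e \<ge> n is at most |q|^n 2^n (1/2)^e, so summability at q = 1/2
  alone controls the whole tail.\<close>

lemma near_sparse_series:
  fixes e s :: "'i \<Rightarrow> int"
  assumes sum: "(\<lambda>i. (1 / 2) ^ nat (e i) :: real) summable_on UNIV"
    and s: "\<And>i. \<bar>s i\<bar> \<le> 1" and e: "\<And>i. e i \<ge> 0" and xs: "distinct xs" "\<And>i. i \<notin> set xs \<Longrightarrow> e i \<ge> n"
  shows "near_sparse n (map (\<lambda>i. (s i, e i)) (filter (\<lambda>i. e i < n) xs)) (\<lambda>q. \<Sum>\<^sub>\<infinity>i. of_int (s i) * q ^ nat (e i))"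
proof -
  define F where "F = {i \<in> set xs. e i < n}"
  define t where "t q i = of_int (s i) * q ^ nat (e i)" for q :: complex and i
  define w where "w i = ((1 / 2) ^ nat (e i) :: real)" for i
  define K where "K = 2 ^ nat n * (\<Sum>\<^sub>\<infinity>i\<in>-F. w i)"
  have fin: "finite F" by (simp add: F_def)
  have sparse_poly: "sparse_poly (map (\<lambda>i. (s i, e i)) (filter (\<lambda>i. e i < n) xs)) q = sum (t q) F" for q
    unfolding sparse_poly_def map_map o_def fst_conv snd_conv t_def[symmetric] F_def
    using sum_list_distinct_conv_sum_set[of "filter (\<lambda>i. e i < n) xs" "t q"] xs(1) by simp
  have s1: "\<bar>real_of_int (s i)\<bar> \<le> 1" for i using s[of i] by (simp flip: of_int_abs)
  have wF: "w summable_on - F" using sum summable_on_subset_banach[of w UNIV "- F"] by (simp add: w_def[abs_def])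
  have "norm ((\<Sum>\<^sub>\<infinity>i. t q i) - sum (t q) F) \<le> K * norm q ^ nat n" if q: "norm q \<le> 1 / 2" for q
  proof -
    have tw: "norm (t q i) \<le> w i" for i
    proof -
      have "norm (t q i) \<le> 1 * (1 / 2) ^ nat (e i)"
        unfolding t_def norm_mult norm_power using q s1[of i] by (intro mult_mono power_mono) auto
      then show ?thesis by (simp add: w_def)
    qed
    have tw': "norm (t q i) \<le> (2 ^ nat n * norm q ^ nat n) * w i" if i: "i \<in> - F" for i
    proof -
      have "n \<le> e i" using i xs(2)[of i] by (auto simp: F_def)
      then obtain m where m: "nat (e i) = nat n + m" using le_Suc_ex[OF nat_mono] by blast
      have "norm (t q i) \<le> 1 * (norm q ^ nat n * (1 / 2) ^ m)"
        unfolding t_def norm_mult norm_power m power_add using q s1[of i] by (intro mult_mono power_mono) auto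
      also have "\<dots> = (2 ^ nat n * norm q ^ nat n) * w i"
        by (simp add: w_def m power_add power_one_over)
      finally show ?thesis .
    qed
    have ts: "t q summable_on UNIV"
      by (rule abs_summable_summable[OF Infinite_Sum.abs_summable_on_comparison_test'[OF sum]]) (use tw in \<open>auto simp: w_def\<close>)
    have tF: "t q summable_on - F" using ts by (rule summable_on_subset_banach) simp
    have "(\<Sum>\<^sub>\<infinity>i\<in>F \<union> - F. t q i) = (\<Sum>\<^sub>\<infinity>i\<in>F. t q i) + (\<Sum>\<^sub>\<infinity>i\<in>-F. t q i)"
      using fin tF by (intro infsum_Un_disjoint) auto
    then have eq: "(\<Sum>\<^sub>\<infinity>i. t q i) - sum (t q) F = (\<Sum>\<^sub>\<infinity>i\<in>-F. t q i)" using fin by simp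
    have "norm (\<Sum>\<^sub>\<infinity>i\<in>-F. t q i) \<le> (2 ^ nat n * norm q ^ nat n) * (\<Sum>\<^sub>\<infinity>i\<in>-F. w i)"
      by (rule norm_infsum_le[OF has_sum_infsum[OF tF] has_sum_cmult_right[OF has_sum_infsum[OF wF]]]) (use tw' in auto)
    then show ?thesis unfolding eq by (simp add: K_def mult_ac)
  qed
  then show ?thesis unfolding near_sparse_def sparse_poly t_def[symmetric] by blast
qed

text \<open>The terms below \<open>q\<^sup>n\<close> of the pentagonal series of \<open>eulerE (q\<^sup>\<delta>)\<close> with index at most \<open>J\<close>, and of \<open>c\<close>
  times a theta series with \<open>\<bar>x\<bar> \<le> X\<close> and \<open>\<bar>y\<bar> \<le> Y\<close>.\<close>
definition euler_terms :: "int \<Rightarrow> int \<Rightarrow> int \<Rightarrow> (int \<times> int) list" where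
  "euler_terms n J \<delta> = map (\<lambda>j. (if even j then 1 else -1, \<delta> * ((3 * j * j - j) div 2)))
     (filter (\<lambda>j. \<delta> * ((3 * j * j - j) div 2) < n) [-J..J])"

definition theta_terms :: "int \<Rightarrow> int \<Rightarrow> int \<Rightarrow> int \<Rightarrow> int \<Rightarrow> int \<Rightarrow> int \<Rightarrow> (int \<times> int) list" where
  "theta_terms n c X Y A B C = map (\<lambda>p. (c, case p of (x, y) \<Rightarrow> Qf A B C x y))
     (filter (\<lambda>p. (case p of (x, y) \<Rightarrow> Qf A B C x y) < n) (List.product [-X..X] [-Y..Y]))"

section \<open>Truncations of the pentagonal and theta series\<close>

lemma pent_exponent: "(3 * j * j - j) div 2 = int (tri_plus j + 2 * tri_minus j)"
proof -
  have "2 * int (tri_plus j + 2 * tri_minus j) = 3 * j * j - j" using two_tri_plus[of j] two_tri_minus[of j] by (simp add: algebra_simps)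
  then show ?thesis by simp
qed

text \<open>This makes every index beyond J irrelevant as soon as n \<le> (J + 1)^2.\<close>

lemma pent_exponent_ge: "(j :: int)\<^sup>2 \<le> (3 * j * j - j) div 2"
proof -
  have "j \<le> j * j" using self_le_power[of "\<bar>j\<bar>" 2] by (cases "j = 0") (simp, simp add: power2_eq_square, linarith)
  then have "2 * j\<^sup>2 \<le> 3 * j * j - j" by (simp add: power2_eq_square)
  then show ?thesis by simp
qed

lemma eulerE_near_sparse:
  assumes d: "\<delta> > 0" and J: "n \<le> (J + 1)\<^sup>2" "J \<ge> 0"
  shows "near_sparse n (euler_terms n J (int \<delta>)) (\<lambda>q. eulerE (q ^ \<delta>))"
proof -
  define e where "e j = int \<delta> * ((3 * j * j - j) div 2)" for j
  define s where "s j = (if even j then 1 else - 1 :: int)" for j :: int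
  have ege: "j\<^sup>2 \<le> e j" for j
  proof -
    have "1 * j\<^sup>2 \<le> int \<delta> * ((3 * j * j - j) div 2)" using pent_exponent_ge[of j] d by (intro mult_mono) auto
    then show ?thesis by (simp add: e_def)
  qed
  have "near_sparse n (map (\<lambda>i. (s i, e i)) (filter (\<lambda>i. e i < n) [-J..J])) (\<lambda>q. \<Sum>\<^sub>\<infinity>i. of_int (s i) * q ^ nat (e i))"
  proof (rule near_sparse_series)
    have "\<bar>j\<bar> \<le> e j" for j
    proof -
      have "\<bar>j\<bar> \<le> \<bar>j\<bar>\<^sup>2" using self_le_power[of "\<bar>j\<bar>" 2] by (cases "j = 0") auto
      then show ?thesis using ege[of j] by simp
    qed
    then have "(1 / 2 :: real) ^ nat (e j) \<le> (1 / 2) ^ nat \<bar>j\<bar>" for j by (intro power_decreasing nat_mono) auto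
    moreover have "(\<lambda>j. (1 / 2 :: real) ^ nat \<bar>j\<bar>) summable_on UNIV" by (rule summable_on_power_abs) auto
    ultimately show "(\<lambda>j. (1 / 2 :: real) ^ nat (e j)) summable_on UNIV"
      by (auto intro: summable_on_comparison_test)
    show "e j \<ge> 0" for j using ege[of j] by (rule order_trans[OF zero_le_power2])
    show "n \<le> e j" if "j \<notin> set [-J..J]" for j
    proof -
      have "J + 1 \<le> \<bar>j\<bar>" using that by auto
      then have "(J + 1)\<^sup>2 \<le> \<bar>j\<bar>\<^sup>2" using J(2) by (intro power_mono) auto
      then show ?thesis using J(1) ege[of j] by simp
    qed
  qed (auto simp: s_def)
  moreover have "(\<Sum>\<^sub>\<infinity>i. of_int (s i) * q ^ nat (e i)) = eulerE (q ^ \<delta>)" if q: "norm q \<le> 1 / 2" for q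
  proof -
    have "norm (q ^ \<delta>) < 1" using norm_power_less_1[of q \<delta>] q d by simp
    from pentagonal[OF this] show ?thesis
    proof (rule subst, intro infsum_cong)
      fix j :: int
      have minus: "(- u) ^ m * (- v) ^ l = (- 1) ^ (m + l) * (u ^ m * v ^ l)" for u v :: complex and m l
        by (simp add: power_minus[of u] power_minus[of v] power_add)
      have "(- (q ^ \<delta>)) ^ tri_plus j * (- ((q ^ \<delta>)\<^sup>2)) ^ tri_minus j = (- 1) ^ (tri_plus j + tri_minus j) * q ^ (\<delta> * (tri_plus j + 2 * tri_minus j))"
        unfolding minus by (simp add: power_add power_mult[symmetric] algebra_simps)
      moreover have "(- 1 :: complex) ^ (tri_plus j + tri_minus j) = of_int (s j)"
        unfolding tri_plus_tri_minus s_def by (auto simp: even_nat_iff uminus_power_if)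
      moreover have "nat (e j) = \<delta> * (tri_plus j + 2 * tri_minus j)"
        unfolding e_def pent_exponent of_nat_mult[symmetric] nat_int ..
      ultimately show "of_int (s j) * q ^ nat (e j) = jacobi_term (- (q ^ \<delta>)) (- ((q ^ \<delta>)\<^sup>2)) j" by (simp add: jacobi_term_def)
    qed
  qed
  ultimately show ?thesis by (simp add: near_sparse_def euler_terms_def e_def s_def)
qed

definition form_series :: "int \<Rightarrow> int \<Rightarrow> int \<Rightarrow> complex \<Rightarrow> complex" where
  "form_series A B C q = (\<Sum>\<^sub>\<infinity>(x, y). q ^ nat (Qf A B C x y))"

context pos_form
begin

lemma Qf_nonneg: "Qf A B C x y \<ge> 0"
proof -
  have "A * Qf A B C x y = (A * x + B * y)\<^sup>2 + k * y\<^sup>2" unfolding disc[symmetric] Qf_def by (simp add: power2_eq_square algebra_simps)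
  then have "A * Qf A B C x y \<ge> 0" using k by simp
  then show ?thesis using A by (simp add: zero_le_mult_iff)
qed

text \<open>Completing the square; this and its mirror image justify the rectangles of lattice
  points in \<open>form_box\<close>.\<close>

lemma Qf_snd_le: "k * y\<^sup>2 \<le> A * Qf A B C x y"
proof -
  have "A * Qf A B C x y = (A * x + B * y)\<^sup>2 + k * y\<^sup>2" unfolding disc[symmetric] Qf_def by (simp add: power2_eq_square algebra_simps)
  then show ?thesis by simp
qed

lemma Qf_fst_le: "k * x\<^sup>2 \<le> C * Qf A B C x y"
proof -
  have "C * Qf A B C x y = (C * y + B * x)\<^sup>2 + k * x\<^sup>2" unfolding disc[symmetric] Qf_def by (simp add: power2_eq_square algebra_simps)
  then show ?thesis by simp
qed

lemma ee_Qf: "ee (of_int (Qf A B C x y) * \<tau>) = ee \<tau> ^ nat (Qf A B C x y)"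
  using ee_of_nat_mult[of "nat (Qf A B C x y)" \<tau>] Qf_nonneg[of x y] by simp

lemma form_theta_eq_form_series: "form_theta A B C \<tau> = form_series A B C (ee \<tau>)"
  unfolding form_theta_def form_series_def ee_Qf ..

lemma norm_summable: "Im \<tau> > 0 \<Longrightarrow> (\<lambda>(x, y). norm (ee \<tau>) ^ nat (Qf A B C x y)) summable_on UNIV"
  using abs_summable[OF Re_gauss, of \<tau>] unfolding ee_eq_exp_gauss[symmetric] ee_Qf norm_power .

lemma form_series_near_sparse:
  assumes c: "\<bar>c\<bar> \<le> 1" and X: "X \<ge> 0" "C * n \<le> k * (X + 1)\<^sup>2" and Y: "Y \<ge> 0" "A * n \<le> k * (Y + 1)\<^sup>2"
  shows "near_sparse n (theta_terms n c X Y A B C) (\<lambda>q. of_int c * form_series A B C q)"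
proof -
  define e where "e = (\<lambda>(x, y). Qf A B C x y)"
  have "near_sparse n (map (\<lambda>i. (c, e i)) (filter (\<lambda>i. e i < n) (List.product [-X..X] [-Y..Y]))) (\<lambda>q. \<Sum>\<^sub>\<infinity>i. of_int c * q ^ nat (e i))"
  proof (rule near_sparse_series)
    \<comment> \<open>The point with |e(tau)| = 1/2, at which summability on the half plane gives
      the summability required at q = 1/2.\<close>
    define \<tau> where "\<tau> = Complex 0 (ln 2 / (2 * pi))"
    have "norm (ee \<tau>) = 1 / 2" by (simp add: norm_ee \<tau>_def exp_minus)
    then show "(\<lambda>i. (1 / 2 :: real) ^ nat (e i)) summable_on UNIV"
      using norm_summable[of \<tau>] by (simp only: e_def) (simp add: \<tau>_def case_prod_unfold)
    show "distinct (List.product [-X..X] [-Y..Y])" by (simp add: distinct_product)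
    show "0 \<le> e i" for i by (simp add: e_def Qf_nonneg split: prod.split)
    show "n \<le> e i" if i: "i \<notin> set (List.product [-X..X] [-Y..Y])" for i
    proof -
      obtain x y where xy: "i = (x, y)" by (cases i)
      then consider "X + 1 \<le> \<bar>x\<bar>" | "Y + 1 \<le> \<bar>y\<bar>" using i by fastforce
      then show ?thesis
      proof cases
        case 1
        then have "k * (X + 1)\<^sup>2 \<le> k * \<bar>x\<bar>\<^sup>2" using X(1) k by (intro mult_left_mono power_mono) auto
        then have "C * n \<le> C * e i" using X(2) Qf_fst_le[of x y] by (simp add: xy e_def)
        then show ?thesis using C by simp
      next
        case 2
        then have "k * (Y + 1)\<^sup>2 \<le> k * \<bar>y\<bar>\<^sup>2" using Y(1) k by (intro mult_left_mono power_mono) auto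
        then have "A * n \<le> A * e i" using Y(2) Qf_snd_le[of y x] by (simp add: xy e_def)
        then show ?thesis using A by simp
      qed
    qed
  qed (use c in auto)
  then show ?thesis unfolding infsum_cmult_right' by (simp add: theta_terms_def e_def form_series_def case_prod_unfold)
qed

text \<open>The point q = 0 is not a value of \<open>ee\<close>, so the final identity is checked
  there by constant terms.\<close>

lemma form_series_0: "form_series A B C 0 = 1"
proof -
  have "Qf A B C x y = 0 \<longleftrightarrow> (x, y) = (0, 0)" for x y
  proof
    assume "Qf A B C x y = 0"
    then have "k * y\<^sup>2 \<le> 0" "k * x\<^sup>2 \<le> 0" using Qf_snd_le[of y x] Qf_fst_le[of x y] by auto
    then show "(x, y) = (0, 0)" using k by (auto simp: mult_le_0_iff)
  qed (simp add: Qf_def)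
  then have "(0 :: complex) ^ nat (Qf A B C x y) = (if (x, y) = (0, 0) then 1 else 0)" for x y
    using Qf_nonneg[of x y] by (auto simp: power_0_left)
  then have "form_series A B C 0 = (\<Sum>\<^sub>\<infinity>p. if p = (0 :: int, 0 :: int) then 1 else 0 :: complex)" by (simp add: form_series_def case_prod_unfold prod_eq_iff)
  also have "\<dots> = (\<Sum>\<^sub>\<infinity>p\<in>{(0 :: int, 0 :: int)}. 1)" by (rule infsum_cong_neutral) auto
  finally show ?thesis by simp
qed

text \<open>On the imaginary axis all terms are positive and the origin contributes 1. This gives
  the lower bound on the denominator that decides the sign.\<close>

lemma form_theta_imaginary:
  assumes y: "y > 0"
  obtains r where "r \<ge> 1" "form_theta A B C (Complex 0 y) = of_real r"
proof -
  define \<tau> where "\<tau> = Complex 0 y"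
  define r where "r = (\<lambda>(u, v). exp (- 2 * pi * y) ^ nat (Qf A B C u v))"
  have "ee \<tau> = of_real (exp (- 2 * pi * y))" by (simp add: ee_def \<tau>_def exp_of_real[symmetric] complex_eq_iff mult_ac Complex_eq)
  then have eq: "(\<lambda>(u, v). ee (of_int (Qf A B C u v) * \<tau>)) = (\<lambda>p. of_real (r p))"
    by (simp add: ee_Qf r_def case_prod_unfold)
  have "norm (ee \<tau>) = exp (- 2 * pi * y)" by (simp add: norm_ee \<tau>_def)
  then have rs: "r summable_on UNIV" using norm_summable[of \<tau>] y by (simp only: r_def) (simp add: \<tau>_def)
  have "form_theta A B C \<tau> = (\<Sum>\<^sub>\<infinity>p. complex_of_real (r p))" unfolding form_theta_def eq ..
  also have "\<dots> = of_real (infsum r UNIV)" by (rule infsumI[OF has_sum_of_real[OF has_sum_infsum[OF rs]]])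
  finally have "form_theta A B C \<tau> = of_real (infsum r UNIV)" .
  moreover have "infsum r {(0, 0)} \<le> infsum r UNIV" using rs by (intro infsum_mono_neutral) (auto simp: r_def)
  then have "1 \<le> infsum r UNIV" by (simp add: r_def Qf_def)
  ultimately show thesis by (intro that) (auto simp: \<tau>_def)
qed

end

primrec euler_prod :: "int \<Rightarrow> int \<Rightarrow> int list \<Rightarrow> int list \<Rightarrow> int list" where
  "euler_prod n J [] p = p"
| "euler_prod n J (\<delta> # ds) p = sparse_mult (euler_terms n J \<delta>) (euler_prod n J ds p) (zeros n)"

lemma agrees_euler_prod:
  assumes "agrees n p f" "\<forall>\<delta>\<in>set ds. \<delta> > 0" "n \<le> (J + 1)\<^sup>2" "J \<ge> 0"
  shows "agrees n (euler_prod n J (map int ds) p) (\<lambda>q. (\<Prod>\<delta>\<leftarrow>ds. eulerE (q ^ \<delta>)) * f q)"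
  using assms(2)
proof (induction ds)
  case (Cons \<delta> ds)
  have "agrees n (sparse_mult (euler_terms n J (int \<delta>)) (euler_prod n J (map int ds) p) (zeros n)) (\<lambda>q. eulerE (q ^ \<delta>) * ((\<Prod>\<delta>\<leftarrow>ds. eulerE (q ^ \<delta>)) * f q))"
    using Cons assms(3,4) by (intro agrees_mult eulerE_near_sparse) auto
  then show ?case by (simp add: mult_ac)
qed (use assms(1) in simp)

lemma eta_prod_eulerE:
  assumes t: "Im \<tau> > 0" and "\<forall>\<delta>\<in>set ds. \<delta> > 0"
  shows "eta_prod ds \<tau> = ee (of_nat (sum_list ds) * \<tau> / 24) * (\<Prod>\<delta>\<leftarrow>ds. eulerE (ee \<tau> ^ \<delta>))"
  using assms(2)
proof (induction ds)
  case (Cons \<delta> ds)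
  have "eta (of_nat \<delta> * \<tau>) = ee (of_nat \<delta> * \<tau> / 24) * eulerE (ee \<tau> ^ \<delta>)"
    using eta_eulerE[of "of_nat \<delta> * \<tau>"] t Cons.prems by (simp add: ee_of_nat_mult)
  moreover have "of_nat (sum_list (\<delta> # ds)) * \<tau> / 24 = of_nat \<delta> * \<tau> / 24 + of_nat (sum_list ds) * \<tau> / 24"
    by (simp add: field_simps)
  then have "ee (of_nat (sum_list (\<delta> # ds)) * \<tau> / 24) = ee (of_nat \<delta> * \<tau> / 24) * ee (of_nat (sum_list ds) * \<tau> / 24)"
    by (simp only: ee_add)
  ultimately show ?case using Cons by (simp only: eta_prod_simps list.map prod_list.Cons) (simp add: mult_ac)
qed simp

lemma agrees_unique:
  assumes "agrees n p f" "agrees n p g"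
  obtains K where "\<And>q. norm q \<le> 1 / 2 \<Longrightarrow> norm (f q - g q) \<le> K * norm q ^ nat n"
proof -
  obtain K1 K2 where K1: "\<And>q. norm q \<le> 1 / 2 \<Longrightarrow> norm (f q - list_poly p q) \<le> K1 * norm q ^ nat n"
    and K2: "\<And>q. norm q \<le> 1 / 2 \<Longrightarrow> norm (g q - list_poly p q) \<le> K2 * norm q ^ nat n" using assms by (auto simp: agrees_def)
  have "norm (f q - g q) \<le> (K1 + K2) * norm q ^ nat n" if q: "norm q \<le> 1 / 2" for q
    using norm_triangle_ineq4[of "f q - list_poly p q" "g q - list_poly p q"] K1[OF q] K2[OF q] by (simp add: distrib_right)
  then show thesis by (rule that)
qed

lemma form_theta_automorphy_nonzero:
  assumes k: "k > 0" and det: "a * d - b * c = 1" and c: "4 * k dvd c"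
  obtains \<kappa> where "\<kappa> \<noteq> 0" "\<And>A B C \<tau>. genform k A B C \<Longrightarrow> Im \<tau> > 0 \<Longrightarrow>
     form_theta A B C (mob a b c d \<tau>) = \<kappa> * (of_int c * \<tau> + of_int d) * form_theta A B C \<tau>"
proof -
  obtain \<kappa> where \<kappa>: "\<And>A B C \<tau>. genform k A B C \<Longrightarrow> Im \<tau> > 0 \<Longrightarrow>
     form_theta A B C (mob a b c d \<tau>) = \<kappa> * (of_int c * \<tau> + of_int d) * form_theta A B C \<tau>" by (rule form_theta_automorphy[OF k det c]) blast
  have "genform k 1 0 k" using k by (simp add: genform_def pos_form_def)
  from \<kappa>[OF this, of \<i>] have "\<kappa> \<noteq> 0"
    using form_theta_principal_nonzero[OF k, of "mob a b c d \<i>"] Im_mob_pos[OF det, of \<i>] by auto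
  then show thesis using \<kappa> by (rule that)
qed

text \<open>\<open>X\<close> and \<open>Y\<close> bound the lattice points at which the form takes a value below \<open>n\<close>.\<close>
definition form_box :: "int \<Rightarrow> int \<Rightarrow> int \<Rightarrow> int \<Rightarrow> int \<Rightarrow> int \<Rightarrow> int \<Rightarrow> bool" where
  "form_box k n X Y A B C \<longleftrightarrow> genform k A B C \<and> X \<ge> 0 \<and> C * n \<le> k * (X + 1)\<^sup>2 \<and> Y \<ge> 0 \<and> A * n \<le> k * (Y + 1)\<^sup>2"

lemma form_boxD:
  assumes "form_box k n X Y A B C"
  shows "pos_form A B C k" "genform k A B C" "\<bar>c\<bar> \<le> 1 \<Longrightarrow> near_sparse n (theta_terms n c X Y A B C) (\<lambda>q. of_int c * form_series A B C q)"
proof -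
  show p: "pos_form A B C k" "genform k A B C" using assms by (auto simp: form_box_def genform_def)
  show "near_sparse n (theta_terms n c X Y A B C) (\<lambda>q. of_int c * form_series A B C q)" if "\<bar>c\<bar> \<le> 1"
    by (rule pos_form.form_series_near_sparse[OF p(1) that]) (use assms in \<open>auto simp: form_box_def\<close>)
qed

lemma card_filter_upto: "card {u \<in> {0..<m}. P u} = length (filter P [0..m - 1])"
proof -
  have "{u \<in> {0..<m}. P u} = set (filter P [0..m - 1])" by auto
  then show ?thesis by (simp only: distinct_card[OF distinct_filter[OF distinct_upto]])
qed

lemma ee_surj:
  assumes "q \<noteq> 0" "norm q < 1"
  obtains \<tau> where "Im \<tau> > 0" "ee \<tau> = q"
proof
  define \<tau> where "\<tau> = Ln q / (2 * of_real pi * \<i>)"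
  show "ee \<tau> = q" using assms(1) by (simp add: ee_def \<tau>_def)
  then have "exp (- 2 * pi * Im \<tau>) < 1" using assms(2) by (simp only: norm_ee[symmetric])
  then show "Im \<tau> > 0" by (simp add: zero_less_mult_iff)
qed

text \<open>Reduces an identity to finitely many numerical conditions. The prefactor q^s balances
  the leading powers of the two eta products, which is the condition on the sums and implies their
  congruence modulo 12. The equations in \<open>lists\<close> separate integer from natural
  literals, so that the computed comparison matches \<open>check\<close> directly.\<close>

theorem theta_eulerE_identity:
  fixes k n J X1 X2 X3 X4 Y1 Y2 Y3 Y4 :: int and ys xs :: "nat list" and s :: nat
  assumes forms: "form_box k n X1 Y1 A1 B1 C1" "form_box k n X2 Y2 A2 B2 C2"
      "form_box k n X3 Y3 A3 B3 C3" "form_box k n X4 Y4 A4 B4 C4"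
    and J: "J \<ge> 0" "n \<le> (J + 1)\<^sup>2"
    and len: "length xs = length ys"
    and lev: "\<forall>\<delta>\<in>set (ys @ xs). \<delta> > 0 \<and> int \<delta> dvd 4 * k"
    and s: "s > 0" "sum_list xs = sum_list ys + 24 * s"
    and c2: "[(\<Sum>\<delta>\<leftarrow>ys. 4 * k div int \<delta>) = (\<Sum>\<delta>\<leftarrow>xs. 4 * k div int \<delta>)] (mod 12)"
    and n0: "int (sum_list xs) < 24 * n"
    and count: "(2 + int (length ys)) * k\<^sup>2 < n * int (length (filter (\<lambda>u. gcd u (4 * k) = 1) [0..4 * k - 1]))"
    and lists: "ysi = map int ys" "xsi = map int xs" "si = int s"
    and check: "euler_prod n J ysi (sparse_mult (theta_terms n 1 X1 Y1 A1 B1 C1 @ theta_terms n (-1) X2 Y2 A2 B2 C2) [1] (zeros n))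
       = sparse_mult [(1, si)] (euler_prod n J xsi (sparse_mult (theta_terms n 1 X3 Y3 A3 B3 C3 @ theta_terms n 1 X4 Y4 A4 B4 C4) [1] (zeros n))) (zeros n)"
    and q: "norm q < 1"
  shows "(form_series A1 B1 C1 q - form_series A2 B2 C2 q) * (\<Prod>\<delta>\<leftarrow>ys. eulerE (q ^ \<delta>))
    = q ^ s * ((form_series A3 B3 C3 q + form_series A4 B4 C4 q) * (\<Prod>\<delta>\<leftarrow>xs. eulerE (q ^ \<delta>)))"
proof -
  note pf = forms[THEN form_boxD(1)] and gf = forms[THEN form_boxD(2)]
  have k: "k > 0" using pf(1) by (simp add: pos_form_def)
  have npos: "n > 0" using n0 by simp
  define m where "m = nat n"
  have m: "n = int m" using npos by (simp add: m_def)
  define N where "N \<tau> = form_theta A1 B1 C1 \<tau> - form_theta A2 B2 C2 \<tau>" for \<tau>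
  define D where "D \<tau> = form_theta A3 B3 C3 \<tau> + form_theta A4 B4 C4 \<tau>" for \<tau>
  define F where "F q = (form_series A1 B1 C1 q - form_series A2 B2 C2 q) * (\<Prod>\<delta>\<leftarrow>ys. eulerE (q ^ \<delta>))" for q
  define G where "G q = q ^ s * ((form_series A3 B3 C3 q + form_series A4 B4 C4 q) * (\<Prod>\<delta>\<leftarrow>xs. eulerE (q ^ \<delta>)))" for q
  have ND: "N \<tau> = form_series A1 B1 C1 (ee \<tau>) - form_series A2 B2 C2 (ee \<tau>)" "D \<tau> = form_series A3 B3 C3 (ee \<tau>) + form_series A4 B4 C4 (ee \<tau>)" for \<tau>
    unfolding N_def D_def using pf[THEN pos_form.form_theta_eq_form_series] by simp_all
  have pos: "\<forall>\<delta>\<in>set ys. \<delta> > 0" "\<forall>\<delta>\<in>set xs. \<delta> > 0" using lev by auto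
  \<comment> \<open>The common fractional power of q splits off, leaving two power series in q whose
    truncations \<open>check\<close> compares.\<close>
  have factor: "N \<tau> * eta_prod ys \<tau> - D \<tau> * eta_prod xs \<tau> = ee (of_nat (sum_list ys) * \<tau> / 24) * (F (ee \<tau>) - G (ee \<tau>))" if t: "Im \<tau> > 0" for \<tau>
  proof -
    have "of_nat (sum_list xs) * \<tau> / 24 = of_nat (sum_list ys) * \<tau> / 24 + of_nat s * \<tau>" by (simp add: s(2) field_simps)
    then have "ee (of_nat (sum_list xs) * \<tau> / 24) = ee (of_nat (sum_list ys) * \<tau> / 24) * ee \<tau> ^ s" by (simp only: ee_add ee_of_nat_mult)
    then show ?thesis unfolding eta_prod_eulerE[OF t pos(1)] eta_prod_eulerE[OF t pos(2)] F_def G_def ND by (simp add: algebra_simps)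
  qed
  obtain K where K: "\<And>q. norm q \<le> 1 / 2 \<Longrightarrow> norm (F q - G q) \<le> K * norm q ^ nat n"
  proof (rule agrees_unique)
    show "agrees n (euler_prod n J ysi (sparse_mult (theta_terms n 1 X1 Y1 A1 B1 C1 @ theta_terms n (-1) X2 Y2 A2 B2 C2) [1] (zeros n))) F"
      using agrees_euler_prod[OF agrees_mult[OF agrees_one near_sparse_append[OF form_boxD(3)[OF forms(1), of 1] form_boxD(3)[OF forms(2), of "-1"]]] pos(1) J(2,1)]
      by (simp add: lists F_def[abs_def] mult_ac)
    show "agrees n (euler_prod n J ysi (sparse_mult (theta_terms n 1 X1 Y1 A1 B1 C1 @ theta_terms n (-1) X2 Y2 A2 B2 C2) [1] (zeros n))) G"
      unfolding check
      using agrees_mult[OF agrees_euler_prod[OF agrees_mult[OF agrees_one near_sparse_append[OF form_boxD(3)[OF forms(3), of 1] form_boxD(3)[OF forms(4), of 1]]] pos(2) J(2,1)] near_sparse_power[of n s]]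
      by (simp only: lists G_def[abs_def]) (simp add: mult_ac)
  qed blast
  have main: "N z * eta_prod ys z = D z * eta_prod xs z" if z: "z \<in> uhp" for z
  proof (rule eta_theta_identity[where k = k and ?n0.0 = m, OF k])
    show "N holomorphic_on uhp" "D holomorphic_on uhp" unfolding N_def[abs_def] D_def[abs_def]
      by (intro holomorphic_on_add holomorphic_on_diff pf[THEN pos_form.form_theta_holomorphic])+
    have growth: "\<exists>K. \<forall>\<tau>\<in>uhp. norm (c1 * form_theta A B C \<tau> + c2 * form_theta A' B' C' \<tau>) \<le> K * (1 + 1 / Im \<tau>)"
      if p: "pos_form A B C k" "pos_form A' B' C' k" for A B C A' B' C' and c1 c2 :: complex
    proof -
      obtain K1 where K1: "\<And>\<tau>. Im \<tau> > 0 \<Longrightarrow> norm (form_theta A B C \<tau>) \<le> K1 * (1 + 1 / Im \<tau>)" using pos_form.form_theta_growth[OF p(1)] by blast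
      obtain K2 where K2: "\<And>\<tau>. Im \<tau> > 0 \<Longrightarrow> norm (form_theta A' B' C' \<tau>) \<le> K2 * (1 + 1 / Im \<tau>)" using pos_form.form_theta_growth[OF p(2)] by blast
      have "norm (c1 * form_theta A B C \<tau> + c2 * form_theta A' B' C' \<tau>) \<le> (norm c1 * K1 + norm c2 * K2) * (1 + 1 / Im \<tau>)" if t: "\<tau> \<in> uhp" for \<tau>
      proof -
        have t: "Im \<tau> > 0" using t by simp
        have "norm (c1 * form_theta A B C \<tau> + c2 * form_theta A' B' C' \<tau>) \<le> norm c1 * norm (form_theta A B C \<tau>) + norm c2 * norm (form_theta A' B' C' \<tau>)"
          using norm_triangle_ineq[of "c1 * form_theta A B C \<tau>" "c2 * form_theta A' B' C' \<tau>"] by (simp add: norm_mult)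
        also have "\<dots> \<le> norm c1 * (K1 * (1 + 1 / Im \<tau>)) + norm c2 * (K2 * (1 + 1 / Im \<tau>))"
          by (intro add_mono mult_left_mono K1 K2 t) auto
        finally show ?thesis by (simp only: distrib_right mult.assoc)
      qed
      then show ?thesis by blast
    qed
    show "\<exists>K. \<forall>\<tau>\<in>uhp. norm (N \<tau>) \<le> K * (1 + 1 / Im \<tau>)" using growth[OF pf(1,2), of 1 "-1"] by (simp add: N_def)
    show "\<exists>K. \<forall>\<tau>\<in>uhp. norm (D \<tau>) \<le> K * (1 + 1 / Im \<tau>)" using growth[OF pf(3,4), of 1 1] by (simp add: D_def)
    show "\<exists>\<kappa>. \<kappa> \<noteq> 0 \<and> (\<forall>\<tau>\<in>uhp. N (mob a b c d \<tau>) = \<kappa> * (of_int c * \<tau> + of_int d) * N \<tau> \<and>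
                 D (mob a b c d \<tau>) = \<kappa> * (of_int c * \<tau> + of_int d) * D \<tau>)"
      if det: "a * d - b * c = 1" and c: "4 * k dvd c" for a b c d
    proof -
      obtain \<kappa> where "\<kappa> \<noteq> 0" and \<kappa>: "\<And>A B C \<tau>. genform k A B C \<Longrightarrow> Im \<tau> > 0 \<Longrightarrow>
        form_theta A B C (mob a b c d \<tau>) = \<kappa> * (of_int c * \<tau> + of_int d) * form_theta A B C \<tau>" by (rule form_theta_automorphy_nonzero[OF k det c]) blast
      then show ?thesis unfolding N_def D_def
        by (intro exI[of _ \<kappa>]) (auto simp: \<kappa>[OF gf(1)] \<kappa>[OF gf(2)] \<kappa>[OF gf(3)] \<kappa>[OF gf(4)] algebra_simps)
    qed
    show "length xs = length ys" by (rule len)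
    show "\<forall>\<delta>\<in>set (ys @ xs). \<delta> > 0 \<and> int \<delta> dvd 4 * k" by (rule lev)
    have "(\<Sum>\<delta>\<leftarrow>ds. int \<delta>) = int (sum_list ds)" for ds by (induction ds) auto
    then show "[(\<Sum>\<delta>\<leftarrow>ys. int \<delta>) = (\<Sum>\<delta>\<leftarrow>xs. int \<delta>)] (mod 12)"
      by (simp add: s(2) cong_iff_dvd_diff)
    show "[(\<Sum>\<delta>\<leftarrow>ys. 4 * k div int \<delta>) = (\<Sum>\<delta>\<leftarrow>xs. 4 * k div int \<delta>)] (mod 12)" by (rule c2)
    have "norm (N \<tau> * eta_prod ys \<tau> - D \<tau> * eta_prod xs \<tau>) \<le> K * exp (- (2 * pi * real m) * Im \<tau>)" if y: "Im \<tau> \<ge> 1 / 2" for \<tau>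
    proof -
      have t: "Im \<tau> > 0" using y by simp
      \<comment> \<open>Brings the closed half plane Im tau \<ge> 1/2 into the disc |q| \<le> 1/2,
        where the truncation error is controlled.\<close>
      have "2 \<le> exp pi" using exp_ge_add_one_self[of pi] pi_gt3 by linarith
      also have "exp pi \<le> exp (2 * pi * Im \<tau>)" using y by simp
      finally have "norm (ee \<tau>) \<le> 1 / 2" by (simp add: norm_ee exp_minus field_simps)
      from K[OF this] have "norm (F (ee \<tau>) - G (ee \<tau>)) \<le> K * exp (- (2 * pi * real m) * Im \<tau>)"
        by (simp add: norm_ee m_def[symmetric] exp_of_nat_mult[symmetric] mult_ac)
      moreover have "norm (ee (of_nat (sum_list ys) * \<tau> / 24)) \<le> 1" using t by (simp add: norm_ee)
      ultimately have "norm (ee (of_nat (sum_list ys) * \<tau> / 24)) * norm (F (ee \<tau>) - G (ee \<tau>)) \<le> 1 * (K * exp (- (2 * pi * real m) * Im \<tau>))"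
        by (intro mult_mono) auto
      then show ?thesis unfolding factor[OF t] norm_mult by simp
    qed
    then show "\<exists>K. \<forall>\<tau>. Im \<tau> \<ge> 1 / 2 \<longrightarrow> norm (N \<tau> * eta_prod ys \<tau> - D \<tau> * eta_prod xs \<tau>) \<le> K * exp (- (2 * pi * real m) * Im \<tau>)" by blast
    show "norm (D (Complex 0 y)) \<ge> 1" if y: "y \<ge> 1" for y
    proof -
      obtain r1 r2 where "r1 \<ge> 1" "r2 \<ge> 1" "form_theta A3 B3 C3 (Complex 0 y) = of_real r1" "form_theta A4 B4 C4 (Complex 0 y) = of_real r2"
        using pos_form.form_theta_imaginary[OF pf(3), of y] pos_form.form_theta_imaginary[OF pf(4), of y] y by (smt (verit))
      then have "D (Complex 0 y) = of_real (r1 + r2)" "r1 + r2 \<ge> 1" by (auto simp: D_def)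
      then show ?thesis by (simp only: norm_of_real)
    qed
    show "sum_list xs < 24 * m" using n0 by (simp add: m)
    have "card {u \<in> {0..<4 * k}. coprime u (4 * k)} = length (filter (\<lambda>u. gcd u (4 * k) = 1) [0..4 * k - 1])"
      unfolding card_filter_upto coprime_iff_gcd_eq_1 ..
    then show "(2 + int (length ys)) * k\<^sup>2 < int m * int (card {u \<in> {0..<4 * k}. coprime u (4 * k)})" using count by (simp add: m)
    show "z \<in> uhp" by (rule z)
  qed
  have "F q = G q"
  proof (cases "q = 0")
    case True
    then show ?thesis using pf[THEN pos_form.form_series_0] s(1) by (simp add: F_def G_def)
  next
    case False
    obtain \<tau> where t: "Im \<tau> > 0" "ee \<tau> = q" by (rule ee_surj[OF False q])
    have "ee (of_nat (sum_list ys) * \<tau> / 24) * (F q - G q) = 0" using factor[OF t(1)] main[of \<tau>] t by simp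
    then show ?thesis by simp
  qed
  then show ?thesis by (simp only: F_def G_def)
qed

text \<open>The formula for psi at -q, rewritten by (q;q^2)(-q;q^2) = (q^2;q^4) so that only
  products at positive powers of q remain.\<close>

lemma rampsi_minus_eulerE:
  assumes q: "norm q < 1"
  shows "(\<Sum>n::nat. (- q) ^ (n * (n + 1) div 2)) * eulerE (q\<^sup>2) = eulerE q * eulerE (q ^ 4)"
proof -
  have n: "norm (- q) < 1" "norm (q\<^sup>2) < 1" using q norm_power_less_1[OF q, of 2] by auto
  have q4: "(q\<^sup>2)\<^sup>2 = q ^ 4" by (simp add: power_mult[symmetric])
  define P where "P = (\<Sum>n::nat. (- q) ^ (n * (n + 1) div 2))"
  have 1: "P * eulerE (- q) = eulerE (q\<^sup>2) ^ 2" using rampsi_eulerE[OF n(1)] by (simp add: P_def)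
  have 2: "eulerE (- q) = oddE (- q) * eulerE (q\<^sup>2)" using eulerE_split2[OF n(1)] by simp
  have 3: "eulerE (q\<^sup>2) = oddE q * oddE (- q) * eulerE (q ^ 4)"
    using eulerE_split2[OF n(2)] oddE_mult_minus[OF q] by (simp add: q4)
  have nz: "oddE (- q) \<noteq> 0" "eulerE (q\<^sup>2) \<noteq> 0" using oddE_nonzero[OF n(1)] eulerE_nonzero[OF n(2)] by auto
  have "oddE (- q) * (P * eulerE (q\<^sup>2)) = oddE (- q) * (eulerE q * eulerE (q ^ 4))"
    using 1 2 3 eulerE_split2[OF q] nz by (auto simp: power2_eq_square mult_ac)
  then show ?thesis using nz by (simp add: P_def)
qed

section \<open>The five identities\<close>

text \<open>The order 487 is the least n with 12 * 54^2 < 72 n, where 12 is two more than the number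
  of factors and 72 = phi(216); 22 is the least J with 487 \<le> (J + 1)^2. The two numbers before
  each form bound |x| and |y|. The lists arise by writing phi and psi as quotients of
  \<open>eulerE\<close> and clearing denominators. The other checks are set up in the same
  way.\<close>

lemma series_check_54:
  "euler_prod 487 22 [2, 2, 12, 18, 108, 108, 3, 72, 8, 27]
     (sparse_mult (theta_terms 487 1 15 4 2 0 27 @ theta_terms 487 (-1) 9 7 7 3 9) [1] (zeros 487))
   = sparse_mult [(1, 2)] (euler_prod 487 22 [1, 4, 4, 6, 24, 9, 36, 54, 54, 216]
     (sparse_mult (theta_terms 487 1 22 3 1 0 54 @ theta_terms 487 1 9 6 5 1 11) [1] (zeros 487))) (zeros 487)"
  by code_simp

lemma series_check_34:
  "euler_prod 145 12 [8, 17, 68, 68, 2, 2]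
     (sparse_mult (theta_terms 145 1 8 2 2 0 17 @ theta_terms 145 (-1) 5 4 5 1 7) [1] (zeros 145))
   = sparse_mult [(1, 2)] (euler_prod 145 12 [4, 4, 34, 34, 136, 1]
     (sparse_mult (theta_terms 145 1 12 2 1 0 34 @ theta_terms 145 1 5 4 5 1 7) [1] (zeros 145))) (zeros 145)"
  by code_simp

lemma series_check_26:
  "euler_prod 57 7 [4, 26]
     (sparse_mult (theta_terms 57 1 7 1 1 0 26 @ theta_terms 57 (-1) 3 3 5 2 6) [1] (zeros 57))
   = sparse_mult [(1, 1)] (euler_prod 57 7 [2, 52]
     (sparse_mult (theta_terms 57 1 5 2 2 0 13 @ theta_terms 57 1 4 2 3 1 9) [1] (zeros 57))) (zeros 57)"
  by code_simp

lemma series_check_66a: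
  "euler_prod 436 20 [6, 8, 33, 44, 2, 132]
     (sparse_mult (theta_terms 436 1 8 6 6 0 11 @ theta_terms 436 (-1) 8 6 7 2 10) [1] (zeros 436))
   = sparse_mult [(1, 6)] (euler_prod 436 20 [12, 22, 1, 4, 66, 264]
     (sparse_mult (theta_terms 436 1 12 4 3 0 22 @ theta_terms 436 1 9 5 5 2 14) [1] (zeros 436))) (zeros 436)"
  by code_simp

lemma series_check_66b:
  "euler_prod 436 20 [88, 66, 22, 12, 4, 3]
     (sparse_mult (theta_terms 436 1 20 2 1 0 66 @ theta_terms 436 (-1) 9 5 5 2 14) [1] (zeros 436))
   = sparse_mult [(1, 1)] (euler_prod 436 20 [132, 44, 24, 11, 6, 2]
     (sparse_mult (theta_terms 436 1 14 3 2 0 33 @ theta_terms 436 1 8 6 7 2 10) [1] (zeros 436))) (zeros 436)"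
  by code_simp

text \<open>For \<open>genform\<close>: the leading coefficients are 1, 2 or 6, each dividing 4k
  where it occurs, or one of these primes.\<close>

lemma prime_small: "prime (3 :: int)" "prime (5 :: int)" "prime (7 :: int)"
  using prime_nat_int_transfer[of 3] prime_nat_int_transfer[of 5] prime_nat_int_transfer[of 7] by simp_all

lemma qtheta_eq_form_series: "qtheta a (2 * b) c q = form_series a b c q"
  by (simp add: qtheta_def form_series_def Qf_def)

lemma count_units_104: "length (filter (\<lambda>u. gcd u 104 = 1) [0..103 :: int]) = 48"
  by code_simp

lemma count_units_136: "length (filter (\<lambda>u. gcd u 136 = 1) [0..135 :: int]) = 64"
  by code_simp

lemma count_units_216: "length (filter (\<lambda>u. gcd u 216 = 1) [0..215 :: int]) = 72"
  by code_simp

lemma count_units_264: "length (filter (\<lambda>u. gcd u 264 = 1) [0..263 :: int]) = 80"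
  by code_simp

lemma identity_54:
  assumes "norm q < 1"
  shows "(form_series 2 0 27 q - form_series 7 3 9 q) * (\<Prod>\<delta>\<leftarrow>[2, 2, 12, 18, 108, 108, 3, 72, 8, 27]. eulerE (q ^ \<delta>))
    = q ^ 2 * ((form_series 1 0 54 q + form_series 5 1 11 q) * (\<Prod>\<delta>\<leftarrow>[1, 4, 4, 6, 24, 9, 36, 54, 54, 216]. eulerE (q ^ \<delta>)))"
  by (rule theta_eulerE_identity[where k = 54 and s = 2 and ys = "[2, 2, 12, 18, 108, 108, 3, 72, 8, 27]" and xs = "[1, 4, 4, 6, 24, 9, 36, 54, 54, 216]", OF _ _ _ _ _ _ _ _ _ _ _ _ _ _ _ _ series_check_54 assms])
     (simp_all add: form_box_def genform_def pos_form_def prime_small cong_def count_units_216 del: upto_rec_numeral)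

lemma identity_34:
  assumes "norm q < 1"
  shows "(form_series 2 0 17 q - form_series 5 1 7 q) * (\<Prod>\<delta>\<leftarrow>[8, 17, 68, 68, 2, 2]. eulerE (q ^ \<delta>))
    = q ^ 2 * ((form_series 1 0 34 q + form_series 5 1 7 q) * (\<Prod>\<delta>\<leftarrow>[4, 4, 34, 34, 136, 1]. eulerE (q ^ \<delta>)))"
  by (rule theta_eulerE_identity[where k = 34 and s = 2 and ys = "[8, 17, 68, 68, 2, 2]" and xs = "[4, 4, 34, 34, 136, 1]", OF _ _ _ _ _ _ _ _ _ _ _ _ _ _ _ _ series_check_34 assms])
     (simp_all add: form_box_def genform_def pos_form_def prime_small cong_def count_units_136 del: upto_rec_numeral)

lemma identity_26:
  assumes "norm q < 1"
  shows "(form_series 1 0 26 q - form_series 5 2 6 q) * (\<Prod>\<delta>\<leftarrow>[4, 26]. eulerE (q ^ \<delta>))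
    = q ^ 1 * ((form_series 2 0 13 q + form_series 3 1 9 q) * (\<Prod>\<delta>\<leftarrow>[2, 52]. eulerE (q ^ \<delta>)))"
  by (rule theta_eulerE_identity[where k = 26 and s = 1 and ys = "[4, 26]" and xs = "[2, 52]", OF _ _ _ _ _ _ _ _ _ _ _ _ _ _ _ _ series_check_26 assms])
     (simp_all add: form_box_def genform_def pos_form_def prime_small cong_def count_units_104 del: upto_rec_numeral)

lemma identity_66a:
  assumes "norm q < 1"
  shows "(form_series 6 0 11 q - form_series 7 2 10 q) * (\<Prod>\<delta>\<leftarrow>[6, 8, 33, 44, 2, 132]. eulerE (q ^ \<delta>))
    = q ^ 6 * ((form_series 3 0 22 q + form_series 5 2 14 q) * (\<Prod>\<delta>\<leftarrow>[12, 22, 1, 4, 66, 264]. eulerE (q ^ \<delta>)))"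
  by (rule theta_eulerE_identity[where k = 66 and s = 6 and ys = "[6, 8, 33, 44, 2, 132]" and xs = "[12, 22, 1, 4, 66, 264]", OF _ _ _ _ _ _ _ _ _ _ _ _ _ _ _ _ series_check_66a assms])
     (simp_all add: form_box_def genform_def pos_form_def prime_small cong_def count_units_264 del: upto_rec_numeral)

lemma identity_66b:
  assumes "norm q < 1"
  shows "(form_series 1 0 66 q - form_series 5 2 14 q) * (\<Prod>\<delta>\<leftarrow>[88, 66, 22, 12, 4, 3]. eulerE (q ^ \<delta>))
    = q ^ 1 * ((form_series 2 0 33 q + form_series 7 2 10 q) * (\<Prod>\<delta>\<leftarrow>[132, 44, 24, 11, 6, 2]. eulerE (q ^ \<delta>)))"
  by (rule theta_eulerE_identity[where k = 66 and s = 1 and ys = "[88, 66, 22, 12, 4, 3]" and xs = "[132, 44, 24, 11, 6, 2]", OF _ _ _ _ _ _ _ _ _ _ _ _ _ _ _ _ series_check_66b assms])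
     (simp_all add: form_box_def genform_def pos_form_def prime_small cong_def count_units_264 del: upto_rec_numeral)

lemma ramphi_eq: "norm q < 1 \<Longrightarrow> ramphi (- q) = eulerE q ^ 2 / eulerE (q\<^sup>2)"
  using ramphi_eulerE[of q] eulerE_nonzero[of "q\<^sup>2"] norm_power_less_1[of q 2] by (simp add: ramphi_def field_simps)

lemma rampsi_eq: "norm q < 1 \<Longrightarrow> rampsi q = eulerE (q\<^sup>2) ^ 2 / eulerE q"
  using rampsi_eulerE[of q] eulerE_nonzero[of q] by (simp add: rampsi_def field_simps)

lemma rampsi_minus_eq: "norm q < 1 \<Longrightarrow> rampsi (- q) = eulerE q * eulerE (q ^ 4) / eulerE (q\<^sup>2)"
  using rampsi_minus_eulerE[of q] eulerE_nonzero[of "q\<^sup>2"] norm_power_less_1[of q 2] by (simp add: rampsi_def field_simps)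

lemma quotient_eq_iff:
  fixes N D P Q s :: complex
  assumes "N * P = s * (D * Q)" "P \<noteq> 0" "D \<noteq> 0"
  shows "N / D = s * (Q / P)"
  using assms by (simp add: field_simps)

theorem theorem4p6:
  fixes q :: complex
  assumes "norm q < 1"
  shows
    "(qtheta 1 0 54 q + qtheta 5 2 11 q \<noteq> 0 \<longrightarrow>
        (qtheta 2 0 27 q - qtheta 7 6 9 q) / (qtheta 1 0 54 q + qtheta 5 2 11 q) =
        q^2 * ((rampsi (-q) * rampsi (-(q^6)) * rampsi (-(q^9)) * rampsi (-(q^54))) /
               (eulerE (q^3) * eulerE (q^72) * rampsi (-(q^2)) * rampsi (-(q^27)))))
     \<and>
     (qtheta 1 0 34 q + qtheta 5 2 7 q \<noteq> 0 \<longrightarrow>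
        (qtheta 2 0 17 q - qtheta 5 2 7 q) / (qtheta 1 0 34 q + qtheta 5 2 7 q) =
        q^2 * ((ramphi (-(q^4)) * rampsi (q^17)) / (ramphi (-(q^68)) * rampsi q)))
     \<and>
     (qtheta 2 0 13 q + qtheta 3 2 9 q \<noteq> 0 \<longrightarrow>
        (qtheta 1 0 26 q - qtheta 5 4 6 q) / (qtheta 2 0 13 q + qtheta 3 2 9 q) =
        q * ((eulerE (q^2) * eulerE (q^52)) / (eulerE (q^4) * eulerE (q^26))))
     \<and>
     (qtheta 3 0 22 q + qtheta 5 4 14 q \<noteq> 0 \<longrightarrow>
        (qtheta 6 0 11 q - qtheta 7 4 10 q) / (qtheta 3 0 22 q + qtheta 5 4 14 q) =
        q^6 * ((eulerE (q^12) * eulerE (q^22) * rampsi (-q) * rampsi (-(q^66))) /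
               (eulerE (q^6) * eulerE (q^8) * eulerE (q^33) * eulerE (q^44))))
     \<and>
     (qtheta 2 0 33 q + qtheta 7 4 10 q \<noteq> 0 \<longrightarrow>
        (qtheta 1 0 66 q - qtheta 5 4 14 q) / (qtheta 2 0 33 q + qtheta 7 4 10 q) =
        q * ((eulerE (q^132) * eulerE (q^44) * eulerE (q^24) * eulerE (q^11) *
              eulerE (q^6) * eulerE (q^2)) /
             (eulerE (q^88) * eulerE (q^66) * eulerE (q^22) * eulerE (q^12) *
              eulerE (q^4) * eulerE (q^3))))"
proof -
  have nz: "eulerE (q ^ m) \<noteq> 0" if "m > 0" for m
    using eulerE_nonzero[OF norm_power_less_1[OF assms that]] .
  have ps: "rampsi (q ^ m) = eulerE (q ^ (2 * m)) ^ 2 / eulerE (q ^ m)"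
    "rampsi (- (q ^ m)) = eulerE (q ^ m) * eulerE (q ^ (4 * m)) / eulerE (q ^ (2 * m))"
    "ramphi (- (q ^ m)) = eulerE (q ^ m) ^ 2 / eulerE (q ^ (2 * m))" if "m > 0" for m
    using rampsi_eq[OF norm_power_less_1[OF assms that]] rampsi_minus_eq[OF norm_power_less_1[OF assms that]]
      ramphi_eq[OF norm_power_less_1[OF assms that]] by (simp_all add: power_mult[symmetric] mult.commute)
  \<comment> \<open>The case m = 1 is stated apart because the statement has q itself rather than
    \<open>q ^ 1\<close>.\<close>
  have ps1: "rampsi q = eulerE (q ^ 2) ^ 2 / eulerE q" "rampsi (- q) = eulerE q * eulerE (q ^ 4) / eulerE (q ^ 2)"
    using ps[of 1] by simp_all
  have nz1: "eulerE q \<noteq> 0" using nz[of 1] by simp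
  \<comment> \<open>Instances for the four values of B that occur, so that 2B becomes the literal
    middle coefficient.\<close>
  note th = qtheta_eq_form_series[of _ 0, simplified] qtheta_eq_form_series[of _ 1, simplified] qtheta_eq_form_series[of _ 2, simplified] qtheta_eq_form_series[of _ 3, simplified]
  note i54 = quotient_eq_iff[OF identity_54[OF assms]]
  note i34 = quotient_eq_iff[OF identity_34[OF assms]]
  note i26 = quotient_eq_iff[OF identity_26[OF assms]]
  note i66a = quotient_eq_iff[OF identity_66a[OF assms]]
  note i66b = quotient_eq_iff[OF identity_66b[OF assms]]
  show ?thesis
    unfolding th
  proof (intro conjI impI)
    assume "form_series 1 0 54 q + form_series 5 1 11 q \<noteq> 0"
    from i54[OF _ this] show "(form_series 2 0 27 q - form_series 7 3 9 q) / (form_series 1 0 54 q + form_series 5 1 11 q) = q^2 * ((rampsi (-q) * rampsi (-(q^6)) * rampsi (-(q^9)) * rampsi (-(q^54))) / (eulerE (q^3) * eulerE (q^72) * rampsi (-(q^2)) * rampsi (-(q^27))))"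
      by (simp add: nz nz1 ps ps1) (simp add: nz nz1 divide_simps power2_eq_square)
  next
    assume "form_series 1 0 34 q + form_series 5 1 7 q \<noteq> 0"
    from i34[OF _ this] show "(form_series 2 0 17 q - form_series 5 1 7 q) / (form_series 1 0 34 q + form_series 5 1 7 q) = q^2 * ((ramphi (-(q^4)) * rampsi (q^17)) / (ramphi (-(q^68)) * rampsi q))"
      by (simp add: nz nz1 ps ps1) (simp add: nz nz1 divide_simps power2_eq_square)
  next
    assume "form_series 2 0 13 q + form_series 3 1 9 q \<noteq> 0"
    from i26[OF _ this] show "(form_series 1 0 26 q - form_series 5 2 6 q) / (form_series 2 0 13 q + form_series 3 1 9 q) = q * ((eulerE (q^2) * eulerE (q^52)) / (eulerE (q^4) * eulerE (q^26)))"
      by (simp add: nz mult.assoc)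
  next
    assume "form_series 3 0 22 q + form_series 5 2 14 q \<noteq> 0"
    from i66a[OF _ this] show "(form_series 6 0 11 q - form_series 7 2 10 q) / (form_series 3 0 22 q + form_series 5 2 14 q) = q^6 * ((eulerE (q^12) * eulerE (q^22) * rampsi (-q) * rampsi (-(q^66))) / (eulerE (q^6) * eulerE (q^8) * eulerE (q^33) * eulerE (q^44)))"
      by (simp add: nz nz1 ps ps1) (simp add: nz nz1 divide_simps power2_eq_square)
  next
    assume "form_series 2 0 33 q + form_series 7 2 10 q \<noteq> 0"
    from i66b[OF _ this] show "(form_series 1 0 66 q - form_series 5 2 14 q) / (form_series 2 0 33 q + form_series 7 2 10 q) = q * ((eulerE (q^132) * eulerE (q^44) * eulerE (q^24) * eulerE (q^11) * eulerE (q^6) * eulerE (q^2)) / (eulerE (q^88) * eulerE (q^66) * eulerE (q^22) * eulerE (q^12) * eulerE (q^4) * eulerE (q^3)))"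
      by (simp add: nz mult.assoc)
  qed
qed

end
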